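(* Let $n\ge 1$ and let $Q=\mathbf H^n_{\mathbb C}/\Gamma$ be a complex hyperbolic $n$-orbifold, i.e. the quotient of complex hyperbolic $n$-space $\mathbf H^n_{\mathbb C}$ (with the Bergman metric normalized to have holomorphic sectional curvature $-1$) by a discrete group $\Gamma$ of holomorphic isometries. Then $\mathrm{Vol}[Q]\ge \mathcal C(n)$, where \[\mathcal C(n)=\frac{2^{n^2+n+1}\,\pi^{n/2}\,\prod_{k=1}^{n-1}k!}{(36n+21)^{(n^2+2n)/2}\,\Gamma\!\left(\frac{n^2+2n}{2}\right)}\int_{0}^{\min\left[0.06925\sqrt{36n+21},\,\pi\right]}\sin^{n^2+2n-1}\rho\,d\rho .\]
   Context: $\mathbf H^n_{\mathbb C}$ is the set of negative lines in $\mathbb C^{n,1}$ (Hermitian form $z_1\bar w_1+\dots+z_n\bar w_n-z_{n+1}\bar w_{n+1}$) with the Bergman metric, whose distance $\rho$ satisfies $\cosh^2(\rho(z,w)/2)=\frac{\langle\mathbf z,\mathbf w\rangle\langle\mathbf w,\mathbf z\rangle}{\langle\mathbf z,\mathbf z\rangle\langle\mathbf w,\mathbf w\rangle}$; its holomorphic sectional curvature is $-1$ and its sectional curvatures lie in $[-1,-1/4]$. Dimension $n$ means complex dimension. The product $\prod_{k=1}^{n-1}k!$ is written in the paper as $(n-1)!\,(n-2)!\cdots 3!\,2!\,1!$ (equal to $1$ when $n=1$). *)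

theory Defs
  imports "HOL-Analysis.Analysis"
begin

text \<open>Ball model of complex hyperbolic space: the negative line spanned by (z,1) in C^{n,1},
  z in the open unit ball of C^n, n = CARD('n).\<close>

definition cball_model :: "(complex ^ 'n) set" where
  "cball_model = {z. norm z < 1}"

definition herm :: "complex ^ 'n \<Rightarrow> complex ^ 'n \<Rightarrow> complex" where
  "herm z w = (\<Sum>i\<in>UNIV. z $ i * cnj (w $ i))"

text \<open>Bergman distance: cosh^2(rho/2) = <Z,W><W,Z> / (<Z,Z><W,W>) with Z = (z,1), W = (w,1).\<close>
definition bergman_dist :: "complex ^ 'n \<Rightarrow> complex ^ 'n \<Rightarrow> real" where
  "bergman_dist z w =
     2 * arcosh (sqrt ((cmod (herm z w - 1))\<^sup>2 / ((1 - (norm z)\<^sup>2) * (1 - (norm w)\<^sup>2))))"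

definition holo_map_on :: "(complex ^ 'n \<Rightarrow> complex ^ 'n) \<Rightarrow> (complex ^ 'n) set \<Rightarrow> bool" where
  "holo_map_on f S \<longleftrightarrow> (\<forall>z\<in>S. \<exists>f'. (f has_derivative f') (at z) \<and>
       (\<forall>v. f' (\<chi> i. \<i> * v $ i) = (\<chi> i. \<i> * f' v $ i)))"

definition holo_isometry :: "(complex ^ 'n \<Rightarrow> complex ^ 'n) \<Rightarrow> bool" where
  "holo_isometry g \<longleftrightarrow> bij_betw g cball_model cball_model \<and> holo_map_on g cball_model \<and>
     (\<forall>z\<in>cball_model. \<forall>w\<in>cball_model. bergman_dist (g z) (g w) = bergman_dist z w)"

definition discrete_holo_group :: "(complex ^ 'n \<Rightarrow> complex ^ 'n) set \<Rightarrow> bool" where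
  "discrete_holo_group \<Gamma> \<longleftrightarrow>
     (\<forall>g\<in>\<Gamma>. holo_isometry g \<and> (\<forall>z. z \<notin> cball_model \<longrightarrow> g z = z)) \<and>
     id \<in> \<Gamma> \<and> (\<forall>g\<in>\<Gamma>. \<forall>h\<in>\<Gamma>. g \<circ> h \<in> \<Gamma>) \<and> (\<forall>g\<in>\<Gamma>. \<exists>h\<in>\<Gamma>. h \<circ> g = id) \<and>
     (\<forall>x\<in>cball_model. \<forall>r::real. finite {g\<in>\<Gamma>. bergman_dist x (g x) \<le> r})"

text \<open>Riemannian volume of the Bergman metric with holomorphic sectional curvature -1:
  density 4^n / (1-|z|^2)^(n+1) w.r.t. Lebesgue measure on C^n = R^(2n).\<close>
definition bergman_volume :: "(complex ^ 'n) measure" where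
  "bergman_volume = density lborel
     (\<lambda>z. indicator cball_model z * ennreal (4 ^ CARD('n) / (1 - (norm z)\<^sup>2) ^ (CARD('n) + 1)))"

definition fundamental_set :: "(complex ^ 'n \<Rightarrow> complex ^ 'n) set \<Rightarrow> (complex ^ 'n) set \<Rightarrow> bool" where
  "fundamental_set \<Gamma> F \<longleftrightarrow> F \<subseteq> cball_model \<and> F \<in> sets lborel \<and>
     (\<forall>z\<in>cball_model. \<exists>!w. w \<in> F \<and> (\<exists>g\<in>\<Gamma>. g z = w))"

definition orbifold_vol :: "(complex ^ 'n \<Rightarrow> complex ^ 'n) set \<Rightarrow> ennreal" where
  "orbifold_vol \<Gamma> = (INF F\<in>{F. fundamental_set \<Gamma> F}. emeasure bergman_volume F)"

definition volC :: "nat \<Rightarrow> real" where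
  "volC n = 2 ^ (n\<^sup>2 + n + 1) * pi powr (real n / 2) * (\<Prod>k=1..n-1. fact k)
     / ((36 * real n + 21) powr ((real n ^ 2 + 2 * real n) / 2) * Gamma ((real n ^ 2 + 2 * real n) / 2))
     * integral {0 .. min (0.06925 * sqrt (36 * real n + 21)) pi} (\<lambda>\<rho>. sin \<rho> ^ (n\<^sup>2 + 2 * n - 1))"

end

theory Submission
  imports Defs
begin

text \<open>Lift the group to the matrices of \<open>U(n,1)\<close> and measure a matrix by its Frobenius distance to the
  identity. The Boettcher--Wenzel inequality makes commutators of matrices closer than \<open>9/20\<close> to the identity
  strictly smaller than their factors (Zassenhaus), so if every conjugate \<open>G\<^sup>-\<^sup>1 \<Lambda> G\<close> of the lift had a
  nonscalar element closer than \<open>9/20\<close>, then at a conjugate whose smallest nonscalar element is as large as possible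
  the smallest elements would commute up to scalars; moving the base point then enlarges all of them at once, which
  is absurd. Such an extremal conjugate exists when the volume is finite, because a fundamental set has room for only
  finitely many disjoint orbits of small balls. Hence some conjugate has all its nonscalar elements at distance at
  least \<open>9/20\<close>. A packing argument, with shells in the unitary group around a ball of radius \<open>\<surd>q\<close>, then
  bounds the number of group elements that move a point of this ball into the ball, and therefore the volume from below.\<close>

section \<open>Hermitian forms and complex matrices\<close>

text \<open>The group may contain elements with fixed points, so a small ball need not embed in the
  quotient and no injectivity radius is available; counting the elements that return a ball to
  itself takes its place. All unit scalars are kept in the lift because they act trivially: the
  nonscalar matrices are then exactly the lifts of nontrivial isometries. Conjugation by G measures
  displacement at the point to which G moves 0, since unitary conjugation preserves the Frobenius
  norm; an extremal conjugate is thus an extremal base point. Taking the supremum over all base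
  points avoids any separate treatment of cusps, thin tubes and fixed points. The threshold 9/20
  comes from the commutator estimate: with K = (1 + m)^4 it needs (K + 1/K) m^2 < 1, which fails
  from about m = 0.459 on. The target \<open>volC\<close> has the shape of a ball volume in
  dimension n^2 + 2 n, the dimension of SU(n,1), whereas packing gives the volume of a ball in
  complex dimension n times a product of n cap ratios; comparing the two for all n is the purpose of
  the numerical estimates.\<close>

definition adj :: "complex ^ 'n ^ 'm \<Rightarrow> complex ^ 'm ^ 'n" where
  "adj A = (\<chi> i j. cnj (A $ j $ i))"

definition outer :: "complex ^ 'm \<Rightarrow> complex ^ 'n \<Rightarrow> complex ^ 'n ^ 'm" where
  "outer a b = (\<chi> i j. a $ i * cnj (b $ j))"

lemma adj_adj [simp]: "adj (adj A) = A"
  by (simp add: adj_def vec_eq_iff)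

lemma adj_mult: "adj (A ** B) = adj B ** adj A"
  by (simp add: adj_def matrix_matrix_mult_def vec_eq_iff mult.commute)

lemma adj_add: "adj (A + B) = adj A + adj B"
  by (simp add: adj_def vec_eq_iff)

lemma adj_diff: "adj (A - B) = adj A - adj B"
  by (simp add: adj_def vec_eq_iff)

lemma adj_mat [simp]: "adj (mat c) = mat (cnj c)"
  by (simp add: adj_def vec_eq_iff mat_def)

lemma adj_outer [simp]: "adj (outer a b) = outer b a"
  by (simp add: adj_def outer_def vec_eq_iff mult.commute)

lemma herm_add_left: "herm (x + y) z = herm x z + herm y z"
  by (simp add: herm_def sum.distrib algebra_simps)

lemma herm_add_right: "herm x (y + z) = herm x y + herm x z"
  by (simp add: herm_def sum.distrib algebra_simps)

lemma herm_diff_left: "herm (x - y) z = herm x z - herm y z"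
  by (simp add: herm_def sum_subtractf algebra_simps)

lemma herm_diff_right: "herm x (y - z) = herm x y - herm x z"
  by (simp add: herm_def sum_subtractf algebra_simps)

lemma herm_scale_left: "herm (c *s x) y = c * herm x y"
  by (simp add: herm_def sum_distrib_left algebra_simps)

lemma herm_scale_right: "herm x (c *s y) = cnj c * herm x y"
  by (simp add: herm_def sum_distrib_left algebra_simps)

lemma herm_scaleR_left: "herm (r *\<^sub>R x) y = of_real r * herm x y"
  by (simp add: herm_def sum_distrib_left vector_scaleR_component, simp add: scaleR_conv_of_real algebra_simps)

lemma herm_0 [simp]: "herm 0 x = 0" "herm x 0 = 0"
  by (simp_all add: herm_def)

lemma herm_minus_left: "herm (- x) y = - herm x y"
  by (simp add: herm_def sum_negf)

lemma herm_minus_right: "herm x (- y) = - herm x y"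
  by (simp add: herm_def sum_negf)

lemma herm_commute: "herm y x = cnj (herm x y)"
  by (simp add: herm_def cnj_sum mult.commute)

lemma herm_scaleR_right: "herm x (r *\<^sub>R y) = of_real r * herm x y"
  by (metis complex_cnj_complex_of_real complex_cnj_mult herm_commute herm_scaleR_left)

lemmas herm_simps = herm_add_left herm_add_right herm_diff_left herm_diff_right herm_scale_left
  herm_scale_right herm_scaleR_left herm_scaleR_right herm_minus_left herm_minus_right

lemma inner_eq_Re_herm: "x \<bullet> y = Re (herm x y)"
  by (simp add: inner_vec_def herm_def inner_complex_def)

lemma herm_self: "herm x x = of_real ((norm x)\<^sup>2)"
proof -
  have "Im (herm x x) = 0" by (simp add: herm_def Im_sum)
  moreover have "Re (herm x x) = (norm x)\<^sup>2"
    using inner_eq_Re_herm[of x x] by (simp add: power2_norm_eq_inner)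
  ultimately show ?thesis by (simp add: complex_eq_iff)
qed

lemma herm_axis_right [simp]: "herm x (axis i 1) = x $ i"
  by (simp add: herm_def axis_def if_distrib cong: if_cong)

lemma herm_axis_left [simp]: "herm (axis i 1) x = cnj (x $ i)"
  using herm_axis_right[of x i] herm_commute by metis

lemma herm_cauchy: "cmod (herm x y) \<le> norm x * norm y"
proof (cases "herm x y = 0")
  case False
  \<comment> \<open>A unit factor that rotates \<open>herm x y\<close> onto the nonnegative real
    axis and so reduces the claim to the real Cauchy-Schwarz inequality.\<close>
  define c where "c = cnj (herm x y) / of_real (cmod (herm x y))"
  have c: "cmod c = 1" using False by (simp add: c_def norm_divide)
  have "herm (c *s x) y = of_real (cmod (herm x y))"
    using False by (simp add: herm_scale_left c_def complex_norm_square[symmetric] field_simps power2_eq_square)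
  then have "cmod (herm x y) = (c *s x) \<bullet> y" by (simp add: inner_eq_Re_herm)
  also have "\<dots> \<le> norm (c *s x) * norm y" by (rule norm_cauchy_schwarz)
  also have "norm (c *s x) = norm x"
    by (simp add: norm_vec_def L2_set_def norm_mult c)
  finally show ?thesis .
qed simp

lemma norm_vector_scalar [simp]: "norm (c *s (x :: complex ^ 'n)) = cmod c * norm x"
  by (simp add: norm_vec_def norm_mult L2_set_right_distrib)

lemma herm_mult_left: "herm (A *v x) y = herm x (adj A *v y)"
  unfolding herm_def matrix_vector_mult_def adj_def
  by (simp add: sum_distrib_left sum_distrib_right cnj_sum)
     (subst sum.swap, simp add: algebra_simps)

lemma herm_mult_right: "herm x (A *v y) = herm (adj A *v x) y"
  by (simp add: herm_mult_left)

lemma matrix_entry: "A $ i $ j = herm (A *v axis j 1) (axis i 1)"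
  unfolding herm_axis_right
  by (simp add: matrix_vector_mult_def axis_def if_distrib cong: if_cong)

lemma outer_mult_vec: "outer a b *v x = herm x b *s a"
  by (simp add: outer_def matrix_vector_mult_def herm_def vec_eq_iff sum_distrib_right sum_distrib_left algebra_simps)

lemma trace_outer: "trace (outer a b) = herm a b"
  by (simp add: trace_def outer_def herm_def)

lemma trace_mult_outer: "trace (A ** outer a b) = herm (A *v a) b"
  by (simp add: trace_def outer_def herm_def matrix_matrix_mult_def matrix_vector_mult_def sum_distrib_right mult.assoc)

lemma trace_outer_mult: "trace (outer a b ** A) = herm (A *v a) b"
  by (subst trace_mul_sym) (rule trace_mult_outer)

lemma mult_outer: "A ** outer a b = outer (A *v a) b"
  by (simp add: outer_def matrix_matrix_mult_def matrix_vector_mult_def vec_eq_iff sum_distrib_right mult.assoc)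

lemma outer_mult: "outer a b ** A = outer a (adj A *v b)"
  by (simp add: outer_def matrix_matrix_mult_def matrix_vector_mult_def adj_def vec_eq_iff sum_distrib_left cnj_sum algebra_simps)

lemma trace_adj: "trace (adj A) = cnj (trace A)"
  by (simp add: trace_def adj_def cnj_sum)

text \<open>Summing over entries identifies the inner product of the nested vector type with the
  real part of the Hilbert-Schmidt pairing. Hence \<open>norm\<close> of a matrix is its Frobenius
  norm throughout, and adjoints can be moved across \<open>\<bullet>\<close>.\<close>

lemma matrix_inner: "A \<bullet> B = Re (trace (adj B ** A))" for A B :: "complex ^ 'n ^ 'm"
  unfolding inner_vec_def trace_def adj_def matrix_matrix_mult_def
  by (subst sum.swap) (simp add: inner_complex_def Re_sum algebra_simps)

lemma inner_mult_left: "(X ** Y) \<bullet> Z = Y \<bullet> (adj X ** Z)"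
  for X :: "complex ^ 'n ^ 'm" and Y :: "complex ^ 'k ^ 'n"
  by (simp add: matrix_inner adj_mult matrix_mul_assoc)

lemma inner_mult_right: "(X ** Y) \<bullet> Z = X \<bullet> (Z ** adj Y)"
  for X :: "complex ^ 'n ^ 'm" and Y :: "complex ^ 'k ^ 'n"
  unfolding matrix_inner adj_mult adj_adj
  by (subst (2) trace_mul_sym[symmetric]) (metis matrix_mul_assoc trace_mul_sym)

lemma inner_adj: "adj A \<bullet> adj B = A \<bullet> B" for A B :: "complex ^ 'n ^ 'm"
  by (simp add: matrix_inner) (metis adj_adj adj_mult complex_cnj_cnj cnj.simps(1) trace_adj trace_mul_sym)

lemma norm_adj [simp]: "norm (adj A) = norm A"
  by (simp add: norm_eq_sqrt_inner inner_adj)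

lemma norm_matrix_columns: "(norm A)\<^sup>2 = (\<Sum>j\<in>UNIV. (norm (A *v axis j 1))\<^sup>2)" for A :: "complex ^ 'n ^ 'm"
proof -
  have "(A *v axis j 1) $ i = A $ i $ j" for i j
    by (simp add: matrix_vector_mult_def axis_def if_distrib cong: if_cong)
  then show ?thesis
    unfolding norm_vec_def L2_set_def
    by (simp add: sum_nonneg) (rule sum.swap)
qed

lemma norm_matrix_vector: "norm (A *v x) \<le> norm A * norm x" for A :: "complex ^ 'n ^ 'm"
proof -
  have "cmod ((A *v x) $ i) \<le> norm (A $ i) * norm x" for i
  proof -
    have "(A *v x) $ i = herm (A $ i) (\<chi> j. cnj (x $ j))"
      by (simp add: matrix_vector_mult_def herm_def)
    also have "cmod \<dots> \<le> norm (A $ i) * norm (\<chi> j. cnj (x $ j))" by (rule herm_cauchy)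
    also have "norm (\<chi> j. cnj (x $ j)) = norm x" by (simp add: norm_vec_def)
    finally show ?thesis .
  qed
  then have "norm (A *v x) \<le> L2_set (\<lambda>i. norm (A $ i) * norm x) UNIV"
    unfolding norm_vec_def by (intro L2_set_mono) (auto simp: norm_vec_def)
  also have "\<dots> = norm A * norm x"
    by (simp add: L2_set_left_distrib norm_vec_def)
  finally show ?thesis .
qed

lemma matrix_vector_mult_assoc': "(A ** B) *v x = A *v (B *v x)"
  by (simp add: matrix_vector_mul_assoc)

lemma norm_matrix_mult_bound:
  fixes A :: "complex ^ 'n ^ 'm" and B :: "complex ^ 'k ^ 'n"
  assumes "\<And>x. norm (A *v x) \<le> K * norm x" "K \<ge> 0"
  shows "norm (A ** B) \<le> K * norm B"
proof -
  have "(norm (A ** B))\<^sup>2 = (\<Sum>j\<in>UNIV. (norm (A *v (B *v axis j 1)))\<^sup>2)"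
    by (simp add: norm_matrix_columns matrix_vector_mult_assoc')
  also have "\<dots> \<le> (\<Sum>j\<in>UNIV. (K * norm (B *v axis j 1))\<^sup>2)"
    by (intro sum_mono power_mono assms) auto
  also have "\<dots> = (K * norm B)\<^sup>2"
    by (simp add: power_mult_distrib norm_matrix_columns sum_distrib_left)
  finally show ?thesis using assms(2) by (simp add: power2_le_iff_abs_le)
qed

lemma norm_matrix_mult: "norm (A ** B) \<le> norm A * norm B"
  for A :: "complex ^ 'n ^ 'm" and B :: "complex ^ 'k ^ 'n"
  by (rule norm_matrix_mult_bound) (auto intro: norm_matrix_vector)

lemma mat_commute: "mat c ** A = A ** mat c" for A :: "complex ^ 'n ^ 'n"
  by (simp add: matrix_matrix_mult_def mat_def vec_eq_iff if_distrib if_distribR mult.commute cong: if_cong)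

lemma mat_vec: "mat c *v x = c *s (x :: complex ^ 'n)"
proof -
  have "(if i = j then c else 0) * x $ j = (if i = j then c * x $ j else 0)" for i j by simp
  then show ?thesis by (simp add: matrix_vector_mult_def mat_def vec_eq_iff)
qed

lemma mat_mult_mat: "mat c ** mat d = (mat (c * d) :: complex ^ 'n ^ 'n)"
  by (simp add: matrix_eq mat_vec vector_smult_assoc flip: matrix_vector_mul_assoc)

lemma trace_mat_mult: "trace (mat c ** A) = c * trace A" for A :: "complex ^ 'n ^ 'n"
proof -
  have "(if i = j then c else 0) * A $ j $ k = (if i = j then c * A $ j $ k else 0)" for i j k by simp
  then show ?thesis by (simp add: trace_def matrix_matrix_mult_def mat_def sum_distrib_left)
qed

lemma trace_mat: "trace (mat c :: complex ^ 'n ^ 'n) = of_nat CARD('n) * c"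
  by (simp add: trace_def mat_def)

lemma norm_mat_mult: "norm (mat c ** A) = cmod c * norm A" for A :: "complex ^ 'n ^ 'm"
proof -
  have "(norm (mat c ** A))\<^sup>2 = (cmod c * norm A)\<^sup>2"
    unfolding norm_matrix_columns[of "mat c ** A"] matrix_vector_mult_assoc' mat_vec
    by (simp add: power_mult_distrib norm_matrix_columns[of A] sum_distrib_left)
  then show ?thesis by (simp add: power2_eq_iff_nonneg)
qed

lemma matrix_mult_diff_left: "(A - B) ** C = A ** C - B ** C" for A :: "complex ^ 'n ^ 'm"
  by (simp add: matrix_matrix_mult_def vec_eq_iff sum_subtractf algebra_simps)

lemma matrix_mult_diff_right: "A ** (B - C) = A ** B - A ** C" for A :: "complex ^ 'n ^ 'm"
  by (simp add: matrix_matrix_mult_def vec_eq_iff sum_subtractf algebra_simps)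

lemma matrix_mult_add_left: "(A + B) ** C = A ** C + B ** C" for A :: "complex ^ 'n ^ 'm"
  by (simp add: matrix_matrix_mult_def vec_eq_iff sum.distrib algebra_simps)

lemma matrix_mult_minus_left: "(- A) ** C = - (A ** C)" for A :: "complex ^ 'n ^ 'm"
  by (simp add: matrix_matrix_mult_def vec_eq_iff sum_negf)

text \<open>Used whenever norm or trace is under control: conjugation inside \<open>U(n,1)\<close>
  keeps the trace and unitary factors keep the norm, so in either case the distance to the identity
  varies through one quantity only.\<close>

lemma norm_diff_mat1:
  "(norm (A - mat 1))\<^sup>2 = (norm A)\<^sup>2 + of_nat CARD('n) - 2 * Re (trace A)" for A :: "complex ^ 'n ^ 'n"
proof -
  have "A \<bullet> mat 1 = Re (trace A)" by (simp add: matrix_inner)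
  moreover have "mat 1 \<bullet> (mat 1 :: complex ^ 'n ^ 'n) = of_nat CARD('n)"
    by (simp add: matrix_inner trace_mat)
  moreover have "(norm (A - mat 1))\<^sup>2 = (norm A)\<^sup>2 + mat 1 \<bullet> (mat 1 :: complex ^ 'n ^ 'n) - 2 * (A \<bullet> mat 1)"
    unfolding power2_norm_eq_inner inner_diff_left inner_diff_right using inner_commute[of A "mat 1"] by linarith
  ultimately show ?thesis by linarith
qed

section \<open>The unitary group and its isometric action on matrices\<close>

definition unitary :: "complex ^ 'n ^ 'n \<Rightarrow> bool" where
  "unitary U \<longleftrightarrow> adj U ** U = mat 1"

lemma unitaryD: "unitary U \<Longrightarrow> adj U ** U = mat 1" "unitary U \<Longrightarrow> U ** adj U = mat 1"
  unfolding unitary_def by (assumption, metis matrix_left_right_inverse)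

lemma unitary_adj: "unitary U \<Longrightarrow> unitary (adj U)"
  unfolding unitary_def by (metis adj_adj matrix_left_right_inverse)

lemma unitary_mult: "unitary U \<Longrightarrow> unitary V \<Longrightarrow> unitary (U ** V)"
  unfolding unitary_def adj_mult by (metis matrix_mul_assoc matrix_mul_lid)

lemma unitary_mat1 [simp]: "unitary (mat 1)"
  by (simp add: unitary_def)

lemma unitary_herm: "unitary U \<Longrightarrow> herm (U *v x) (U *v y) = herm x y"
  by (simp add: herm_mult_left matrix_vector_mul_assoc unitaryD)

lemma unitary_norm_vec: "unitary U \<Longrightarrow> norm (U *v x) = norm x"
  using unitary_herm[of U x x] by (simp add: herm_self flip: of_real_power)

lemma unitary_adj_cancel: "unitary U \<Longrightarrow> adj U *v (U *v x) = x" "unitary U \<Longrightarrow> U *v (adj U *v x) = x"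
  by (simp_all add: matrix_vector_mul_assoc unitaryD)

lemma unitary_norm_left: "unitary U \<Longrightarrow> norm (U ** A) = norm A"
  for A :: "complex ^ 'm ^ 'n"
  by (simp add: norm_eq_sqrt_inner inner_mult_left matrix_mul_assoc unitaryD)

lemma unitary_norm_right: "unitary U \<Longrightarrow> norm (A ** U) = norm A"
  for A :: "complex ^ 'n ^ 'm"
  by (simp add: norm_eq_sqrt_inner inner_mult_right unitaryD flip: matrix_mul_assoc)

lemma norm_matrix_columns_unitary:
  fixes A :: "complex ^ 'n ^ 'm"
  assumes "unitary W"
  shows "(norm A)\<^sup>2 = (\<Sum>j\<in>UNIV. (norm (A *v (W *v axis j 1)))\<^sup>2)"
  using norm_matrix_columns[of "A ** W"] by (simp add: unitary_norm_right assms matrix_vector_mult_assoc')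

section \<open>Unitary matrices\<close>

text \<open>The unitary group of the coordinate subspace of I, embedded in the full matrix type.
  Keeping the type fixed lets inductions on the dimension run over the finite set I.\<close>

definition fixes_off :: "'n set \<Rightarrow> complex ^ 'n ^ 'n \<Rightarrow> bool" where
  "fixes_off I U \<longleftrightarrow> unitary U \<and> (\<forall>i. i \<notin> I \<longrightarrow> U *v axis i 1 = axis i 1)"

text \<open>The value 1 at zero keeps the modulus equal to 1 for every argument.\<close>

definition phase :: "complex \<Rightarrow> complex" where
  "phase a = (if a = 0 then 1 else a / of_real (cmod a))"

lemma phase_simps: "phase a * cnj (phase a) = 1" "a * cnj (phase a) = of_real (cmod a)"
  "cnj a * phase a = of_real (cmod a)"
proof -
  have "cmod (phase a) = 1" by (simp add: phase_def norm_divide)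
  then show "phase a * cnj (phase a) = 1" by (simp add: complex_norm_square[symmetric])
  have "a = of_real (cmod a) * phase a" by (simp add: phase_def)
  then show "a * cnj (phase a) = of_real (cmod a)"
    using \<open>phase a * cnj (phase a) = 1\<close> by (metis mult.assoc mult.right_neutral)
  then show "cnj a * phase a = of_real (cmod a)"
    by (metis complex_cnj_cnj complex_cnj_complex_of_real complex_cnj_mult)
qed

text \<open>A unitary matrix carrying e to the unit vector v, close to the identity when v is close
  to e. It multiplies the coordinate along e by \<open>phase \<alpha>\<close> and then turns
  \<open>phase \<alpha> *s e\<close> into v by a rotation in the span of e and v; w is the component
  of v orthogonal to e. Dividing by 1 + |\<alpha>| instead of the norm of w keeps the formula valid
  for w = 0.\<close>

definition rot :: "'n \<Rightarrow> complex ^ 'n \<Rightarrow> complex ^ 'n ^ 'n" where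
  "rot i v = (let e = axis i 1; \<alpha> = v $ i; w = v - \<alpha> *s e in
     mat 1 + outer (v - e) e - outer (phase \<alpha> *s e) w - outer (of_real (1 / (1 + cmod \<alpha>)) *s w) w)"

lemma rot_facts:
  fixes v :: "complex ^ 'n" and i :: 'n
  assumes v: "norm v = 1"
  defines "e \<equiv> (axis i 1 :: complex ^ 'n)"
  defines "w \<equiv> v - (v $ i) *s e"
  shows "herm e w = 0" "herm w e = 0" "herm e e = 1" "herm w w = of_real (1 - (cmod (v $ i))\<^sup>2)"
proof -
  show ee: "herm e e = 1" by (simp add: e_def)
  have ve: "herm v e = v $ i" by (simp add: e_def)
  show we: "herm w e = 0" by (simp add: w_def herm_simps ee ve)
  then show "herm e w = 0" using herm_commute[of w e] by simp
  have "herm w w = herm w v" using we by (simp add: w_def herm_simps)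
  also have "\<dots> = herm v v - (v $ i) * cnj (v $ i)"
    by (simp add: w_def herm_simps, simp add: e_def)
  finally show "herm w w = of_real (1 - (cmod (v $ i))\<^sup>2)"
    using herm_self[of v] v by (simp add: complex_norm_square[symmetric])
qed

lemma rot_mult_vec:
  fixes v :: "complex ^ 'n" and i :: 'n
  defines "e \<equiv> (axis i 1 :: complex ^ 'n)"
  defines "w \<equiv> v - (v $ i) *s e"
  shows "rot i v *v x = x + (herm x e * (v $ i - 1) - phase (v $ i) * herm x w) *s e
    + (herm x e - herm x w / of_real (1 + cmod (v $ i))) *s w"
  unfolding rot_def Let_def e_def[symmetric] w_def[symmetric]
  by (simp add: matrix_vector_mult_add_rdistrib matrix_vector_mult_diff_rdistrib outer_mult_vec w_def[symmetric])
     (simp add: w_def vec_eq_iff algebra_simps add_divide_distrib diff_divide_distrib)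

lemma rot_unitary:
  fixes v :: "complex ^ 'n"
  assumes v: "norm v = 1"
  shows "unitary (rot i v)"
proof -
  define e where "e = (axis i 1 :: complex ^ 'n)"
  define w where "w = v - (v $ i) *s e"
  define r where "r = complex_of_real (cmod (v $ i))"
  define k where "k = 1 / (1 + r)"
  have "1 + r \<noteq> 0" unfolding r_def
    by (metis add_nonneg_eq_0_iff norm_ge_zero of_real_1 of_real_add of_real_eq_0_iff zero_le_one zero_neq_one)
  then have k: "k * (1 + r) = 1" by (simp add: k_def)
  have kc: "cnj k = k" by (simp add: k_def r_def)
  note f = rot_facts[OF v, of i, folded e_def, folded w_def]
  have b: "herm w w = 1 - r\<^sup>2" using f(4) by (simp add: r_def)
  have R: "rot i v *v x = x + (herm x e * (v $ i - 1) - phase (v $ i) * herm x w) *s e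
    + (herm x e - k * herm x w) *s w" for x
  proof -
    have "herm x w / of_real (1 + cmod (v $ i)) = k * herm x w"
      unfolding k_def r_def of_real_add of_real_1 by (simp only: times_divide_eq_left mult_1)
    then show ?thesis unfolding rot_mult_vec e_def[symmetric] w_def[symmetric] by (simp only:)
  qed
  have "herm (rot i v *v x) (rot i v *v y) = herm x y" for x y
  proof -
    define a b a' b' where ab: "a = herm x e" "b = herm x w" "a' = cnj (herm y e)" "b' = cnj (herm y w)"
    have ab': "herm e y = a'" "herm w y = b'" unfolding ab using herm_commute[of e y] herm_commute[of w y] by simp_all
    let ?P = "a * (v $ i - 1) - phase (v $ i) * b" and ?P' = "a' * (cnj (v $ i) - 1) - cnj (phase (v $ i)) * b'"
    let ?Q = "a - k * b" and ?Q' = "a' - k * b'"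
    have "herm (rot i v *v x) (rot i v *v y)
      = herm x y + ?P * a' + ?Q * b' + ?P' * a + ?Q' * b + ?P * ?P' + ?Q * ?Q' * (1 - r\<^sup>2)"
      unfolding R by (simp add: herm_simps f(1-3) b ab' kc flip: ab) (simp add: algebra_simps)
    moreover have "?P * a' + ?Q * b' + ?P' * a + ?Q' * b + ?P * ?P' + ?Q * ?Q' * (1 - r\<^sup>2) = 0"
    proof -
      have "phase (v $ i) * cnj (phase (v $ i)) = 1" "v $ i * cnj (phase (v $ i)) = r"
        "cnj (v $ i) * phase (v $ i) = r" "v $ i * cnj (v $ i) = r\<^sup>2"
        by (simp_all only: phase_simps r_def complex_norm_square flip: of_real_power)
      then show ?thesis using k by algebra
    qed
    ultimately show ?thesis by (simp add: algebra_simps)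
  qed
  then have h: "herm ((adj (rot i v) ** rot i v) *v axis j 1) (axis l 1) = herm (mat 1 *v axis j 1) (axis l 1)" for j l
    by (simp only: herm_mult_left matrix_vector_mul_assoc[symmetric] matrix_vector_mul_lid adj_adj)
  have "(adj (rot i v) ** rot i v) $ l $ j = mat 1 $ l $ j" for l j
    using h[of j l] matrix_entry[of "adj (rot i v) ** rot i v" l j] matrix_entry[of "mat 1 :: complex ^ 'n ^ 'n" l j] by metis
  then show ?thesis unfolding unitary_def vec_eq_iff by blast
qed

lemma rot_axis: "norm v = 1 \<Longrightarrow> rot i v *v axis i 1 = v"
  unfolding rot_mult_vec by (simp add: rot_facts)

lemma rot_fixes_off:
  assumes v: "norm v = 1" and I: "i \<in> I" "\<And>j. j \<notin> I \<Longrightarrow> v $ j = 0"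
  shows "fixes_off I (rot i v)"
  unfolding fixes_off_def
proof (intro conjI allI impI rot_unitary v)
  fix j assume j: "j \<notin> I"
  then have ij: "i \<noteq> j" using I by auto
  then have "herm (axis j 1) (axis i 1 :: complex ^ 'a) = 0"
    unfolding herm_axis_right by (simp add: axis_def)
  moreover have "herm (axis j 1) (v - (v $ i) *s axis i 1) = 0"
    using I(2)[OF j] ij unfolding herm_diff_right herm_scale_right herm_axis_left by (simp add: axis_def)
  ultimately show "rot i v *v axis j 1 = axis j 1" unfolding rot_mult_vec by simp
qed

lemma fixes_off_adj: "fixes_off I U \<Longrightarrow> fixes_off I (adj U)"
  unfolding fixes_off_def using unitary_adj unitary_adj_cancel(1) by metis

lemma fixes_off_mult: "fixes_off I U \<Longrightarrow> fixes_off I V \<Longrightarrow> fixes_off I (U ** V)"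
  unfolding fixes_off_def by (simp add: unitary_mult matrix_vector_mult_assoc')

lemma fixes_off_mono: "fixes_off I U \<Longrightarrow> I \<subseteq> J \<Longrightarrow> fixes_off J U"
  unfolding fixes_off_def by blast

text \<open>Since Y fixes the axis, the cross term with \<open>phase\<close> drops out and the term
  in w costs at most (1 - r^2) / (1 + r) = 1 - r. By \<open>norm_diff_mat1\<close>, multiplying by
  the rotation raises the squared distance to the identity by at most 4 (1 - Re (v $ i)).\<close>

lemma trace_rot_mult:
  assumes v: "norm v = 1" and Y: "unitary Y" "Y *v axis i 1 = axis i 1"
  shows "Re (trace (rot i v ** Y)) \<ge> Re (trace Y) - 2 * (1 - Re (v $ i))"
proof -
  define e where "e = (axis i 1 :: complex ^ 'a)"
  define w where "w = v - (v $ i) *s e"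
  define r where "r = cmod (v $ i)"
  note f = rot_facts[OF v, of i, folded e_def, folded w_def]
  have Ye: "Y *v e = e" "adj Y *v e = e"
    using Y unitary_adj_cancel(1)[OF Y(1), of "axis i 1"] by (simp_all add: e_def)
  have "trace (rot i v ** Y) = trace Y + herm (v - e) (adj Y *v e)
    - phase (v $ i) * herm e (adj Y *v w) - of_real (1 / (1 + r)) * herm w (adj Y *v w)"
    unfolding rot_def Let_def e_def[symmetric] w_def[symmetric] r_def[symmetric]
    by (simp add: matrix_mult_diff_left matrix_mult_add_left trace_add trace_sub outer_mult trace_outer herm_scale_left)
  also have "herm e (adj Y *v w) = 0" using Ye f(1) by (simp add: herm_mult_right)
  also have "herm (v - e) (adj Y *v e) = v $ i - 1" by (simp add: Ye herm_simps, simp add: e_def)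
  finally have eq: "Re (trace (rot i v ** Y)) = Re (trace Y) + (Re (v $ i) - 1) - (1 / (1 + r)) * Re (herm w (adj Y *v w))"
    by (simp del: of_real_divide)
  have "(1 / (1 + r)) * Re (herm w (adj Y *v w)) \<le> 1 - Re (v $ i)"
  proof -
    have r: "0 \<le> r" "Re (v $ i) \<le> r" by (auto simp: r_def complex_Re_le_cmod)
    have "r \<le> 1" using v Finite_Cartesian_Product.norm_nth_le[of v i] by (simp add: r_def)
    have "(norm w)\<^sup>2 = 1 - r\<^sup>2" using f(4) herm_self[of w] by (metis of_real_eq_iff r_def)
    moreover have "Re (herm w (adj Y *v w)) \<le> norm w * norm w"
      using complex_Re_le_cmod[of "herm w (adj Y *v w)"] herm_cauchy[of w "adj Y *v w"]
        unitary_norm_vec[OF unitary_adj[OF Y(1)]] by simp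
    ultimately have "Re (herm w (adj Y *v w)) \<le> (1 - r) * (1 + r)"
      by (simp add: power2_eq_square algebra_simps)
    then have "(1 / (1 + r)) * Re (herm w (adj Y *v w)) \<le> 1 - r"
      using r by (simp add: field_simps)
    then show ?thesis using r by linarith
  qed
  with eq show ?thesis by argo
qed

text \<open>By compactness the quadratic form of H has a maximum on the unit sphere of the subspace
  of I, and the residual of a maximizer must vanish. The assumption \<open>off\<close> says that H
  is already diagonal outside I, which keeps this residual in the subspace.\<close>

lemma hermitian_eigenvector:
  fixes H :: "complex ^ 'n ^ 'n"
  assumes H: "adj H = H" and I: "i \<in> I"
    and off: "\<And>j. j \<notin> I \<Longrightarrow> \<exists>c::real. H *v axis j 1 = of_real c *s axis j 1"
  shows "\<exists>v (c::real). norm v = 1 \<and> (\<forall>j. j \<notin> I \<longrightarrow> v $ j = 0) \<and> H *v v = of_real c *s v"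
proof -
  define S where "S = {x :: complex ^ 'n. norm x = 1 \<and> (\<forall>j. j \<notin> I \<longrightarrow> x $ j = 0)}"
  have S: "S = sphere 0 1 \<inter> (\<Inter>j\<in>-I. {x. x $ j = 0})" by (auto simp: S_def)
  have "closed {x :: complex ^ 'n. x $ j = 0}" for j
    by (rule closed_Collect_eq) (auto intro: continuous_intros)
  then have "compact S" unfolding S by (intro compact_Int_closed compact_sphere closed_INT) auto
  moreover have "norm (axis i 1 :: complex ^ 'n) = 1" by (simp add: norm_eq_sqrt_inner inner_axis_axis)
  then have "axis i 1 \<in> S" using I by (auto simp: S_def axis_def)
  moreover have "continuous_on S (\<lambda>x. (H *v x) \<bullet> x)"
    by (intro continuous_on_inner linear_continuous_on continuous_on_id)
       (simp add: linear_conv_bounded_linear[symmetric])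
  ultimately obtain v where v: "v \<in> S" and max: "\<And>x. x \<in> S \<Longrightarrow> (H *v x) \<bullet> x \<le> (H *v v) \<bullet> v"
    using continuous_attains_sup[of S "\<lambda>x. (H *v x) \<bullet> x"] by blast
  define c where "c = (H *v v) \<bullet> v"
  have scale: "(H *v x) \<bullet> x \<le> c * (x \<bullet> x)" if x: "\<And>j. j \<notin> I \<Longrightarrow> x $ j = 0" for x
  proof (cases "x = 0")
    case False
    have "(1 / norm x) *\<^sub>R x \<in> S" using False x by (simp add: S_def)
    then have "(H *v ((1 / norm x) *\<^sub>R x)) \<bullet> ((1 / norm x) *\<^sub>R x) \<le> c" using max c_def by blast
    moreover have "H *v ((1 / norm x) *\<^sub>R x) = (1 / norm x) *\<^sub>R (H *v x)"
      using matrix_vector_mul_linear[of H] by (rule linear_scale)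
    ultimately have "(H *v x) \<bullet> x / (norm x * norm x) \<le> c" by simp
    then show ?thesis using False by (simp add: divide_le_eq dot_square_norm power2_eq_square)
  qed simp
  define y where "y = H *v v - c *\<^sub>R v"
  have yI: "y $ j = 0" if j: "j \<notin> I" for j
  proof -
    obtain d where d: "H *v axis j 1 = of_real d *s axis j 1" using off[OF j] by blast
    have "(H *v v) $ j = herm v (H *v axis j 1)" using herm_mult_left[of H v "axis j 1"] H by simp
    also have "\<dots> = 0" using v j by (simp add: d herm_scale_right S_def)
    finally show ?thesis using v j by (simp add: y_def S_def)
  qed
  have vI: "v $ j = 0" if "j \<notin> I" for j using v that by (simp add: S_def)
  have sym: "(H *v a) \<bullet> b = (H *v b) \<bullet> a" for a b
    unfolding inner_eq_Re_herm using herm_mult_left[of H a b] H herm_commute[of a "H *v b"] by simp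
  have vv: "v \<bullet> v = 1" using v by (simp add: S_def dot_square_norm)
  \<comment> \<open>Perturbing the maximizer by t times its residual gains 2 t |y|^2 to first order
    and loses only order t^2; a small positive t then forces y = 0.\<close>
  have ineq: "2 * t * (y \<bullet> y) \<le> t\<^sup>2 * (c * (y \<bullet> y) - (H *v y) \<bullet> y)" for t
  proof -
    have "(H *v (v + t *\<^sub>R y)) \<bullet> (v + t *\<^sub>R y) \<le> c * ((v + t *\<^sub>R y) \<bullet> (v + t *\<^sub>R y))"
      by (rule scale) (simp add: vI yI)
    moreover have "H *v (v + t *\<^sub>R y) = H *v v + t *\<^sub>R (H *v y)"
      using matrix_vector_mul_linear[of H] by (simp add: linear_add linear_scale)
    moreover have "(H *v v) \<bullet> y = y \<bullet> y + c * (v \<bullet> y)"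
      by (simp add: y_def inner_diff_left algebra_simps inner_commute)
    ultimately show ?thesis
      using sym[of y v] c_def vv
      by (simp add: inner_add_left inner_add_right power2_eq_square algebra_simps inner_commute)
  qed
  have "y = 0"
  proof (rule ccontr)
    assume "y \<noteq> 0"
    then have yy: "y \<bullet> y > 0" by simp
    define b where "b = \<bar>c * (y \<bullet> y) - (H *v y) \<bullet> y\<bar> + 1"
    define t where "t = (y \<bullet> y) / b"
    have b: "b > 0" "c * (y \<bullet> y) - (H *v y) \<bullet> y \<le> b" by (auto simp: b_def)
    have t: "t > 0" using yy b by (simp add: t_def)
    have "2 * t * (y \<bullet> y) \<le> t\<^sup>2 * b"
      using ineq[of t] b mult_left_mono[of _ b "t\<^sup>2"] by (meson order_trans zero_le_power2)
    also have "t\<^sup>2 * b = t * (y \<bullet> y)" using b by (simp add: t_def power2_eq_square)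
    finally show False using t yy by simp
  qed
  then have "H *v v = of_real c *s v"
    unfolding y_def by (simp add: vec_eq_iff) (simp add: scaleR_conv_of_real)
  then show ?thesis using v by (auto simp: S_def)
qed

text \<open>Deflation over the index set: \<open>rot\<close> moves axis i onto an eigenvector in the
  subspace of \<open>insert i I\<close>, after which the conjugated matrix is diagonal outside I.
  For I = UNIV the diagonality condition is vacuous.\<close>

lemma hermitian_diagonalizable:
  fixes H :: "complex ^ 'n ^ 'n"
  assumes H: "adj H = H"
  obtains W h where "unitary W" "\<And>i. H *v (W *v axis i 1) = of_real (h i) *s (W *v axis i 1)"
proof -
  have "\<exists>W h. unitary W \<and> (\<forall>i. H *v (W *v axis i 1) = of_real (h i) *s (W *v axis i 1))"
    if "adj H = H" "\<And>j. j \<notin> I \<Longrightarrow> \<exists>c::real. H *v axis j 1 = of_real c *s axis j 1" for H :: "complex ^ 'n ^ 'n" and I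
    using finite[of I] that
  proof (induction I arbitrary: H rule: finite_induct)
    case empty
    then have "\<forall>j. \<exists>c::real. H *v axis j 1 = of_real c *s axis j 1" by simp
    then obtain h :: "'n \<Rightarrow> real" where h: "\<And>j. H *v axis j 1 = of_real (h j) *s axis j 1" by metis
    show ?case by (rule exI[of _ "mat 1"], rule exI[of _ h]) (simp add: h)
  next
    case (insert i I)
    have "\<exists>v (c::real). norm v = 1 \<and> (\<forall>j. j \<notin> insert i I \<longrightarrow> v $ j = 0) \<and> H *v v = of_real c *s v"
      by (rule hermitian_eigenvector[of H i]) (use insert in auto)
    then obtain v and c :: real where v: "norm v = 1" "\<And>j. j \<notin> insert i I \<Longrightarrow> v $ j = 0" "H *v v = of_real c *s v"
      by blast
    define R where "R = rot i v"
    have R: "unitary R" "R *v axis i 1 = v" by (auto simp: R_def rot_unitary rot_axis v)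
    have Roff: "R *v axis j 1 = axis j 1" if "j \<notin> insert i I" for j
      using rot_fixes_off[OF v(1), of i "insert i I"] v(2) that by (auto simp: fixes_off_def R_def)
    define H' where "H' = adj R ** H ** R"
    have H'ax: "\<exists>c::real. H' *v axis j 1 = of_real c *s axis j 1" if j: "j \<notin> I" for j
    proof (cases "j = i")
      case True
      have "H' *v axis i 1 = of_real c *s (adj R *v v)"
        by (simp add: H'_def matrix_vector_mult_assoc' R v vector_scalar_commute)
      also have "adj R *v v = axis i 1" using unitary_adj_cancel(1)[OF R(1), of "axis i 1"] R by simp
      finally show ?thesis using True by blast
    next
      case False
      then obtain d :: real where d: "H *v axis j 1 = of_real d *s axis j 1" using insert.prems(2)[of j] j by blast
      have "H' *v axis j 1 = of_real d *s (adj R *v axis j 1)"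
        using Roff[of j] False j by (simp add: H'_def matrix_vector_mult_assoc' d vector_scalar_commute)
      also have "adj R *v axis j 1 = axis j 1"
        using unitary_adj_cancel(1)[OF R(1), of "axis j 1"] Roff[of j] False j by simp
      finally show ?thesis by blast
    qed
    have "adj H' = H'" by (simp add: H'_def adj_mult insert.prems matrix_mul_assoc)
    from insert.IH[OF this H'ax] obtain W h where W: "unitary W"
      "\<And>i. H' *v (W *v axis i 1) = of_real (h i) *s (W *v axis i 1)" by blast
    show ?case
    proof (rule exI[of _ "R ** W"], rule exI[of _ h], intro conjI allI)
      show "unitary (R ** W)" using R W by (simp add: unitary_mult)
      fix j
      have "R *v (H' *v (W *v axis j 1)) = H *v (R *v (W *v axis j 1))"
        by (simp add: H'_def matrix_vector_mult_assoc' unitary_adj_cancel R)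
      then show "H *v ((R ** W) *v axis j 1) = of_real (h j) *s ((R ** W) *v axis j 1)"
        by (simp add: W(2) matrix_vector_mult_assoc' vector_scalar_commute)
    qed
  qed
  from this[OF H, of UNIV] that show ?thesis by auto
qed

section \<open>The Boettcher--Wenzel inequality\<close>

text \<open>The factor \<open>1/2\<close> is what yields the sharp constant in the Boettcher--Wenzel inequality.\<close>

lemma variance_bound:
  fixes z :: "'n::finite \<Rightarrow> complex" and p :: "'n \<Rightarrow> real"
  assumes p: "\<And>i. p i \<ge> 0" "(\<Sum>i\<in>UNIV. p i) = 1"
  defines "\<mu> \<equiv> \<Sum>i\<in>UNIV. p i *\<^sub>R z i"
  shows "2 * (\<Sum>i\<in>UNIV. p i * (cmod (z i - \<mu>))\<^sup>2) \<le> (\<Sum>i\<in>UNIV. (cmod (z i))\<^sup>2)"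
proof -
  let ?S = "\<Sum>i\<in>UNIV. p i * (cmod (z i))\<^sup>2"
  have mm: "(\<Sum>i\<in>UNIV. \<Sum>j\<in>UNIV. p i * p j * (z i \<bullet> z j)) = \<mu> \<bullet> \<mu>"
    unfolding \<mu>_def inner_sum_left inner_sum_right by (simp add: algebra_simps inner_commute)
  have pz: "(\<Sum>i\<in>UNIV. p i * (z i \<bullet> \<mu>)) = \<mu> \<bullet> \<mu>"
    unfolding \<mu>_def by (simp add: inner_sum_left)
  have "(\<Sum>i\<in>UNIV. p i * (cmod (z i - \<mu>))\<^sup>2)
      = (\<Sum>i\<in>UNIV. p i * (cmod (z i))\<^sup>2 - 2 * (p i * (z i \<bullet> \<mu>)) + p i * (\<mu> \<bullet> \<mu>))"
    by (intro sum.cong refl) (simp add: power2_norm_eq_inner inner_diff_left inner_diff_right inner_commute algebra_simps)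
  also have "\<dots> = ?S - 2 * (\<mu> \<bullet> \<mu>) + \<mu> \<bullet> \<mu>"
    using p(2) pz by (simp add: sum.distrib sum_subtractf flip: sum_distrib_left sum_distrib_right)
  finally have var: "2 * (\<Sum>i\<in>UNIV. p i * (cmod (z i - \<mu>))\<^sup>2) = 2 * ?S - 2 * (\<mu> \<bullet> \<mu>)" by simp
  \<comment> \<open>This double sum is twice the variance. Each pair is bounded by 2 |z i|^2 + 2 |z
    j|^2, but the diagonal pairs contribute 0; removing them leaves the factors 4 (p i - (p i)^2),
    which are at most 1.\<close>
  have "(\<Sum>i\<in>UNIV. \<Sum>j\<in>UNIV. p i * p j * (cmod (z i - z j))\<^sup>2)
      \<le> (\<Sum>i\<in>UNIV. \<Sum>j\<in>UNIV. 2 * p j * (p i * (cmod (z i))\<^sup>2) + 2 * p i * (p j * (cmod (z j))\<^sup>2)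
           - (if j = i then 4 * (p i)\<^sup>2 * (cmod (z i))\<^sup>2 else 0))"
  proof (intro sum_mono)
    fix i j
    have "(cmod (z i - z j))\<^sup>2 \<le> 2 * (cmod (z i))\<^sup>2 + 2 * (cmod (z j))\<^sup>2"
      using zero_le_power2[of "cmod (z i + z j)"]
      by (simp add: power2_norm_eq_inner inner_diff_left inner_diff_right inner_add_left inner_add_right inner_commute)
    then have "p i * p j * (cmod (z i - z j))\<^sup>2 \<le> p i * p j * (2 * (cmod (z i))\<^sup>2 + 2 * (cmod (z j))\<^sup>2)"
      using p(1) by (intro mult_left_mono) auto
    then show "p i * p j * (cmod (z i - z j))\<^sup>2 \<le> 2 * p j * (p i * (cmod (z i))\<^sup>2) + 2 * p i * (p j * (cmod (z j))\<^sup>2)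
           - (if j = i then 4 * (p i)\<^sup>2 * (cmod (z i))\<^sup>2 else 0)"
      by (auto simp: algebra_simps power2_eq_square)
  qed
  also have "\<dots> = 4 * ?S - (\<Sum>i\<in>UNIV. 4 * (p i)\<^sup>2 * (cmod (z i))\<^sup>2)"
  proof -
    have "(\<Sum>i\<in>UNIV. \<Sum>j\<in>UNIV. 2 * p j * (p i * (cmod (z i))\<^sup>2)) = 2 * ?S"
      using p(2) by (simp flip: sum_distrib_left sum_distrib_right)
    moreover have "(\<Sum>i\<in>UNIV. \<Sum>j\<in>UNIV. 2 * p i * (p j * (cmod (z j))\<^sup>2)) = 2 * ?S"
      using p(2) by (simp flip: sum_distrib_left sum_distrib_right)
    ultimately show ?thesis by (simp add: sum.distrib sum_subtractf)
  qed
  also have "\<dots> = (\<Sum>i\<in>UNIV. 4 * (p i - (p i)\<^sup>2) * (cmod (z i))\<^sup>2)"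
    by (simp add: sum_distrib_left sum_subtractf[symmetric] algebra_simps)
  also have "\<dots> \<le> (\<Sum>i\<in>UNIV. 1 * (cmod (z i))\<^sup>2)"
  proof (intro sum_mono mult_right_mono)
    fix i show "4 * (p i - (p i)\<^sup>2) \<le> 1"
      using zero_le_power2[of "1 - 2 * p i"] by (simp add: power2_eq_square algebra_simps)
  qed auto
  finally have pairs: "(\<Sum>i\<in>UNIV. \<Sum>j\<in>UNIV. p i * p j * (cmod (z i - z j))\<^sup>2) \<le> (\<Sum>i\<in>UNIV. (cmod (z i))\<^sup>2)" by simp
  have "(\<Sum>i\<in>UNIV. \<Sum>j\<in>UNIV. p i * p j * (cmod (z i - z j))\<^sup>2)
     = (\<Sum>i\<in>UNIV. \<Sum>j\<in>UNIV. p j * (p i * (cmod (z i))\<^sup>2) + p i * (p j * (cmod (z j))\<^sup>2) - 2 * (p i * p j * (z i \<bullet> z j)))"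
    by (intro sum.cong refl) (simp add: power2_norm_eq_inner inner_diff_left inner_diff_right inner_commute algebra_simps)
  also have "\<dots> = (\<Sum>i\<in>UNIV. \<Sum>j\<in>UNIV. p j * (p i * (cmod (z i))\<^sup>2)) + (\<Sum>i\<in>UNIV. \<Sum>j\<in>UNIV. p i * (p j * (cmod (z j))\<^sup>2))
     - 2 * (\<Sum>i\<in>UNIV. \<Sum>j\<in>UNIV. p i * p j * (z i \<bullet> z j))"
    by (simp add: sum.distrib sum_subtractf sum_distrib_left)
  also have "\<dots> = 2 * ?S - 2 * (\<mu> \<bullet> \<mu>)"
    unfolding mm using p(2) by (simp flip: sum_distrib_left sum_distrib_right)
  finally show ?thesis using pairs var by linarith
qed

text \<open>The cross term \<open>(X ** Y) \<bullet> (Y ** X)\<close> equals the pairing of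
  \<open>Y ** adj X\<close> with \<open>adj X ** Y\<close>, and the squared norm of the sum of these
  two is nonnegative. The resulting bound treats Y and \<open>adj Y\<close> alike, so that only
  \<open>Y ** adj Y + adj Y ** Y\<close> enters afterwards.\<close>

lemma commutator_norm_le:
  fixes X Y :: "complex ^ 'n ^ 'n"
  shows "(norm (X ** Y - Y ** X))\<^sup>2
    \<le> (norm (X ** Y))\<^sup>2 + (norm (X ** adj Y))\<^sup>2 + (norm (adj X ** Y))\<^sup>2 + (norm (adj X ** adj Y))\<^sup>2"
proof -
  have "(X ** Y) \<bullet> (Y ** X) = (X ** Y ** adj X) \<bullet> Y"
    by (simp add: inner_mult_right[of "X ** Y"])
  also have "\<dots> = (Y ** adj X) \<bullet> (adj X ** Y)"
    by (simp add: matrix_mul_assoc[symmetric] inner_mult_left)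
  finally have c: "(X ** Y) \<bullet> (Y ** X) = (Y ** adj X) \<bullet> (adj X ** Y)" .
  have e1: "norm (Y ** X) = norm (adj X ** adj Y)" "norm (Y ** adj X) = norm (X ** adj Y)"
    by (metis adj_mult norm_adj adj_adj)+
  have "0 \<le> (norm (adj X ** Y + Y ** adj X))\<^sup>2" by simp
  also have "\<dots> = (norm (adj X ** Y))\<^sup>2 + (norm (Y ** adj X))\<^sup>2 + 2 * ((Y ** adj X) \<bullet> (adj X ** Y))"
    by (simp add: power2_norm_eq_inner inner_add_left inner_add_right inner_commute)
  finally have "- 2 * ((Y ** adj X) \<bullet> (adj X ** Y)) \<le> (norm (adj X ** Y))\<^sup>2 + (norm (Y ** adj X))\<^sup>2" by simp
  moreover have "(norm (X ** Y - Y ** X))\<^sup>2 = (norm (X ** Y))\<^sup>2 + (norm (Y ** X))\<^sup>2 - 2 * ((X ** Y) \<bullet> (Y ** X))"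
    by (simp add: power2_norm_eq_inner inner_diff_left inner_diff_right inner_commute)
  ultimately show ?thesis using c e1 by simp
qed

lemma matrix_inner_columns:
  "A \<bullet> B = (\<Sum>i\<in>UNIV. Re (herm (A *v axis i 1) (B *v axis i 1)))" for A B :: "complex ^ 'n ^ 'm"
proof -
  have ax: "(C *v axis j 1) $ i = C $ i $ j" for C :: "complex ^ 'n ^ 'm" and i j
    by (metis matrix_entry herm_axis_right)
  show ?thesis unfolding inner_vec_def herm_def ax
    by (subst sum.swap) (simp add: inner_complex_def)
qed

lemma inner_mult_diagonalized:
  fixes M :: "complex ^ 'n ^ 'm"
  assumes W: "unitary W" and Wh: "\<And>i. H *v (W *v axis i 1) = of_real (h i) *s (W *v axis i 1)"
  shows "M \<bullet> (M ** H) = (\<Sum>i\<in>UNIV. h i * (norm (M *v (W *v axis i 1)))\<^sup>2)"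
proof -
  have "M \<bullet> (M ** H) = (M ** W) \<bullet> (M ** H ** W)"
    using W by (simp add: inner_mult_right unitaryD flip: matrix_mul_assoc)
  also have "\<dots> = (\<Sum>i\<in>UNIV. h i * (norm (M *v (W *v axis i 1)))\<^sup>2)"
    by (simp add: matrix_inner_columns matrix_vector_mult_assoc' Wh vector_scalar_commute herm_scale_right herm_self)
  finally show ?thesis .
qed

text \<open>The Boettcher--Wenzel inequality, by Audenaert's argument: shift \<open>X\<close> by its mean in the state
  proportional to \<open>Y Y\<^sup>* + Y\<^sup>* Y\<close>.\<close>

theorem boettcher_wenzel:
  fixes X Y :: "complex ^ 'n ^ 'n"
  shows "(norm (X ** Y - Y ** X))\<^sup>2 \<le> 2 * (norm X)\<^sup>2 * (norm Y)\<^sup>2"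
proof (cases "Y = 0")
  case False
  define H where "H = Y ** adj Y + adj Y ** Y"
  have "adj H = H" by (simp add: H_def adj_add adj_mult)
  then obtain W h where W: "unitary W" and Wh: "\<And>i. H *v (W *v axis i 1) = of_real (h i) *s (W *v axis i 1)"
    using hermitian_diagonalizable by blast
  have W1: "norm (W *v axis i 1) = 1" for i
    using unitary_norm_vec[OF W, of "axis i 1"] by (simp add: norm_eq_sqrt_inner inner_axis_axis)
  have split: "(norm (M ** Y))\<^sup>2 + (norm (M ** adj Y))\<^sup>2 = (\<Sum>i\<in>UNIV. h i * (norm (M *v (W *v axis i 1)))\<^sup>2)"
    for M :: "complex ^ 'n ^ 'n"
  proof -
    have "(norm (M ** Y))\<^sup>2 + (norm (M ** adj Y))\<^sup>2 = M \<bullet> (M ** H)"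
      by (simp add: power2_norm_eq_inner inner_mult_right H_def matrix_add_ldistrib inner_add_right matrix_mul_assoc)
    also have "\<dots> = (\<Sum>i\<in>UNIV. h i * (norm (M *v (W *v axis i 1)))\<^sup>2)"
      by (rule inner_mult_diagonalized[OF W Wh])
    finally show ?thesis .
  qed
  have h: "h i \<ge> 0" for i
  proof -
    have "h i = Re (herm (H *v (W *v axis i 1)) (W *v axis i 1))"
      by (simp add: Wh herm_scale_left herm_self W1)
    also have "\<dots> = (norm (adj Y *v (W *v axis i 1)))\<^sup>2 + (norm (Y *v (W *v axis i 1)))\<^sup>2"
      by (simp add: H_def matrix_vector_mult_add_rdistrib herm_add_left herm_self
          flip: matrix_vector_mul_assoc, simp add: herm_mult_left[of Y] herm_mult_left[of "adj Y"] herm_self)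
    finally show ?thesis by simp
  qed
  have hs: "(\<Sum>i\<in>UNIV. h i) = 2 * (norm Y)\<^sup>2"
    using split[of "mat 1"] by (simp add: W1)
  \<comment> \<open>The eigenvalues of H are nonnegative with sum 2 |Y|^2, so they become
    probability weights.\<close>
  define p where "p i = h i / (2 * (norm Y)\<^sup>2)" for i
  have p: "p i \<ge> 0" "(\<Sum>i\<in>UNIV. p i) = 1" for i
    using h hs False by (simp_all add: p_def flip: sum_divide_distrib)
  have hp: "h i = 2 * (norm Y)\<^sup>2 * p i" for i using False by (simp add: p_def)
  define V where "V = adj W ** X ** W"
  define \<mu> where "\<mu> = (\<Sum>i\<in>UNIV. p i *\<^sub>R (V $ i $ i))"
  define X' where "X' = X - mat \<mu>"
  have "X' ** Y - Y ** X' = X ** Y - Y ** X"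
    unfolding X'_def matrix_mult_diff_left matrix_mult_diff_right by (simp add: mat_commute)
  then have "(norm (X ** Y - Y ** X))\<^sup>2
      \<le> (norm (X' ** Y))\<^sup>2 + (norm (X' ** adj Y))\<^sup>2 + (norm (adj X' ** Y))\<^sup>2 + (norm (adj X' ** adj Y))\<^sup>2"
    using commutator_norm_le[of X' Y] by simp
  also have "\<dots> = (\<Sum>i\<in>UNIV. h i * ((norm (X' *v (W *v axis i 1)))\<^sup>2 + (norm (adj X' *v (W *v axis i 1)))\<^sup>2))"
    using split[of X'] split[of "adj X'"] by (simp add: sum.distrib algebra_simps)
  also have "\<dots> = 2 * (norm Y)\<^sup>2 * (\<Sum>i\<in>UNIV. p i * ((norm (X' *v (W *v axis i 1)))\<^sup>2 + (norm (adj X' *v (W *v axis i 1)))\<^sup>2))"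
    by (simp add: hp sum_distrib_left mult.assoc)
  also have "\<dots> \<le> 2 * (norm Y)\<^sup>2 * (norm X)\<^sup>2"
  proof (rule mult_left_mono)
    define V' where "V' = V - mat \<mu>"
    have V': "V' = adj W ** X' ** W"
    proof -
      have "adj W ** mat \<mu> ** W = mat \<mu>"
        using W by (metis mat_commute matrix_mul_assoc matrix_mul_rid unitaryD(1))
      then show ?thesis
        by (simp add: V'_def V_def X'_def matrix_mult_diff_left matrix_mult_diff_right)
    qed
    have col: "(norm (A *v axis i 1))\<^sup>2 = (\<Sum>j\<in>UNIV. (cmod (A $ j $ i))\<^sup>2)" for A :: "complex ^ 'n ^ 'n" and i
    proof -
      have "(A *v axis i 1) $ j = A $ j $ i" for j by (metis matrix_entry herm_axis_right)
      then show ?thesis by (simp add: norm_vec_def L2_set_def sum_nonneg)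
    qed
    have 1: "(norm (X' *v (W *v axis i 1)))\<^sup>2 = (\<Sum>j\<in>UNIV. (cmod (V' $ j $ i))\<^sup>2)" for i
      using unitary_norm_vec[OF unitary_adj[OF W], of "X' *v (W *v axis i 1)"]
      by (simp add: V' matrix_vector_mult_assoc' flip: col)
    have 2: "(norm (adj X' *v (W *v axis i 1)))\<^sup>2 = (\<Sum>j\<in>UNIV. (cmod (V' $ i $ j))\<^sup>2)" for i
    proof -
      have "(norm (adj X' *v (W *v axis i 1)))\<^sup>2 = (norm (adj V' *v axis i 1))\<^sup>2"
        using unitary_norm_vec[OF unitary_adj[OF W], of "adj X' *v (W *v axis i 1)"]
        by (simp add: V' adj_mult matrix_vector_mult_assoc')
      then show ?thesis by (simp add: col) (simp add: adj_def)
    qed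
    have V'V: "V' $ i $ j = V $ i $ j - (if i = j then \<mu> else 0)" for i j by (simp add: V'_def mat_def)
    have "(\<Sum>i\<in>UNIV. p i * ((norm (X' *v (W *v axis i 1)))\<^sup>2 + (norm (adj X' *v (W *v axis i 1)))\<^sup>2))
       = (\<Sum>i\<in>UNIV. \<Sum>j\<in>UNIV. p i * (cmod (V' $ j $ i))\<^sup>2) + (\<Sum>i\<in>UNIV. \<Sum>j\<in>UNIV. p i * (cmod (V' $ i $ j))\<^sup>2)"
      unfolding 1 2 by (simp add: sum.distrib sum_distrib_left distrib_left)
    also have "\<dots> = (\<Sum>i\<in>UNIV. \<Sum>j\<in>UNIV. (p j + p i) * (cmod (V' $ i $ j))\<^sup>2)"
      by (subst sum.swap) (simp add: sum.distrib[symmetric] distrib_right)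
    \<comment> \<open>Off the diagonal the weights p i + p j are at most 1. On the diagonal the
      weight may reach 2, and exactly there the shift by the mean \<mu> acts, so that
      \<open>variance_bound\<close> absorbs the excess.\<close>
    also have "\<dots> \<le> (\<Sum>i\<in>UNIV. \<Sum>j\<in>UNIV. (cmod (V $ i $ j))\<^sup>2
        + (if j = i then 2 * (p i * (cmod (V $ i $ i - \<mu>))\<^sup>2) - (cmod (V $ i $ i))\<^sup>2 else 0))"
    proof (intro sum_mono)
      fix i j
      show "(p j + p i) * (cmod (V' $ i $ j))\<^sup>2 \<le> (cmod (V $ i $ j))\<^sup>2
        + (if j = i then 2 * (p i * (cmod (V $ i $ i - \<mu>))\<^sup>2) - (cmod (V $ i $ i))\<^sup>2 else 0)"
      proof (cases "j = i")
        case False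
        have "p j + p i = sum p {i, j}" using False by simp
        also have "\<dots> \<le> sum p UNIV" by (intro sum_mono2) (auto simp: p)
        finally have "p j + p i \<le> 1" using p by simp
        then show ?thesis using False by (simp add: V'V mult_left_le_one_le p)
      qed (simp add: V'V)
    qed
    also have "\<dots> = (\<Sum>i\<in>UNIV. \<Sum>j\<in>UNIV. (cmod (V $ i $ j))\<^sup>2)
        + 2 * (\<Sum>i\<in>UNIV. p i * (cmod (V $ i $ i - \<mu>))\<^sup>2) - (\<Sum>i\<in>UNIV. (cmod (V $ i $ i))\<^sup>2)"
      by (simp add: sum.distrib sum_subtractf sum_distrib_left)
    also have "\<dots> \<le> (\<Sum>i\<in>UNIV. \<Sum>j\<in>UNIV. (cmod (V $ i $ j))\<^sup>2)"
      using variance_bound[of p "\<lambda>i. V $ i $ i"] p by (simp add: \<mu>_def)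
    also have "\<dots> = (norm V)\<^sup>2" by (simp add: norm_vec_def L2_set_def sum_nonneg)
    also have "norm V = norm X" using W by (simp add: V_def unitary_norm_left unitary_norm_right unitary_adj)
    finally show "(\<Sum>i\<in>UNIV. p i * ((norm (X' *v (W *v axis i 1)))\<^sup>2 + (norm (adj X' *v (W *v axis i 1)))\<^sup>2)) \<le> (norm X)\<^sup>2" .
  qed simp
  finally show ?thesis by (simp add: algebra_simps)
qed simp

section \<open>The group U(n,1) and the Zassenhaus lemma\<close>

text \<open>The signature matrix; the index \<open>None\<close> marks the single negative direction
  of the form.\<close>

definition Jm :: "complex ^ ('n::finite option) ^ ('n option)" where
  "Jm = (\<chi> i j. if i = j then (if i = None then -1 else 1) else 0)"

definition un1 :: "complex ^ ('n::finite option) ^ ('n option) \<Rightarrow> bool" where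
  "un1 A \<longleftrightarrow> adj A ** Jm ** A = Jm"

text \<open>The inverse on \<open>U(n,1)\<close>, written so that it is defined, additive and norm
  preserving on all matrices; it can therefore be applied to differences of group elements.\<close>

definition uinv :: "complex ^ ('n::finite option) ^ ('n option) \<Rightarrow> complex ^ ('n option) ^ ('n option)" where
  "uinv A = Jm ** adj A ** Jm"

lemma adj_Jm [simp]: "adj Jm = Jm"
  by (auto simp: adj_def Jm_def vec_eq_iff)

lemma Jm_vec: "(Jm *v x) $ i = (if i = None then - x $ i else x $ i)"
proof -
  have "(if i = j then if i = None then - 1 else 1 else 0) * x $ j
    = (if i = j then (if i = None then - x $ j else x $ j) else 0)" for j by simp
  then show ?thesis by (simp add: Jm_def matrix_vector_mult_def)
qed

lemma Jm_Jm [simp]: "Jm ** Jm = mat 1"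
  by (simp add: matrix_eq vec_eq_iff Jm_vec flip: matrix_vector_mul_assoc)

lemma unitary_Jm [simp]: "unitary Jm"
  by (simp add: unitary_def)

lemma norm_Jm_mult [simp]: "norm (Jm ** A) = norm A" "norm (A ** Jm) = norm A"
  by (simp_all add: unitary_norm_left unitary_norm_right)

lemma un1_mat: "cmod c = 1 \<Longrightarrow> un1 (mat c)"
proof -
  assume "cmod c = 1"
  then have "cnj c * c = 1" by (metis complex_norm_square mult.commute of_real_1 power_one)
  moreover have "mat (cnj c) ** Jm ** mat c = Jm ** mat (cnj c * c)"
    by (simp add: mat_commute[of "cnj c"] mat_mult_mat flip: matrix_mul_assoc)
  ultimately show ?thesis by (simp add: un1_def)
qed

lemma un1_mat1 [simp]: "un1 (mat 1)"
  by (simp add: un1_mat)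

lemma Jm_cancel: "Jm ** (Jm ** X) = X" "X ** Jm ** Jm = X"
  by (simp_all add: matrix_mul_assoc) (simp flip: matrix_mul_assoc)

lemma un1_mult: assumes "un1 A" "un1 B" shows "un1 (A ** B)"
proof -
  have "adj (A ** B) ** Jm ** (A ** B) = adj B ** (adj A ** Jm ** A) ** B"
    by (simp add: adj_mult matrix_mul_assoc)
  then show ?thesis using assms by (simp add: un1_def)
qed

lemma uinv_left: assumes "un1 A" shows "uinv A ** A = mat 1"
proof -
  have "uinv A ** A = Jm ** (adj A ** Jm ** A)"
    by (simp add: uinv_def matrix_mul_assoc)
  then show ?thesis using assms by (simp add: un1_def)
qed

lemma uinv_right: "un1 A \<Longrightarrow> A ** uinv A = mat 1"
  using uinv_left matrix_left_right_inverse by blast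

lemma uinv_uinv [simp]: "uinv (uinv A) = A"
  by (simp add: uinv_def adj_mult Jm_cancel flip: matrix_mul_assoc)

lemma uinv_mult: "uinv (A ** B) = uinv B ** uinv A"
  by (simp add: uinv_def adj_mult Jm_cancel flip: matrix_mul_assoc)

lemma uinv_diff: "uinv (A - B) = uinv A - uinv B"
  by (simp add: uinv_def adj_diff matrix_mult_diff_left matrix_mult_diff_right)

lemma uinv_mat: "uinv (mat c) = mat (cnj c)"
proof -
  have "uinv (mat c) = mat (cnj c) ** Jm ** Jm" by (simp add: uinv_def mat_commute)
  then show ?thesis by (simp add: Jm_cancel)
qed

lemma un1_uinv:
  assumes "un1 A" shows "un1 (uinv A)"
proof -
  have "A ** (Jm ** (adj A ** Jm)) = mat 1"
    using uinv_right[OF assms] by (simp add: uinv_def matrix_mul_assoc)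
  then show ?thesis
    by (simp add: un1_def uinv_def adj_mult Jm_cancel flip: matrix_mul_assoc)
qed

lemma un1_adj:
  assumes "un1 A" shows "un1 (adj A)"
proof -
  have "A ** (Jm ** (adj A ** Jm)) ** Jm = Jm"
    using uinv_right[OF assms] by (simp add: uinv_def matrix_mul_assoc)
  then show ?thesis by (simp add: un1_def flip: matrix_mul_assoc)
qed

lemma norm_uinv [simp]: "norm (uinv A) = norm A"
  by (simp add: uinv_def)

lemma norm_uinv_diff1: "norm (uinv A - mat 1) = norm (A - mat 1)"
  using norm_uinv[of "A - mat 1"] by (simp add: uinv_diff uinv_mat)

lemma norm_adj_diff1: "norm (adj A - mat 1) = norm (A - mat 1)" for A :: "complex ^ 'n ^ 'n"
  using norm_adj[of "A - mat 1"] by (simp add: adj_diff)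

lemma herm_Jm_self: "herm (Jm *v x) x = of_real ((norm x)\<^sup>2 - 2 * (cmod (x $ None))\<^sup>2)"
proof -
  have "herm (Jm *v x) x = (\<Sum>i\<in>UNIV. x $ i * cnj (x $ i) - (if i = None then 2 * (x $ i * cnj (x $ i)) else 0))"
    unfolding herm_def by (intro sum.cong) (auto simp: Jm_vec)
  also have "\<dots> = herm x x - 2 * (x $ None * cnj (x $ None))"
    by (simp add: sum_subtractf herm_def)
  finally show ?thesis by (simp add: herm_self complex_norm_square[symmetric])
qed

lemma un1_herm: "un1 A \<Longrightarrow> herm (Jm *v (A *v x)) (A *v y) = herm (Jm *v x) y"
  unfolding un1_def herm_mult_right by (simp add: matrix_vector_mul_assoc matrix_mul_assoc)

lemma un1_norm_column:
  assumes "un1 A"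
  shows "(norm (A *v axis j 1))\<^sup>2 = (if j = None then -1 else 1) + 2 * (cmod (A $ None $ j))\<^sup>2"
proof -
  have "herm (Jm *v axis j 1) (axis j 1) = (if j = None then -1 else 1)"
    unfolding herm_axis_right Jm_vec by (simp add: axis_def)
  then have "of_real ((norm (A *v axis j 1))\<^sup>2 - 2 * (cmod ((A *v axis j 1) $ None))\<^sup>2) = (if j = None then -1 else 1 :: complex)"
    using un1_herm[OF assms, of "axis j 1" "axis j 1"] herm_Jm_self[of "A *v axis j 1"] by simp
  moreover have "(A *v axis j 1) $ None = A $ None $ j" by (metis matrix_entry herm_axis_right)
  ultimately have "complex_of_real ((norm (A *v axis j 1))\<^sup>2 - 2 * (cmod (A $ None $ j))\<^sup>2) = of_real (if j = None then -1 else 1)" by simp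
  then have "(norm (A *v axis j 1))\<^sup>2 - 2 * (cmod (A $ None $ j))\<^sup>2 = (if j = None then -1 else 1)"
    by (simp only: of_real_eq_iff)
  then show ?thesis by simp
qed

text \<open>Each column has indefinite norm 1 or -1, so its length depends only on its entry in row
  \<open>None\<close>; the same argument for the adjoint sums these entries. The size of A is thus a
  function of the corner entry alone, whose modulus is the hyperbolic cosine of half the
  displacement of 0.\<close>

lemma un1_norm:
  fixes A :: "complex ^ ('n::finite option) ^ ('n option)"
  assumes "un1 A"
  shows "(norm A)\<^sup>2 = real CARD('n) - 3 + 4 * (cmod (A $ None $ None))\<^sup>2"
proof -
  have "(norm A)\<^sup>2 = (\<Sum>j\<in>UNIV. (if j = None then -1 else 1) + 2 * (cmod (A $ None $ j))\<^sup>2)"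
    unfolding norm_matrix_columns using un1_norm_column[OF assms] by (intro sum.cong) auto
  also have "\<dots> = (\<Sum>j\<in>UNIV. (if j = (None :: 'n option) then -1 else 1)) + 2 * (\<Sum>j\<in>UNIV. (cmod (A $ None $ j))\<^sup>2)"
    by (simp only: sum.distrib sum_distrib_left)
  also have "(\<Sum>j\<in>UNIV. (if j = (None :: 'n option) then -1 else 1 :: real)) = real CARD('n) - 1"
    by (subst UNIV_option_conv) (simp add: sum.reindex)
  also have "(\<Sum>j\<in>UNIV. (cmod (A $ None $ j))\<^sup>2) = (norm (adj A *v axis None 1))\<^sup>2"
  proof -
    have "(adj A *v axis None 1) $ j = cnj (A $ None $ j)" for j
      using matrix_entry[of "adj A" j None] by (simp add: adj_def)
    then show ?thesis by (simp add: norm_vec_def L2_set_def sum_nonneg)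
  qed
  also have "\<dots> = -1 + 2 * (cmod (A $ None $ None))\<^sup>2"
    using un1_norm_column[OF un1_adj[OF assms], of None] by (simp add: adj_def)
  finally show ?thesis by simp
qed

lemma norm_vec_le_if_near_one:
  fixes A :: "complex ^ 'n ^ 'n"
  assumes "norm (A - mat 1) \<le> m"
  shows "norm (A *v x) \<le> (1 + m) * norm x"
proof -
  have "A *v x = (A - mat 1) *v x + x" by (simp add: matrix_vector_mult_diff_rdistrib)
  then have "norm (A *v x) \<le> norm ((A - mat 1) *v x) + norm x" by (metis norm_triangle_ineq)
  also have "norm ((A - mat 1) *v x) \<le> m * norm x"
    using norm_matrix_vector[of "A - mat 1" x] mult_right_mono[OF assms norm_ge_zero[of x]] by linarith
  finally show ?thesis by (simp add: algebra_simps)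
qed

text \<open>The bilinear function \<open>(h - 1) (1 - q)\<close> on a square \<open>[1/K, K] \<times> [1/K, K]\<close> is largest at
  the corner \<open>(K, 1/K)\<close>.\<close>

lemma corner_bound:
  fixes K h q z :: real
  assumes K: "K \<ge> 1" and h: "1 / K \<le> h" "h \<le> K" and q: "z \<le> K * q" "q \<le> K * z" and z: "0 \<le> z"
  shows "h * z + q - h * q - z \<le> (K + 1 / K - 2) * z"
proof -
  have eq: "h * z + q - h * q - z = (h - 1) * (z - q)" by (simp add: algebra_simps)
  have zq: "z - q \<le> (1 - 1 / K) * z" "q - z \<le> (K - 1) * z"
    using q K by (simp_all add: field_simps)
  have kk: "(K - 1) * ((1 - 1 / K) * z) = (K + 1 / K - 2) * z"
    using K by (simp add: field_simps)
  show ?thesis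
  proof (cases "h \<ge> 1")
    case True
    have "(h - 1) * (z - q) \<le> (h - 1) * ((1 - 1 / K) * z)" using True zq by (intro mult_left_mono) auto
    also have "\<dots> \<le> (K - 1) * ((1 - 1 / K) * z)" using h K z by (intro mult_right_mono) auto
    finally show ?thesis by (simp only: eq kk)
  next
    case False
    have "(1 - h) * (q - z) \<le> (1 - h) * ((K - 1) * z)" using False zq by (intro mult_left_mono) auto
    also have "\<dots> \<le> (1 - 1 / K) * ((K - 1) * z)" using h K z by (intro mult_right_mono) auto
    also have "(1 - 1 / K) * ((K - 1) * z) = (K - 1) * ((1 - 1 / K) * z)" by (simp only: ac_simps)
    also have "(1 - h) * (q - z) = (h - 1) * (z - q)" by (simp add: algebra_simps)
    finally show ?thesis by (simp only: eq kk)
  qed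
qed

text \<open>Zassenhaus' lemma for \<open>U(n,1)\<close>. The cruder estimate of the two commutators one at a time would
  lose the factor \<open>K\<close> where their average only costs \<open>(K + 1/K) / 2\<close>.\<close>

theorem commutator_contraction:
  fixes A B :: "complex ^ ('n::finite option) ^ ('n option)"
  assumes A: "un1 A" "norm (A - mat 1) \<le> m" and B: "un1 B" "norm (B - mat 1) \<le> m"
    and m: "0 < m" "m \<le> 9 / 20"
  shows "norm (A ** B ** uinv A ** uinv B - mat 1) < m \<or> norm (uinv B ** uinv A ** B ** A - mat 1) < m"
proof (rule ccontr)
  assume "\<not> ?thesis"
  then have neg: "norm (A ** B ** uinv A ** uinv B - mat 1) \<ge> m" "norm (uinv B ** uinv A ** B ** A - mat 1) \<ge> m"
    by auto
  define Z P Q where "Z = A ** B - B ** A" and "P = uinv A ** uinv B" and "Q = uinv B ** uinv A"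
  \<comment> \<open>K = (29/20)^4 bounds the factor by which a product of two matrices within 9/20
    of the identity can change a squared length. The same holds for the inverses and adjoints, which
    are equally close to the identity.\<close>
  define K :: real where "K = 707281 / 160000"
  note nearA = A(2) norm_uinv_diff1[of A] norm_adj_diff1[of "uinv A"]
  note nearB = B(2) norm_uinv_diff1[of B] norm_adj_diff1[of "uinv B"]
  have vb: "norm (C *v x) \<le> 29 / 20 * norm x" if "norm (C - mat 1) \<le> m" for C :: "complex ^ ('n option) ^ ('n option)" and x
    using norm_vec_le_if_near_one[OF that, of x] mult_right_mono[of "1 + m" "29 / 20" "norm x"] m by simp
  have vb2: "(norm (C *v (D *v x)))\<^sup>2 \<le> K * (norm x)\<^sup>2" if "norm (C - mat 1) \<le> m" "norm (D - mat 1) \<le> m"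
    for C D :: "complex ^ ('n option) ^ ('n option)" and x
  proof -
    have "norm (C *v (D *v x)) \<le> 29 / 20 * (29 / 20 * norm x)"
      using vb[OF that(1), of "D *v x"] vb[OF that(2), of x] by linarith
    then have "(norm (C *v (D *v x)))\<^sup>2 \<le> (29 / 20 * (29 / 20 * norm x))\<^sup>2" by (intro power_mono) auto
    then show ?thesis by (simp add: K_def power2_eq_square)
  qed
  have QAB: "Q ** (A ** B) = mat 1" "A ** B ** Q = mat 1" and PBA: "P ** (B ** A) = mat 1" "B ** A ** P = mat 1"
    using A(1) B(1) uinv_left uinv_right unfolding P_def Q_def
    by (metis matrix_mul_assoc matrix_mul_rid)+
  have 1: "A ** B ** uinv A ** uinv B - mat 1 = Z ** P"
    using PBA(2) by (simp add: Z_def matrix_mult_diff_left) (simp add: P_def matrix_mul_assoc)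
  have 2: "uinv B ** uinv A ** B ** A - mat 1 = - (Q ** Z)"
    using QAB(1) by (simp add: Z_def matrix_mult_diff_right) (simp add: Q_def matrix_mul_assoc)
  \<comment> \<open>Up to sign the double product is \<open>uinv Z\<close>. Hence Z and
    \<open>Q ** Z ** P\<close> have equal norm, while the two commutators in question are
    \<open>Z ** P\<close> and, up to sign, \<open>Q ** Z\<close>.\<close>
  have "Q ** Z ** P = P - Q"
  proof -
    have "Q ** Z ** P = Q ** (A ** B) ** P - Q ** (B ** A ** P)"
      by (simp add: Z_def matrix_mult_diff_left matrix_mult_diff_right matrix_mul_assoc)
    then show ?thesis using QAB PBA by simp
  qed
  moreover have "uinv Z = Q - P" by (simp add: Z_def P_def Q_def uinv_diff uinv_mult)
  ultimately have QZP: "norm (Q ** Z ** P) = norm Z" by (metis norm_minus_commute norm_uinv)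
  have "adj (P ** adj P) = P ** adj P" by (simp add: adj_mult)
  then obtain W h where W: "unitary W" and Wh: "\<And>i. P ** adj P *v (W *v axis i 1) = of_real (h i) *s (W *v axis i 1)"
    using hermitian_diagonalizable by blast
  have split: "(norm (M ** P))\<^sup>2 = (\<Sum>i\<in>UNIV. h i * (norm (M *v (W *v axis i 1)))\<^sup>2)" for M :: "complex ^ ('n option) ^ ('n option)"
    using inner_mult_diagonalized[OF W Wh, of M] by (simp add: power2_norm_eq_inner inner_mult_right matrix_mul_assoc)
  have h: "1 / K \<le> h i" "h i \<le> K" for i
  proof -
    let ?w = "W *v axis i 1"
    have w: "norm ?w = 1" using unitary_norm_vec[OF W, of "axis i 1"] by (simp add: norm_eq_sqrt_inner inner_axis_axis)
    have hi: "h i = (norm (adj P *v ?w))\<^sup>2"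
    proof -
      have "herm (P ** adj P *v ?w) ?w = of_real ((norm (adj P *v ?w))\<^sup>2)"
        by (simp add: matrix_vector_mult_assoc' herm_mult_left[of P] herm_self)
      then have "complex_of_real (h i) = of_real ((norm (adj P *v ?w))\<^sup>2)"
        by (simp add: Wh herm_scale_left herm_self w)
      then show ?thesis by (simp only: of_real_eq_iff)
    qed
    have aP: "adj P *v x = adj (uinv B) *v (adj (uinv A) *v x)" for x
      by (simp add: P_def adj_mult matrix_vector_mult_assoc')
    show "h i \<le> K" using vb2[of "adj (uinv B)" "adj (uinv A)" ?w] nearA nearB w by (simp add: hi aP)
    have inv: "adj A *v (adj B *v (adj P *v ?w)) = ?w"
    proof -
      have "adj (P ** (B ** A)) = mat 1" using PBA by simp
      then have "adj A ** adj B ** adj P = mat 1" by (simp add: adj_mult)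
      then show ?thesis by (simp add: matrix_vector_mul_assoc matrix_mul_assoc)
    qed
    then have "1 \<le> K * h i"
      using vb2[of "adj A" "adj B" "adj P *v ?w"] A(2) B(2) w by (simp add: norm_adj_diff1 hi)
    then show "1 / K \<le> h i" by (simp add: K_def field_simps)
  qed
  let ?z = "\<lambda>i. Z *v (W *v axis i 1)"
  have nn: "(norm Z)\<^sup>2 = (\<Sum>i\<in>UNIV. (norm (?z i))\<^sup>2)" "(norm (Q ** Z))\<^sup>2 = (\<Sum>i\<in>UNIV. (norm (Q *v ?z i))\<^sup>2)"
    using norm_matrix_columns_unitary[OF W, of Z] norm_matrix_columns_unitary[OF W, of "Q ** Z"]
    by (simp_all add: matrix_vector_mult_assoc')
  \<comment> \<open>In an eigenbasis of \<open>P ** adj P\<close> this combination splits into terms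
    (h i - 1) (z - q), with z and q the squared lengths of the images of the i-th eigenvector under
    Z and \<open>Q ** Z\<close>; \<open>corner_bound\<close> applies to each.\<close>
  have "(norm (Z ** P))\<^sup>2 + (norm (Q ** Z))\<^sup>2 - (norm (Q ** Z ** P))\<^sup>2 - (norm Z)\<^sup>2
    = (\<Sum>i\<in>UNIV. h i * (norm (?z i))\<^sup>2 + (norm (Q *v ?z i))\<^sup>2 - h i * (norm (Q *v ?z i))\<^sup>2 - (norm (?z i))\<^sup>2)"
    unfolding split nn by (simp add: sum.distrib sum_subtractf matrix_vector_mult_assoc')
  also have "\<dots> \<le> (\<Sum>i\<in>UNIV. (K + 1 / K - 2) * (norm (?z i))\<^sup>2)"
  proof (intro sum_mono corner_bound)
    fix i
    show "(norm (Q *v ?z i))\<^sup>2 \<le> K * (norm (?z i))\<^sup>2"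
      using vb2[of "uinv B" "uinv A" "?z i"] nearA nearB by (simp add: Q_def matrix_vector_mult_assoc')
    have "A *v (B *v (Q *v ?z i)) = ?z i"
      using QAB(2) by (simp add: matrix_vector_mul_assoc matrix_mul_assoc)
    then show "(norm (?z i))\<^sup>2 \<le> K * (norm (Q *v ?z i))\<^sup>2" using vb2[OF A(2) B(2), of "Q *v ?z i"] by simp
  qed (use h in \<open>auto simp: K_def\<close>)
  also have "\<dots> = (K + 1 / K - 2) * (norm Z)\<^sup>2" by (simp add: nn sum_distrib_left)
  finally have key: "(norm (Z ** P))\<^sup>2 + (norm (Q ** Z))\<^sup>2 \<le> (K + 1 / K) * (norm Z)\<^sup>2"
    using QZP by (simp add: algebra_simps)
  have "m\<^sup>2 \<le> (norm (Z ** P))\<^sup>2" "m\<^sup>2 \<le> (norm (Q ** Z))\<^sup>2"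
    using neg m unfolding 1 2 by (auto intro: power_mono)
  then have "2 * m\<^sup>2 \<le> (K + 1 / K) * (norm Z)\<^sup>2" using key by linarith
  also have "(norm Z)\<^sup>2 \<le> 2 * m\<^sup>2 * m\<^sup>2"
  proof -
    \<comment> \<open>The commutator is unchanged when A and B are shifted by the identity, which
      makes it of second order in m.\<close>
    have "Z = (A - mat 1) ** (B - mat 1) - (B - mat 1) ** (A - mat 1)"
      by (simp add: Z_def matrix_mult_diff_left matrix_mult_diff_right)
    then have "(norm Z)\<^sup>2 \<le> 2 * (norm (A - mat 1))\<^sup>2 * (norm (B - mat 1))\<^sup>2" using boettcher_wenzel by metis
    also have "\<dots> \<le> 2 * m\<^sup>2 * m\<^sup>2" using A B m by (intro mult_mono power_mono) auto
    finally show ?thesis .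
  qed
  finally have "2 * m\<^sup>2 \<le> (K + 1 / K) * (2 * m\<^sup>2 * m\<^sup>2)" by (simp add: K_def)
  then have "1 \<le> (K + 1 / K) * m\<^sup>2" using m by (simp add: K_def power2_eq_square)
  also have "\<dots> \<le> (K + 1 / K) * (9 / 20)\<^sup>2" using m by (intro mult_left_mono power_mono) (auto simp: K_def)
  also have "\<dots> < 1" by (simp add: K_def power2_eq_square)
  finally show False by simp
qed

section \<open>The action on the ball\<close>

text \<open>The last row is stored as a vector c with conjugated entries: \<open>adj\<close> then
  merely exchanges b and c and acts on the corners, and the lower left block acts on z as
  \<open>herm z c\<close>.\<close>

definition blk :: "complex ^ 'n ^ 'n \<Rightarrow> complex ^ 'n \<Rightarrow> complex ^ 'n \<Rightarrow> complex \<Rightarrow> complex ^ ('n::finite option) ^ ('n option)" where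
  "blk a b c d = (\<chi> i j. case i of
      None \<Rightarrow> (case j of None \<Rightarrow> d | Some l \<Rightarrow> cnj (c $ l))
    | Some k \<Rightarrow> (case j of None \<Rightarrow> b $ k | Some l \<Rightarrow> a $ k $ l))"

definition pv :: "complex ^ 'n \<Rightarrow> complex \<Rightarrow> complex ^ ('n::finite option)" where
  "pv z t = (\<chi> i. case i of None \<Rightarrow> t | Some k \<Rightarrow> z $ k)"

lemma sum_option: "(\<Sum>i\<in>UNIV. f i) = f None + (\<Sum>k\<in>UNIV. f (Some k))" for f :: "'n::finite option \<Rightarrow> 'a::comm_monoid_add"
  by (subst UNIV_option_conv) (simp add: sum.reindex)

lemma vec_eq_option: "x = y \<longleftrightarrow> x $ None = y $ None \<and> (\<forall>k. x $ Some k = y $ Some k)"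
  by (metis not_Some_eq vec_eq_iff)

lemma pv_nth [simp]: "pv z t $ None = t" "pv z t $ Some k = z $ k"
  by (simp_all add: pv_def)

lemma blk_nth [simp]: "blk a b c d $ None $ None = d" "blk a b c d $ None $ Some l = cnj (c $ l)"
  "blk a b c d $ Some k $ None = b $ k" "blk a b c d $ Some k $ Some l = a $ k $ l"
  by (simp_all add: blk_def)

lemma blk_mult: "blk a b c d ** blk a' b' c' d'
  = blk (a ** a' + outer b c') (a *v b' + d' *s b) (adj a' *v c + cnj d *s c') (herm b' c + d * d')"
  by (simp add: vec_eq_option matrix_matrix_mult_def sum_option matrix_vector_mult_def outer_def adj_def herm_def cnj_sum algebra_simps)

lemma adj_blk: "adj (blk a b c d) = blk (adj a) c b (cnj d)"
  by (simp add: vec_eq_option adj_def)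

lemma blk_vec: "blk a b c d *v pv z t = pv (a *v z + t *s b) (herm z c + d * t)"
  by (simp add: vec_eq_option sum_option matrix_vector_mult_def herm_def algebra_simps)

lemma mat_blk: "mat c = blk (mat c) 0 0 c"
  by (simp add: vec_eq_option mat_def)

lemma Jm_blk: "Jm = blk (mat 1) 0 0 (- 1)"
  by (simp add: vec_eq_option mat_def Jm_def)

lemma trace_blk: "trace (blk a b c d) = trace a + d"
  by (simp add: trace_def sum_option)

lemma blk_eq_iff: "blk a b c d = blk a' b' c' d' \<longleftrightarrow> a = a' \<and> b = b' \<and> c = c' \<and> d = d'"
  by (auto simp: vec_eq_option) (auto simp: vec_eq_iff)

lemma blk_cases: obtains a b c d where "A = blk a b c d"
proof
  show "A = blk (\<chi> i j. A $ Some i $ Some j) (\<chi> i. A $ Some i $ None) (\<chi> j. cnj (A $ None $ Some j)) (A $ None $ None)"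
    by (simp add: vec_eq_option)
qed

lemma blk_inner: "blk a b c d \<bullet> blk a' b' c' d' = a \<bullet> a' + b \<bullet> b' + c \<bullet> c' + d \<bullet> d'"
  by (simp add: inner_vec_def sum_option sum.distrib inner_complex_def)

lemma pv_scale: "c *s pv z t = pv (c *s z) (c * t)"
  by (simp add: vec_eq_option)

lemma herm_pv: "herm (pv z s) (pv w t) = herm z w + s * cnj t"
  by (simp add: herm_def sum_option)

lemma Jm_pv: "Jm *v pv z t = pv z (- t)"
  by (simp add: vec_eq_option Jm_vec)

lemma norm_pv: "(norm (pv z t))\<^sup>2 = (norm z)\<^sup>2 + (cmod t)\<^sup>2"
proof -
  have "complex_of_real ((norm (pv z t))\<^sup>2) = of_real ((norm z)\<^sup>2 + (cmod t)\<^sup>2)"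
    unfolding herm_self[symmetric] herm_pv of_real_add complex_norm_square ..
  then show ?thesis by (simp only: of_real_eq_iff)
qed

section \<open>Boosts along a fixed direction\<close>

lemma outer_simps: "outer (x + y) z = outer x z + outer y z" "outer x (y + z) = outer x y + outer x z"
  "outer (r *\<^sub>R x) y = r *\<^sub>R outer x y" "outer x (r *\<^sub>R y) = r *\<^sub>R outer x y"
  "outer x 0 = 0" "outer 0 x = 0" "outer (- x) y = - outer x y" "outer x (- y) = - outer x y"
  by (simp_all add: outer_def vec_eq_iff algebra_simps)

text \<open>Matrices that act nontrivially only on u and the negative direction. The boosts
  \<open>Tm\<close> and \<open>Em\<close> along u are both of this kind, which turns identities
  between them into identities between three real coefficients.\<close>

definition bo :: "real \<Rightarrow> real \<Rightarrow> real \<Rightarrow> complex ^ 'n \<Rightarrow> complex ^ ('n::finite option) ^ ('n option)" where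
  "bo k s c u = blk (mat 1 + k *\<^sub>R outer u u) (s *\<^sub>R u) (s *\<^sub>R u) (of_real c)"

lemma matrix_scaleR_left: "(r *\<^sub>R A) ** B = r *\<^sub>R (A ** B)" for A :: "complex ^ 'n ^ 'm"
  by (simp add: matrix_matrix_mult_def vec_eq_iff scaleR_sum_right)

lemma matrix_scaleR_right: "A ** (r *\<^sub>R B) = r *\<^sub>R (A ** B)" for A :: "complex ^ 'n ^ 'm"
  by (simp add: matrix_matrix_mult_def vec_eq_iff scaleR_sum_right)

lemma matrix_vec_scaleR: "(r *\<^sub>R A) *v x = r *\<^sub>R (A *v x)" for A :: "complex ^ 'n ^ 'm"
  by (simp add: matrix_vector_mult_def vec_eq_iff scaleR_sum_right)

lemma adj_scaleR: "adj (r *\<^sub>R A) = r *\<^sub>R adj A"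
  by (simp add: adj_def vec_eq_iff)

lemma of_real_vec_scale: "complex_of_real r *s x = r *\<^sub>R x"
  unfolding vec_eq_iff vector_scaleR_component vector_smult_component by (simp add: scaleR_conv_of_real)

lemma outer_mult_vec_self: "outer u u *v u = (norm u)\<^sup>2 *\<^sub>R u"
  by (simp add: outer_mult_vec herm_self of_real_vec_scale del: of_real_power)

lemma outer_mult_self: "outer u u ** outer u u = (norm u)\<^sup>2 *\<^sub>R outer u u"
  by (simp add: mult_outer outer_mult_vec_self outer_simps)

lemma adj_bo [simp]: "adj (bo k s c u) = bo k s c u"
  by (simp add: bo_def adj_blk adj_add adj_scaleR)

text \<open>A product of two self-adjoint matrices is self-adjoint only if its off-diagonal blocks
  match; the assumption is this equality.\<close>

lemma bo_mult: "bo k s c u ** bo k' s' c' u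
  = bo (k + k' + k * k' * (norm u)\<^sup>2 + s * s') (s' * (1 + k * (norm u)\<^sup>2) + s * c') (s * s' * (norm u)\<^sup>2 + c * c') u"
  if "s' * (1 + k * (norm u)\<^sup>2) + s * c' = s * (1 + k' * (norm u)\<^sup>2) + s' * c"
proof -
  have 1: "(mat 1 + k *\<^sub>R outer u u) *v x = x + k *\<^sub>R (outer u u *v x)" for k x
    by (simp add: matrix_vector_mult_add_rdistrib matrix_vec_scaleR)
  have 2: "(mat 1 + k *\<^sub>R outer u u) *v (s' *\<^sub>R u) = (s' * (1 + k * (norm u)\<^sup>2)) *\<^sub>R u" for k s'
    unfolding 1 by (simp add: outer_mult_vec herm_simps herm_self of_real_vec_scale of_real_vec_scale[of "_ * _", simplified]
        vec_eq_iff algebra_simps flip: of_real_power)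
  have 3: "(mat 1 + k *\<^sub>R outer u u) ** (mat 1 + k' *\<^sub>R outer u u) + outer (s *\<^sub>R u) (s' *\<^sub>R u)
    = mat 1 + (k + k' + k * k' * (norm u)\<^sup>2 + s * s') *\<^sub>R outer u u"
    by (simp add: matrix_mult_add_left matrix_add_ldistrib matrix_scaleR_left matrix_scaleR_right outer_mult_self outer_simps
        algebra_simps)
  show ?thesis
    unfolding bo_def blk_mult blk_eq_iff adj_add adj_scaleR adj_outer adj_mat complex_cnj_one 2 3 complex_cnj_complex_of_real
      of_real_vec_scale
    using that by (simp add: algebra_simps herm_simps herm_self flip: scaleR_add_left)
qed

lemma mat1_bo: "mat 1 = bo 0 0 1 u"
  by (simp add: bo_def mat_blk[of 1])

lemma Jm_bo_Jm: "Jm ** bo k s c u ** Jm = bo k (- s) c u"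
  by (simp add: Jm_blk bo_def blk_mult herm_simps outer_simps of_real_vec_scale vec_eq_iff blk_eq_iff)

lemma uinv_bo: "uinv (bo k s c u) = bo k (- s) c u"
  by (simp add: uinv_def Jm_bo_Jm)

lemma un1_bo:
  assumes "c = 1 + k * (norm u)\<^sup>2" "s\<^sup>2 = 2 * k + k\<^sup>2 * (norm u)\<^sup>2"
  shows "un1 (bo k s c u)"
proof -
  have "bo k (- s) c u ** bo k s c u = mat 1"
    unfolding mat1_bo[of u]
    by (subst bo_mult) (use assms in \<open>auto simp: algebra_simps power2_eq_square\<close>)
  then have "Jm ** (adj (bo k s c u) ** Jm ** bo k s c u) = Jm ** Jm"
    by (simp add: matrix_mul_assoc Jm_bo_Jm)
  then have "Jm ** (Jm ** (adj (bo k s c u) ** Jm ** bo k s c u)) = Jm ** (Jm ** Jm)" by simp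
  then show ?thesis unfolding un1_def Jm_cancel .
qed

section \<open>Fractional linear action in the ball model\<close>

definition act :: "complex ^ ('n::finite option) ^ ('n option) \<Rightarrow> complex ^ 'n \<Rightarrow> complex ^ 'n" where
  "act A z = (\<chi> k. (A *v pv z 1) $ Some k / (A *v pv z 1) $ None)"

lemma act_pv:
  assumes "(A *v pv z 1) $ None \<noteq> 0"
  shows "A *v pv z 1 = (A *v pv z 1) $ None *s pv (act A z) 1"
  using assms by (simp add: vec_eq_option act_def)

lemma un1_pv:
  assumes "un1 A"
  shows "(cmod ((A *v pv z 1) $ None))\<^sup>2 - (norm (\<chi> k. (A *v pv z 1) $ Some k))\<^sup>2 = 1 - (norm z)\<^sup>2"
proof -
  have eq: "A *v pv z 1 = pv (\<chi> k. (A *v pv z 1) $ Some k) ((A *v pv z 1) $ None)" by (simp add: vec_eq_option)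
  have "complex_of_real ((norm (A *v pv z 1))\<^sup>2 - 2 * (cmod ((A *v pv z 1) $ None))\<^sup>2)
    = of_real ((norm (pv z 1))\<^sup>2 - 2 * (cmod (pv z 1 $ None))\<^sup>2)"
    unfolding herm_Jm_self[symmetric] by (rule un1_herm[OF assms])
  then have "(norm (A *v pv z 1))\<^sup>2 - 2 * (cmod ((A *v pv z 1) $ None))\<^sup>2 = (norm (pv z 1))\<^sup>2 - 2 * (cmod (pv z 1 $ None))\<^sup>2"
    by (simp only: of_real_eq_iff)
  moreover have "(norm (A *v pv z 1))\<^sup>2 = (norm (\<chi> k. (A *v pv z 1) $ Some k))\<^sup>2 + (cmod ((A *v pv z 1) $ None))\<^sup>2"
    by (subst eq) (simp only: norm_pv)
  ultimately show ?thesis by (simp add: norm_pv)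
qed

lemma ball_iff: "z \<in> cball_model \<longleftrightarrow> (norm z)\<^sup>2 < 1"
  by (simp add: cball_model_def power_less_one_iff abs_square_less_1)

lemma zero_in_ball [simp]: "0 \<in> cball_model"
  by (simp add: ball_iff)

lemma un1_denom:
  assumes "un1 A" "z \<in> cball_model"
  shows "(A *v pv z 1) $ None \<noteq> 0"
proof
  assume "(A *v pv z 1) $ None = 0"
  then have "- (norm (\<chi> k. (A *v pv z 1) $ Some k))\<^sup>2 = 1 - (norm z)\<^sup>2" using un1_pv[OF assms(1), of z] by simp
  moreover have "1 - (norm z)\<^sup>2 > 0" using assms(2) by (simp add: ball_iff)
  ultimately show False using zero_le_power2[of "norm (\<chi> k. (A *v pv z 1) $ Some k)"] by linarith
qed

text \<open>The form is preserved on the homogeneous vectors (z,1) and (w,1), and the two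
  denominators come out as factors. This identity gives the effect on 1 - |z|^2, and also the
  invariance of the distance, in which the denominators cancel.\<close>

lemma un1_act_herm:
  assumes "un1 A" "z \<in> cball_model" "w \<in> cball_model"
  shows "(A *v pv z 1) $ None * cnj ((A *v pv w 1) $ None) * (herm (act A z) (act A w) - 1) = herm z w - 1"
proof -
  have "herm (Jm *v (A *v pv z 1)) (A *v pv w 1) = herm z w - 1"
    using un1_herm[OF assms(1), of "pv z 1" "pv w 1"] by (simp add: Jm_pv herm_pv)
  moreover have "herm (Jm *v (a *s pv z' 1)) (b *s pv w' 1) = a * cnj b * (herm z' w' - 1)" for a b z' w'
    by (simp add: pv_scale Jm_pv herm_pv herm_simps algebra_simps)
  ultimately show ?thesis
    using act_pv[OF un1_denom[OF assms(1,2)]] act_pv[OF un1_denom[OF assms(1,3)]] by metis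
qed

lemma un1_act_norm:
  assumes "un1 A" "z \<in> cball_model"
  shows "1 - (norm (act A z))\<^sup>2 = (1 - (norm z)\<^sup>2) / (cmod ((A *v pv z 1) $ None))\<^sup>2"
proof -
  have "complex_of_real ((cmod ((A *v pv z 1) $ None))\<^sup>2 * ((norm (act A z))\<^sup>2 - 1)) = of_real ((norm z)\<^sup>2 - 1)"
    using un1_act_herm[OF assms(1,2,2)] unfolding herm_self of_real_mult complex_norm_square of_real_diff of_real_1 .
  then have "(cmod ((A *v pv z 1) $ None))\<^sup>2 * ((norm (act A z))\<^sup>2 - 1) = (norm z)\<^sup>2 - 1"
    by (simp only: of_real_eq_iff)
  then show ?thesis using un1_denom[OF assms] by (simp add: field_simps)
qed

lemma act_in_ball: "un1 A \<Longrightarrow> z \<in> cball_model \<Longrightarrow> act A z \<in> cball_model"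
  using un1_act_norm[of A z] un1_denom[of A z] by (simp add: ball_iff) (smt (verit) divide_pos_pos zero_less_power2 norm_eq_zero)

lemma act_mult:
  assumes "un1 B" "z \<in> cball_model"
  shows "act (A ** B) z = act A (act B z)"
proof -
  have "(A ** B) *v pv z 1 = (B *v pv z 1) $ None *s (A *v pv (act B z) 1)"
    using act_pv[OF un1_denom[OF assms]] by (metis matrix_vector_mult_assoc' vector_scalar_commute)
  then show ?thesis using un1_denom[OF assms] by (simp add: act_def)
qed

lemma act_mat [simp]: "c \<noteq> 0 \<Longrightarrow> act (mat c) z = z"
  by (simp add: act_def mat_vec vec_eq_iff)

lemma act_uinv:
  assumes "un1 A" "z \<in> cball_model"
  shows "act (uinv A) (act A z) = z" "act A (act (uinv A) z) = z"
  using act_mult[OF assms, of "uinv A"] act_mult[OF un1_uinv[OF assms(1)] assms(2), of A] assms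
  by (simp_all add: uinv_left uinv_right)

lemma act_blk_diag: "act (blk U 0 0 d) z = (1 / d) *s (U *v z)"
  by (simp add: act_def blk_vec vec_eq_iff)

lemma act_blk_zero: "act (blk a b c d) 0 = (1 / d) *s b"
  by (simp add: act_def blk_vec vec_eq_iff)

text \<open>The hyperbolic cosine of half the Bergman distance from 0 to p.\<close>

definition gam :: "complex ^ 'n \<Rightarrow> real" where
  "gam p = 1 / sqrt (1 - (norm p)\<^sup>2)"

text \<open>The boost carrying 0 to p. For nonzero p its first coefficient is (gam p - 1) / |p|^2;
  the form chosen also covers p = 0.\<close>

definition Tm :: "complex ^ 'n \<Rightarrow> complex ^ ('n::finite option) ^ ('n option)" where
  "Tm p = bo ((gam p)\<^sup>2 / (1 + gam p)) (gam p) (gam p) p"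

lemma gam:
  assumes "p \<in> cball_model"
  shows "gam p \<ge> 1" "(gam p)\<^sup>2 * (1 - (norm p)\<^sup>2) = 1" "(gam p)\<^sup>2 = 1 / (1 - (norm p)\<^sup>2)"
    "(gam p)\<^sup>2 * (norm p)\<^sup>2 = (gam p)\<^sup>2 - 1"
proof -
  have p: "0 < 1 - (norm p)\<^sup>2" "1 - (norm p)\<^sup>2 \<le> 1" using assms by (auto simp: ball_iff)
  then have "sqrt (1 - (norm p)\<^sup>2) \<le> 1" "sqrt (1 - (norm p)\<^sup>2) > 0" by auto
  then show "gam p \<ge> 1" by (simp add: gam_def)
  show 1: "(gam p)\<^sup>2 = 1 / (1 - (norm p)\<^sup>2)" using p by (simp add: gam_def power_divide)
  show "(gam p)\<^sup>2 * (1 - (norm p)\<^sup>2) = 1" using p by (simp add: 1)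
  then show "(gam p)\<^sup>2 * (norm p)\<^sup>2 = (gam p)\<^sup>2 - 1" by (simp add: algebra_simps)
qed

lemma Tm_coeffs:
  assumes "p \<in> cball_model"
  defines "k \<equiv> (gam p)\<^sup>2 / (1 + gam p)"
  shows "gam p = 1 + k * (norm p)\<^sup>2" "(gam p)\<^sup>2 = 2 * k + k\<^sup>2 * (norm p)\<^sup>2"
proof -
  note g = gam[OF assms(1)]
  have nz: "1 + gam p \<noteq> 0" using g(1) by simp
  have "k * (norm p)\<^sup>2 = ((gam p)\<^sup>2 * (norm p)\<^sup>2) / (1 + gam p)" by (simp add: k_def)
  also have "\<dots> = gam p - 1" unfolding g(4) using nz by (simp add: field_simps power2_eq_square)
  finally show 1: "gam p = 1 + k * (norm p)\<^sup>2" by simp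
  have "k * (1 + gam p) = (gam p)\<^sup>2" using nz by (simp add: k_def)
  moreover have "2 * k + k\<^sup>2 * (norm p)\<^sup>2 = k * (1 + (1 + k * (norm p)\<^sup>2))" by (simp add: power2_eq_square algebra_simps)
  ultimately show "(gam p)\<^sup>2 = 2 * k + k\<^sup>2 * (norm p)\<^sup>2" using 1 by simp
qed

lemma un1_Tm: "p \<in> cball_model \<Longrightarrow> un1 (Tm p)"
  unfolding Tm_def by (rule un1_bo) (rule Tm_coeffs, assumption)+

lemma act_Tm_0: "p \<in> cball_model \<Longrightarrow> act (Tm p) 0 = p"
  using gam(1)[of p] by (simp add: Tm_def bo_def act_blk_zero vec_eq_iff) (simp add: scaleR_conv_of_real)

lemma un1_blk_diag:
  assumes "un1 (blk a 0 c d)"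
  shows "c = 0" "unitary a" "cmod d = 1"
proof -
  have "blk (adj a ** a + outer c (- c)) (- (d *s c)) (adj a *v 0 + - (d *s c)) (- (cnj d * d)) = Jm"
    using assms unfolding un1_def adj_blk Jm_blk blk_mult
    by (simp add: outer_simps blk_eq_iff herm_simps vec_eq_iff)
  then have *: "adj a ** a + outer c (- c) = mat 1" "d *s c = 0" "cnj d * d = 1"
    by (simp_all add: Jm_blk blk_eq_iff)
  have "complex_of_real ((cmod d)\<^sup>2) = 1" using *(3) by (simp only: complex_norm_square) (simp add: mult.commute)
  then have "(cmod d)\<^sup>2 = 1" by (simp only: of_real_eq_1_iff)
  then show d: "cmod d = 1" by (simp add: power2_eq_1_iff) (smt (verit) norm_ge_zero)
  show c: "c = 0" using *(2) d by (auto simp: vec_eq_iff)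
  show "unitary a" using *(1) by (simp add: c outer_simps unitary_def)
qed

text \<open>The Cartan decomposition: undoing the boost to \<open>act A 0\<close> leaves an element
  fixing 0, whose column b vanishes; preservation of the form then makes it block diagonal and
  unitary.\<close>

lemma un1_polar:
  assumes "un1 A"
  obtains U d where "unitary U" "cmod d = 1" "A = Tm (act A 0) ** blk U 0 0 d"
proof -
  let ?p = "act A 0"
  have p: "?p \<in> cball_model" by (rule act_in_ball[OF assms]) simp
  note T = un1_Tm[OF p]
  obtain a b c d where K: "uinv (Tm ?p) ** A = blk a b c d" using blk_cases by blast
  have unK: "un1 (blk a b c d)" using un1_mult[OF un1_uinv[OF T] assms] K by simp
  have "act (blk a b c d) 0 = act (uinv (Tm ?p)) ?p" unfolding K[symmetric] by (rule act_mult[OF assms]) simp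
  also have "\<dots> = 0" using act_uinv(1)[OF T, of 0] act_Tm_0[OF p] by simp
  finally have "(1 / d) *s b = 0" by (simp add: act_blk_zero)
  moreover have "d \<noteq> 0" using un1_denom[OF unK, of 0] by (simp add: blk_vec)
  ultimately have b: "b = 0" by (auto simp: vec_eq_iff)
  note * = un1_blk_diag[OF unK[unfolded b]]
  have "A = Tm ?p ** (uinv (Tm ?p) ** A)" by (simp add: matrix_mul_assoc uinv_right[OF T])
  then have "A = Tm ?p ** blk a 0 0 d" unfolding K b *(1) .
  then show ?thesis using that * by blast
qed

lemma un1_blk_unitary: "unitary U \<Longrightarrow> cmod d = 1 \<Longrightarrow> un1 (blk U 0 0 d)"
  unfolding un1_def adj_blk Jm_blk blk_mult
  by (simp add: outer_simps blk_eq_iff unitaryD vec_eq_iff) (metis complex_norm_square mult.commute of_real_1 power_one)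

text \<open>An element fixing 0 is block diagonal by \<open>un1_polar\<close>, and scaling an
  arbitrary vector into the ball shows that U is a multiple of the identity. Two lifts of the same
  isometry therefore differ by a unit scalar.\<close>

lemma act_trivial:
  fixes A :: "complex ^ ('n::finite option) ^ ('n option)"
  assumes A: "un1 A" and triv: "\<And>z. z \<in> cball_model \<Longrightarrow> act A z = z"
  shows "\<exists>d. cmod d = 1 \<and> A = mat d"
proof -
  have T0: "Tm 0 = mat 1" by (simp add: Tm_def gam_def bo_def outer_simps mat_blk[of 1])
  obtain U d where U: "unitary U" "cmod d = 1" "A = Tm 0 ** blk U 0 0 d"
    using un1_polar[OF A] triv[of 0] by auto
  have Ad: "A = blk U 0 0 d" using U(3) unfolding T0 by simp
  have "U = mat d"
  proof (subst matrix_eq, intro allI)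
    fix x :: "complex ^ 'n"
    define r where "r = 1 / (2 * (norm x + 1))"
    have r: "r > 0" by (simp add: r_def add_nonneg_pos)
    have "N / (2 * (N + 1)) < 1" if "0 \<le> N" for N :: real using that by (simp add: field_simps)
    from this[OF norm_ge_zero[of x]] have "norm x / (2 * (norm x + 1)) < 1" .
    then have "norm (r *\<^sub>R x) < 1" using r by (simp add: r_def)
    then have "(1 / d) *s (U *v (r *\<^sub>R x)) = r *\<^sub>R x"
      using triv[of "r *\<^sub>R x"] by (simp add: Ad act_blk_diag cball_model_def)
    then have "r *\<^sub>R ((1 / d) *s (U *v x)) = r *\<^sub>R x"
      by (simp add: of_real_vec_scale[symmetric] vector_scalar_commute vector_smult_assoc mult.commute)
    then have "(1 / d) *s (U *v x) = x" using r by simp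
    then have "d *s ((1 / d) *s (U *v x)) = d *s x" by simp
    moreover have "d \<noteq> 0" using U by auto
    ultimately show "U *v x = mat d *v x" by (simp add: vector_smult_assoc mat_vec)
  qed
  then show ?thesis using U(2) Ad mat_blk[of d] by metis
qed

section \<open>Holomorphic isometries\<close>

lemma bounded_bilinear_herm: "bounded_bilinear (herm :: complex ^ 'n \<Rightarrow> complex ^ 'n \<Rightarrow> complex)"
proof
  show "\<exists>K. \<forall>a b. norm (herm a b) \<le> norm (a :: complex ^ 'n) * norm b * K"
    by (rule exI[of _ 1]) (simp add: herm_cauchy)
qed (simp_all only: herm_simps, simp_all add: scaleR_conv_of_real)

lemma bounded_bilinear_vector_scalar: "bounded_bilinear ((*s) :: complex \<Rightarrow> complex ^ 'n \<Rightarrow> complex ^ 'n)"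
proof
  show "\<exists>K. \<forall>a b. norm (a *s b :: complex ^ 'n) \<le> norm a * norm b * K"
    by (rule exI[of _ 1]) simp
qed (simp_all add: vec_eq_iff algebra_simps)

lemma bounded_linear_matrix_vector: "bounded_linear (\<lambda>v. A *v (v :: complex ^ 'n))"
  by (simp flip: linear_conv_bounded_linear)

lemma bounded_linear_matrix_left: "bounded_linear (\<lambda>B. A ** (B :: complex ^ 'k ^ 'n))" for A :: "complex ^ 'n ^ 'm"
  by (subst linear_conv_bounded_linear[symmetric], rule linearI)
     (simp_all add: matrix_add_ldistrib matrix_scaleR_right)

lemma bounded_linear_matrix_right: "bounded_linear (\<lambda>A. (A :: complex ^ 'n ^ 'm) ** B)" for B :: "complex ^ 'k ^ 'n"
  by (subst linear_conv_bounded_linear[symmetric], rule linearI)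
     (simp_all add: matrix_mult_add_left matrix_scaleR_left)

text \<open>The quotient rule applied to numerator and denominator of \<open>act\<close>; the
  direction enters as the homogeneous vector (v,0).\<close>

definition act_deriv :: "complex ^ ('n::finite option) ^ ('n option) \<Rightarrow> complex ^ 'n \<Rightarrow> complex ^ 'n \<Rightarrow> complex ^ 'n" where
  "act_deriv A z v = (let w = (A *v pv z 1) $ None; u = A *v pv v 0 in
     (1 / w) *s ((\<chi> k. u $ Some k) - u $ None *s act A z))"

lemma bounded_linear_pv:
  fixes A :: "complex ^ ('n::finite option) ^ ('n option)"
  shows "bounded_linear (\<lambda>v. (\<chi> k. (A *v pv v 0) $ Some k))" "bounded_linear (\<lambda>v. (A *v pv v 0) $ None)"
proof -
  obtain a b c d where A: "A = blk a b c d" using blk_cases by blast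
  have 1: "(\<chi> k. (A *v pv v 0) $ Some k) = a *v v" "(A *v pv v 0) $ None = herm v c" for v
    by (simp_all add: A blk_vec vec_eq_iff)
  show "bounded_linear (\<lambda>v. (\<chi> k. (A *v pv v 0) $ Some k))" unfolding 1 by (rule bounded_linear_matrix_vector)
  show "bounded_linear (\<lambda>v. (A *v pv v 0) $ None)" unfolding 1
    by (rule bounded_bilinear.bounded_linear_left[OF bounded_bilinear_herm])
qed

lemma act_has_derivative:
  assumes "(A *v pv z 1) $ None \<noteq> 0"
  shows "(act A has_derivative act_deriv A z) (at z)"
proof -
  define N where "N v = (\<chi> k. (A *v pv v 0) $ Some k)" for v
  define D where "D v = (A *v pv v 0) $ None" for v
  have N: "bounded_linear N" and D: "bounded_linear D" unfolding N_def D_def by (rule bounded_linear_pv)+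
  define N0 D0 where "N0 = (\<chi> k. (A *v pv 0 1) $ Some k)" and "D0 = (A *v pv 0 1) $ None"
  have split: "A *v pv x 1 = A *v pv x 0 + A *v pv 0 1" for x
    by (simp add: matrix_vector_right_distrib[symmetric], rule arg_cong[of _ _ "(*v) A"]) (simp add: vec_eq_option)
  have act: "act A x = inverse (D x + D0) *s (N x + N0)" for x
    unfolding act_def split[of x] by (simp add: N_def D_def N0_def D0_def vec_eq_iff divide_inverse algebra_simps)
  have w: "(A *v pv z 1) $ None = D z + D0" unfolding split[of z] by (simp add: D_def D0_def)
  have nz: "D z + D0 \<noteq> 0" using assms w by simp
  have "((\<lambda>x. inverse (D x + D0) *s (N x + N0)) has_derivative
      (\<lambda>v. inverse (D z + D0) *s (N v + 0) + (- (inverse (D z + D0) * (D v + 0) * inverse (D z + D0))) *s (N z + N0))) (at z)"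
    by (rule bounded_bilinear.FDERIV[OF bounded_bilinear_vector_scalar] Deriv.has_derivative_inverse has_derivative_add
        bounded_linear_imp_has_derivative has_derivative_const N D nz)+
  moreover have "(\<lambda>v. inverse (D z + D0) *s (N v + 0) + (- (inverse (D z + D0) * (D v + 0) * inverse (D z + D0))) *s (N z + N0))
     = act_deriv A z"
    unfolding act_deriv_def Let_def w act
    by (rule ext) (simp add: N_def[symmetric] D_def[symmetric] vec_eq_iff field_simps)
  ultimately show ?thesis unfolding act[abs_def] by simp
qed

lemma act_deriv_scale: "act_deriv A z (c *s v) = c *s act_deriv A z v"
proof -
  have "pv (c *s v) 0 = c *s pv v 0" by (simp add: pv_scale)
  then have "A *v pv (c *s v) 0 = c *s (A *v pv v 0)" by (simp add: vector_scalar_commute)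
  then show ?thesis by (simp add: act_deriv_def Let_def vec_eq_iff algebra_simps)
qed

lemma bergman_ratio_ge_1:
  assumes "z \<in> cball_model" "w \<in> cball_model"
  shows "(cmod (herm z w - 1))\<^sup>2 / ((1 - (norm z)\<^sup>2) * (1 - (norm w)\<^sup>2)) \<ge> 1"
proof -
  have z: "norm z < 1" "norm w < 1" using assms by (auto simp: cball_model_def)
  have pos: "(1 - (norm z)\<^sup>2) * (1 - (norm w)\<^sup>2) > 0" using assms by (simp add: ball_iff)
  have zw: "norm z * norm w \<le> 1" using z by (simp add: mult_le_one)
  have "1 - norm z * norm w \<le> 1 - cmod (herm z w)" using herm_cauchy[of z w] by simp
  also have "\<dots> \<le> cmod (herm z w - 1)" using norm_triangle_ineq2[of 1 "herm z w"] by (simp add: norm_minus_commute)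
  finally have "(1 - norm z * norm w)\<^sup>2 \<le> (cmod (herm z w - 1))\<^sup>2" using zw by (intro power_mono) auto
  moreover have "(1 - (norm z)\<^sup>2) * (1 - (norm w)\<^sup>2) \<le> (1 - norm z * norm w)\<^sup>2"
    using zero_le_power2[of "norm z - norm w"] by (simp add: power2_eq_square algebra_simps)
  ultimately show ?thesis using pos by (simp add: le_divide_eq)
qed

lemma bergman_dist_eqD:
  assumes "z \<in> cball_model" "w \<in> cball_model" "z' \<in> cball_model" "w' \<in> cball_model"
    and "bergman_dist z' w' = bergman_dist z w"
  shows "(cmod (herm z' w' - 1))\<^sup>2 / ((1 - (norm z')\<^sup>2) * (1 - (norm w')\<^sup>2)) = (cmod (herm z w - 1))\<^sup>2 / ((1 - (norm z)\<^sup>2) * (1 - (norm w)\<^sup>2))"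
proof -
  let ?R = "\<lambda>z w. (cmod (herm z w - 1))\<^sup>2 / ((1 - (norm z)\<^sup>2) * (1 - (norm w)\<^sup>2))"
  have ge: "sqrt (?R z w) \<ge> 1" "sqrt (?R z' w') \<ge> 1" using bergman_ratio_ge_1 assms by (simp_all del: norm_minus_commute)
  have "cosh (arcosh (sqrt (?R z' w'))) = cosh (arcosh (sqrt (?R z w)))"
    using assms(5) by (simp add: bergman_dist_def)
  then have "sqrt (?R z' w') = sqrt (?R z w)" using ge by (simp only: cosh_arcosh_real)
  then show ?thesis by (simp only: real_sqrt_eq_iff)
qed

lemma act_bergman_ratio:
  assumes "un1 A" "z \<in> cball_model" "w \<in> cball_model"
  shows "(cmod (herm (act A z) (act A w) - 1))\<^sup>2 / ((1 - (norm (act A z))\<^sup>2) * (1 - (norm (act A w))\<^sup>2))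
    = (cmod (herm z w - 1))\<^sup>2 / ((1 - (norm z)\<^sup>2) * (1 - (norm w)\<^sup>2))"
proof -
  let ?a = "(A *v pv z 1) $ None" and ?b = "(A *v pv w 1) $ None"
  have nz: "?a \<noteq> 0" "?b \<noteq> 0" using un1_denom assms by auto
  have "cmod ?a * cmod ?b * cmod (herm (act A z) (act A w) - 1) = cmod (herm z w - 1)"
    unfolding un1_act_herm[OF assms, symmetric] by (simp add: norm_mult)
  then have "(cmod (herm z w - 1))\<^sup>2 = (cmod ?a)\<^sup>2 * (cmod ?b)\<^sup>2 * (cmod (herm (act A z) (act A w) - 1))\<^sup>2"
    by (metis power_mult_distrib)
  then show ?thesis unfolding un1_act_norm[OF assms(1,2)] un1_act_norm[OF assms(1,3)] using nz by simp
qed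

lemma act_bergman_dist:
  "un1 A \<Longrightarrow> z \<in> cball_model \<Longrightarrow> w \<in> cball_model \<Longrightarrow> bergman_dist (act A z) (act A w) = bergman_dist z w"
  unfolding bergman_dist_def by (simp only: act_bergman_ratio)

lemma small_scale_in_ball:
  fixes z :: "complex ^ 'n"
  shows "\<exists>e>0. \<forall>t::real. \<bar>t\<bar> < e \<longrightarrow> t *\<^sub>R z \<in> cball_model"
proof (intro exI conjI allI impI)
  show "0 < 1 / (norm z + 1)" by (simp add: add_nonneg_pos)
  fix t :: real assume "\<bar>t\<bar> < 1 / (norm z + 1)"
  then have "\<bar>t\<bar> * (norm z + 1) < 1" using norm_ge_zero[of z] by (simp add: pos_less_divide_eq)
  then have "\<bar>t\<bar> * norm z < 1" by (simp add: algebra_simps)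
  then show "t *\<^sub>R z \<in> cball_model" by (simp add: cball_model_def)
qed

text \<open>Differentiating \<open>|1 - <h z, h (t w)>| = |1 - <z, t w>|\<close> at \<open>t = 0\<close>, in two complex directions,
  identifies \<open><h z, L w>\<close> with \<open><z, w>\<close>.\<close>

lemma isometry_fixing_zero_unitary:
  fixes h :: "complex ^ 'n \<Rightarrow> complex ^ 'n"
  assumes ball: "\<And>z. z \<in> cball_model \<Longrightarrow> h z \<in> cball_model"
    and dist: "\<And>z w. z \<in> cball_model \<Longrightarrow> w \<in> cball_model \<Longrightarrow> bergman_dist (h z) (h w) = bergman_dist z w"
    and h0: "h 0 = 0" and L: "(h has_derivative L) (at 0)"
    and Li: "\<And>v. L (\<i> *s v) = \<i> *s L v"
  shows "\<exists>U. unitary U \<and> (\<forall>z \<in> cball_model. h z = U *v z)"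
proof -
  have lin: "bounded_linear L" using L by (rule has_derivative_bounded_linear)
  have nh: "(norm (h z))\<^sup>2 = (norm z)\<^sup>2" if z: "z \<in> cball_model" for z
  proof -
    have "1 / (1 - (norm (h z))\<^sup>2) = 1 / (1 - (norm z)\<^sup>2)"
      using bergman_dist_eqD[OF z zero_in_ball ball[OF z] ball[OF zero_in_ball] dist[OF z zero_in_ball]] h0 by simp
    then show ?thesis by simp
  qed
  have hh: "(cmod (herm (h z) (h w) - 1))\<^sup>2 = (cmod (herm z w - 1))\<^sup>2" if "z \<in> cball_model" "w \<in> cball_model" for z w
  proof -
    have "(1 - (norm z)\<^sup>2) * (1 - (norm w)\<^sup>2) \<noteq> 0" using that by (auto simp: ball_iff)
    then show ?thesis
      using bergman_dist_eqD[OF that ball[OF that(1)] ball[OF that(2)] dist[OF that]] nh that by simp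
  qed
  have dh: "((\<lambda>t. h (t *\<^sub>R w)) has_derivative (\<lambda>t. L (t *\<^sub>R w))) (at 0)" for w
  proof -
    have "((\<lambda>t. t *\<^sub>R w) has_derivative (\<lambda>t. t *\<^sub>R w)) (at (0::real))"
      by (intro bounded_linear_imp_has_derivative bounded_linear_scaleR_left)
    then have "(h \<circ> (\<lambda>t. t *\<^sub>R w) has_derivative L \<circ> (\<lambda>t. t *\<^sub>R w)) (at (0::real))"
      by (rule diff_chain_at) (use L in simp)
    then show ?thesis by (simp add: o_def)
  qed
  have re: "Re (herm (h z) (L w)) = Re (herm z w)" if z: "z \<in> cball_model" for z w
  proof -
    obtain e where e: "e > 0" "\<And>t. \<bar>t\<bar> < e \<Longrightarrow> t *\<^sub>R w \<in> cball_model" using small_scale_in_ball by blast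
    have d: "((\<lambda>t. (cmod (herm a (k t) - 1))\<^sup>2) has_derivative (\<lambda>t. 2 * ((herm a (k 0) - 1) \<bullet> herm a (k' t)))) (at 0)"
      if "(k has_derivative k') (at (0::real))" for a and k :: "real \<Rightarrow> complex ^ 'n" and k'
    proof -
      have 1: "((\<lambda>t. herm a (k t) - 1) has_derivative (\<lambda>t. herm a (k' t) - 0)) (at 0)"
        by (intro has_derivative_diff has_derivative_const
            bounded_linear.has_derivative[OF bounded_bilinear.bounded_linear_right[OF bounded_bilinear_herm]] that)
      show ?thesis unfolding power2_norm_eq_inner
        by (rule has_derivative_eq_rhs[OF has_derivative_inner[OF 1 1]]) (simp add: fun_eq_iff inner_commute)
    qed
    have "((\<lambda>t. (cmod (herm z (t *\<^sub>R w) - 1))\<^sup>2) has_derivative (\<lambda>t. 2 * ((herm (h z) (h (0 *\<^sub>R w)) - 1) \<bullet> herm (h z) (L (t *\<^sub>R w))))) (at 0)"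
    proof (rule has_derivative_transform_within[OF d[OF dh] e(1)])
      fix t :: real assume "dist t 0 < e"
      then show "(cmod (herm (h z) (h (t *\<^sub>R w)) - 1))\<^sup>2 = (cmod (herm z (t *\<^sub>R w) - 1))\<^sup>2"
        using hh[OF z e(2)] by (simp add: dist_real_def)
    qed simp
    moreover have "((\<lambda>t. (cmod (herm z (t *\<^sub>R w) - 1))\<^sup>2) has_derivative (\<lambda>t. 2 * ((herm z (0 *\<^sub>R w) - 1) \<bullet> herm z (t *\<^sub>R w)))) (at 0)"
      by (intro d bounded_linear_imp_has_derivative bounded_linear_scaleR_left)
    ultimately have "(\<lambda>t. 2 * ((herm (h z) (h (0 *\<^sub>R w)) - 1) \<bullet> herm (h z) (L (t *\<^sub>R w)))) = (\<lambda>t. 2 * ((herm z (0 *\<^sub>R w) - 1) \<bullet> herm z (t *\<^sub>R w)))"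
      by (rule has_derivative_unique)
    from fun_cong[OF this, of 1] show ?thesis by (simp add: h0 inner_complex_def)
  qed
  \<comment> \<open>Testing with \<open>\<i> *s w\<close> supplies the imaginary part; here the
    complex linearity of L enters.\<close>
  have hL: "herm (h z) (L w) = herm z w" if z: "z \<in> cball_model" for z w
    using re[OF z, of w] re[OF z, of "\<i> *s w"] by (simp add: Li herm_scale_right complex_eq_iff)
  have LL: "herm (L z) (L w) = herm z w" for z w
  proof -
    obtain e where e: "e > 0" "\<And>t. \<bar>t\<bar> < e \<Longrightarrow> t *\<^sub>R z \<in> cball_model" using small_scale_in_ball by blast
    have "((\<lambda>t. herm (h (t *\<^sub>R z)) (L w)) has_derivative (\<lambda>t. herm (L (t *\<^sub>R z)) (L w))) (at 0)"
      by (rule bounded_linear.has_derivative[OF bounded_bilinear.bounded_linear_left[OF bounded_bilinear_herm] dh])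
    then have "((\<lambda>t. herm (t *\<^sub>R z) w) has_derivative (\<lambda>t. herm (L (t *\<^sub>R z)) (L w))) (at 0)"
      by (rule has_derivative_transform_within[OF _ e(1)]) (auto simp: dist_real_def hL e(2))
    moreover have "((\<lambda>t. herm (t *\<^sub>R z) w) has_derivative (\<lambda>t. herm (t *\<^sub>R z) w)) (at (0::real))"
      by (intro bounded_linear.has_derivative[OF bounded_bilinear.bounded_linear_left[OF bounded_bilinear_herm]]
          bounded_linear_imp_has_derivative bounded_linear_scaleR_left)
    ultimately have "(\<lambda>t::real. herm (L (t *\<^sub>R z)) (L w)) = (\<lambda>t. herm (t *\<^sub>R z) w)"
      by (rule has_derivative_unique)
    from fun_cong[OF this, of 1] show ?thesis by simp
  qed
  have "Vector_Spaces.linear (*s) (*s) L"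
  proof
    fix a b and c :: complex
    show "L (a + b) = L a + L b" using lin by (simp add: bounded_linear.linear linear_add)
    have "c *s x = Re c *\<^sub>R x + Im c *\<^sub>R (\<i> *s x)" for x :: "complex ^ 'n"
    proof -
      have "c *s x = (of_real (Re c) + \<i> * of_real (Im c)) *s x" by (simp only: complex_eq[symmetric])
      then show ?thesis unfolding of_real_vec_scale[symmetric] by (simp add: vec_eq_iff algebra_simps)
    qed
    then show "L (c *s a) = c *s L a"
      using lin by (simp add: bounded_linear.linear linear_add linear_scale Li)
  qed
  then have U: "matrix L *v x = L x" for x by (rule matrix_works)
  show ?thesis
  proof (intro exI[of _ "matrix L"] conjI ballI)
    have "(adj (matrix L) ** matrix L) $ i $ j = mat 1 $ i $ j" for i j
      using LL[of "axis j 1" "axis i 1"]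
      by (subst (1 2) matrix_entry) (simp only: matrix_vector_mult_assoc' herm_mult_left[of "adj _"] adj_adj U matrix_vector_mul_lid)
    then show "unitary (matrix L)" unfolding unitary_def vec_eq_iff by blast
    fix z :: "complex ^ 'n" assume z: "z \<in> cball_model"
    \<comment> \<open>All four terms of the expanded form equal \<open>herm z z\<close> up to
      sign.\<close>
    have "herm (h z - L z) (h z - L z) = 0"
    proof -
      have "herm (h z) (h z) = herm z z" "herm (L z) (h z) = herm z z"
        using nh[OF z] hL[OF z, of z] herm_commute[of "L z" "h z"] by (simp_all add: herm_self)
      then show ?thesis using hL[OF z, of z] LL[of z z] by (simp add: herm_simps)
    qed
    then show "h z = matrix L *v z" by (simp add: herm_self U)
  qed
qed

text \<open>Composing with the inverse of the boost to \<open>g 0\<close> gives an isometry fixing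
  0, which is unitary by \<open>isometry_fixing_zero_unitary\<close>. Holomorphy is what excludes
  isometries such as complex conjugation.\<close>

theorem holo_isometry_act:
  assumes g: "holo_isometry g"
  obtains A where "un1 A" "\<And>z. z \<in> cball_model \<Longrightarrow> g z = act A z"
proof -
  have gb: "g z \<in> cball_model" if "z \<in> cball_model" for z
    using g that by (auto simp: holo_isometry_def bij_betw_def)
  define p where "p = g 0"
  have p: "p \<in> cball_model" unfolding p_def by (rule gb) simp
  note T = un1_Tm[OF p]
  define h where "h z = act (uinv (Tm p)) (g z)" for z
  obtain g' where g': "(g has_derivative g') (at 0)" "\<And>v. g' (\<i> *s v) = \<i> *s g' v"
    using g zero_in_ball unfolding holo_isometry_def holo_map_on_def vector_scalar_mult_def by blast
  have "(h has_derivative act_deriv (uinv (Tm p)) p \<circ> g') (at 0)"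
    unfolding h_def using diff_chain_at[OF g'(1), of "act (uinv (Tm p))"] act_has_derivative[of "uinv (Tm p)" p]
      un1_denom[OF un1_uinv[OF T] p] by (simp add: p_def o_def)
  note hd = this
  have "\<exists>U. unitary U \<and> (\<forall>z \<in> cball_model. h z = U *v z)"
  proof (rule isometry_fixing_zero_unitary[OF _ _ _ hd])
    show "h z \<in> cball_model" if "z \<in> cball_model" for z unfolding h_def by (intro act_in_ball un1_uinv T gb that)
    show "bergman_dist (h z) (h w) = bergman_dist z w" if "z \<in> cball_model" "w \<in> cball_model" for z w
      using g that unfolding h_def by (simp add: act_bergman_dist un1_uinv T gb holo_isometry_def)
    show "h 0 = 0" using act_uinv(1)[OF T, of 0] act_Tm_0[OF p] by (simp add: h_def p_def[symmetric])
    show "(act_deriv (uinv (Tm p)) p \<circ> g') (\<i> *s v) = \<i> *s (act_deriv (uinv (Tm p)) p \<circ> g') v" for v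
      by (simp add: g' act_deriv_scale)
  qed
  then obtain U where U: "unitary U" "\<And>z. z \<in> cball_model \<Longrightarrow> h z = U *v z" by blast
  have unU: "un1 (blk U 0 0 1)" by (rule un1_blk_unitary[OF U(1)]) simp
  show ?thesis
  proof (rule that[of "Tm p ** blk U 0 0 1"])
    show "un1 (Tm p ** blk U 0 0 1)" by (rule un1_mult[OF T unU])
    fix z :: "complex ^ 'a" assume z: "z \<in> cball_model"
    have "act (Tm p ** blk U 0 0 1) z = act (Tm p) (U *v z)"
      using act_mult[OF unU z, of "Tm p"] by (simp add: act_blk_diag)
    also have "\<dots> = act (Tm p) (act (uinv (Tm p)) (g z))" using U(2)[OF z] by (simp add: h_def)
    finally show "g z = act (Tm p ** blk U 0 0 1) z" using act_uinv(2)[OF T gb[OF z]] by simp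
  qed
qed

section \<open>Enlarging small elements\<close>

definition scalar_matrix :: "complex ^ 'n ^ 'n \<Rightarrow> bool" where
  "scalar_matrix A \<longleftrightarrow> (\<exists>d. cmod d = 1 \<and> A = mat d)"

text \<open>The Lie algebra element generating the boosts in direction w; the factor 1/2 makes the
  parameter t of \<open>Em\<close> the Bergman distance.\<close>

definition Xm :: "complex ^ 'n \<Rightarrow> complex ^ ('n::finite option) ^ ('n option)" where
  "Xm w = (1 / 2) *\<^sub>R blk 0 w w 0"

text \<open>The closed form of exp (t Xm u) for a unit vector u: the square of
  \<open>blk 0 u u 0\<close> is the projection \<open>blk (outer u u) 0 0 1\<close>, so the
  exponential series sums to hyperbolic functions.\<close>

definition Em :: "real \<Rightarrow> complex ^ 'n \<Rightarrow> complex ^ ('n::finite option) ^ ('n option)" where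
  "Em t u = mat 1 + (cosh (t / 2) - 1) *\<^sub>R blk (outer u u) 0 0 1 + sinh (t / 2) *\<^sub>R blk 0 u u 0"

lemma blk_scaleR: "r *\<^sub>R blk a b c d = blk (r *\<^sub>R a) (r *\<^sub>R b) (r *\<^sub>R c) (r *\<^sub>R d)"
  by (simp add: vec_eq_option)

lemma blk_add: "blk a b c d + blk a' b' c' d' = blk (a + a') (b + b') (c + c') (d + d')"
  by (simp add: vec_eq_option)

lemma Em_bo: "Em t u = bo (cosh (t / 2) - 1) (sinh (t / 2)) (cosh (t / 2)) u"
  unfolding Em_def bo_def mat_blk[of 1] blk_scaleR blk_add by (simp add: blk_eq_iff scaleR_conv_of_real)

lemma uinv_Em: "uinv (Em t u) = Em (- t) u"
  by (simp add: Em_bo uinv_bo)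

lemma un1_Em: "norm u = 1 \<Longrightarrow> un1 (Em t u)"
  unfolding Em_bo by (rule un1_bo) (auto simp: power2_eq_square cosh_square_eq[unfolded power2_eq_square] algebra_simps hyperbolic_pythagoras)

lemma Em_0: "Em 0 u = mat 1"
  by (simp add: Em_def)

lemma adj_Xm [simp]: "adj (Xm w) = Xm w"
  by (simp add: Xm_def adj_scaleR adj_blk) (simp add: adj_def vec_eq_iff zero_vec_def)

lemma Xm_add: "Xm (v + w) = Xm v + Xm w"
  by (simp add: Xm_def blk_add flip: scaleR_add_right)

lemma Xm_scaleR: "Xm (r *\<^sub>R w) = r *\<^sub>R Xm w"
  by (simp add: Xm_def blk_scaleR)

lemma Em_Xm:
  assumes "norm u = 1"
  shows "Em t u ** Xm u = (1 / 2) *\<^sub>R (sinh (t / 2) *\<^sub>R blk (outer u u) 0 0 1 + cosh (t / 2) *\<^sub>R blk 0 u u 0)"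
    "Xm u ** Em t u = (1 / 2) *\<^sub>R (sinh (t / 2) *\<^sub>R blk (outer u u) 0 0 1 + cosh (t / 2) *\<^sub>R blk 0 u u 0)"
proof -
  let ?P = "blk (outer u u) 0 0 1" and ?S = "blk 0 u u 0"
  have z: "(0 :: complex ^ 'a ^ 'a) ** C = 0" "C ** (0 :: complex ^ 'a ^ 'a) = 0" "adj (0 :: complex ^ 'a ^ 'a) = 0" for C :: "complex ^ 'a ^ 'a"
    by (simp_all add: matrix_matrix_mult_def vec_eq_iff adj_def)
  have o: "outer u u *v u = u" "herm u u = 1" using assms by (simp_all add: outer_mult_vec herm_self)
  have PS: "?P ** ?S = ?S" "?S ** ?P = ?S" "?S ** ?S = ?P"
    unfolding blk_mult blk_eq_iff by (simp_all add: z o outer_simps)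
  show "Em t u ** Xm u = (1 / 2) *\<^sub>R (sinh (t / 2) *\<^sub>R ?P + cosh (t / 2) *\<^sub>R ?S)"
    "Xm u ** Em t u = (1 / 2) *\<^sub>R (sinh (t / 2) *\<^sub>R ?P + cosh (t / 2) *\<^sub>R ?S)"
    unfolding Em_def Xm_def
    by (simp_all add: matrix_mult_add_left matrix_add_ldistrib matrix_mult_diff_left matrix_mult_diff_right
        matrix_scaleR_left matrix_scaleR_right PS algebra_simps)
qed

lemma Em_derivative:
  assumes "norm u = 1"
  shows "((\<lambda>t. Em t u) has_vector_derivative Em t u ** Xm u) (at t)"
    "((\<lambda>t. Em (- t) u) has_vector_derivative - (Xm u ** Em (- t) u)) (at t)"
  unfolding Em_Xm[OF assms] unfolding Em_def
  by (auto intro!: derivative_eq_intros simp: scaleR_add_right scaleR_diff_right)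

text \<open>The conjugate \<open>A\<^sub>t\<close> of \<open>A\<close> by the boost of length \<open>t\<close> moves along the vector field \<open>[A\<^sub>t, X]\<close>;
  since \<open>X\<close> is Hermitian, the second derivative of \<open>|A\<^sub>t|\<^sup>2\<close> is \<open>4 |[A\<^sub>t, X]|\<^sup>2\<close>.\<close>

definition conjE :: "complex ^ ('n::finite option) ^ ('n option) \<Rightarrow> complex ^ 'n \<Rightarrow> real \<Rightarrow> complex ^ ('n option) ^ ('n option)" where
  "conjE A u t = Em (- t) u ** A ** Em t u"

definition adX :: "complex ^ 'n \<Rightarrow> complex ^ ('n::finite option) ^ ('n option) \<Rightarrow> complex ^ ('n option) ^ ('n option)" where
  "adX u A = A ** Xm u - Xm u ** A"

lemma bounded_bilinear_matrix_mult: "bounded_bilinear (\<lambda>(A :: complex ^ 'n ^ 'm) (B :: complex ^ 'k ^ 'n). A ** B)"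
proof
  show "\<exists>K. \<forall>(A :: complex ^ 'n ^ 'm) (B :: complex ^ 'k ^ 'n). norm (A ** B) \<le> norm A * norm B * K"
    by (rule exI[of _ 1]) (simp add: norm_matrix_mult)
qed (simp_all add: matrix_mult_add_left matrix_add_ldistrib matrix_scaleR_left matrix_scaleR_right)

lemma conjE_derivative:
  assumes "norm u = 1"
  shows "(conjE A u has_vector_derivative adX u (conjE A u t)) (at t)"
proof -
  have 1: "((\<lambda>t. Em (- t) u ** A) has_vector_derivative (- (Xm u ** Em (- t) u)) ** A) (at t)"
    by (rule bounded_linear.has_vector_derivative[OF bounded_linear_matrix_right Em_derivative(2)[OF assms]])
  show ?thesis
    unfolding conjE_def[abs_def] adX_def
    by (rule has_vector_derivative_eq_rhs[OF bounded_bilinear.has_vector_derivative[OF bounded_bilinear_matrix_mult 1 Em_derivative(1)[OF assms]]])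
       (simp add: matrix_mult_minus_left matrix_mul_assoc)
qed

lemma adX_self_adjoint: "A \<bullet> adX u B = adX u A \<bullet> B"
proof -
  have "A \<bullet> (B ** Xm u) = (A ** Xm u) \<bullet> B" using inner_mult_right[of A "Xm u" B] by simp
  moreover have "A \<bullet> (Xm u ** B) = (Xm u ** A) \<bullet> B" using inner_mult_left[of "Xm u" A B] by simp
  ultimately show ?thesis by (simp add: adX_def inner_diff_left inner_diff_right)
qed

lemma linear_adX: "bounded_linear (adX u)"
  unfolding adX_def[abs_def] by (intro bounded_linear_sub bounded_linear_matrix_left bounded_linear_matrix_right)

lemma conjE_norm_derivatives:
  assumes "norm u = 1"
  shows "((\<lambda>t. (norm (conjE A u t))\<^sup>2) has_real_derivative 2 * (conjE A u t \<bullet> adX u (conjE A u t))) (at t)"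
    "((\<lambda>t. 2 * (conjE A u t \<bullet> adX u (conjE A u t))) has_real_derivative 4 * (norm (adX u (conjE A u t)))\<^sup>2) (at t)"
proof -
  note d = conjE_derivative[OF assms, of A t]
  have d2: "((\<lambda>t. adX u (conjE A u t)) has_vector_derivative adX u (adX u (conjE A u t))) (at t)"
    by (rule bounded_linear.has_vector_derivative[OF linear_adX d])
  have i: "((\<lambda>t. f t \<bullet> g t) has_real_derivative f t \<bullet> g' + f' \<bullet> g t) (at t)"
    if "(f has_vector_derivative f') (at t)" "(g has_vector_derivative g') (at t)"
    for f g :: "real \<Rightarrow> complex ^ ('a option) ^ ('a option)" and f' g'
    using bounded_bilinear.has_vector_derivative[OF bounded_bilinear_inner that]
    by (simp add: has_real_derivative_iff_has_vector_derivative)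
  show "((\<lambda>t. (norm (conjE A u t))\<^sup>2) has_real_derivative 2 * (conjE A u t \<bullet> adX u (conjE A u t))) (at t)"
    unfolding power2_norm_eq_inner using i[OF d d] by (simp add: inner_commute)
  have "((\<lambda>t. conjE A u t \<bullet> adX u (conjE A u t)) has_real_derivative 2 * (norm (adX u (conjE A u t)))\<^sup>2) (at t)"
    using i[OF d d2] by (simp add: adX_self_adjoint[of "conjE A u t"] power2_norm_eq_inner)
  from DERIV_cmult[OF this, of 2] show "((\<lambda>t. 2 * (conjE A u t \<bullet> adX u (conjE A u t))) has_real_derivative 4 * (norm (adX u (conjE A u t)))\<^sup>2) (at t)"
    by simp
qed

section \<open>Convexity of the norm along boosts\<close>

lemma conjE_0: "conjE A u 0 = A"
  by (simp add: conjE_def Em_0)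

lemma conjE_slope_mono:
  assumes "norm u = 1" "s \<le> t"
  shows "conjE A u s \<bullet> adX u (conjE A u s) \<le> conjE A u t \<bullet> adX u (conjE A u t)"
proof -
  have "2 * (conjE A u s \<bullet> adX u (conjE A u s)) \<le> 2 * (conjE A u t \<bullet> adX u (conjE A u t))"
    by (rule DERIV_nonneg_imp_nondecreasing[OF assms(2)])
       (use conjE_norm_derivatives(2)[OF assms(1)] in \<open>fastforce\<close>)
  then show ?thesis by simp
qed

text \<open>Equal norms at 0 and l give an interior critical point, and the slope, being
  nondecreasing, cannot be positive before it.\<close>

lemma conjE_slope_le_0:
  assumes u: "norm u = 1" and l: "0 < l" "norm (conjE A u l) = norm A"
  shows "A \<bullet> adX u A \<le> 0"
proof -
  obtain z where z: "0 < z" "z < l"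
    "(norm (conjE A u l))\<^sup>2 - (norm (conjE A u 0))\<^sup>2 = (l - 0) * (2 * (conjE A u z \<bullet> adX u (conjE A u z)))"
    using MVT2[OF l(1), of "\<lambda>t. (norm (conjE A u t))\<^sup>2" "\<lambda>t. 2 * (conjE A u t \<bullet> adX u (conjE A u t))"]
      conjE_norm_derivatives(1)[OF u] by blast
  then have "conjE A u z \<bullet> adX u (conjE A u z) = 0" using l by (simp add: conjE_0)
  then show ?thesis using conjE_slope_mono[OF u, of 0 z A] z by (simp add: conjE_0)
qed

text \<open>If the initial slope is zero, the second derivative at 0 is 4 |adX u A|^2 > 0, so the
  slope becomes positive at once and stays positive by monotonicity.\<close>

lemma conjE_increases:
  assumes u: "norm u = 1" and pos: "0 \<le> A \<bullet> adX u A" "0 < A \<bullet> adX u A \<or> adX u A \<noteq> 0" and t: "0 < t"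
  shows "norm A < norm (conjE A u t)"
proof -
  let ?f' = "\<lambda>t. 2 * (conjE A u t \<bullet> adX u (conjE A u t))"
  have f': "?f' s > 0" if s: "0 < s" for s
  proof (cases "A \<bullet> adX u A > 0")
    case True
    then show ?thesis using conjE_slope_mono[OF u, of 0 s A] s by (simp add: conjE_0)
  next
    case False
    then have "adX u A \<noteq> 0" "A \<bullet> adX u A = 0" using pos by auto
    then have "0 < 4 * (norm (adX u (conjE A u 0)))\<^sup>2" by (simp add: conjE_0)
    then obtain d where d: "d > 0" "\<And>h. 0 < h \<Longrightarrow> h < d \<Longrightarrow> ?f' 0 < ?f' (0 + h)"
      using DERIV_pos_inc_right[OF conjE_norm_derivatives(2)[OF u, of A 0]] by blast
    define h where "h = min (d / 2) s"
    have h: "0 < h" "h < d" "h \<le> s" using d s by (auto simp: h_def)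
    have "0 < ?f' h" using d(2)[OF h(1,2)] \<open>A \<bullet> adX u A = 0\<close> by (simp add: conjE_0)
    then show ?thesis using conjE_slope_mono[OF u h(3), of A] by simp
  qed
  obtain z where z: "0 < z" "z < t" "(norm (conjE A u t))\<^sup>2 - (norm (conjE A u 0))\<^sup>2 = (t - 0) * ?f' z"
    using MVT2[OF t, of "\<lambda>t. (norm (conjE A u t))\<^sup>2" ?f'] conjE_norm_derivatives(1)[OF u] by blast
  moreover have "0 < t * ?f' z" using t f'[OF z(1)] by (rule mult_pos_pos)
  ultimately have "(norm A)\<^sup>2 < (norm (conjE A u t))\<^sup>2" by (simp add: conjE_0)
  then show ?thesis by (rule power2_less_imp_less) simp
qed

lemma trace_conjE: "norm u = 1 \<Longrightarrow> trace (conjE A u t) = trace A"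
proof -
  assume u: "norm u = 1"
  have "trace (conjE A u t) = trace (Em t u ** Em (- t) u ** A)"
    unfolding conjE_def by (subst trace_mul_sym) (simp add: matrix_mul_assoc)
  then show ?thesis using uinv_right[OF un1_Em[OF u]] by (simp add: uinv_Em)
qed

lemma norm_conjE_diff1:
  "norm u = 1 \<Longrightarrow> (norm (conjE A u t - mat 1))\<^sup>2 = (norm (conjE A u t))\<^sup>2 + real CARD('n option) - 2 * Re (trace A)"
  for A :: "complex ^ ('n::finite option) ^ ('n option)"
  using norm_diff_mat1[of "conjE A u t"] by (simp add: trace_conjE)

text \<open>Joins the two descriptions of a boost: by its end point, suited to the polar
  decomposition, and by length and direction, suited to differentiation.\<close>

lemma Em_eq_Tm:
  assumes p: "p \<in> cball_model" "p \<noteq> 0"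
  shows "Em (2 * arcosh (gam p)) ((1 / norm p) *\<^sub>R p) = Tm p" "0 < 2 * arcosh (gam p)"
proof -
  note g = gam[OF p(1)]
  have np: "norm p > 0" using p by simp
  have c: "cosh (arcosh (gam p)) = gam p" using g(1) by (rule cosh_arcosh_real)
  have a0: "arcosh (gam p) \<ge> 0" using g(1) by (rule arcosh_nonneg_real)
  have "(sinh (arcosh (gam p)))\<^sup>2 = (gam p * norm p)\<^sup>2"
    using g(4) by (simp add: sinh_square_eq c power_mult_distrib)
  then have s: "sinh (arcosh (gam p)) = gam p * norm p"
    using a0 g(1) by (subst (asm) power2_eq_iff_nonneg) auto
  have "gam p - 1 = (gam p)\<^sup>2 / (1 + gam p) * (norm p)\<^sup>2" using Tm_coeffs(1)[OF p(1)] by simp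
  then have k: "(gam p - 1) / (norm p * norm p) = (gam p)\<^sup>2 / (1 + gam p)"
    using np by (simp add: power2_eq_square)
  show "Em (2 * arcosh (gam p)) ((1 / norm p) *\<^sub>R p) = Tm p"
    unfolding Em_bo Tm_def bo_def blk_eq_iff using np k by (simp add: c s outer_simps)
  have "gam p \<noteq> 1"
  proof
    assume "gam p = 1"
    then have "(norm p)\<^sup>2 = 0" using g(4) by simp
    then show False using np by simp
  qed
  then show "0 < 2 * arcosh (gam p)" using a0 c by (metis cosh_0 less_eq_real_def mult_pos_pos zero_less_numeral)
qed

text \<open>Only the off-diagonal blocks of \<open>adj A ** A\<close> and \<open>A ** adj A\<close>
  pair with \<open>Xm w\<close>, and each is 2 (gam p)^2 times a vector. Since
  \<open>d *s (adj U *v p)\<close> is minus the image of 0 under the inverse of A, the slope pairs w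
  with -2 (gam p)^2 times the sum of the images of 0 under A and its inverse.\<close>

lemma inner_adX_polar:
  assumes p: "p \<in> cball_model" and U: "unitary U" "cmod d = 1" and A: "A = Tm p ** blk U 0 0 d"
  shows "A \<bullet> adX w A = 2 * (gam p)\<^sup>2 * ((d *s (adj U *v p) - p) \<bullet> w)"
proof -
  let ?K = "blk U 0 0 d" and ?g = "gam p"
  define k where "k = ?g\<^sup>2 / (1 + ?g)"
  have dd: "cnj d * d = 1" "d * cnj d = 1" using U(2)
    by (metis complex_norm_square mult.commute of_real_1 power_one)+
  have K: "adj ?K ** ?K = mat 1" "?K ** adj ?K = mat 1"
    using U dd by (simp_all add: adj_blk blk_mult outer_simps unitaryD mat_blk[of 1] blk_eq_iff)
  have TT: "Tm p ** Tm p = bo (2 * k + k\<^sup>2 * (norm p)\<^sup>2 + ?g\<^sup>2) (?g * (1 + k * (norm p)\<^sup>2) + ?g\<^sup>2) (?g\<^sup>2 * (norm p)\<^sup>2 + ?g\<^sup>2) p"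
    unfolding Tm_def k_def[symmetric] by (subst bo_mult) (simp_all add: power2_eq_square algebra_simps)
  define m where "m = ?g * (1 + k * (norm p)\<^sup>2) + ?g\<^sup>2"
  have AA: "A ** adj A = Tm p ** Tm p" "adj A ** A = adj ?K ** (Tm p ** Tm p) ** ?K"
    unfolding A adj_mult using K
    by (simp_all add: Tm_def) (metis matrix_mul_assoc matrix_mul_rid, metis matrix_mul_assoc)
  have Xb: "Xm w = blk 0 ((1 / 2) *\<^sub>R w) ((1 / 2) *\<^sub>R w) 0" by (simp add: Xm_def blk_scaleR)
  have "A \<bullet> adX w A = (adj A ** A) \<bullet> Xm w - (A ** adj A) \<bullet> Xm w"
    unfolding adX_def inner_diff_right using inner_mult_left[of "adj A" A "Xm w"] inner_mult_right[of A "adj A" "Xm w"] by simp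
  also have "(A ** adj A) \<bullet> Xm w = m * (p \<bullet> w)"
    unfolding AA TT bo_def Xb m_def[symmetric] blk_inner by simp
  also have "(adj A ** A) \<bullet> Xm w = m * ((d *s (adj U *v p)) \<bullet> w)"
  proof -
    have eq: "adj ?K ** (Tm p ** Tm p) ** ?K = blk (adj U ** (mat 1 + (2 * k + k\<^sup>2 * (norm p)\<^sup>2 + ?g\<^sup>2) *\<^sub>R outer p p) ** U)
      (m *\<^sub>R (d *s (adj U *v p))) (m *\<^sub>R (d *s (adj U *v p))) (of_real (?g\<^sup>2 * (norm p)\<^sup>2 + ?g\<^sup>2))"
    proof -
      have s: "adj U *v (d *s (m *\<^sub>R p)) = m *\<^sub>R (d *s (adj U *v p))"
        by (simp add: of_real_vec_scale[symmetric] vector_scalar_commute vector_smult_assoc mult.commute)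
      then have "d *s (adj U *v (m *\<^sub>R p)) = m *\<^sub>R (d *s (adj U *v p))" by (simp add: vector_scalar_commute)
      with s show ?thesis
        unfolding TT bo_def adj_blk blk_mult m_def[symmetric] blk_eq_iff using dd by (simp add: outer_simps)
    qed
    show ?thesis unfolding AA(2) eq Xb blk_inner by simp
  qed
  also have "m = 2 * ?g\<^sup>2" unfolding m_def k_def using Tm_coeffs(1)[OF p] by (simp add: power2_eq_square)
  finally show ?thesis by (simp add: inner_diff_left algebra_simps)
qed

lemma adX_add: "adX (v + w) A = adX v A + adX w A"
  by (simp add: adX_def Xm_add matrix_add_ldistrib matrix_mult_add_left)

lemma adX_scaleR: "adX (r *\<^sub>R w) A = r *\<^sub>R adX w A"
  by (simp add: adX_def Xm_scaleR matrix_scaleR_left matrix_scaleR_right scaleR_diff_right)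

lemma linear_adX_direction: "linear (\<lambda>w. adX w A)"
  by (rule linearI) (simp_all add: adX_add adX_scaleR)

lemma adX_eq_0_all:
  assumes A: "un1 A" and all: "\<And>w. adX w A = 0"
  shows "scalar_matrix A"
proof -
  obtain a b c d where Ab: "A = blk a b c d" using blk_cases by blast
  have zz: "(0 :: complex ^ 'a ^ 'a) ** C = 0" "C ** (0 :: complex ^ 'a ^ 'a) = 0" "adj (0 :: complex ^ 'a ^ 'a) = 0" for C :: "complex ^ 'a ^ 'a"
    by (simp_all add: matrix_matrix_mult_def vec_eq_iff adj_def)
  have eq: "outer b w = outer w c" "a *v w = d *s w" for w
  proof -
    have "(1 / 2) *\<^sub>R (A ** blk 0 w w 0 - blk 0 w w 0 ** A) = 0"
      using all[of w] by (simp add: adX_def Xm_def matrix_scaleR_left matrix_scaleR_right scaleR_diff_right)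
    then have "A ** blk 0 w w 0 = blk 0 w w 0 ** A" by simp
    then show "outer b w = outer w c" "a *v w = d *s w"
      unfolding Ab blk_mult blk_eq_iff by (simp_all add: zz)
  qed
  have "a = mat d" using eq(2) by (simp add: matrix_eq mat_vec)
  moreover have "b = 0"
  proof -
    have bw: "b $ i * cnj (w $ j) = w $ i * cnj (c $ j)" for w i j
      using eq(1)[of w] by (simp add: outer_def vec_eq_iff)
    \<comment> \<open>\<open>outer b w\<close> is conjugate linear in w while
      \<open>outer w c\<close> is linear; comparing the real and the imaginary vector along axis i
      makes both sides vanish.\<close>
    have "b $ i = 0" for i
    proof -
      have 1: "b $ i = cnj (c $ i)" using bw[of i "axis i 1" i] by (simp add: axis_def)
      have 2: "b $ i * (- \<i>) = \<i> * cnj (c $ i)" using bw[of i "axis i \<i>" i] by (simp add: axis_def)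
      show ?thesis using 2 unfolding 1[symmetric] by (simp add: algebra_simps)
    qed
    then show ?thesis by (simp add: vec_eq_iff)
  qed
  ultimately have "A = blk (mat d) 0 c d" by (simp add: Ab)
  then have "c = 0" "cmod d = 1" using un1_blk_diag[of "mat d" c d] A by simp_all
  with \<open>A = blk (mat d) 0 c d\<close> have "A = mat d" "cmod d = 1" by (simp_all only: mat_blk[of d, symmetric])
  then show ?thesis by (auto simp: scalar_matrix_def)
qed

text \<open>By \<open>adX_eq_0_all\<close> the directions whose generators commute with A form a
  proper real subspace, so a generic direction avoids the kernels of finitely many A.\<close>

lemma negligible_adX_kernel:
  assumes "un1 A" "\<not> scalar_matrix A"
  shows "negligible {w. adX w A = 0}"
proof (rule negligible_lowdim)
  have sub: "subspace {w. adX w A = 0}"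
    using linear_subspace_vimage[OF linear_adX_direction subspace_single_0] by (simp add: vimage_def)
  obtain w where "adX w A \<noteq> 0" using adX_eq_0_all assms by blast
  then have "{w. adX w A = 0} \<subset> UNIV" by auto
  then have "span {w. adX w A = 0} \<subset> span UNIV" using sub by (simp add: span_eq_iff[THEN iffD2])
  from dim_psubset[OF this] show "dim {w. adX w A = 0} < DIM(complex ^ 'a)" by simp
qed

lemma un1_cancel:
  assumes "un1 A" shows "uinv A ** (A ** X) = X" "A ** (uinv A ** X) = X"
  using assms by (simp_all add: matrix_mul_assoc uinv_left uinv_right)

text \<open>Conjugation by \<open>Tm p\<close> is conjugation by B followed by a unitary one. The
  former only multiplies A by a unit scalar, and the latter preserves the Frobenius norm.\<close>

lemma norm_conj_commute:
  assumes A: "un1 A" and B: "un1 B" "B = Tm p ** blk U 0 0 d" "unitary U" "cmod d = 1" and p: "p \<in> cball_model"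
    and comm: "A ** B = mat l ** (B ** A)" "cmod l = 1"
  shows "norm (uinv (Tm p) ** A ** Tm p) = norm A"
proof -
  let ?K = "blk U 0 0 d"
  have dd: "cnj d * d = 1" "d * cnj d = 1" using B(4)
    by (metis complex_norm_square mult.commute of_real_1 power_one)+
  have K: "adj ?K ** ?K = mat 1" "?K ** adj ?K = mat 1"
    using B(3) dd by (simp_all add: adj_blk blk_mult outer_simps unitaryD mat_blk[of 1] blk_eq_iff)
  then have uK: "unitary ?K" "unitary (adj ?K)" by (simp_all add: unitary_def)
  have uiK: "uinv ?K = adj ?K"
    by (simp add: uinv_def adj_blk Jm_blk blk_mult outer_simps blk_eq_iff)
  have T: "Tm p = B ** adj ?K" unfolding B(2) using K by (simp flip: matrix_mul_assoc)
  have "uinv (Tm p) = ?K ** uinv B"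
    unfolding T uinv_mult using uiK by (metis uinv_uinv)
  then have "norm (uinv (Tm p) ** A ** Tm p) = norm (?K ** (uinv B ** A ** B) ** adj ?K)"
    unfolding T by (simp add: matrix_mul_assoc)
  also have "\<dots> = norm (uinv B ** (A ** B))"
    by (subst unitary_norm_right[OF uK(2)], subst unitary_norm_left[OF uK(1)]) (simp add: matrix_mul_assoc)
  also have "uinv B ** (A ** B) = mat l ** (uinv B ** B ** A)"
    unfolding comm(1) by (metis mat_commute matrix_mul_assoc)
  also have "norm \<dots> = norm A" using comm(2) by (simp add: norm_mat_mult uinv_left[OF B(1)])
  finally show ?thesis .
qed

text \<open>At a maximum point of the minimal size of the nonscalar elements, the elements of minimal size would commute
  up to scalars. Displacement functions are convex and constant along orbits of commuting elements, so moving
  away from the orbit points of all these elements at once increases all their sizes.\<close>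

theorem small_elements_can_be_enlarged:
  fixes \<Lambda> :: "(complex ^ ('n::finite option) ^ ('n option)) set"
  assumes un: "\<And>A. A \<in> \<Lambda> \<Longrightarrow> un1 A" and mult: "\<And>A B. A \<in> \<Lambda> \<Longrightarrow> B \<in> \<Lambda> \<Longrightarrow> A ** B \<in> \<Lambda>"
    and inv: "\<And>A. A \<in> \<Lambda> \<Longrightarrow> uinv A \<in> \<Lambda>" and scal: "\<And>d. cmod d = 1 \<Longrightarrow> mat d \<in> \<Lambda>"
    and fin: "\<And>R. \<exists>T. finite T \<and> T \<subseteq> \<Lambda> \<and> (\<forall>A\<in>\<Lambda>. norm A \<le> R \<longrightarrow> (\<exists>B\<in>T. \<exists>d. cmod d = 1 \<and> A = mat d ** B))"
    and m: "0 < m" "m \<le> 9 / 20"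
    and low: "\<And>A. A \<in> \<Lambda> \<Longrightarrow> \<not> scalar_matrix A \<Longrightarrow> m \<le> norm (A - mat 1)"
  shows "\<exists>g. un1 g \<and> (\<forall>A\<in>\<Lambda>. \<not> scalar_matrix A \<longrightarrow> m < norm (uinv g ** A ** g - mat 1))"
proof -
  \<comment> \<open>C bounds the norms of boosts of length at most 1, through
    \<open>un1_norm\<close>; R bounds the norm of every A that such a boost can bring within m of
    the identity. Elements larger than R thus cannot become too close.\<close>
  define C where "C = sqrt (real CARD('n) - 3 + 4 * (cosh (1 / 2))\<^sup>2)"
  define R where "R = C * (m + norm (mat 1 :: complex ^ ('n option) ^ ('n option))) * C"
  obtain T0 where T0: "finite T0" "T0 \<subseteq> \<Lambda>"
    "\<And>A. A \<in> \<Lambda> \<Longrightarrow> norm A \<le> R \<Longrightarrow> \<exists>B\<in>T0. \<exists>d. cmod d = 1 \<and> A = mat d ** B" using fin[of R] by blast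
  \<comment> \<open>Among the unit multiples of B the one with nonnegative real trace is closest to
    the identity, and it remains so under conjugation because the trace does not change. Finitely
    many representatives therefore suffice.\<close>
  define best where "best B = mat (cnj (phase (trace B))) ** B" for B :: "complex ^ ('n option) ^ ('n option)"
  define T where "T = best ` T0 - {A. scalar_matrix A}"
  have phase1: "cmod (phase a) = 1" for a by (simp add: phase_def norm_divide)
  have trbest: "trace (best B) = of_real (cmod (trace B))" for B
    using phase_simps(2)[of "trace B"] by (simp add: best_def trace_mat_mult mult.commute)
  have finT: "finite T" and TL: "\<And>B. B \<in> T \<Longrightarrow> B \<in> \<Lambda> \<and> \<not> scalar_matrix B"
    using T0 mult scal phase1 by (auto simp: T_def best_def subset_iff)
  have cover: "\<exists>B\<in>T. \<exists>d. cmod d = 1 \<and> A = mat d ** B \<and> Re (trace A) \<le> Re (trace B)"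
    if A: "A \<in> \<Lambda>" "norm A \<le> R" "\<not> scalar_matrix A" for A
  proof -
    obtain B d where B: "B \<in> T0" "cmod d = 1" "A = mat d ** B" using T0(3)[OF A(1,2)] by blast
    define e where "e = d * phase (trace B)"
    have e: "cmod e = 1" by (simp add: e_def norm_mult B phase1)
    have Ae: "A = mat e ** best B"
      using phase_simps(1)[of "trace B"] by (simp add: e_def best_def matrix_mul_assoc mat_mult_mat B mult.assoc)
    have "\<not> scalar_matrix (best B)"
    proof
      assume "scalar_matrix (best B)"
      then obtain c where "cmod c = 1" "best B = mat c" by (auto simp: scalar_matrix_def)
      then have "A = mat (e * c)" "cmod (e * c) = 1" using Ae e by (simp_all add: mat_mult_mat norm_mult)
      then show False using A(3) by (auto simp: scalar_matrix_def)
    qed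
    then have "best B \<in> T" using B by (simp add: T_def)
    moreover have "Re (trace A) \<le> Re (trace (best B))"
      using complex_Re_le_cmod[of "trace A"] B(2) by (simp add: trbest B(3) trace_mat_mult norm_mult)
    ultimately show ?thesis using e Ae by blast
  qed
  define M where "M = {B \<in> T. norm (B - mat 1) = m}"
  have finM: "finite M" and MinL: "\<And>B. B \<in> M \<Longrightarrow> B \<in> \<Lambda> \<and> \<not> scalar_matrix B \<and> norm (B - mat 1) = m"
    using finT TL by (auto simp: M_def)
  have MinU: "un1 B" if "B \<in> M" for B using un MinL that by blast
  \<comment> \<open>One of the two commutators lies strictly below m; as it belongs to \<Lambda>, it
    must be scalar by \<open>low\<close>.\<close>
  have comm: "\<exists>l. cmod l = 1 \<and> A ** B = mat l ** (B ** A)" if A: "A \<in> M" and B: "B \<in> M" for A B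
  proof -
    have uA: "un1 A" "un1 B" using un MinL A B by auto
    have L: "A ** B ** uinv A ** uinv B \<in> \<Lambda>" "uinv B ** uinv A ** B ** A \<in> \<Lambda>"
      using MinL A B mult inv by auto
    from commutator_contraction[OF uA(1) _ uA(2) _ m] MinL A B
    have "scalar_matrix (A ** B ** uinv A ** uinv B) \<or> scalar_matrix (uinv B ** uinv A ** B ** A)"
      using low[OF L(1)] low[OF L(2)] by fastforce
    then show ?thesis
    proof
      assume "scalar_matrix (A ** B ** uinv A ** uinv B)"
      then obtain l where l: "cmod l = 1" "A ** B ** uinv A ** uinv B = mat l" by (auto simp: scalar_matrix_def)
      have "A ** B = A ** B ** uinv A ** uinv B ** (B ** A)"
        using uA by (simp add: un1_cancel uinv_left flip: matrix_mul_assoc)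
      then show ?thesis using l by auto
    next
      assume "scalar_matrix (uinv B ** uinv A ** B ** A)"
      then obtain l where l: "cmod l = 1" "uinv B ** uinv A ** B ** A = mat l" by (auto simp: scalar_matrix_def)
      have ll: "cnj l * l = 1" using l(1) by (metis complex_norm_square mult.commute of_real_1 power_one)
      have "B ** A = A ** B ** (uinv B ** uinv A ** B ** A)"
        using uA by (simp add: un1_cancel flip: matrix_mul_assoc)
      then have "B ** A = mat l ** (A ** B)" using l by (simp add: mat_commute)
      then have "mat (cnj l) ** (B ** A) = A ** B" by (simp add: matrix_mul_assoc mat_mult_mat ll)
      then show ?thesis using l(1) by (metis complex_mod_cnj)
    qed
  qed
  define D where "D A w = A \<bullet> adX w A" for A :: "complex ^ ('n option) ^ ('n option)" and w
  have Dlin: "linear (D A)" for A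
    unfolding D_def by (rule linearI) (simp_all add: adX_add adX_scaleR inner_add_right)
  have act0: "act B 0 \<in> cball_model" if "B \<in> M" for B by (rule act_in_ball[OF MinU[OF that] zero_in_ball])
  have Dle: "D A (act B 0) \<le> 0" if A: "A \<in> M" and B: "B \<in> M" for A B
  proof (cases "act B 0 = 0")
    case True
    then show ?thesis using Dlin by (simp add: linear_0)
  next
    case False
    let ?p = "act B 0"
    define u where "u = (1 / norm ?p) *\<^sub>R ?p"
    have u: "norm u = 1" using False by (simp add: u_def)
    obtain l where l: "cmod l = 1" "A ** B = mat l ** (B ** A)" using comm[OF A B] by blast
    obtain U d where Ud: "unitary U" "cmod d = 1" "B = Tm ?p ** blk U 0 0 d" using un1_polar[OF MinU[OF B]] by metis
    have E: "Em (2 * arcosh (gam ?p)) u = Tm ?p" "0 < 2 * arcosh (gam ?p)"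
      using Em_eq_Tm[OF act0[OF B] False] by (simp_all add: u_def)
    have "norm (conjE A u (2 * arcosh (gam ?p))) = norm A"
      unfolding conjE_def uinv_Em[symmetric] E(1)
      by (rule norm_conj_commute[OF _ _ Ud(3,1,2) act0[OF B] l(2,1)]) (use MinU A B in auto)
    from conjE_slope_le_0[OF u E(2) this] have "D A u \<le> 0" by (simp add: D_def)
    moreover have "D A ?p = norm ?p * D A u" using False linear_scale[OF Dlin, of A "norm ?p" u] by (simp add: u_def)
    ultimately show ?thesis by (simp add: mult_nonneg_nonpos)
  qed
  \<comment> \<open>The vectors q and \<open>?p\<close> have equal length, so the pairing of q -
    \<open>?p\<close> with \<open>?p\<close> is minus half the squared length of the difference. It
    is negative unless q = \<open>?p\<close>, and then the slope vanishes in every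
    direction.\<close>
  have Dself: "D A (act A 0) < 0 \<or> (\<forall>w. D A w = 0)" if A: "A \<in> M" for A
  proof -
    let ?p = "act A 0"
    obtain U d where Ud: "unitary U" "cmod d = 1" "A = Tm ?p ** blk U 0 0 d" using un1_polar[OF MinU[OF A]] by metis
    define q where "q = d *s (adj U *v ?p)"
    have Dq: "D A w = 2 * (gam ?p)\<^sup>2 * ((q - ?p) \<bullet> w)" for w
      unfolding D_def q_def by (rule inner_adX_polar[OF act0[OF A] Ud])
    have nq: "norm q = norm ?p" using Ud(1,2) by (simp add: q_def unitary_norm_vec unitary_adj)
    have "(norm (q - ?p))\<^sup>2 = - 2 * ((q - ?p) \<bullet> ?p)"
      using nq by (simp add: power2_norm_eq_inner inner_diff_left inner_diff_right inner_commute)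
        (metis power2_norm_eq_inner)
    moreover have "2 * (gam ?p)\<^sup>2 > 0" using gam(1)[OF act0[OF A]] by simp
    ultimately show ?thesis
    proof (cases "q = ?p")
      case False
      then have "(norm (q - ?p))\<^sup>2 > 0" by simp
      then have "(q - ?p) \<bullet> ?p < 0" using \<open>(norm (q - ?p))\<^sup>2 = _\<close> by simp
      then show ?thesis using \<open>2 * (gam ?p)\<^sup>2 > 0\<close> unfolding Dq by (simp add: mult_pos_neg)
    qed (simp add: Dq)
  qed
  \<comment> \<open>A direction away from all orbit points at once: every
    \<open>D A (act B 0)\<close> is at most 0, and for A in M1 the term B = A is negative.\<close>
  define v where "v = - (\<Sum>B\<in>M. act B 0)"
  define M1 where "M1 = {A \<in> M. D A (act A 0) < 0}"
  have Dv: "D A v > 0" if "A \<in> M1" for A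
  proof -
    have A: "A \<in> M" "D A (act A 0) < 0" using that by (auto simp: M1_def)
    have "D A v = - (\<Sum>B\<in>M. D A (act B 0))"
      by (simp add: v_def linear_neg[OF Dlin] linear_sum[OF Dlin])
    moreover have "(\<Sum>B\<in>M. D A (act B 0)) < (\<Sum>B\<in>M. 0)"
      by (rule sum_strict_mono_ex1) (use finM Dle A in auto)
    ultimately show ?thesis by simp
  qed
  \<comment> \<open>The directions with positive slopes form a nonempty open set, whereas the
    kernels of \<open>adX\<close> are negligible. Some w therefore increases the elements of M1 by
    its slope and the remaining ones, whose slope is identically zero, by strict convexity.\<close>
  define G where "G = (\<Inter>A\<in>M1. {w. 0 < D A w})"
  have "open {w. 0 < D A w}" for A
    by (intro open_Collect_less continuous_on_const linear_continuous_on)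
       (simp add: Dlin linear_conv_bounded_linear[symmetric])
  then have "open G" unfolding G_def using finM by (intro open_INT) (auto simp: M1_def)
  moreover have "v \<in> G" using Dv by (auto simp: G_def)
  ultimately have "\<not> negligible G" using open_not_negligible by blast
  moreover have "negligible (insert 0 (\<Union>A\<in>M. {w. adX w A = 0}))"
    using finM negligible_adX_kernel un MinL by (intro negligible_insert[THEN iffD2] negligible_Union) auto
  ultimately obtain w where w: "w \<in> G" "w \<noteq> 0" "\<And>A. A \<in> M \<Longrightarrow> adX w A \<noteq> 0"
    using negligible_subset[of _ G] by blast
  define u where "u = (1 / norm w) *\<^sub>R w"
  have u: "norm u = 1" using w by (simp add: u_def)
  have incr: "norm A < norm (conjE A u t)" if A: "A \<in> M" and t: "0 < t" for A t
  proof (rule conjE_increases[OF u _ _ t])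
    have "D A u = (1 / norm w) * D A w" by (simp add: u_def linear_scale[OF Dlin])
    moreover have "0 \<le> D A w"
      using Dself[OF A] w(1) A by (force simp: G_def M1_def)
    ultimately show "0 \<le> A \<bullet> adX u A" by (simp add: D_def)
    show "0 < A \<bullet> adX u A \<or> adX u A \<noteq> 0" using w(2) w(3)[OF A] by (simp add: u_def adX_scaleR)
  qed
  \<comment> \<open>Elements of M grow for every t > 0; the other representatives start strictly
    above m and stay there for small t by continuity.\<close>
  have "\<forall>B\<in>T. \<forall>\<^sub>F t in at_right 0. m < norm (conjE B u t - mat 1)"
  proof
    fix B assume B: "B \<in> T"
    show "\<forall>\<^sub>F t in at_right 0. m < norm (conjE B u t - mat 1)"
    proof (cases "B \<in> M")
      case True
      have "m < norm (conjE B u t - mat 1)" if t: "0 < t" for t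
      proof -
        have "(norm B)\<^sup>2 < (norm (conjE B u t))\<^sup>2" using incr[OF True t] by (simp add: power_strict_mono)
        then have "(norm (conjE B u 0 - mat 1))\<^sup>2 < (norm (conjE B u t - mat 1))\<^sup>2"
          unfolding norm_conjE_diff1[OF u] by (simp add: conjE_0)
        then have "norm (B - mat 1) < norm (conjE B u t - mat 1)"
          unfolding conjE_0 by (rule power2_less_imp_less) simp
        then show ?thesis using MinL[OF True] by simp
      qed
      then show ?thesis by (auto simp: eventually_at_right_field intro!: exI[of _ 1])
    next
      case False
      then have gt: "m < norm (B - mat 1)" using B low TL[OF B] by (force simp: M_def)
      have "isCont (conjE B u) 0" using conjE_derivative[OF u] by (rule has_vector_derivative_continuous)
      then have "((\<lambda>t. norm (conjE B u t - mat 1)) \<longlongrightarrow> norm (conjE B u 0 - mat 1)) (at 0)"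
        by (intro tendsto_intros) (simp add: isCont_def)
      then have "((\<lambda>t. norm (conjE B u t - mat 1)) \<longlongrightarrow> norm (B - mat 1)) (at_right 0)"
        unfolding conjE_0 by (rule tendsto_mono[OF at_le, rotated]) simp
      then show ?thesis using gt by (rule order_tendstoD)
    qed
  qed
  then have "\<forall>\<^sub>F t in at_right (0::real). \<forall>B\<in>T. m < norm (conjE B u t - mat 1)"
    using finT by (simp add: eventually_ball_finite)
  then obtain b where b: "b > 0" "\<And>t B. 0 < t \<Longrightarrow> t < b \<Longrightarrow> B \<in> T \<Longrightarrow> m < norm (conjE B u t - mat 1)"
    by (auto simp: eventually_at_right_field)
  define t where "t = min (b / 2) 1"
  have t: "0 < t" "t < b" "t \<le> 1" using b by (auto simp: t_def)
  show ?thesis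
  proof (intro exI[of _ "Em t u"] conjI ballI impI)
    show "un1 (Em t u)" by (rule un1_Em[OF u])
    fix A assume A: "A \<in> \<Lambda>" "\<not> scalar_matrix A"
    have "m < norm (conjE A u t - mat 1)"
    proof (cases "norm A \<le> R")
      case True
      obtain B d where B: "B \<in> T" "cmod d = 1" "A = mat d ** B" "Re (trace A) \<le> Re (trace B)"
        using cover[OF A(1) True A(2)] by blast
      have "conjE A u t = mat d ** conjE B u t"
        unfolding conjE_def B(3) by (metis mat_commute matrix_mul_assoc)
      then have "norm (conjE A u t) = norm (conjE B u t)" by (simp add: norm_mat_mult B(2))
      then have "(norm (conjE B u t - mat 1))\<^sup>2 \<le> (norm (conjE A u t - mat 1))\<^sup>2"
        unfolding norm_conjE_diff1[OF u] using B(4) by simp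
      then have "norm (conjE B u t - mat 1) \<le> norm (conjE A u t - mat 1)" by (rule power2_le_imp_le) simp
      then show ?thesis using b(2)[OF t(1,2) B(1)] by simp
    next
      case False
      have nE: "norm (Em s u) \<le> C" if "\<bar>s\<bar> \<le> 1" for s
      proof -
        have "cosh (s / 2) = cosh \<bar>s / 2\<bar>" unfolding abs_if by (simp only: cosh_minus if_cancel split: if_split) simp
        moreover have "cosh \<bar>s / 2\<bar> \<le> cosh (1 / 2)"
          using cosh_real_nonneg_le_iff[of "\<bar>s / 2\<bar>" "1 / 2"] that by linarith
        ultimately have "cosh (s / 2) \<le> cosh (1 / 2)" by (simp only:)
        then have "(cosh (s / 2))\<^sup>2 \<le> (cosh (1 / 2 :: real))\<^sup>2" by (intro power_mono) auto
        moreover have "(norm (Em s u))\<^sup>2 = real CARD('n) - 3 + 4 * (cosh (s / 2))\<^sup>2"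
          using un1_norm[OF un1_Em[OF u], of s] by (simp add: Em_bo bo_def)
        ultimately show ?thesis unfolding C_def by (intro real_le_rsqrt) simp
      qed
      have C0: "C \<ge> 0" using nE[of 0] norm_ge_zero[of "Em 0 u"] by linarith
      show ?thesis
      proof (rule ccontr)
        assume "\<not> ?thesis"
        then have "norm (conjE A u t - mat 1) \<le> m" by simp
        then have k: "norm (conjE A u t) \<le> m + norm (mat 1 :: complex ^ ('n option) ^ ('n option))"
          using norm_triangle_ineq[of "conjE A u t - mat 1" "mat 1"] by simp
        have "Em t u ** Em (- t) u = mat 1" using uinv_right[OF un1_Em[OF u], of t] by (simp only: uinv_Em)
        moreover have "Em t u ** conjE A u t ** Em (- t) u = (Em t u ** Em (- t) u) ** A ** (Em t u ** Em (- t) u)"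
          by (simp only: conjE_def matrix_mul_assoc)
        ultimately have "A = Em t u ** conjE A u t ** Em (- t) u" by (simp only: matrix_mul_lid matrix_mul_rid)
        then have "norm A = norm (Em t u ** conjE A u t ** Em (- t) u)" by (rule arg_cong)
        also have "\<dots> \<le> norm (Em t u) * norm (conjE A u t) * norm (Em (- t) u)"
          by (rule order_trans[OF norm_matrix_mult mult_right_mono[OF norm_matrix_mult norm_ge_zero]])
        also have "\<dots> \<le> C * (m + norm (mat 1 :: complex ^ ('n option) ^ ('n option))) * C"
          using k nE[of t] nE[of "- t"] t C0 m by (intro mult_mono) auto
        finally show False using False by (simp add: R_def)
      qed
    qed
    then show "m < norm (uinv (Em t u) ** A ** Em t u - mat 1)" by (simp add: conjE_def uinv_Em)
  qed
qed

section \<open>Packing\<close>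

lemma sqrt_one_plus_bounds:
  fixes h :: real
  assumes "0 \<le> h" "h \<le> 1"
  shows "1 + h / 2 - h\<^sup>2 / 8 \<le> sqrt (1 + h)" "sqrt (1 + h) \<le> 1 + h / 2"
proof -
  have "h\<^sup>2 \<le> h" using assms by (simp add: power2_eq_square mult_left_le)
  have "(1 + h / 2 - h\<^sup>2 / 8)\<^sup>2 = 1 + h - h\<^sup>2 * h * (8 - h) / 64"
    by (simp add: power2_eq_square field_simps)
  also have "\<dots> \<le> 1 + h" using assms by simp
  finally show "1 + h / 2 - h\<^sup>2 / 8 \<le> sqrt (1 + h)" by (rule real_le_rsqrt)
  show "sqrt (1 + h) \<le> 1 + h / 2"
    by (rule real_le_lsqrt) (use assms in \<open>auto simp: power2_eq_square algebra_simps\<close>)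
qed

text \<open>Monotonicity of suitable groups of terms allows \<sigma> to be replaced by h and g, g'
  by G = sqrt (1 + h). The coefficient 17 is 16 from 4 (1 + 2 h)^2 plus 1 from the quadratic error
  in the bound of -8 G.\<close>

lemma boost_twist_polynomial:
  fixes g g' \<sigma> h X :: real
  assumes g: "1 \<le> g" "g\<^sup>2 \<le> 1 + h" "1 \<le> g'" "g'\<^sup>2 \<le> 1 + h" and s: "0 \<le> \<sigma>" "\<sigma> \<le> h"
    and h: "0 \<le> h" "h \<le> 1" and X: "0 \<le> X"
  shows "4 * (g * g' + \<sigma>)\<^sup>2 - 4 * \<sigma> + 4 - 4 * g - 4 * g' + 2 * X * \<sigma> + X\<^sup>2 * (g + g' - 1)
    \<le> 8 * h + 17 * h\<^sup>2 + 2 * h * X + X\<^sup>2 * (1 + h)"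
proof -
  define G where "G = sqrt (1 + h)"
  have G2: "G\<^sup>2 = 1 + h" using h by (simp add: G_def)
  have gG: "g \<le> G" "g' \<le> G" unfolding G_def using g by (simp_all add: real_le_rsqrt)
  have Gb: "1 + h / 2 - h\<^sup>2 / 8 \<le> G" "G \<le> 1 + h / 2" unfolding G_def by (rule sqrt_one_plus_bounds[OF h])+
  have G1: "1 \<le> G" using gG g by simp
  have gg: "1 \<le> g * g'" "1 \<le> G * g'" using g G1 mult_mono[of 1 g 1 g'] mult_mono[of 1 G 1 g'] by auto
  have 1: "4 * (g * g' + \<sigma>)\<^sup>2 - 4 * \<sigma> \<le> 4 * (g * g' + h)\<^sup>2 - 4 * h"
  proof -
    have "0 \<le> (h - \<sigma>) * (8 * (g * g') + 4 * (h + \<sigma>) - 4)" using s gg h by (intro mult_nonneg_nonneg) auto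
    then show ?thesis by (simp add: power2_eq_square algebra_simps)
  qed
  have mono: "4 * (x * y + h)\<^sup>2 - 4 * x \<le> 4 * (G * y + h)\<^sup>2 - 4 * G" if "1 \<le> x" "x \<le> G" "1 \<le> y" for x y
  proof -
    have "1 \<le> y * (G * y + x * y + 2 * h)"
    proof -
      have "1 \<le> G * y" using mult_mono[of 1 G 1 y] that G1 by auto
      moreover have "0 \<le> x * y" using that by simp
      ultimately have "1 \<le> G * y + x * y + 2 * h" using h by linarith
      then have "1 * 1 \<le> y * (G * y + x * y + 2 * h)" using that h by (intro mult_mono) auto
      then show ?thesis by simp
    qed
    then have "0 \<le> 4 * (G - x) * (y * (G * y + x * y + 2 * h) - 1)" using that by (intro mult_nonneg_nonneg) auto
    then show ?thesis by (simp add: power2_eq_square algebra_simps)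
  qed
  have 2: "4 * (g * g' + h)\<^sup>2 - 4 * g - 4 * g' \<le> 4 * (G * G + h)\<^sup>2 - 8 * G"
    using mono[of g g'] mono[of g' G] g gG G1 by (simp add: mult.commute)
  have GG: "G * G = 1 + h" using G2 by (simp add: power2_eq_square)
  have 3: "X\<^sup>2 * (g + g' - 1) \<le> X\<^sup>2 * (1 + h)" using gG Gb by (intro mult_left_mono) auto
  have 4: "2 * X * \<sigma> \<le> 2 * h * X" using mult_left_mono[OF s(2) X] by (simp add: mult.commute)
  have "4 * (G * G + h)\<^sup>2 - 8 * G - 4 * h + 4 \<le> 8 * h + 17 * h\<^sup>2"
    unfolding GG using Gb(1) by (simp add: power2_eq_square algebra_simps)
  then show ?thesis using 1 2 3 4 by linarith
qed

text \<open>Products are abstracted to variables, because the last step of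
  \<open>boost_twist_norm\<close> is linear in them.\<close>

lemma boost_twist_arith:
  fixes N :: real
  assumes "N - X2 / 2 \<le> tV" "g - 1 - gX / 2 + X2 / 2 \<le> B" "g' - 1 - g'X / 2 + X2 / 2 \<le> B'" "Pz \<le> PY + Xs"
    "PY2 \<le> s2" "- K \<le> P - g - g' + 1" "4 * PY - 8 * PPY \<le> 8 * Ps - 4 * s"
  shows "2 * N - 2 + 4 * (P2 - 2 * PPY + PY2) - 2 * (tV + B' + B + K - Pz + (P - PY))
    \<le> 4 * P2 + 8 * Ps + 4 * s2 - 4 * s + 4 - 4 * g - 4 * g' + 2 * Xs + (gX + g'X - X2)"
  using assms by argo

lemma matrix_vec_scaleR_right: "A *v (r *\<^sub>R x) = r *\<^sub>R (A *v x)" for A :: "complex ^ 'n ^ 'm"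
  by (simp add: of_real_vec_scale[symmetric] vector_scalar_commute)

lemma matrix_vec_minus: "A *v (- x) = - (A *v x)" for A :: "complex ^ 'n ^ 'm"
  by (rule linear_neg[OF matrix_vector_mul_linear])

text \<open>The matrix is the quotient of two group elements applied to one base point: p and p' are
  the images of that point and V is the quotient of the rotational parts. Its distance to the
  identity is determined by corner entry and trace, both computed from the blocks. To leading order
  the displacement contributes 8 h and the rotation X^2.\<close>

lemma boost_twist_norm:
  fixes p p' :: "complex ^ 'n" and V :: "complex ^ 'n ^ 'n"
  assumes p: "p \<in> cball_model" "p' \<in> cball_model" and V: "unitary V" and X: "norm (V - mat 1) \<le> X"
    and h: "(gam p)\<^sup>2 \<le> 1 + h" "(gam p')\<^sup>2 \<le> 1 + h" "h \<le> 1"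
  shows "(norm (Tm p' ** blk V 0 0 1 ** uinv (Tm p) - mat 1))\<^sup>2 \<le> 8 * h + 17 * h\<^sup>2 + 2 * h * X + X\<^sup>2 * (1 + h)"
proof -
  define C where "C = Tm p' ** blk V 0 0 1 ** uinv (Tm p)"
  define g g' where "g = gam p" and "g' = gam p'"
  define k k' where "k = g\<^sup>2 / (1 + g)" and "k' = g'\<^sup>2 / (1 + g')"
  define y z where "y = herm (V *v p) p'" and "z = herm p' p"
  define a a' where "a = norm p" and "a' = norm p'"
  have X0: "0 \<le> X" using X norm_ge_zero order_trans by blast
  have g1: "1 \<le> g" "1 \<le> g'" using gam(1) p by (auto simp: g_def g'_def)
  have k0: "0 \<le> k" "0 \<le> k'" using g1 by (auto simp: k_def k'_def)
  have ka: "k * a\<^sup>2 = g - 1" "k' * a'\<^sup>2 = g' - 1"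
    using Tm_coeffs(1)[OF p(1)] Tm_coeffs(1)[OF p(2)] by (simp_all add: k_def k'_def g_def g'_def a_def a'_def)
  have ga: "g\<^sup>2 * a\<^sup>2 = g\<^sup>2 - 1" "g'\<^sup>2 * a'\<^sup>2 = g'\<^sup>2 - 1"
    using gam(4)[OF p(1)] gam(4)[OF p(2)] by (simp_all add: g_def g'_def a_def a'_def)
  have a0: "0 \<le> a" "0 \<le> a'" by (auto simp: a_def a'_def)
  have unC: "un1 C" unfolding C_def
    by (intro un1_mult un1_Tm un1_uinv un1_blk_unitary p V) simp
  let ?D = "mat 1 + k *\<^sub>R outer p p" and ?D' = "mat 1 + k' *\<^sub>R outer p' p'"
  have uT: "uinv (Tm p) = blk ?D (- (g *\<^sub>R p)) (- (g *\<^sub>R p)) (of_real g)"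
    unfolding Tm_def uinv_bo unfolding bo_def g_def k_def by simp
  have T': "Tm p' = blk ?D' (g' *\<^sub>R p') (g' *\<^sub>R p') (of_real g')"
    unfolding Tm_def bo_def g'_def k'_def by simp
  have Cb: "C = blk (?D' ** V ** ?D + outer (g' *\<^sub>R p') (- (g *\<^sub>R p))) (?D' ** V *v (- (g *\<^sub>R p)) + of_real g *s (g' *\<^sub>R p'))
      (adj ?D *v (adj V *v (g' *\<^sub>R p')) + of_real g' *s (- (g *\<^sub>R p))) (herm (- (g *\<^sub>R p)) (adj V *v (g' *\<^sub>R p')) + of_real g' * of_real g)"
    unfolding C_def T' uT blk_mult by (simp add: outer_simps)
  have hpy: "herm (- (g *\<^sub>R p)) (adj V *v (g' *\<^sub>R p')) = - of_real (g * g') * y"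
    by (simp add: y_def herm_mult_right herm_simps matrix_vec_scaleR_right matrix_vec_minus)
  have C00: "C $ None $ None = of_real (g * g') * (1 - y)"
    by (subst Cb) (simp add: hpy algebra_simps)
  have trD: "trace (?D' ** V ** ?D) = trace V + of_real k' * herm (V *v p') p' + of_real k * herm (V *v p) p
      + of_real (k * k') * (y * z)"
  proof -
    have sc: "trace (r *\<^sub>R B) = of_real r * trace B" for r and B :: "complex ^ 'n ^ 'n"
      unfolding trace_def vector_scaleR_component sum_distrib_left by (simp add: scaleR_conv_of_real)
    have "trace (outer p' p' ** V ** outer p p) = y * z"
      unfolding mult_outer trace_outer by (simp add: matrix_vector_mult_assoc' outer_mult_vec herm_scale_left y_def z_def)
    then show ?thesis
      by (simp add: matrix_mult_add_left matrix_add_ldistrib matrix_scaleR_left matrix_scaleR_right trace_add sc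
          trace_mult_outer trace_outer_mult algebra_simps)
  qed
  have trC: "trace C = trace (?D' ** V ** ?D) - of_real (g * g') * z + of_real (g * g') * (1 - y)"
    using C00 by (subst Cb, subst (asm) Cb) (simp add: trace_blk trace_add trace_outer herm_simps z_def algebra_simps)
  have near: "Re (herm (V *v x) x) \<ge> (norm x)\<^sup>2 * (1 - X\<^sup>2 / 2)" for x
  proof -
    have "V *v x - x = (V - mat 1) *v x" by (simp add: matrix_vector_mult_diff_rdistrib)
    then have "norm (V *v x - x) \<le> X * norm x"
      using norm_matrix_vector[of "V - mat 1" x] mult_right_mono[OF X norm_ge_zero[of x]] by simp
    then have "(norm (V *v x - x))\<^sup>2 \<le> (X * norm x)\<^sup>2" by (rule power_mono) simp
    moreover have "(norm (V *v x - x))\<^sup>2 = 2 * (norm x)\<^sup>2 - 2 * Re (herm (V *v x) x)"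
      using unitary_norm_vec[OF V, of x]
      by (simp add: power2_norm_eq_inner inner_diff_left inner_diff_right inner_commute flip: inner_eq_Re_herm)
        (metis power2_norm_eq_inner)
    ultimately show ?thesis by (simp add: power_mult_distrib algebra_simps)
  qed
  have yz: "Re z - Re y \<le> X * (a * a')"
  proof -
    have "Re z = Re (herm p p')" by (metis cnj.simps(1) herm_commute z_def)
    then have "Re z - Re y = - Re (herm ((V - mat 1) *v p) p')"
      by (simp add: y_def matrix_vector_mult_diff_rdistrib herm_simps)
    also have "\<dots> \<le> cmod (herm ((V - mat 1) *v p) p')" using abs_Re_le_cmod[of "herm ((V - mat 1) *v p) p'"] by linarith
    also have "\<dots> \<le> norm ((V - mat 1) *v p) * norm p'" by (rule herm_cauchy)
    also have "\<dots> \<le> (X * norm p) * norm p'"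
      using norm_matrix_vector[of "V - mat 1" p] mult_right_mono[OF X norm_ge_zero[of p]] by (intro mult_right_mono) auto
    finally show ?thesis by (simp add: a_def a'_def mult.assoc)
  qed
  have yb: "cmod y \<le> a * a'" "cmod z \<le> a * a'"
    using herm_cauchy[of "V *v p" p'] herm_cauchy[of p' p] unitary_norm_vec[OF V, of p]
    by (simp_all add: y_def z_def a_def a'_def mult.commute)
  \<comment> \<open>The product of the hyperbolic sines of half the distances of p and p' from 0. It
    controls the terms g g' Re y and (g g')^2 |y|^2 and is itself at most h.\<close>
  define \<sigma> where "\<sigma> = g * g' * (a * a')"
  have s0: "0 \<le> \<sigma>" using g1 a0 by (simp add: \<sigma>_def)
  have h0: "0 \<le> h" using h(1) one_le_power[OF g1(1), of 2] by (simp add: g_def)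
  have "\<sigma>\<^sup>2 = (g\<^sup>2 * a\<^sup>2) * (g'\<^sup>2 * a'\<^sup>2)" by (simp add: \<sigma>_def power_mult_distrib)
  also have "\<dots> \<le> h * h" unfolding ga using h h0 one_le_power[OF g1(2), of 2] by (intro mult_mono) (auto simp: g_def g'_def)
  finally have "\<sigma>\<^sup>2 \<le> h\<^sup>2" by (simp add: power2_eq_square)
  then have sh: "\<sigma> \<le> h" using h0 by (rule power2_le_imp_le)
  have "(norm (C - mat 1))\<^sup>2 = 2 * real CARD('n) - 2 + 4 * (cmod (C $ None $ None))\<^sup>2 - 2 * Re (trace C)"
    using norm_diff_mat1[of C] un1_norm[OF unC] by simp
  also have "(cmod (C $ None $ None))\<^sup>2 = (g * g')\<^sup>2 * (1 - 2 * Re y + (cmod y)\<^sup>2)"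
  proof -
    have "(cmod (1 - y))\<^sup>2 = 1 - 2 * Re y + (cmod y)\<^sup>2"
      unfolding cmod_power2 by (simp add: power2_eq_square algebra_simps)
    then show ?thesis unfolding C00 norm_mult[of "of_real _"] norm_of_real
      by (simp only: power_mult_distrib[of "\<bar>g * g'\<bar>"] power2_abs)
  qed
  also have "Re (trace C) = Re (trace V) + k' * Re (herm (V *v p') p') + k * Re (herm (V *v p) p)
      + k * k' * Re (y * z) - g * g' * Re z + g * g' * (1 - Re y)"
    unfolding trC trD by simp
  finally have eq: "(norm (C - mat 1))\<^sup>2 = 2 * real CARD('n) - 2 + 4 * ((g * g')\<^sup>2 * (1 - 2 * Re y + (cmod y)\<^sup>2))
    - 2 * (Re (trace V) + k' * Re (herm (V *v p') p') + k * Re (herm (V *v p) p)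
      + k * k' * Re (y * z) - g * g' * Re z + g * g' * (1 - Re y))" .
  have b1: "Re (trace V) \<ge> real CARD('n) - X\<^sup>2 / 2"
  proof -
    have "(norm (V - mat 1))\<^sup>2 \<le> X\<^sup>2" using X by (rule power_mono) simp
    moreover have "(norm V)\<^sup>2 = real CARD('n)"
      using unitary_norm_left[OF V, of "mat 1"] by (simp add: power2_norm_eq_inner matrix_inner trace_mat)
    ultimately show ?thesis using norm_diff_mat1[of V] by simp
  qed
  have b2: "k * Re (herm (V *v p) p) \<ge> (g - 1) * (1 - X\<^sup>2 / 2)" "k' * Re (herm (V *v p') p') \<ge> (g' - 1) * (1 - X\<^sup>2 / 2)"
    using mult_left_mono[OF near[of p] k0(1)] mult_left_mono[OF near[of p'] k0(2)] unfolding ka[symmetric] a_def a'_def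
    by (simp_all only: mult.assoc)
  have b3: "g * g' * Re z \<le> g * g' * Re y + X * \<sigma>"
  proof -
    have "g * g' * (Re z - Re y) \<le> g * g' * (X * (a * a'))" using yz g1 by (intro mult_left_mono) auto
    then show ?thesis by (simp add: \<sigma>_def algebra_simps)
  qed
  have b4: "(g * g')\<^sup>2 * (cmod y)\<^sup>2 \<le> \<sigma>\<^sup>2"
    unfolding \<sigma>_def power_mult_distrib[of "g * g'"] using yb a0 by (intro mult_left_mono power_mono) auto
  have b5: "- (k * k' * Re (y * z)) \<le> (g - 1) * (g' - 1)"
  proof -
    have "- Re (y * z) \<le> cmod y * cmod z" using abs_Re_le_cmod[of "y * z"] by (simp add: norm_mult)
    also have "\<dots> \<le> (a * a') * (a * a')" using yb a0 by (intro mult_mono) auto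
    finally have "k * k' * (- Re (y * z)) \<le> k * k' * ((a * a') * (a * a'))" using k0 by (intro mult_left_mono) auto
    also have "\<dots> = (k * a\<^sup>2) * (k' * a'\<^sup>2)" by (simp add: power2_eq_square)
    finally show ?thesis unfolding ka by (simp only: mult_minus_right)
  qed
  have b6: "- (g * g' * Re y) \<le> \<sigma>"
  proof -
    have "- Re y \<le> a * a'" using abs_Re_le_cmod[of y] yb(1) by linarith
    then have "g * g' * (- Re y) \<le> g * g' * (a * a')" using g1 by (intro mult_left_mono) auto
    then show ?thesis unfolding \<sigma>_def by (simp only: mult_minus_right)
  qed
  define P Y where "P = g * g'" and "Y = Re y"
  have "1 \<le> P" using mult_mono[of 1 g 1 g'] g1 by (simp add: P_def)
  then have "0 \<le> 8 * P - 4" by linarith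
  then have b7: "(8 * P - 4) * (- (P * Y)) \<le> (8 * P - 4) * \<sigma>"
    using b6 unfolding P_def Y_def by (intro mult_left_mono)
  have e1: "P\<^sup>2 * (1 - 2 * Y + (cmod y)\<^sup>2) = P\<^sup>2 - 2 * (P * (P * Y)) + P\<^sup>2 * (cmod y)\<^sup>2"
    and e2: "(8 * P - 4) * (- (P * Y)) = 4 * (P * Y) - 8 * (P * (P * Y))" and e3: "(8 * P - 4) * \<sigma> = 8 * (P * \<sigma>) - 4 * \<sigma>"
    and e4: "4 * (P + \<sigma>)\<^sup>2 = 4 * P\<^sup>2 + 8 * (P * \<sigma>) + 4 * \<sigma>\<^sup>2"
    and e5: "(g - 1) * (1 - X\<^sup>2 / 2) = g - 1 - (g * X\<^sup>2) / 2 + X\<^sup>2 / 2" "(g' - 1) * (1 - X\<^sup>2 / 2) = g' - 1 - (g' * X\<^sup>2) / 2 + X\<^sup>2 / 2"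
    and e6: "X\<^sup>2 * (g + g' - 1) = g * X\<^sup>2 + g' * X\<^sup>2 - X\<^sup>2" and e7: "2 * X * \<sigma> = 2 * (X * \<sigma>)"
    and e9: "P * (1 - Y) = P - P * Y"
    by (simp_all add: power2_eq_square field_simps)
  have e8: "(g - 1) * (g' - 1) = P - g - g' + 1" by (simp add: P_def algebra_simps)
  have "(norm (C - mat 1))\<^sup>2 \<le> 4 * (g * g' + \<sigma>)\<^sup>2 - 4 * \<sigma> + 4 - 4 * g - 4 * g' + 2 * X * \<sigma> + X\<^sup>2 * (g + g' - 1)"
    unfolding eq P_def[symmetric] Y_def[symmetric] e1 e4 e6 e7 e9
    by (rule boost_twist_arith[OF b1 b2(1)[unfolded e5] b2(2)[unfolded e5] b3[folded P_def Y_def] b4[folded P_def]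
        b5[unfolded e8] b7[unfolded e2 e3]])
  also have "\<dots> \<le> 8 * h + 17 * h\<^sup>2 + 2 * h * X + X\<^sup>2 * (1 + h)"
    by (rule boost_twist_polynomial) (use g1 h s0 sh h0 X0 in \<open>auto simp: g_def g'_def\<close>)
  finally show ?thesis by (simp add: C_def)
qed

text \<open>The volume of a ball of radius t in complex dimension j, divided by that of the shell of
  radii 1 - t and 1 + t; this shell contains every ball of radius t centred on the unit
  sphere.\<close>

definition cap_ratio :: "nat \<Rightarrow> real \<Rightarrow> real" where
  "cap_ratio j t = t ^ (2 * j) / ((1 + t) ^ (2 * j) - (1 - t) ^ (2 * j))"

section \<open>Lebesgue measure of cylinders and a pigeonhole principle on spheres\<close>

definition coord_proj :: "'n set \<Rightarrow> complex ^ 'n \<Rightarrow> complex ^ 'n" where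
  "coord_proj I x = (\<chi> i. if i \<in> I then x $ i else 0)"

definition cylinder :: "'n set \<Rightarrow> complex ^ 'n \<Rightarrow> real \<Rightarrow> (complex ^ 'n) set" where
  "cylinder I v r = {x. norm (coord_proj I x - v) < r \<and> (\<forall>i. i \<notin> I \<longrightarrow> cmod (x $ i) < 1)}"

lemma linear_coord_proj: "linear (coord_proj I)"
  by (rule linearI) (simp_all add: coord_proj_def vec_eq_iff)

lemma coord_proj_id: "(\<And>i. i \<notin> I \<Longrightarrow> v $ i = 0) \<Longrightarrow> coord_proj I v = v"
  by (auto simp: coord_proj_def vec_eq_iff)

lemma open_cylinder: "open (cylinder I v r)"
proof -
  have "open {x. norm (coord_proj I x - v) < r}"
    by (intro open_Collect_less continuous_intros linear_continuous_on)
       (simp add: linear_coord_proj linear_conv_bounded_linear[symmetric])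
  moreover have "open {x :: complex ^ 'a. cmod (x $ i) < 1}" for i
    by (intro open_Collect_less continuous_intros)
  then have "open (\<Inter>i\<in>-I. {x :: complex ^ 'a. cmod (x $ i) < 1})" by (intro open_INT) auto
  moreover have "cylinder I v r = {x. norm (coord_proj I x - v) < r} \<inter> (\<Inter>i\<in>-I. {x. cmod (x $ i) < 1})"
    by (auto simp: cylinder_def)
  ultimately show ?thesis by (simp add: open_Int)
qed

lemma sets_cylinder [measurable]: "cylinder I v r \<in> sets borel"
  by (simp add: open_cylinder)

lemma emeasure_cylinder_translate:
  assumes "\<And>i. i \<notin> I \<Longrightarrow> v $ i = 0"
  shows "emeasure lborel (cylinder I v r) = emeasure lborel (cylinder I 0 r)"
proof -
  have eq: "(+) v -` cylinder I v r = cylinder I 0 r"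
    using assms by (auto simp: cylinder_def linear_add[OF linear_coord_proj] coord_proj_id)
  have "emeasure lborel (cylinder I v r) = emeasure (distr lborel borel ((+) v)) (cylinder I v r)"
    by (simp only: lborel_distr_plus)
  also have "\<dots> = emeasure lborel (cylinder I 0 r)"
    by (subst emeasure_distr) (auto simp: eq)
  finally show ?thesis .
qed

text \<open>Only the coordinates in I are rescaled, and each complex coordinate is two real ones;
  this gives the exponent 2 |I| in the affine change of Lebesgue measure.\<close>

lemma emeasure_cylinder_scale:
  assumes r: "0 < r"
  shows "emeasure lborel (cylinder I 0 r) = ennreal (r ^ (2 * card I)) * emeasure lborel (cylinder I 0 1 :: (complex ^ 'n) set)"
proof -
  define c :: "complex ^ 'n \<Rightarrow> real" where "c b = (if \<exists>i\<in>I. b $ i \<noteq> 0 then r else 1)" for b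
  define T :: "complex ^ 'n \<Rightarrow> complex ^ 'n" where "T x = 0 + (\<Sum>j\<in>Basis. (c j * (x \<bullet> j)) *\<^sub>R j)" for x
  have T: "T x = (\<chi> i. if i \<in> I then r *\<^sub>R x $ i else x $ i)" for x
  proof (rule euclidean_eqI)
    fix b :: "complex ^ 'n" assume b: "b \<in> Basis"
    then obtain i u where iu: "b = axis i u" "u \<in> Basis" by (auto simp: Basis_vec_def)
    have "u \<noteq> 0" using iu(2) by auto
    have "T x \<bullet> b = c b * (x \<bullet> b)"
      using b by (simp add: T_def inner_sum_left inner_Basis if_distrib cong: if_cong)
    also have "c b = (if i \<in> I then r else 1)"
      using \<open>u \<noteq> 0\<close> by (auto simp: c_def iu axis_def)
    finally show "T x \<bullet> b = (\<chi> i. if i \<in> I then r *\<^sub>R x $ i else x $ i) \<bullet> b"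
      by (simp add: iu inner_axis)
  qed
  have card: "card {b \<in> Basis :: (complex ^ 'n) set. \<exists>i\<in>I. b $ i \<noteq> 0} = 2 * card I"
  proof -
    have "{b \<in> Basis :: (complex ^ 'n) set. \<exists>i\<in>I. b $ i \<noteq> 0} = (\<lambda>(i, u). axis i u) ` (I \<times> (Basis :: complex set))"
    proof (intro equalityI subsetI)
      fix b :: "complex ^ 'n" assume "b \<in> {b \<in> Basis. \<exists>i\<in>I. b $ i \<noteq> 0}"
      then obtain i u l where "b = axis i u" "u \<in> Basis" "l \<in> I" "b $ l \<noteq> 0" by (auto simp: Basis_vec_def)
      then show "b \<in> (\<lambda>(i, u). axis i u) ` (I \<times> Basis)" by (auto simp: axis_def split: if_splits)
    next
      fix b :: "complex ^ 'n" assume "b \<in> (\<lambda>(i, u). axis i u) ` (I \<times> Basis)"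
      then obtain i u where "b = axis i u" "u \<in> Basis" "i \<in> I" by auto
      then show "b \<in> {b \<in> Basis. \<exists>i\<in>I. b $ i \<noteq> 0}" by (auto simp: Basis_vec_def axis_def)
    qed
    moreover have "inj_on (\<lambda>(i, u). axis i u :: complex ^ 'n) (I \<times> (Basis :: complex set))"
      by (auto simp: inj_on_def axis_eq_axis)
    ultimately show ?thesis by (simp add: card_image card_cartesian_product)
  qed
  have prodc: "(\<Prod>b\<in>Basis. \<bar>c b\<bar>) = r ^ (2 * card I)"
  proof -
    have "(\<Prod>b\<in>Basis. \<bar>c b\<bar>) = (\<Prod>b\<in>(Basis :: (complex ^ 'n) set). if \<exists>i\<in>I. b $ i \<noteq> 0 then r else 1)"
      using r by (intro prod.cong) (auto simp: c_def)
    also have "\<dots> = r ^ card {b \<in> Basis :: (complex ^ 'n) set. \<exists>i\<in>I. b $ i \<noteq> 0}"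
      by (subst prod.If_cases) (auto simp: Int_def intro: arg_cong2[of _ _ _ _ "(^)"])
    finally show ?thesis by (simp only: card)
  qed
  have Tm: "T \<in> borel_measurable borel" unfolding T_def by measurable
  have "coord_proj I (T x) = r *\<^sub>R coord_proj I x" for x by (simp add: T coord_proj_def vec_eq_iff)
  then have vim: "T -` cylinder I 0 r = cylinder I 0 1"
    using r by (auto simp: cylinder_def T)
  have lb: "lborel = density (distr lborel borel T) (\<lambda>_. ennreal (\<Prod>b\<in>Basis. \<bar>c b\<bar>))"
    unfolding T_def by (rule lborel_affine_euclidean) (use r in \<open>auto simp: c_def\<close>)
  have "emeasure lborel (cylinder I 0 r) = emeasure (density (distr lborel borel T) (\<lambda>_. ennreal (\<Prod>b\<in>Basis. \<bar>c b\<bar>))) (cylinder I 0 r)"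
    using lb by (rule arg_cong)
  also have "\<dots> = ennreal (\<Prod>b\<in>Basis. \<bar>c b\<bar>) * emeasure (distr lborel borel T) (cylinder I 0 r)"
    by (subst emeasure_density_const) auto
  also have "emeasure (distr lborel borel T) (cylinder I 0 r) = emeasure lborel (cylinder I 0 1)"
    using Tm by (subst emeasure_distr) (auto simp: vim)
  finally show ?thesis unfolding prodc .
qed

lemma cylinder_unit_measure: "0 < emeasure lborel (cylinder I 0 1)" "emeasure lborel (cylinder I 0 1) < \<infinity>"
proof -
  have "0 \<in> cylinder I 0 1" by (simp add: cylinder_def linear_0[OF linear_coord_proj])
  then have "\<not> negligible (cylinder I 0 1)" using open_not_negligible[OF open_cylinder] by blast
  then have "emeasure lborel (cylinder I 0 1) \<noteq> 0"
    by (auto simp: negligible_iff_null_sets null_sets_def)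
  then show "0 < emeasure lborel (cylinder I 0 1)" by (simp add: zero_less_iff_neq_zero)
  have "bounded (cylinder I 0 1)"
  proof (rule boundedI)
    fix x :: "complex ^ 'a" assume x: "x \<in> cylinder I 0 1"
    have "cmod (x $ i) \<le> 1" for i
    proof (cases "i \<in> I")
      case True
      have "cmod (x $ i) = cmod (coord_proj I x $ i)" using True by (simp add: coord_proj_def)
      also have "\<dots> \<le> norm (coord_proj I x)" by (rule Finite_Cartesian_Product.norm_nth_le)
      finally show ?thesis using x by (simp add: cylinder_def)
    qed (use x in \<open>auto simp: cylinder_def intro: less_imp_le\<close>)
    then show "norm x \<le> (\<Sum>i\<in>(UNIV :: 'a set). 1)"
      unfolding norm_vec_def by (intro order_trans[OF L2_set_le_sum] sum_mono) auto
  qed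
  then show "emeasure lborel (cylinder I 0 1) < \<infinity>" by (rule emeasure_bounded_finite)
qed

text \<open>Averaging over a spherical shell of \<open>\<complex>\<^sup>I\<close>; the unit box in the other coordinates only serves to
  measure subsets of \<open>\<complex>\<^sup>I\<close> by Lebesgue measure on the whole space.\<close>

lemma sphere_pigeonhole:
  fixes v :: "'k \<Rightarrow> complex ^ 'n"
  assumes K: "finite K" and v: "\<And>k. k \<in> K \<Longrightarrow> norm (v k) = 1" "\<And>k i. k \<in> K \<Longrightarrow> i \<notin> I \<Longrightarrow> v k $ i = 0"
    and I: "I \<noteq> {}" and t: "0 < t" "t < 1"
  shows "\<exists>c. (\<forall>i. i \<notin> I \<longrightarrow> c $ i = 0) \<and> real (card K) * cap_ratio (card I) t \<le> real (card {k \<in> K. norm (v k - c) < t})"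
proof -
  let ?j = "card I"
  define M where "M = measure lborel (cylinder I 0 1 :: (complex ^ 'n) set)"
  have eM: "emeasure lborel (cylinder I 0 1 :: (complex ^ 'n) set) = ennreal M"
    unfolding M_def by (rule emeasure_eq_ennreal_measure) (metis cylinder_unit_measure(2) infinity_ennreal_def less_irrefl)
  have M: "M > 0" using cylinder_unit_measure(1)[where I = I and 'a = 'n] unfolding eM by simp
  have cyl: "emeasure lborel (cylinder I 0 r :: (complex ^ 'n) set) = ennreal (r ^ (2 * ?j) * M)" if "r > 0" for r
    using emeasure_cylinder_scale[OF that, of I] that M by (simp add: eM ennreal_mult')
  define cnt where "cnt x = card {k \<in> K. x \<in> cylinder I (v k) t}" for x
  define S where "S = cylinder I 0 (1 + t) - cylinder I 0 (1 - t) "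
  have sub: "cylinder I (v k) t \<subseteq> S" if k: "k \<in> K" for k
  proof
    fix x assume x: "x \<in> cylinder I (v k) t"
    have "norm (coord_proj I x) \<le> norm (coord_proj I x - v k) + norm (v k)"
      "norm (v k) \<le> norm (coord_proj I x - v k) + norm (coord_proj I x)"
      using norm_triangle_ineq[of "coord_proj I x - v k" "v k"] norm_triangle_ineq2[of "v k" "coord_proj I x"]
      by (simp_all add: norm_minus_commute)
    then show "x \<in> S" using x v(1)[OF k] by (auto simp: S_def cylinder_def)
  qed
  have S: "emeasure lborel S = ennreal (((1 + t) ^ (2 * ?j) - (1 - t) ^ (2 * ?j)) * M)"
  proof -
    have "emeasure lborel S = emeasure lborel (cylinder I 0 (1 + t) :: (complex ^ 'n) set) - emeasure lborel (cylinder I 0 (1 - t) :: (complex ^ 'n) set)"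
      unfolding S_def
    proof (rule emeasure_Diff)
      show "emeasure lborel (cylinder I 0 (1 - t) :: (complex ^ 'n) set) \<noteq> \<infinity>" using t cyl[of "1 - t"] by simp
      show "cylinder I 0 (1 - t) \<subseteq> (cylinder I 0 (1 + t) :: (complex ^ 'n) set)" using t by (auto simp: cylinder_def)
    qed simp_all
    then show ?thesis using t M by (simp add: cyl ennreal_minus left_diff_distrib)
  qed
  have fin: "finite (range cnt)"
  proof (rule finite_subset)
    show "range cnt \<subseteq> {..card K}" unfolding cnt_def using K by (auto intro!: card_mono)
  qed simp
  then obtain x where x: "\<And>y. cnt y \<le> cnt x"
    using Max_in[OF fin] Max_ge[OF fin] by (metis UNIV_not_empty image_is_empty rangeE rangeI)
  \<comment> \<open>Double counting: the multiplicity function is supported in the shell S and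
    nowhere exceeds its value at x, so comparing integrals bounds this value from below.\<close>
  have "(\<Sum>k\<in>K. emeasure lborel (cylinder I (v k) t)) = (\<integral>\<^sup>+ y. (\<Sum>k\<in>K. indicator (cylinder I (v k) t) y) \<partial>lborel)"
    by (subst nn_integral_sum) auto
  also have "\<dots> \<le> (\<integral>\<^sup>+ y. ennreal (real (cnt x)) * indicator S y \<partial>lborel)"
  proof (rule nn_integral_mono)
    fix y
    show "(\<Sum>k\<in>K. indicator (cylinder I (v k) t) y) \<le> ennreal (real (cnt x)) * indicator S y"
    proof (cases "y \<in> S")
      case True
      have "(\<Sum>k\<in>K. indicator (cylinder I (v k) t) y) = (of_nat (cnt y) :: ennreal)"
        using K by (simp add: cnt_def indicator_def sum.If_cases Int_def)
      then show ?thesis using True x[of y] by (simp add: ennreal_of_nat_eq_real_of_nat)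
    next
      case False
      then have "(\<Sum>k\<in>K. indicator (cylinder I (v k) t) y) = (0 :: ennreal)" using subsetD[OF sub] by (intro sum.neutral) (auto simp: indicator_def)
      then show ?thesis by simp
    qed
  qed
  also have "\<dots> = ennreal (real (cnt x)) * emeasure lborel S"
    by (rule nn_integral_cmult_indicator) (simp add: S_def)
  finally have "(\<Sum>k\<in>K. emeasure lborel (cylinder I (v k) t)) \<le> ennreal (real (cnt x)) * emeasure lborel S" .
  moreover have "(\<Sum>k\<in>K. emeasure lborel (cylinder I (v k) t)) = (\<Sum>k\<in>K. ennreal (t ^ (2 * ?j) * M))"
  proof (intro sum.cong refl)
    fix k assume "k \<in> K"
    have "emeasure lborel (cylinder I (v k) t) = emeasure lborel (cylinder I 0 t :: (complex ^ 'n) set)"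
      by (rule emeasure_cylinder_translate) (rule v(2)[OF \<open>k \<in> K\<close>])
    then show "emeasure lborel (cylinder I (v k) t) = ennreal (t ^ (2 * ?j) * M)" unfolding cyl[OF t(1)] .
  qed
  moreover have pos: "(1 + t) ^ (2 * ?j) - (1 - t) ^ (2 * ?j) > 0"
  proof -
    have "0 < ?j" using I by (simp add: card_gt_0_iff)
    then have "(1 - t) ^ (2 * ?j) < (1 + t) ^ (2 * ?j)" using t by (intro power_strict_mono) auto
    then show ?thesis by simp
  qed
  ultimately have "ennreal (real (card K) * (t ^ (2 * ?j) * M)) \<le> ennreal (real (cnt x) * (((1 + t) ^ (2 * ?j) - (1 - t) ^ (2 * ?j)) * M))"
    using t M by (simp add: S ennreal_mult' ennreal_of_nat_eq_real_of_nat)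
  then have "real (card K) * (t ^ (2 * ?j) * M) \<le> real (cnt x) * (((1 + t) ^ (2 * ?j) - (1 - t) ^ (2 * ?j)) * M)"
    using pos M by (subst (asm) ennreal_le_iff) auto
  then have "(real (card K) * t ^ (2 * ?j)) * M \<le> (real (cnt x) * ((1 + t) ^ (2 * ?j) - (1 - t) ^ (2 * ?j))) * M"
    by (simp only: mult.assoc)
  then have "real (card K) * t ^ (2 * ?j) \<le> real (cnt x) * ((1 + t) ^ (2 * ?j) - (1 - t) ^ (2 * ?j))"
    using M by (rule mult_right_le_imp_le)
  then have "real (card K) * cap_ratio ?j t \<le> real (cnt x)"
    using pos by (simp add: cap_ratio_def divide_le_eq)
  also have "cnt x \<le> card {k \<in> K. norm (v k - coord_proj I x) < t}"
    unfolding cnt_def using K by (intro card_mono) (auto simp: cylinder_def norm_minus_commute)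
  finally show ?thesis by (intro exI[of _ "coord_proj I x"]) (auto simp: coord_proj_def)
qed

text \<open>Induction on the number of active coordinates. \<open>sphere_pigeonhole\<close>, applied
  to the images of axis i, keeps a fraction \<open>cap_ratio\<close> of the family with these images
  in one cap. Dividing out rotations onto the images leaves elements that fix axis i, to which the
  induction hypothesis applies; the errors of the stages add up in the squared distance.\<close>

theorem unitary_family_concentrates:
  fixes f :: "'k \<Rightarrow> complex ^ 'n ^ 'n" and I :: "'n set" and t :: "nat \<Rightarrow> real"
  assumes "finite K" "\<And>k. k \<in> K \<Longrightarrow> fixes_off I (f k)" and t: "\<And>j. 1 \<le> j \<Longrightarrow> 0 < t j \<and> t j < 1"
  shows "\<exists>W. fixes_off I W \<and> real (card K) * (\<Prod>j=1..card I. cap_ratio j (t j))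
    \<le> real (card {k \<in> K. (norm (f k - W))\<^sup>2 \<le> (\<Sum>j=1..card I. 4 * (1 - sqrt (1 - (t j)\<^sup>2)))})"
  using finite[of I] assms(1,2)
proof (induction I arbitrary: K f rule: finite_induct)
  case empty
  have "f k = mat 1" if "k \<in> K" for k
  proof -
    have "f k *v axis i 1 = axis i 1" for i using empty(2)[OF that] by (simp add: fixes_off_def)
    then have "f k $ i $ j = mat 1 $ i $ j" for i j
      by (subst (1 2) matrix_entry) simp
    then show ?thesis by (simp add: vec_eq_iff)
  qed
  then have "{k \<in> K. (norm (f k - mat 1))\<^sup>2 \<le> 0} = K" by auto
  then show ?case by (intro exI[of _ "mat 1"]) (simp add: fixes_off_def)
next
  case (insert i I)
  let ?J = "insert i I" and ?j = "Suc (card I)"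
  let ?s = "\<Sum>j=1..card I. 4 * (1 - sqrt (1 - (t j)\<^sup>2))"
  have cardJ: "card ?J = ?j" using insert by simp
  have tj: "0 < t ?j" "t ?j < 1" using t[of ?j] by auto
  define v where "v k = f k *v axis i 1" for k
  have v1: "norm (v k) = 1" if "k \<in> K" for k
    using unitary_norm_vec[of "f k" "axis i 1"] insert.prems(2)[OF that]
    by (simp add: v_def fixes_off_def norm_eq_sqrt_inner inner_axis_axis)
  have v0: "v k $ l = 0" if k: "k \<in> K" and l: "l \<notin> ?J" for k l
  proof -
    have "v k $ l = herm (f k *v axis i 1) (f k *v axis l 1)"
      using insert.prems(2)[OF k] l by (simp add: v_def fixes_off_def)
    also have "\<dots> = herm (axis i 1) (axis l 1)"
      using insert.prems(2)[OF k] by (intro unitary_herm) (simp add: fixes_off_def)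
    also have "\<dots> = axis i 1 $ l" by (rule herm_axis_right)
    also have "\<dots> = 0" using l by (simp add: axis_def)
    finally show ?thesis .
  qed
  obtain c where c: "\<And>l. l \<notin> ?J \<Longrightarrow> c $ l = 0"
    "real (card K) * cap_ratio ?j (t ?j) \<le> real (card {k \<in> K. norm (v k - c) < t ?j})"
    using sphere_pigeonhole[of K v ?J, OF insert.prems(1) v1 v0 _ tj] unfolding cardJ by blast
  define K1 where "K1 = {k \<in> K. norm (v k - c) < t ?j}"
  have K1: "finite K1" "\<And>k. k \<in> K1 \<Longrightarrow> k \<in> K \<and> norm (v k - c) < t ?j" using insert.prems(1) by (auto simp: K1_def)
  have capn: "cap_ratio j (t j) \<ge> 0" if "1 \<le> j" for j
  proof -
    have "(1 - t j) ^ (2 * j) \<le> (1 + t j) ^ (2 * j)" using t[OF that] by (intro power_mono) auto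
    then show ?thesis using t[OF that] by (simp add: cap_ratio_def)
  qed
  have prodJ: "(\<Prod>j=1..card ?J. cap_ratio j (t j)) = cap_ratio ?j (t ?j) * (\<Prod>j=1..card I. cap_ratio j (t j))"
    unfolding cardJ by (simp add: mult.commute)
  show ?case
  proof (cases "K1 = {}")
    case True
    then have "real (card K) * cap_ratio ?j (t ?j) \<le> 0" using c(2) unfolding K1_def[symmetric] True by simp
    then have "real (card K) * cap_ratio ?j (t ?j) * (\<Prod>j=1..card I. cap_ratio j (t j)) \<le> 0"
      by (rule mult_nonpos_nonneg) (auto intro!: prod_nonneg capn)
    then have "real (card K) * (\<Prod>j=1..card ?J. cap_ratio j (t j)) \<le> 0" unfolding prodJ by (simp only: mult.assoc)
    then have "real (card K) * (\<Prod>j=1..card ?J. cap_ratio j (t j)) \<le> real m" for m by (meson of_nat_0_le_iff order_trans)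
    then show ?thesis by (intro exI[of _ "mat 1"]) (simp add: fixes_off_def)
  next
    case False
    have c0: "c \<noteq> 0"
    proof
      assume "c = 0"
      moreover obtain k where "k \<in> K1" using False by blast
      ultimately show False using K1(2)[of k] v1[of k] tj by simp
    qed
    \<comment> \<open>The centre of the cap is moved radially to the unit sphere, so that V can
      rotate axis i onto it.\<close>
    define e where "e = (1 / norm c) *\<^sub>R c"
    have e: "norm e = 1" using c0 by (simp add: e_def)
    define V where "V = rot i e"
    have e0: "e $ j = 0" if "j \<notin> ?J" for j using c(1)[OF that] by (simp add: e_def)
    have V: "fixes_off ?J V" "V *v axis i 1 = e"
      unfolding V_def by (rule rot_fixes_off[OF e _ e0], simp, assumption, rule rot_axis[OF e])
    define w where "w k = adj V *v v k" for k
    have w1: "norm (w k) = 1" if "k \<in> K" for k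
      using V(1) v1[OF that] by (simp add: w_def unitary_norm_vec unitary_adj fixes_off_def)
    have w0: "w k $ l = 0" if k: "k \<in> K" and l: "l \<notin> ?J" for k l
    proof -
      have "w k $ l = herm (v k) (V *v axis l 1)" by (simp add: w_def herm_mult_right)
      then show ?thesis using V(1) l v0[OF k l] by (simp add: fixes_off_def)
    qed
    \<comment> \<open>A unit vector within distance t of c makes an angle of sine at most t with the
      direction of c; the arithmetic-geometric mean inequality eliminates the unknown length of
      c.\<close>
    have wRe: "Re (w k $ i) \<ge> sqrt (1 - (t ?j)\<^sup>2)" if k: "k \<in> K1" for k
    proof -
      let ?r = "sqrt (1 - (t ?j)\<^sup>2)"
      have r2: "?r\<^sup>2 = 1 - (t ?j)\<^sup>2" using tj by (simp add: power_le_one_iff abs_square_le_1)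
      have "w k $ i = herm (v k) (V *v axis i 1)" by (simp add: w_def herm_mult_right)
      then have wk: "norm c * Re (w k $ i) = Re (herm (v k) c)" using c0 by (simp add: V(2) e_def herm_scaleR_right)
      have "(norm (v k - c))\<^sup>2 < (t ?j)\<^sup>2" using K1(2)[OF k] by (intro power_strict_mono) auto
      moreover have "(norm (v k - c))\<^sup>2 = 1 + (norm c)\<^sup>2 - 2 * Re (herm (v k) c)"
        using v1[of k] K1(2)[OF k] inner_eq_Re_herm[of "v k" c] dot_square_norm[of "v k"]
        by (simp add: power2_norm_eq_inner inner_diff_left inner_diff_right inner_commute)
      ultimately have "?r\<^sup>2 + (norm c)\<^sup>2 < 2 * Re (herm (v k) c)" using r2 by simp
      moreover have "2 * (norm c * ?r) \<le> ?r\<^sup>2 + (norm c)\<^sup>2"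
        using zero_le_power2[of "?r - norm c"] by (simp only: power2_diff) (simp add: mult.commute)
      ultimately have "norm c * ?r \<le> norm c * Re (w k $ i)" using wk by simp
      then show ?thesis using c0 by simp
    qed
    \<comment> \<open>V removes the common centre and \<open>rot i (w k)\<close> the individual
      deviation from it.\<close>
    define f' where "f' k = adj (rot i (w k)) ** (adj V ** f k)" for k
    have f': "fixes_off I (f' k)" if k: "k \<in> K1" for k
    proof -
      have kK: "k \<in> K" using K1(2)[OF k] by simp
      have "fixes_off ?J (f' k)"
        unfolding f'_def using V(1) insert.prems(2)[OF kK] rot_fixes_off[OF w1[OF kK], of i ?J] w0[OF kK]
        by (intro fixes_off_mult fixes_off_adj) auto
      moreover have "f' k *v axis i 1 = axis i 1"
      proof -
        have "f' k *v axis i 1 = adj (rot i (w k)) *v w k"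
          by (simp add: f'_def matrix_vector_mult_assoc' v_def w_def)
        also have "w k = rot i (w k) *v axis i 1" using rot_axis[OF w1[OF kK]] by simp
        finally show ?thesis
          using unitary_adj_cancel(1)[OF rot_unitary[OF w1[OF kK], of i], of "axis i 1"] rot_axis[OF w1[OF kK], of i] by simp
      qed
      ultimately show ?thesis by (auto simp: fixes_off_def)
    qed
    obtain W where W: "fixes_off I W"
      "real (card K1) * (\<Prod>j=1..card I. cap_ratio j (t j)) \<le> real (card {k \<in> K1. (norm (f' k - W))\<^sup>2 \<le> ?s})"
      using insert.IH[of K1 f', OF K1(1) f'] by blast
    have step: "(norm (f k - V ** W))\<^sup>2 \<le> ?s + 4 * (1 - sqrt (1 - (t ?j)\<^sup>2))"
      if k: "k \<in> K1" and near: "(norm (f' k - W))\<^sup>2 \<le> ?s" for k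
    proof -
      have kK: "k \<in> K" using K1(2)[OF k] by simp
      let ?R = "rot i (w k)" and ?Y = "f' k ** adj W"
      have uR: "unitary ?R" by (rule rot_unitary[OF w1[OF kK]])
      have uV: "unitary V" and uW: "unitary W" and uf: "unitary (f' k)"
        using V W f'[OF k] by (auto simp: fixes_off_def)
      have uY: "unitary ?Y" using uW uf by (simp add: unitary_mult unitary_adj)
      have Ye: "?Y *v axis i 1 = axis i 1"
        using fixes_off_mult[OF f'[OF k] fixes_off_adj[OF W(1)]] insert.hyps(2) by (simp add: fixes_off_def)
      have "f k = V ** (?R ** f' k)"
      proof -
        have "V ** (?R ** f' k) = V ** ((?R ** adj ?R) ** adj V) ** f k" by (simp only: f'_def matrix_mul_assoc)
        then show ?thesis using unitaryD(2)[OF uR] unitaryD(2)[OF uV] by simp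
      qed
      then have "norm (f k - V ** W) = norm (V ** (?R ** f' k - W))" by (simp add: matrix_mult_diff_right)
      also have "\<dots> = norm (?R ** f' k - W)" by (rule unitary_norm_left[OF uV])
      also have "\<dots> = norm ((?R ** f' k - W) ** adj W)" by (rule unitary_norm_right[OF unitary_adj[OF uW], symmetric])
      also have "(?R ** f' k - W) ** adj W = ?R ** ?Y - mat 1"
        using unitaryD(2)[OF uW] by (simp add: matrix_mult_diff_left matrix_mul_assoc)
      finally have 1: "norm (f k - V ** W) = norm (?R ** ?Y - mat 1)" .
      have "norm (f' k - W) = norm ((f' k - W) ** adj W)" by (rule unitary_norm_right[OF unitary_adj[OF uW], symmetric])
      also have "(f' k - W) ** adj W = ?Y - mat 1"
        using unitaryD(2)[OF uW] by (simp add: matrix_mult_diff_left)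
      finally have 2: "norm (f' k - W) = norm (?Y - mat 1)" .
      \<comment> \<open>Both products have the same norm, so the squared distances differ by a
        difference of traces; \<open>trace_rot_mult\<close> applies because \<open>?Y\<close> fixes
        axis i.\<close>
      have "(norm (?R ** ?Y - mat 1))\<^sup>2 = (norm (?Y - mat 1))\<^sup>2 + 2 * (Re (trace ?Y) - Re (trace (?R ** ?Y)))"
        unfolding norm_diff_mat1 unitary_norm_left[OF uR] by simp
      also have "\<dots> \<le> (norm (?Y - mat 1))\<^sup>2 + 4 * (1 - Re (w k $ i))"
        using trace_rot_mult[OF w1[OF kK] uY Ye] by simp
      finally have "(norm (?R ** ?Y - mat 1))\<^sup>2 \<le> (norm (?Y - mat 1))\<^sup>2 + 4 * (1 - Re (w k $ i))" .
      moreover have "a \<le> s + 4 * (1 - r)" if "a \<le> b + 4 * (1 - c)" "b \<le> s" "r \<le> c" for a b c s r :: real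
        using that by (simp add: algebra_simps)
      ultimately show ?thesis using near wRe[OF k] unfolding 1 2 by blast
    qed
    have "real (card K) * (\<Prod>j=1..card ?J. cap_ratio j (t j)) = (real (card K) * cap_ratio ?j (t ?j)) * (\<Prod>j=1..card I. cap_ratio j (t j))"
      unfolding prodJ by (simp only: mult.assoc)
    also have "\<dots> \<le> real (card K1) * (\<Prod>j=1..card I. cap_ratio j (t j))"
      using c(2) capn unfolding K1_def by (intro mult_right_mono prod_nonneg) auto
    also have "\<dots> \<le> real (card {k \<in> K1. (norm (f' k - W))\<^sup>2 \<le> ?s})" by (rule W(2))
    also have "\<dots> \<le> real (card {k \<in> K. (norm (f k - V ** W))\<^sup>2 \<le> (\<Sum>j=1..card ?J. 4 * (1 - sqrt (1 - (t j)\<^sup>2)))})"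
      unfolding of_nat_le_iff cardJ
    proof (rule card_mono)
      show "{k \<in> K1. (norm (f' k - W))\<^sup>2 \<le> ?s} \<subseteq> {k \<in> K. (norm (f k - V ** W))\<^sup>2 \<le> (\<Sum>j=1..?j. 4 * (1 - sqrt (1 - (t j)\<^sup>2)))}"
      proof
        fix k assume "k \<in> {k \<in> K1. (norm (f' k - W))\<^sup>2 \<le> ?s}"
        then have k: "k \<in> K1" "(norm (f' k - W))\<^sup>2 \<le> ?s" by auto
        then show "k \<in> {k \<in> K. (norm (f k - V ** W))\<^sup>2 \<le> (\<Sum>j=1..?j. 4 * (1 - sqrt (1 - (t j)\<^sup>2)))}"
          using step[OF k] K1(2)[OF k(1)] by simp
      qed
    qed (use insert.prems(1) in simp)
    finally show ?thesis
      using fixes_off_mult[OF V(1) fixes_off_mono[OF W(1)]] by (intro exI[of _ "V ** W"]) auto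
  qed
qed

text \<open>Each element, composed with the boost to b, splits into a boost, a phase and a unitary
  part V. If two of these V lay within X/2 of the same W, the quotient of the two elements would
  contradict \<open>sep\<close> by \<open>boost_twist_norm\<close>; so at most one survives the
  concentration argument.\<close>

theorem packing_count:
  fixes L :: "(complex ^ ('n::finite option) ^ ('n option)) set"
  assumes L: "finite L" "\<And>A. A \<in> L \<Longrightarrow> un1 A" and b: "b \<in> cball_model"
    and q: "\<And>A. A \<in> L \<Longrightarrow> (gam (act A b))\<^sup>2 \<le> 1 + h" "h \<le> 1"
    and sep: "\<And>A A' d. A \<in> L \<Longrightarrow> A' \<in> L \<Longrightarrow> A \<noteq> A' \<Longrightarrow> cmod d = 1 \<Longrightarrow> \<epsilon> \<le> norm (mat d ** (A' ** uinv A) - mat 1)"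
    and t: "\<And>j. 1 \<le> j \<Longrightarrow> 0 < t j \<and> t j < 1"
    and X: "(\<Sum>j=1..CARD('n). 4 * (1 - sqrt (1 - (t j)\<^sup>2))) \<le> (X / 2)\<^sup>2" "0 \<le> X"
    and \<epsilon>: "8 * h + 17 * h\<^sup>2 + 2 * h * X + X\<^sup>2 * (1 + h) < \<epsilon>\<^sup>2" "0 \<le> \<epsilon>"
  shows "real (card L) * (\<Prod>j=1..CARD('n). cap_ratio j (t j)) \<le> 1"
proof -
  have "\<exists>V d. unitary V \<and> cmod d = 1 \<and> A ** Tm b = mat d ** (Tm (act A b) ** blk V 0 0 1)" if A: "A \<in> L" for A
  proof -
    have un: "un1 (A ** Tm b)" using L A b by (simp add: un1_mult un1_Tm)
    have "act (A ** Tm b) 0 = act A b" using act_mult[OF un1_Tm[OF b], of 0 A] act_Tm_0[OF b] by simp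
    then obtain U d where U: "unitary U" "cmod d = 1" "A ** Tm b = Tm (act A b) ** blk U 0 0 d"
      using un1_polar[OF un] by metis
    have dd: "d * cnj d = 1" using U(2) by (metis complex_norm_square of_real_1 power_one)
    have "blk U 0 0 d = mat d ** blk (mat (cnj d) ** U) 0 0 1"
      unfolding mat_blk[of d] blk_mult by (simp add: outer_simps matrix_mul_assoc mat_mult_mat dd)
    moreover have "unitary (mat (cnj d) ** U)"
      using U dd by (intro unitary_mult) (auto simp: unitary_def mat_mult_mat)
    moreover have "Tm (act A b) ** (mat d ** X) = mat d ** (Tm (act A b) ** X)" for X
      by (simp add: matrix_mul_assoc mat_commute)
    ultimately show ?thesis using U by metis
  qed
  then obtain V d where Vd: "\<And>A. A \<in> L \<Longrightarrow> unitary (V A) \<and> cmod (d A) = 1 \<and> A ** Tm b = mat (d A) ** (Tm (act A b) ** blk (V A) 0 0 1)"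
    by metis
  obtain W where W: "fixes_off UNIV W" "real (card L) * (\<Prod>j=1..CARD('n). cap_ratio j (t j))
    \<le> real (card {A \<in> L. (norm (V A - W))\<^sup>2 \<le> (\<Sum>j=1..CARD('n). 4 * (1 - sqrt (1 - (t j)\<^sup>2)))})"
    using unitary_family_concentrates[OF L(1), of UNIV V t] Vd t by (auto simp: fixes_off_def)
  let ?N = "{A \<in> L. (norm (V A - W))\<^sup>2 \<le> (\<Sum>j=1..CARD('n). 4 * (1 - sqrt (1 - (t j)\<^sup>2)))}"
  have "A = A'" if A: "A \<in> ?N" and A': "A' \<in> ?N" for A A'
  proof (rule ccontr)
    assume ne: "A \<noteq> A'"
    have AL: "A \<in> L" "A' \<in> L" using A A' by auto
    note VA = Vd[OF AL(1)] and VA' = Vd[OF AL(2)]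
    have "(norm (V A - W))\<^sup>2 \<le> (X / 2)\<^sup>2" "(norm (V A' - W))\<^sup>2 \<le> (X / 2)\<^sup>2" using A A' X(1) by auto
    then have "norm (V A - W) \<le> X / 2" "norm (V A' - W) \<le> X / 2" using X(2) by (auto intro: power2_le_imp_le)
    then have "norm (V A' - V A) \<le> X"
      using norm_triangle_ineq[of "V A' - W" "W - V A"] by (simp add: norm_minus_commute)
    moreover have "norm (V A' ** adj (V A) - mat 1) = norm (V A' - V A)"
    proof -
      have "V A' ** adj (V A) - mat 1 = (V A' - V A) ** adj (V A)"
        using VA by (simp add: matrix_mult_diff_left unitaryD)
      then show ?thesis using unitary_norm_right[OF unitary_adj, of "V A" "V A' - V A"] VA by simp
    qed
    ultimately have near: "norm (V A' ** adj (V A) - mat 1) \<le> X" by simp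
    have "(norm (Tm (act A' b) ** blk (V A' ** adj (V A)) 0 0 1 ** uinv (Tm (act A b)) - mat 1))\<^sup>2
      \<le> 8 * h + 17 * h\<^sup>2 + 2 * h * X + X\<^sup>2 * (1 + h)"
      by (rule boost_twist_norm[OF _ _ _ near q(1)[OF AL(1)] q(1)[OF AL(2)] q(2)])
         (use L AL b VA VA' in \<open>auto intro: act_in_ball unitary_mult unitary_adj\<close>)
    then have "(norm (Tm (act A' b) ** blk (V A' ** adj (V A)) 0 0 1 ** uinv (Tm (act A b)) - mat 1))\<^sup>2 < \<epsilon>\<^sup>2"
      using \<epsilon>(1) by linarith
    then have small: "norm (Tm (act A' b) ** blk (V A' ** adj (V A)) 0 0 1 ** uinv (Tm (act A b)) - mat 1) < \<epsilon>"
      using \<epsilon>(2) by (rule power2_less_imp_less)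
    \<comment> \<open>This scalar cancels both phases in \<open>A' ** uinv A\<close>; it may be
      chosen freely, since \<open>sep\<close> speaks of all unit multiples.\<close>
    define e where "e = cnj (d A') * d A"
    have e: "cmod e = 1" using VA VA' by (simp add: e_def norm_mult)
    have dd: "cnj (d A') * d A' = 1" "d A * cnj (d A) = 1"
      using VA VA' by (metis complex_norm_square mult.commute of_real_1 power_one)+
    have inv: "Tm b ** uinv (A ** Tm b) = uinv A"
      using uinv_right[OF un1_Tm[OF b]] by (simp add: uinv_mult matrix_mul_assoc)
    have "A' ** uinv A = (A' ** Tm b) ** uinv (A ** Tm b)" by (simp add: inv flip: matrix_mul_assoc)
    also have "\<dots> = mat (d A') ** (Tm (act A' b) ** blk (V A') 0 0 1) ** (uinv (blk (V A) 0 0 1) ** uinv (Tm (act A b)) ** mat (cnj (d A)))"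
      using VA VA' by (simp add: uinv_mult uinv_mat)
    also have "uinv (blk (V A) 0 0 1) = blk (adj (V A)) 0 0 1"
      by (simp add: uinv_def adj_blk Jm_blk blk_mult outer_simps blk_eq_iff)
    finally have "mat e ** (A' ** uinv A) = mat e ** (mat (d A') ** (Tm (act A' b) ** blk (V A') 0 0 1) ** (blk (adj (V A)) 0 0 1 ** uinv (Tm (act A b)) ** mat (cnj (d A))))"
      by simp
    also have "\<dots> = mat (e * d A' * cnj (d A)) ** (Tm (act A' b) ** (blk (V A') 0 0 1 ** blk (adj (V A)) 0 0 1) ** uinv (Tm (act A b)))"
    proof -
      have eq: "mat e ** (mat x ** Y ** (Z ** mat z)) = mat (e * x * z) ** (Y ** Z)" for x z and Y Z :: "complex ^ ('n option) ^ ('n option)"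
      proof -
        have "mat e ** (mat x ** Y ** (Z ** mat z)) = (mat e ** mat x) ** (Y ** Z ** mat z)" by (simp only: matrix_mul_assoc)
        also have "Y ** Z ** mat z = mat z ** (Y ** Z)" by (rule mat_commute[symmetric])
        finally show ?thesis by (simp only: matrix_mul_assoc mat_mult_mat)
      qed
      show ?thesis unfolding eq by (simp only: matrix_mul_assoc)
    qed
    also have "e * d A' * cnj (d A) = 1" using dd by (simp add: e_def mult.assoc mult.left_commute)
    also have "blk (V A') 0 0 1 ** blk (adj (V A)) 0 0 1 = blk (V A' ** adj (V A)) 0 0 1"
      by (simp add: blk_mult outer_simps)
    finally have "mat e ** (A' ** uinv A) = Tm (act A' b) ** blk (V A' ** adj (V A)) 0 0 1 ** uinv (Tm (act A b))" by simp
    then show False using sep[OF AL ne e] small by simp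
  qed
  then have "card ?N \<le> 1" using L(1) by (intro card_le_Suc0_iff_eq[THEN iffD2, unfolded One_nat_def[symmetric]]) auto
  then show ?thesis using W(2) by linarith
qed

section \<open>Numerical estimates\<close>

text \<open>The difference g of the two sides satisfies g'' - g \<ge> 0 and vanishes with its first
  derivative at 0. The operator factors into D + 1 and D - 1, which are integrated one after the
  other with the factors exp y and exp (- y).\<close>

lemma sinh_le_exp:
  fixes x :: real
  assumes x: "0 \<le> x"
  shows "sinh x \<le> x * exp (x\<^sup>2 / 6)"
proof -
  define g where "g x = x * exp (x\<^sup>2 / 6) - sinh x" for x :: real
  define g' where "g' x = (1 + x\<^sup>2 / 3) * exp (x\<^sup>2 / 6) - cosh x" for x :: real
  define g'' where "g'' x = (x + x ^ 3 / 9) * exp (x\<^sup>2 / 6) - sinh x" for x :: real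
  have d1: "(g has_real_derivative g' x) (at x)" for x
    unfolding g_def g'_def by (auto intro!: derivative_eq_intros simp: algebra_simps power2_eq_square)
  have d2: "(g' has_real_derivative g'' x) (at x)" for x
    unfolding g'_def g''_def by (auto intro!: derivative_eq_intros simp: field_simps power2_eq_square power3_eq_cube)
  have gg: "g'' x - g x = x ^ 3 / 9 * exp (x\<^sup>2 / 6)" for x by (simp add: g_def g''_def algebra_simps)
  have 1: "exp 0 * (g' 0 - g 0) \<le> exp y * (g' y - g y)" if y: "0 \<le> y" for y
  proof (rule DERIV_nonneg_imp_nondecreasing[OF y])
    fix z :: real assume z: "0 \<le> z" "z \<le> y"
    have "((\<lambda>y. exp y * (g' y - g y)) has_real_derivative exp z * (g'' z - g z)) (at z)"
      by (auto intro!: derivative_eq_intros d1 d2 simp: algebra_simps)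
    moreover have "0 \<le> exp z * (g'' z - g z)" unfolding gg using z by simp
    ultimately show "\<exists>D. ((\<lambda>y. exp y * (g' y - g y)) has_real_derivative D) (at z) \<and> 0 \<le> D" by blast
  qed
  have g'g: "g y \<le> g' y" if "0 \<le> y" for y
  proof -
    have "0 \<le> exp y * (g' y - g y)" using 1[OF that] by (simp add: g_def g'_def)
    then show ?thesis by (simp add: zero_le_mult_iff)
  qed
  have "exp (- 0) * g 0 \<le> exp (- x) * g x"
  proof (rule DERIV_nonneg_imp_nondecreasing[OF x])
    fix z :: real assume z: "0 \<le> z" "z \<le> x"
    have "((\<lambda>y. exp (- y) * g y) has_real_derivative exp (- z) * (g' z - g z)) (at z)"
      by (auto intro!: derivative_eq_intros d1 simp: algebra_simps)
    then show "\<exists>D. ((\<lambda>y. exp (- y) * g y) has_real_derivative D) (at z) \<and> 0 \<le> D" using g'g[OF z(1)] by fastforce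
  qed
  then have "0 \<le> g x" by (simp add: g_def zero_le_mult_iff)
  then show ?thesis by (simp add: g_def)
qed

text \<open>Both sides vanish at t = 0. For the derivatives, 1 + z \<le> exp z and 1 - z \<le> exp
  (- z) are raised to the power m - 1.\<close>

lemma shell_volume_le:
  fixes t :: real
  assumes t: "0 \<le> t" "t < 1"
  shows "(1 + t) ^ m - (1 - t) ^ m \<le> 2 * sinh (real m * t)"
proof -
  have "2 * sinh (real m * 0) - ((1 + 0) ^ m - (1 - 0) ^ m) \<le> 2 * sinh (real m * t) - ((1 + t) ^ m - (1 - t) ^ m)"
  proof (rule DERIV_nonneg_imp_nondecreasing[OF t(1)])
    fix z :: real assume z: "0 \<le> z" "z \<le> t"
    have d: "((\<lambda>z. 2 * sinh (real m * z) - ((1 + z) ^ m - (1 - z) ^ m)) has_real_derivative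
      real m * (2 * cosh (real m * z) - ((1 + z) ^ (m - 1) + (1 - z) ^ (m - 1)))) (at z)"
      by (auto intro!: derivative_eq_intros simp: algebra_simps)
    have "(1 + z) ^ (m - 1) \<le> exp z ^ (m - 1)" "(1 - z) ^ (m - 1) \<le> exp (- z) ^ (m - 1)"
      using z t exp_ge_add_one_self[of z] exp_ge_add_one_self[of "- z"] by (auto intro!: power_mono)
    moreover have "exp z ^ (m - 1) = exp (real (m - 1) * z)" "exp (- z) ^ (m - 1) = exp (- (real (m - 1) * z))"
      by (simp_all only: exp_of_nat_mult[symmetric] mult_minus_right)
    ultimately have "(1 + z) ^ (m - 1) + (1 - z) ^ (m - 1) \<le> exp (real (m - 1) * z) + exp (- (real (m - 1) * z))"
      by linarith
    also have "\<dots> = 2 * cosh (real (m - 1) * z)" by (simp add: cosh_def exp_minus)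
    also have "\<dots> \<le> 2 * cosh (real m * z)"
      using z by (subst mult_le_cancel_left_pos, simp, subst cosh_real_nonneg_le_iff) (auto intro: mult_right_mono)
    finally show "\<exists>D. ((\<lambda>z. 2 * sinh (real m * z) - ((1 + z) ^ m - (1 - z) ^ m)) has_real_derivative D) (at z) \<and> 0 \<le> D"
      using d by (intro exI conjI) (auto intro!: mult_nonneg_nonneg)
  qed
  then show ?thesis by simp
qed

text \<open>Estimating the shell by \<open>shell_volume_le\<close> and \<open>sinh_le_exp\<close>
  keeps the leading term t^(2k-1) / (4 k) and costs only a Gaussian factor, which remains usable
  where k t is not small.\<close>

lemma ln_cap_ratio_ge:
  assumes t: "0 < t" "t < 1" and k: "1 \<le> k"
  shows "0 < cap_ratio k t" "(2 * real k - 1) * ln t - ln 4 - ln (real k) - (2 * real k * t)\<^sup>2 / 6 \<le> ln (cap_ratio k t)"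
proof -
  have pos: "(1 - t) ^ (2 * k) < (1 + t) ^ (2 * k)" using t k by (intro power_strict_mono) auto
  then show cp: "0 < cap_ratio k t" using t by (simp add: cap_ratio_def)
  have "(1 + t) ^ (2 * k) - (1 - t) ^ (2 * k) \<le> 2 * sinh (real (2 * k) * t)" using shell_volume_le[of t "2 * k"] t by simp
  also have "\<dots> \<le> 2 * ((2 * real k * t) * exp ((2 * real k * t)\<^sup>2 / 6))" using sinh_le_exp[of "2 * real k * t"] t by (simp add: mult_ac)
  finally have le: "(1 + t) ^ (2 * k) - (1 - t) ^ (2 * k) \<le> 4 * real k * t * exp ((2 * real k * t)\<^sup>2 / 6)" by simp
  have "ln ((1 + t) ^ (2 * k) - (1 - t) ^ (2 * k)) \<le> ln (4 * real k * t * exp ((2 * real k * t)\<^sup>2 / 6))"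
    using le pos t k by (subst ln_le_cancel_iff) auto
  also have "\<dots> = ln 4 + ln (real k) + ln t + (2 * real k * t)\<^sup>2 / 6" using t k by (simp add: ln_mult)
  finally show "(2 * real k - 1) * ln t - ln 4 - ln (real k) - (2 * real k * t)\<^sup>2 / 6 \<le> ln (cap_ratio k t)"
    using pos t by (simp add: cap_ratio_def ln_div ln_realpow algebra_simps)
qed

text \<open>With x = d/2, log-convexity at the midpoint gives 2 ln Gamma (x + 1/2) \<le> ln Gamma x
  + ln Gamma (x + 1), and the duplication formula trades Gamma x Gamma (x + 1/2) for a factorial.
  Even and odd d are thereby treated alike.\<close>

lemma Gamma_half_nat_ge:
  assumes d: "1 \<le> d"
  shows "ln (pi * (real d / 2)) / 2 - real d * ln 2 + ln (fact d) \<le> 2 * ln (Gamma (real d / 2 + 1))"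
proof -
  define x where "x = real d / 2"
  have x: "x > 0" using d by (simp add: x_def)
  have g: "Gamma x > 0" "Gamma (x + 1/2) > 0" "Gamma (x + 1) > 0" using x by (auto intro: Gamma_real_pos)
  have "(ln \<circ> Gamma) ((1 - 1/2) *\<^sub>R x + (1/2) *\<^sub>R (x + 1)) \<le> (1 - 1/2) * (ln \<circ> Gamma) x + (1/2) * (ln \<circ> Gamma) (x + 1)"
    by (rule convex_onD[OF log_convex_Gamma_real]) (use x in auto)
  moreover have "(1 - 1/2) *\<^sub>R x + (1/2) *\<^sub>R (x + 1) = x + 1/2" by (simp add: field_simps)
  ultimately have lc: "2 * ln (Gamma (x + 1/2)) \<le> ln (Gamma x) + ln (Gamma (x + 1))" by simp
  have xn: "y \<notin> \<int>\<^sub>\<le>\<^sub>0" if "0 < y" for y :: real using nonpos_Ints_nonpos[of y] that by force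
  have rec: "ln (Gamma (x + 1)) = ln x + ln (Gamma x)" by (subst Gamma_plus1[OF xn[OF x]], rule ln_mult_pos[OF x g(1)])
  have nz: "complex_of_real x \<notin> \<int>\<^sub>\<le>\<^sub>0" "complex_of_real x + 1/2 \<notin> \<int>\<^sub>\<le>\<^sub>0"
  proof -
    have e: "complex_of_real x + 1/2 = of_real (x + 1/2)" by simp
    show "complex_of_real x \<notin> \<int>\<^sub>\<le>\<^sub>0" using xn[OF x] by (simp add: of_real_in_nonpos_Ints_iff)
    show "complex_of_real x + 1/2 \<notin> \<int>\<^sub>\<le>\<^sub>0" unfolding e of_real_in_nonpos_Ints_iff using xn[of "x + 1/2"] x by simp
  qed
  have "complex_of_real (Gamma x * Gamma (x + 1/2)) = of_real (exp ((1 - 2 * x) * ln 2) * sqrt pi * Gamma (2 * x))"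
    using Gamma_legendre_duplication[OF nz]
    by (simp add: Gamma_complex_of_real[symmetric] exp_of_real[symmetric])
  then have "Gamma x * Gamma (x + 1/2) = exp ((1 - 2 * x) * ln 2) * sqrt pi * Gamma (2 * x)" by (simp only: of_real_eq_iff)
  then have "ln (Gamma x * Gamma (x + 1/2)) = ln (exp ((1 - 2 * x) * ln 2) * sqrt pi * Gamma (2 * x))" by (rule arg_cong)
  moreover have "ln (Gamma x * Gamma (x + 1/2)) = ln (Gamma x) + ln (Gamma (x + 1/2))" by (rule ln_mult_pos[OF g(1,2)])
  moreover have "ln (exp ((1 - 2 * x) * ln 2) * sqrt pi * Gamma (2 * x)) = ln (exp ((1 - 2 * x) * ln 2)) + ln (sqrt pi) + ln (Gamma (2 * x))"
    using x Gamma_real_pos[of "2 * x"] by (subst ln_mult_pos, simp, simp, subst ln_mult_pos) auto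
  ultimately have "ln (Gamma x) + ln (Gamma (x + 1/2)) = (1 - 2 * x) * ln 2 + ln pi / 2 + ln (Gamma (2 * x))"
    by (simp only: ln_exp ln_sqrt[OF less_imp_le[OF pi_gt_zero]] ln_sqrt pi_gt_zero)
  moreover have "ln (fact d :: real) = ln (2 * x) + ln (Gamma (2 * x))"
  proof -
    have "fact d = Gamma (2 * x + 1)" by (simp add: x_def Gamma_fact add.commute)
    also have "\<dots> = 2 * x * Gamma (2 * x)" using x by (intro Gamma_plus1 xn) simp
    finally have "fact d = 2 * x * Gamma (2 * x)" .
    then show ?thesis using x Gamma_real_pos[of "2 * x"] ln_mult_pos[of "2 * x" "Gamma (2 * x)"] by simp
  qed
  moreover have "ln (2 * x) = ln 2 + ln x" "ln (pi * x) = ln pi + ln x" using x by (simp_all add: ln_mult_pos)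
  moreover have "2 * x = real d" by (simp add: x_def)
  moreover have "(1 - 2 * x) * ln 2 = ln 2 - real d * ln 2" by (simp add: x_def left_diff_distrib)
  ultimately have "ln (pi * x) / 2 - real d * ln 2 + ln (fact d) \<le> 2 * ln (Gamma (x + 1))"
    using lc rec by linarith
  then show ?thesis by (simp only: x_def)
qed

section \<open>Logarithms and Stirling's approximation\<close>

lemma ln_one_plus_bounds:
  fixes x :: real
  assumes x: "0 \<le> x"
  shows "2 * x / (2 + x) \<le> ln (1 + x)" "ln (1 + x) \<le> x * (2 + x) / (2 * (1 + x))"
proof -
  have "ln (1 + 0) - 2 * 0 / (2 + 0) \<le> ln (1 + x) - 2 * x / (2 + x)"
  proof (rule DERIV_nonneg_imp_nondecreasing[OF x])
    fix z :: real assume z: "0 \<le> z" "z \<le> x"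
    have "((\<lambda>x. ln (1 + x) - 2 * x / (2 + x)) has_real_derivative 1 / (1 + z) - (2 * (2 + z) - 2 * z) / ((2 + z) * (2 + z))) (at z)"
      using z by (auto intro!: derivative_eq_intros)
    moreover have "1 / (1 + z) - (2 * (2 + z) - 2 * z) / ((2 + z) * (2 + z)) = z\<^sup>2 / ((1 + z) * (2 + z)\<^sup>2)"
      using z by (simp add: divide_simps power2_eq_square) (simp add: algebra_simps)
    ultimately have "((\<lambda>x. ln (1 + x) - 2 * x / (2 + x)) has_real_derivative z\<^sup>2 / ((1 + z) * (2 + z)\<^sup>2)) (at z)" by (simp only:)
    then show "\<exists>D. ((\<lambda>x. ln (1 + x) - 2 * x / (2 + x)) has_real_derivative D) (at z) \<and> 0 \<le> D" using z by fastforce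
  qed
  then show "2 * x / (2 + x) \<le> ln (1 + x)" by simp
  have "0 * (2 + 0) / (2 * (1 + 0)) - ln (1 + 0) \<le> x * (2 + x) / (2 * (1 + x)) - ln (1 + x)"
  proof (rule DERIV_nonneg_imp_nondecreasing[OF x])
    fix z :: real assume z: "0 \<le> z" "z \<le> x"
    have "((\<lambda>x. x * (2 + x) / (2 * (1 + x)) - ln (1 + x)) has_real_derivative
        ((2 + z + z) * (2 * (1 + z)) - z * (2 + z) * 2) / ((2 * (1 + z)) * (2 * (1 + z))) - 1 / (1 + z)) (at z)"
      using z by (auto intro!: derivative_eq_intros)
    moreover have "((2 + z + z) * (2 * (1 + z)) - z * (2 + z) * 2) / ((2 * (1 + z)) * (2 * (1 + z))) - 1 / (1 + z) = z\<^sup>2 / (2 * (1 + z)\<^sup>2)"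
      using z by (simp add: divide_simps power2_eq_square) (simp add: algebra_simps)
    ultimately have "((\<lambda>x. x * (2 + x) / (2 * (1 + x)) - ln (1 + x)) has_real_derivative z\<^sup>2 / (2 * (1 + z)\<^sup>2)) (at z)" by (simp only:)
    then show "\<exists>D. ((\<lambda>x. x * (2 + x) / (2 * (1 + x)) - ln (1 + x)) has_real_derivative D) (at z) \<and> 0 \<le> D" using z by fastforce
  qed
  then show "ln (1 + x) \<le> x * (2 + x) / (2 * (1 + x))" by simp
qed

text \<open>Converges to \<open>ln (2 \<pi>) / 2\<close>.\<close>

definition stirling_defect :: "nat \<Rightarrow> real" where
  "stirling_defect k = ln (fact k) - (real k + 1/2) * ln (real k) + real k"

text \<open>The bounds of \<open>ln_one_plus_bounds\<close> at 1/k show that the defect decreases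
  while the defect minus 1/(4k) increases; one computed value therefore brackets all later
  ones.\<close>

lemma stirling_defect_step:
  assumes k: "1 \<le> k"
  shows "stirling_defect (Suc k) \<le> stirling_defect k"
    "stirling_defect k - 1 / (4 * real k) \<le> stirling_defect (Suc k) - 1 / (4 * real (Suc k))"
proof -
  have "real (Suc k) = real k * (1 + 1 / real k)" using k by (simp add: field_simps)
  moreover have "1 + 1 / real k > 0" using k by (simp add: add_pos_nonneg)
  ultimately have l: "ln (real (Suc k)) = ln (real k) + ln (1 + 1 / real k)"
    using k ln_mult_pos[of "real k" "1 + 1 / real k"] by (metis of_nat_0_less_iff less_le_trans zero_less_one)
  have "ln (fact (Suc k) :: real) = ln (real (Suc k)) + ln (fact k)" by (simp add: ln_mult del: of_nat_Suc)
  then have eq: "stirling_defect (Suc k) - stirling_defect k = 1 - (real k + 1/2) * ln (1 + 1 / real k)"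
    unfolding stirling_defect_def l by (simp add: algebra_simps)
  have b: "2 / (2 * real k + 1) \<le> ln (1 + 1 / real k)" "ln (1 + 1 / real k) \<le> (2 * real k + 1) / (2 * real k * (real k + 1))"
  proof -
    have e: "2 * (1 / K) / (2 + 1 / K) = 2 / (2 * K + 1)" "1 / K * (2 + 1 / K) / (2 * (1 + 1 / K)) = (2 * K + 1) / (2 * K * (K + 1))"
      if "0 < K" for K :: real using that by (simp_all add: divide_simps)
    have k0: "0 < real k" "0 \<le> 1 / real k" using k by simp_all
    show "2 / (2 * real k + 1) \<le> ln (1 + 1 / real k)" "ln (1 + 1 / real k) \<le> (2 * real k + 1) / (2 * real k * (real k + 1))"
      using ln_one_plus_bounds[OF k0(2)] unfolding e[OF k0(1)] .
  qed
  have "(real k + 1/2) * (2 / (2 * real k + 1)) \<le> (real k + 1/2) * ln (1 + 1 / real k)"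
    using b(1) by (intro mult_left_mono) auto
  moreover have "(real k + 1/2) * (2 / (2 * real k + 1)) = 1" using k by (simp add: field_simps)
  ultimately show "stirling_defect (Suc k) \<le> stirling_defect k" using eq by linarith
  have "(real k + 1/2) * ln (1 + 1 / real k) \<le> (real k + 1/2) * ((2 * real k + 1) / (2 * real k * (real k + 1)))"
    using b(2) by (intro mult_left_mono) auto
  also have "\<dots> = 1 + 1 / (4 * real k) - 1 / (4 * real (Suc k))" using k by (simp add: divide_simps) (simp add: algebra_simps)
  finally show "stirling_defect k - 1 / (4 * real k) \<le> stirling_defect (Suc k) - 1 / (4 * real (Suc k))" using eq by linarith
qed

lemma exp_1_ge: "27182818 / 10000000 \<le> exp (1 :: real)"
proof -
  have "inverse (2 ^ 32) = (1 / 4294967296 :: real)" by simp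
  then have "\<bar>exp 1 - 5837465777 / 2147483648\<bar> \<le> (1 / 4294967296 :: real)" using e_approx_32 by (simp only:)
  then show ?thesis by linarith
qed

text \<open>Five terms of the series of 2 artanh y, where (1 + y) / (1 - y) = x.\<close>

lemma ln_ge_rational:
  fixes x y :: real
  assumes "1 < x" "y = (x - 1) / (x + 1)"
  shows "2 * y + 2 / 3 * y ^ 3 + 2 / 5 * y ^ 5 + 2 / 7 * y ^ 7 + 2 / 9 * y ^ 9 \<le> ln x"
  using ln_approx_bounds[OF assms(1), of 5] unfolding assms(2)[symmetric] Let_def
  by (simp add: eval_nat_numeral)

lemma ln_2_bounds: "693144 / 1000000 \<le> ln (2 :: real)" "ln (2 :: real) \<le> 6934 / 10000"
proof -
  show "693144 / 1000000 \<le> ln (2 :: real)"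
    using ln_ge_rational[of 2 "1/3"] by (simp add: power_divide)
  show "ln (2 :: real) \<le> 6934 / 10000"
    using ln_approx_bounds[of 2 3, simplified, simplified eval_nat_numeral, simplified] by (simp add: power_divide)
qed

lemma stirling_defect_bounds:
  "stirling_defect 1 = 1" "2 \<le> k \<Longrightarrow> stirling_defect k \<le> 9605 / 10000" "2 \<le> k \<Longrightarrow> 834 / 1000 \<le> stirling_defect k"
proof -
  show "stirling_defect 1 = 1" by (simp add: stirling_defect_def)
  \<comment> \<open>Both bounds start from k = 2, where the defect is about 0.9603; starting from k
    = 1 would not reach the stated constants.\<close>
  have s2: "stirling_defect 2 = 2 - 3/2 * ln 2" by (simp add: stirling_defect_def fact_numeral algebra_simps)
  have u: "stirling_defect k \<le> stirling_defect 2 \<and> stirling_defect 2 - 1/8 \<le> stirling_defect k - 1 / (4 * real k)" if "2 \<le> k" for k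
    using that
  proof (induction k rule: dec_induct)
    case (step k)
    then show ?case using stirling_defect_step[of k] by fastforce
  qed simp
  show "stirling_defect k \<le> 9605 / 10000" if "2 \<le> k" using conjunct1[OF u[OF that]] ln_2_bounds unfolding s2 by linarith
  have h: "834 / 1000 \<le> e" if "0 \<le> y" "2 - 3/2 * ln 2 - 1/8 \<le> e - y" for e y :: real
    using that ln_2_bounds by argo
  show "834 / 1000 \<le> stirling_defect k" if "2 \<le> k" by (rule h[OF _ conjunct2[OF u[OF that], unfolded s2]]) simp
qed

lemma ln_tangent: "0 < x \<Longrightarrow> ln x \<le> a - 1 + x * exp (- a)" for x a :: real
proof -
  assume x: "0 < x"
  have "ln (x * exp (- a)) \<le> x * exp (- a) - 1" using x by (intro ln_le_minus_one) simp
  then show ?thesis using x by (simp add: ln_mult)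
qed

text \<open>Squaring removes the half-integer exponent, so a rational lower bound for e is
  enough.\<close>

lemma exp_neg_bound:
  assumes "0 < (y :: real)" "1 \<le> y ^ 2 * (27182818 / 10000000) ^ a"
  shows "exp (- (real a / 2)) \<le> y"
proof -
  have "(27182818 / 10000000 :: real) ^ a \<le> exp 1 ^ a" by (intro power_mono exp_1_ge) auto
  also have "\<dots> = exp (real a)" by (simp flip: exp_of_nat_mult)
  finally have "(27182818 / 10000000) ^ a \<le> exp (real a)" .
  from mult_left_mono[OF this, of "y\<^sup>2"] have "1 \<le> y\<^sup>2 * exp (real a)"
    using assms(2) by (meson order_trans zero_le_power2)
  then have "exp (- real a) \<le> y\<^sup>2" by (simp add: exp_minus field_simps)
  moreover have "exp (- real a) = (exp (- (real a / 2)))\<^sup>2" by (simp flip: exp_double)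
  ultimately have "(exp (- (real a / 2)))\<^sup>2 \<le> y\<^sup>2" by simp
  then show ?thesis by (rule power2_le_imp_le) (use assms(1) in simp)
qed

text \<open>Tangents to ln at e^(3/2), e^2 and e^(5/2) serve the three ranges of n, on each of which
  n^2 is compared with a linear function. The quadratic on the right is the slack left at the end of
  \<open>volC_le_cap_product\<close>.\<close>

lemma ln_le_quadratic:
  assumes n: "2 \<le> n"
  shows "2 * real n * ln (real n) \<le> 208 / 1000 * (real n)\<^sup>2 + 29236 / 10000 * real n - 2862 / 1000"
proof -
  have e: "exp (- (3 / 2)) \<le> ((22315 / 100000) :: real)" "exp (- 2) \<le> ((13534 / 100000) :: real)" "exp (- (5 / 2)) \<le> ((821 / 10000) :: real)"
    using exp_neg_bound[of "(22315 / 100000)" 3] exp_neg_bound[of "(13534 / 100000)" 4] exp_neg_bound[of "(821 / 10000)" 5] by (simp_all add: power_divide)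
  let ?x = "real n"
  have x: "2 \<le> ?x" using n by simp
  have tang: "2 * ?x * ln ?x \<le> 2 * (a - 1) * ?x + 2 * y * ?x\<^sup>2" if "exp (- a) \<le> y" for a y
  proof -
    have "ln ?x \<le> a - 1 + ?x * y"
      using ln_tangent[of ?x a] mult_left_mono[OF that, of ?x] x by linarith
    then have "2 * ?x * ln ?x \<le> 2 * ?x * (a - 1 + ?x * y)" using x by (intro mult_left_mono) auto
    then show ?thesis by (simp add: algebra_simps power2_eq_square)
  qed
  consider "n \<le> 5" | "5 \<le> n" "n \<le> 10" | "10 \<le> n" by linarith
  then show ?thesis
  proof cases
    case 1
    have "2 * ?x * ln ?x \<le> ?x + 4463 / 10000 * ?x\<^sup>2" using tang[OF e(1)] by simp
    moreover have "0 \<le> (?x - 2) * (5 - ?x)" using x 1 by simp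
    then have "?x\<^sup>2 \<le> 7 * ?x - 10" by (simp add: algebra_simps power2_eq_square)
    ultimately show ?thesis using x by linarith
  next
    case 2
    have "2 * ?x * ln ?x \<le> 2 * ?x + 27068 / 100000 * ?x\<^sup>2" using tang[OF e(2)] by simp
    moreover have "0 \<le> (?x - 5) * (10 - ?x)" using 2 by simp
    then have "?x\<^sup>2 \<le> 15 * ?x - 50" by (simp add: algebra_simps power2_eq_square)
    moreover have "5 \<le> ?x" "?x \<le> 10" using 2 by auto
    ultimately show ?thesis by linarith
  next
    case 3
    have "2 * ?x * ln ?x \<le> 3 * ?x + 1642 / 10000 * ?x\<^sup>2" using tang[OF e(3)] by simp
    moreover have "0 \<le> (?x - 10) * ?x" using 3 by simp
    then have "10 * ?x \<le> ?x\<^sup>2" by (simp add: algebra_simps power2_eq_square)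
    moreover have "10 \<le> ?x" using 3 by auto
    ultimately show ?thesis by linarith
  qed
qed

lemma sum_squares_weighted: "6 * (\<Sum>k=1..n. (real k)\<^sup>2 * (2 * real k - 1)) = real n * (real n + 1) * (3 * (real n)\<^sup>2 + real n - 1)"
proof (induction n)
  case (Suc n)
  have "6 * (\<Sum>k=1..Suc n. (real k)\<^sup>2 * (2 * real k - 1))
    = 6 * (\<Sum>k=1..n. (real k)\<^sup>2 * (2 * real k - 1)) + 6 * ((real n + 1)\<^sup>2 * (2 * (real n + 1) - 1))"
    by (simp add: algebra_simps)
  then show ?case unfolding Suc.IH by (simp add: algebra_simps power2_eq_square)
qed simp

lemma sum_odd_numbers: "(\<Sum>k=1..n. 2 * real k - 1) = (real n)\<^sup>2"
proof (induction n)
  case (Suc n)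
  then show ?case by (simp add: power2_eq_square algebra_simps)
qed simp

text \<open>With u = 2 k - 1, the estimate ln (2 k / u) \<le> 1 / u replaces u ln u by u ln (2 k),
  and the Stirling form of k! then cancels all terms in ln k. This sets the radii of the caps
  against the factorials in \<open>volC\<close>, two sums that both grow like n^2 ln n.\<close>

lemma superfactorial_ratio:
  assumes k: "1 \<le> k"
  shows "(2 * real k - 1) * ln 2 + (2 * real k - 1) - 2 * stirling_defect k
    \<le> (2 * real k - 1) * ln (2 * real k - 1) - 2 * (ln (fact k) - ln (real k))"
proof -
  define u where "u = 2 * real k - 1"
  have u: "1 \<le> u" using k by (simp add: u_def)
  have kk: "real k = (1 + u) / 2" by (simp add: u_def)
  have "ln (2 * real k / u) \<le> 2 * real k / u - 1" using u k by (intro ln_le_minus_one) auto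
  also have "2 * real k / u - 1 = 1 / u" using u by (simp add: kk field_simps)
  finally have "ln (2 * real k) - ln u \<le> 1 / u" using u k by (simp add: ln_divide_pos)
  then have "u * (ln (2 * real k) - ln u) \<le> u * (1 / u)" using u by (intro mult_left_mono) auto
  then have "u * ln (2 * real k) - 1 \<le> u * ln u" using u by (simp add: right_diff_distrib)
  moreover have "ln (2 * real k) = ln 2 + ln (real k)" using k by (simp add: ln_mult_pos)
  ultimately have 1: "u * ln 2 + u * ln (real k) - 1 \<le> u * ln u" by (simp add: distrib_left)
  have "2 * stirling_defect k = 2 * ln (fact k) - (u * ln (real k) + 2 * ln (real k)) + u + 1"
    by (simp add: stirling_defect_def u_def algebra_simps)
  then show ?thesis using 1 unfolding u_def[symmetric] right_diff_distrib[of 2] by linarith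
qed

text \<open>Replacing sin by the identity bounds the integral by a^d / d, where a is at most 0.06925
  sqrt (36 n + 21). The power of the square root cancels the one in the denominator of
  \<open>volC\<close>, and d/2 is absorbed into the Gamma function.\<close>

lemma volC_le:
  assumes n: "1 \<le> n"
  defines "d \<equiv> n\<^sup>2 + 2 * n"
  shows "volC n \<le> 2 ^ (n\<^sup>2 + n) * pi powr (real n / 2) * (\<Prod>k=1..n-1. fact k) * (277 / 4000) ^ d / Gamma (real d / 2 + 1)"
proof -
  define s where "s = sqrt (36 * real n + 21)"
  define a where "a = min (0.06925 * s) pi"
  define K where "K = 2 ^ (n\<^sup>2 + n + 1) * pi powr (real n / 2) * (\<Prod>k=1..n-1. fact k :: real)"
  have K: "0 \<le> K" unfolding K_def by (intro mult_nonneg_nonneg prod_nonneg) auto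
  have s: "0 < s" by (simp add: s_def)
  have a: "0 \<le> a" "a \<le> pi" "a \<le> 277 / 4000 * s" using s by (auto simp: a_def)
  have d: "1 \<le> d" using n by (simp add: d_def)
  have rd: "real d = real n ^ 2 + 2 * real n" by (simp add: d_def)
  have "integral {0..a} (\<lambda>\<rho>. sin \<rho> ^ (d - 1)) \<le> integral {0..a} (\<lambda>\<rho>. \<rho> ^ (d - 1))"
  proof (rule integral_le)
    show "sin x ^ (d - 1) \<le> x ^ (d - 1)" if "x \<in> {0..a}" for x
      using that a by (intro power_mono sin_x_le_x sin_ge_zero) auto
  qed (auto intro!: integrable_continuous_interval continuous_intros)
  also have "\<dots> = a ^ d / real d"
  proof -
    have "((\<lambda>\<rho>. \<rho> ^ (d - 1)) has_integral a ^ d / real d - 0 ^ d / real d) {0..a}"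
    proof (rule fundamental_theorem_of_calculus[OF a(1)])
      fix x :: real
      have "((\<lambda>x. x ^ d / real d) has_real_derivative x ^ (d - 1)) (at x within {0..a})"
        using d by (auto intro!: derivative_eq_intros)
      then show "((\<lambda>x. x ^ d / real d) has_vector_derivative x ^ (d - 1)) (at x within {0..a})"
        by (rule has_real_derivative_iff_has_vector_derivative[THEN iffD1])
    qed
    then show ?thesis using d by (simp add: integral_unique)
  qed
  also have "\<dots> \<le> (277 / 4000 * s) ^ d / real d" using a by (intro divide_right_mono power_mono) auto
  finally have i: "integral {0..a} (\<lambda>\<rho>. sin \<rho> ^ (d - 1)) \<le> (277 / 4000 * s) ^ d / real d" .
  have pw: "(36 * real n + 21) powr (real d / 2) = s ^ d"
  proof -
    have "(36 * real n + 21) powr (real d / 2) = ((36 * real n + 21) powr (1 / 2)) powr real d" by (simp add: powr_powr)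
    also have "\<dots> = s ^ d" using s by (simp add: powr_half_sqrt s_def powr_realpow)
    finally show ?thesis .
  qed
  have nn: "real d / 2 \<notin> \<int>\<^sub>\<le>\<^sub>0" using nonpos_Ints_nonpos[of "real d / 2"] d by force
  have G: "0 < Gamma (real d / 2)" "Gamma (real d / 2 + 1) = real d / 2 * Gamma (real d / 2)"
    using d Gamma_plus1[OF nn] by (auto intro: Gamma_real_pos)
  have "volC n = K / (s ^ d * Gamma (real d / 2)) * integral {0..a} (\<lambda>\<rho>. sin \<rho> ^ (d - 1))"
    using pw unfolding volC_def K_def a_def s_def d_def by simp
  also have "\<dots> \<le> K / (s ^ d * Gamma (real d / 2)) * ((277 / 4000 * s) ^ d / real d)"
    using i K s G by (intro mult_left_mono) auto
  also have "\<dots> = K / 2 * (277 / 4000) ^ d / Gamma (real d / 2 + 1)"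
    using s d G by (simp add: G(2) power_mult_distrib field_simps)
  also have "K / 2 = 2 ^ (n\<^sup>2 + n) * pi powr (real n / 2) * (\<Prod>k=1..n-1. fact k)" by (simp add: K_def)
  finally show ?thesis .
qed

text \<open>The parameters nearly maximize the right-hand side among those admitted by
  \<open>main_packing_parameters\<close>. Both sides are compared after taking logarithms, with every factorial replaced by its
  Stirling approximation.\<close>

lemma volC_le_cap_product:
  fixes n :: nat
  assumes n: "1 \<le> n"
  defines "q \<equiv> 45 / 1000 / (real n + 2)" and "\<sigma> \<equiv> 24 / 1000 / (real n * (real n + 2))"
  shows "volC n \<le> (4 * pi * q) ^ n / fact n * (\<Prod>k=1..n. cap_ratio k (sqrt ((2 * real k - 1) * \<sigma>)))"
proof -
  let ?x = "real n" and ?P = "\<Prod>k=1..n. cap_ratio k (sqrt ((2 * real k - 1) * \<sigma>))"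
  define d where "d = n\<^sup>2 + 2 * n"
  define \<kappa> :: real where "\<kappa> = 277 / 4000"
  define C where "C = 2 ^ (n\<^sup>2 + n) * pi powr (?x / 2) * (\<Prod>k=1..n-1. fact k) * \<kappa> ^ d / Gamma (real d / 2 + 1)"
  have x: "1 \<le> ?x" using n by simp
  have d: "2 \<le> d" "real d = ?x\<^sup>2 + 2 * ?x" using n power_increasing[of 1 2 n] by (auto simp: d_def)
  have q: "0 < q" using x by (simp add: q_def)
  have \<sigma>: "0 < \<sigma>" using x by (simp add: \<sigma>_def)
  have \<kappa>: "0 < \<kappa>" by (simp add: \<kappa>_def)
  have Gp: "0 < Gamma (real d / 2 + 1)" by (intro Gamma_real_pos) simp
  have pp: "0 < (\<Prod>k=1..n-1. fact k :: real)" by (intro prod_pos) simp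
  have Cp: "0 < C" unfolding C_def using Gp pp \<kappa> by simp
  have t: "0 < sqrt ((2 * real k - 1) * \<sigma>)" "sqrt ((2 * real k - 1) * \<sigma>) < 1" if "k \<in> {1..n}" for k
  proof -
    have k: "1 \<le> k" "real k \<le> ?x" using that by auto
    then show "0 < sqrt ((2 * real k - 1) * \<sigma>)" using \<sigma> by simp
    have e: "2 * y * (24 / 1000 / (y * (y + 2))) = 48 / 1000 / (y + 2)" if "1 \<le> y" for y :: real
      using that by ((simp add: divide_simps; fail) | (simp add: divide_simps; simp add: algebra_simps))
    have "(2 * real k - 1) * \<sigma> \<le> (2 * ?x) * \<sigma>" using k \<sigma> by (intro mult_right_mono) auto
    also have "\<dots> = 48 / 1000 / (?x + 2)" unfolding \<sigma>_def by (rule e) (use x in simp)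
    also have "\<dots> < 1" using x by (simp add: field_simps)
    finally show "sqrt ((2 * real k - 1) * \<sigma>) < 1" by simp
  qed
  have cp: "0 < cap_ratio k (sqrt ((2 * real k - 1) * \<sigma>))" if "k \<in> {1..n}" for k
    using ln_cap_ratio_ge(1)[OF t[OF that]] that by simp
  then have Pp: "0 < ?P" by (intro prod_pos) auto
  have lnfact: "ln (fact n :: real) = (\<Sum>k=1..n. ln (real k))"
    unfolding fact_prod of_nat_prod by (rule ln_prod) auto
  have "(\<Sum>k=1..n. (2 * real k - 1) * (ln (2 * real k - 1) + ln \<sigma>) - 2 * ln 4 - 2 * ln (real k) - 4 / 3 * \<sigma> * ((real k)\<^sup>2 * (2 * real k - 1)))
    \<le> (\<Sum>k=1..n. 2 * ln (cap_ratio k (sqrt ((2 * real k - 1) * \<sigma>))))"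
  proof (rule sum_mono)
    fix k assume k: "k \<in> {1..n}"
    define u where "u = (2 * real k - 1)"
    have u: "0 < u" using k by (auto simp: u_def)
    have k1: "1 \<le> k" using k by simp
    have e1: "ln (sqrt (u * \<sigma>)) = (ln u + ln \<sigma>) / 2" using u \<sigma> by (simp add: ln_sqrt ln_mult_pos)
    have e2: "(2 * real k * sqrt (u * \<sigma>))\<^sup>2 / 6 = 2 / 3 * \<sigma> * ((real k)\<^sup>2 * u)"
      using u \<sigma> by (simp add: power_mult_distrib)
    have "u * ((ln u + ln \<sigma>) / 2) - ln 4 - ln (real k) - 2 / 3 * \<sigma> * ((real k)\<^sup>2 * u) \<le> ln (cap_ratio k (sqrt (u * \<sigma>)))"
      using ln_cap_ratio_ge(2)[OF t[OF k] k1] unfolding u_def[symmetric] e1 e2 .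
    moreover have "u * ((ln u + ln \<sigma>) / 2) = u * (ln u + ln \<sigma>) / 2" by simp
    ultimately show "u * (ln u + ln \<sigma>) - 2 * ln 4 - 2 * ln (real k) - 4 / 3 * \<sigma> * ((real k)\<^sup>2 * u)
      \<le> 2 * ln (cap_ratio k (sqrt (u * \<sigma>)))" by linarith
  qed
  also have "(\<Sum>k=1..n. 2 * ln (cap_ratio k (sqrt ((2 * real k - 1) * \<sigma>)))) = 2 * ln ?P"
    using cp by (subst ln_prod) (auto simp: sum_distrib_left less_imp_neq[symmetric])
  also have "(\<Sum>k=1..n. (2 * real k - 1) * (ln (2 * real k - 1) + ln \<sigma>) - 2 * ln 4 - 2 * ln (real k) - 4 / 3 * \<sigma> * ((real k)\<^sup>2 * (2 * real k - 1)))
    = (\<Sum>k=1..n. (2 * real k - 1) * ln (2 * real k - 1)) + ?x\<^sup>2 * ln \<sigma> - ?x * (2 * ln 4) - 2 * ln (fact n)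
      - 4 / 3 * \<sigma> * (\<Sum>k=1..n. (real k)\<^sup>2 * (2 * real k - 1))"
    unfolding lnfact sum_odd_numbers[symmetric]
    by (simp only: distrib_left sum.distrib sum_subtractf sum_distrib_left[symmetric] sum_distrib_right[symmetric] sum_constant card_atLeastAtMost) simp
  finally have P: "(\<Sum>k=1..n. (2 * real k - 1) * ln (2 * real k - 1)) + ?x\<^sup>2 * ln \<sigma> - ?x * (2 * ln 4) - 2 * ln (fact n)
      - 4 / 3 * \<sigma> * (\<Sum>k=1..n. (real k)\<^sup>2 * (2 * real k - 1)) \<le> 2 * ln ?P" .
  have sf: "?x\<^sup>2 * ln 2 + ?x\<^sup>2 - 2 * (\<Sum>k=1..n. stirling_defect k)
    \<le> (\<Sum>k=1..n. (2 * real k - 1) * ln (2 * real k - 1)) - 2 * ((\<Sum>k=1..n. ln (fact k)) - ln (fact n))"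
  proof -
    have "(\<Sum>k=1..n. (2 * real k - 1) * ln 2 + (2 * real k - 1) - 2 * stirling_defect k)
      \<le> (\<Sum>k=1..n. (2 * real k - 1) * ln (2 * real k - 1) - 2 * (ln (fact k) - ln (real k)))"
      by (intro sum_mono superfactorial_ratio) auto
    then show ?thesis unfolding lnfact sum_odd_numbers[symmetric]
      by (simp only: sum.distrib sum_subtractf sum_distrib_left[symmetric] sum_distrib_right[symmetric])
  qed
  \<comment> \<open>The defect is 1 at k = 1 and at most 0.9605 afterwards; the constant 0.0395 is
    the excess of the first term.\<close>
  have sd: "(\<Sum>k=1..n. stirling_defect k) \<le> 9605 / 10000 * ?x + 395 / 10000"
    using n
  proof (induction n rule: dec_induct)
    case (step k)
    have "(\<Sum>k=1..Suc k. stirling_defect k) = (\<Sum>k=1..k. stirling_defect k) + stirling_defect (Suc k)" by simp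
    moreover have "stirling_defect (Suc k) \<le> 9605 / 10000" using step stirling_defect_bounds(2)[of "Suc k"] by simp
    ultimately show ?case using step.IH unfolding of_nat_Suc ring_distribs by linarith
  qed (use stirling_defect_bounds(1) in simp)
  have S: "4 / 3 * \<sigma> * (\<Sum>k=1..n. (real k)\<^sup>2 * (2 * real k - 1)) \<le> 16 / 1000 * ?x\<^sup>2 + 534 / 100000 * ?x"
  proof -
    have e: "2 / 9 * (24 / 1000 / (y * (y + 2))) * (y * (y + 1) * (3 * y\<^sup>2 + y - 1)) = 16 / 3000 * ((y + 1) / (y + 2) * (3 * y\<^sup>2 + y - 1))"
      if "1 \<le> y" for y :: real using that by (simp add: divide_simps)
    have p: "0 \<le> 3 * ?x\<^sup>2 + ?x - 1" using x zero_le_power2[of ?x] by linarith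
    have "4 / 3 * \<sigma> * (\<Sum>k=1..n. (real k)\<^sup>2 * (2 * real k - 1)) = 2 / 9 * \<sigma> * (6 * (\<Sum>k=1..n. (real k)\<^sup>2 * (2 * real k - 1)))" by simp
    also have "\<dots> = 16 / 3000 * ((?x + 1) / (?x + 2) * (3 * ?x\<^sup>2 + ?x - 1))"
      unfolding sum_squares_weighted \<sigma>_def by (rule e[OF x])
    also have "\<dots> \<le> 16 / 3000 * (1 * (3 * ?x\<^sup>2 + ?x - 1))"
      using x p by (intro mult_left_mono mult_right_mono) auto
    finally show ?thesis using x by (simp add: algebra_simps)
  qed
  have lnn: "ln (?x * (?x + 2)) = ln ?x + ln (?x + 2)" using x by (simp add: ln_mult_pos)
  have l\<sigma>: "ln \<sigma> = ln (24 / 1000) - ln ?x - ln (?x + 2)" unfolding \<sigma>_def using x by (subst ln_divide_pos) (auto simp: lnn)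
  have lq: "ln q = ln (45 / 1000) - ln (?x + 2)" unfolding q_def using x by (subst ln_divide_pos) auto
  have ld: "ln (real d) = ln ?x + ln (?x + 2)"
    unfolding lnn[symmetric] d(2) by (simp add: power2_eq_square algebra_simps)
  have lf: "ln (fact n :: real) = stirling_defect n + (?x + 1/2) * ln ?x - ?x" by (simp add: stirling_defect_def)
  have V: "2 * ln ((4 * pi * q) ^ n / fact n * ?P) = 2 * (?x * (ln 4 + ln pi + ln q)) - 2 * ln (fact n) + 2 * ln ?P"
  proof -
    have "ln ((4 * pi * q) ^ n / fact n * ?P) = ln ((4 * pi * q) ^ n / fact n) + ln ?P"
      using q Pp by (intro ln_mult_pos) auto
    also have "ln ((4 * pi * q) ^ n / fact n) = ?x * ln (4 * pi * q) - ln (fact n)"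
      using q by (subst ln_divide_pos) (auto simp: ln_realpow)
    also have "ln (4 * pi * q) = ln 4 + ln pi + ln q" using q by (simp add: ln_mult_pos)
    finally show ?thesis by simp
  qed
  have Cl: "2 * ln C \<le> 2 * (?x\<^sup>2 + ?x) * ln 2 + ?x * ln pi + 2 * ((\<Sum>k=1..n. ln (fact k)) - ln (fact n)) + 2 * (real d * ln \<kappa>)
      - (ln (pi / 2) / 2 + ln (real d) / 2 - real d * ln 2 + (834 / 1000 + (real d + 1/2) * ln (real d) - real d))"
  proof -
    have "ln C = ln (2 ^ (n\<^sup>2 + n) * pi powr (?x / 2) * (\<Prod>k=1..n-1. fact k) * \<kappa> ^ d) - ln (Gamma (real d / 2 + 1))"
      unfolding C_def using pp \<kappa> Gp by (intro ln_divide_pos) auto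
    also have "ln (2 ^ (n\<^sup>2 + n) * pi powr (?x / 2) * (\<Prod>k=1..n-1. fact k) * \<kappa> ^ d)
      = ln (2 ^ (n\<^sup>2 + n) * pi powr (?x / 2) * (\<Prod>k=1..n-1. fact k)) + ln (\<kappa> ^ d)"
      using pp \<kappa> by (intro ln_mult_pos) auto
    also have "ln (2 ^ (n\<^sup>2 + n) * pi powr (?x / 2) * (\<Prod>k=1..n-1. fact k))
      = ln (2 ^ (n\<^sup>2 + n) * pi powr (?x / 2)) + ln (\<Prod>k=1..n-1. fact k :: real)"
      using pp by (intro ln_mult_pos) auto
    also have "ln (2 ^ (n\<^sup>2 + n) * pi powr (?x / 2)) = ln (2 ^ (n\<^sup>2 + n)) + ln (pi powr (?x / 2))"
      by (intro ln_mult_pos) auto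
    also have "ln (2 ^ (n\<^sup>2 + n) :: real) = (?x\<^sup>2 + ?x) * ln 2" by (simp add: ln_realpow)
    also have "ln (pi powr (?x / 2)) = ?x / 2 * ln pi" by (simp add: ln_powr)
    also have "ln (\<Prod>k=1..n-1. fact k :: real) = (\<Sum>k=1..n. ln (fact k)) - ln (fact n)"
      using n by (cases n) (simp_all add: ln_prod)
    also have "ln (\<kappa> ^ d) = real d * ln \<kappa>" using \<kappa> by (simp add: ln_realpow)
    finally have 1: "2 * ln C = 2 * ((?x\<^sup>2 + ?x) * ln 2) + ?x * ln pi + 2 * ((\<Sum>k=1..n. ln (fact k)) - ln (fact n)) + 2 * (real d * ln \<kappa>) - 2 * ln (Gamma (real d / 2 + 1))"
      by simp
    have "ln (pi * (real d / 2)) = ln (pi / 2) + ln (real d)"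
      using d ln_mult_pos[of "pi / 2" "real d"] by simp
    moreover have "834 / 1000 + (real d + 1/2) * ln (real d) - real d \<le> ln (fact d)"
      using stirling_defect_bounds(3)[OF d(1)] by (simp add: stirling_defect_def)
    moreover have "c \<le> 2 * (S * L) + XP + 2 * W + 2 * K - (p / 2 + q / 2 - DL + F)"
      if "c = 2 * (S * L) + XP + 2 * W + 2 * K - 2 * G" "e = p + q" "F \<le> f" "e / 2 - DL + f \<le> 2 * G"
      for c S L XP W K p q DL F G e f :: real
      using that by argo
    ultimately show ?thesis using 1 Gamma_half_nat_ge[of d] d unfolding mult.assoc[of 2] by (meson order_trans one_le_numeral)
  qed
  \<comment> \<open>A and B collect the constant logarithms in the coefficients of n^2 and n that
    remain after the cancellation of the factorials and of the leading terms in ln n and ln (n +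
    2).\<close>
  define A where "A = ln (24 / 1000) - 2 * ln 2 - 2 * ln \<kappa>"
  define B where "B = ln pi + 2 * ln (45 / 1000) - 4 * ln 2 - 4 * ln \<kappa>"
  have A: "28 / 125 \<le> A"
  proof -
    have "28 / 125 \<le> ln (2400000 / 1918225 :: real)" using ln_ge_rational[of "2400000 / 1918225" "19271 / 172729"] by (simp add: power_divide)
    also have "2400000 / 1918225 = (24 / 1000) / (2 ^ 2 * \<kappa> ^ 2)" by (simp add: \<kappa>_def power_divide)
    also have "ln \<dots> = A"
    proof -
      have "ln (a / (b ^ 2 * c ^ 2)) = ln a - 2 * ln b - 2 * ln c" if "0 < a" "0 < b" "0 < c" for a b c :: real
        using that by (simp add: ln_divide_pos ln_mult_pos ln_realpow)
      then show ?thesis unfolding A_def using \<kappa> by (metis zero_less_divide_iff zero_less_numeral)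
    qed
    finally show ?thesis .
  qed
  have pi: "314159 / 100000 \<le> pi" using pi_approx by simp
  have B: "57 / 20 \<le> B"
  proof -
    let ?z = "pi * (45 / 1000)\<^sup>2 / (2 ^ 4 * \<kappa> ^ 4)"
    \<comment> \<open>The factor 2^4 is split off so that the truncated series is evaluated near 1,
      where it is accurate.\<close>
    have "77424 / 1000000 \<le> ln (108054 / 100000 :: real)" using ln_ge_rational[of "108054 / 100000" "4027 / 104027"] by (simp add: power_divide)
    then have "57 / 20 \<le> 4 * ln 2 + ln (108054 / 100000 :: real)" using ln_2_bounds(1) by linarith
    also have "\<dots> = ln (2 ^ 4 * (108054 / 100000))" using ln_realpow[of "2 :: real" 4] ln_mult_pos[of "2 ^ 4 :: real" "108054 / 100000"] by simp
    also have "\<dots> \<le> ln ?z" using pi by (subst ln_le_cancel_iff) (auto simp: \<kappa>_def power_divide field_simps)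
    also have "\<dots> = B"
    proof -
      have "ln (p * a\<^sup>2 / (b ^ 4 * c ^ 4)) = ln p + 2 * ln a - 4 * ln b - 4 * ln c" if "0 < p" "0 < a" "0 < b" "0 < c" for p a b c :: real
        using that by (simp add: ln_divide_pos ln_mult_pos ln_realpow)
      then show ?thesis unfolding B_def using \<kappa> by (metis pi_gt_zero zero_less_divide_iff zero_less_numeral)
    qed
    finally show ?thesis .
  qed
  have p2: "9 / 20 \<le> ln (pi / 2)"
  proof -
    have "9 / 20 \<le> ln ((314159 / 200000) :: real)" using ln_ge_rational[of "314159 / 200000" "114159 / 514159"] by (simp add: power_divide)
    also have "\<dots> \<le> ln (pi / 2)" using pi by (subst ln_le_cancel_iff) auto
    finally show ?thesis by simp
  qed
  have ln4: "ln (4 :: real) = 2 * ln 2" using ln_realpow[of "2 :: real" 2] by simp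
  \<comment> \<open>An identity with all logarithms as variables. Substituting for D and F cancels
    the terms n^2 ln n and n^2 ln (n + 2); only terms of order n ln n remain besides the
    quadratic.\<close>
  have expand: "2 * (X * (2 * L2 + LP + (LQ - L'))) - 2 * F + (T + X\<^sup>2 * (LS - L - L') - X * (2 * (2 * L2)) - 2 * F - SS)
      - (2 * (X\<^sup>2 + X) * L2 + X * LP + 2 * W + 2 * (D * LK)
        - (p / 2 + (L + L') / 2 - D * L2 + (834 / 1000 + (D + 1/2) * (L + L') - D)))
    = (LS - 2 * L2 - 2 * LK) * X\<^sup>2 + (LP + 2 * LQ - 4 * L2 - 4 * LK + 2) * X + L' - (2 * X + 1) * L
      + 834 / 1000 - 4 * a + p / 2 + (T - 2 * W - X\<^sup>2 * L2 - X\<^sup>2) - SS"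
    if "D = X\<^sup>2 + 2 * X" "F = a + (X + 1/2) * L - X" for X L2 LP LQ L L' F T LS SS W D LK p a :: real
    unfolding that by (simp add: field_simps power2_eq_square)
  have main: "(A - 16 / 1000) * ?x\<^sup>2 + (B + 7366 / 100000) * ?x + ln (?x + 2) - (2 * ?x + 1) * ln ?x + 755 / 1000 - 4 * stirling_defect n + ln (pi / 2) / 2
      \<le> 2 * ln ((4 * pi * q) ^ n / fact n * ?P) - 2 * ln C"
  proof -
    let ?T = "\<Sum>k=1..n. (2 * real k - 1) * ln (2 * real k - 1)" and ?W = "(\<Sum>k=1..n. ln (fact k :: real)) - ln (fact n)"
    let ?SS = "4 / 3 * \<sigma> * (\<Sum>k=1..n. (real k)\<^sup>2 * (2 * real k - 1))"
    have "A * ?x\<^sup>2 + (B + 2) * ?x + ln (?x + 2) - (2 * ?x + 1) * ln ?x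
      + 834 / 1000 - 4 * stirling_defect n + ln (pi / 2) / 2 + (?T - 2 * ?W - ?x\<^sup>2 * ln 2 - ?x\<^sup>2) - ?SS
      \<le> 2 * ln ((4 * pi * q) ^ n / fact n * ?P) - 2 * ln C"
      unfolding A_def B_def expand[OF d(2) lf, symmetric]
      using V P Cl unfolding ld l\<sigma> lq ln4 by linarith
    moreover have "- (1921 / 1000 * ?x + 79 / 1000) \<le> ?T - 2 * ?W - ?x\<^sup>2 * ln 2 - ?x\<^sup>2" using sf sd by linarith
    ultimately show ?thesis using S by (simp add: distrib_right left_diff_distrib)
  qed
  have "0 \<le> (A - 16 / 1000) * ?x\<^sup>2 + (B + 7366 / 100000) * ?x + ln (?x + 2) - (2 * ?x + 1) * ln ?x + 755 / 1000 - 4 * stirling_defect n + ln (pi / 2) / 2"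
  proof -
    have AA: "208 / 1000 * ?x\<^sup>2 \<le> (A - 16 / 1000) * ?x\<^sup>2" using A by (intro mult_right_mono) auto
    have BB: "292366 / 100000 * ?x \<le> (B + 7366 / 100000) * ?x" using B by (intro mult_right_mono) auto
    have l0: "ln ?x \<le> ln (?x + 2)" using x by simp
    \<comment> \<open>For n = 1 the defect is 1 and ln n = 0, which lies outside the range of
      \<open>stirling_defect_bounds(2)\<close> and \<open>ln_le_quadratic\<close>.\<close>
    consider "n = 1" | "2 \<le> n" using n by linarith
    then show ?thesis
    proof cases
      case 1
      then have "?x = 1" "?x\<^sup>2 = 1" "(2 * ?x + 1) * ln ?x = 0" "stirling_defect n = 1" "0 \<le> ln (?x + 2)"
        using stirling_defect_bounds(1) by simp_all
      then show ?thesis using AA BB p2 by linarith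
    next
      case 2
      have "(2 * ?x + 1) * ln ?x = 2 * ?x * ln ?x + ln ?x" by (simp add: distrib_right)
      then show ?thesis using AA BB l0 p2 stirling_defect_bounds(2)[OF 2] ln_le_quadratic[OF 2] x by linarith
    qed
  qed
  with main have "ln C \<le> ln ((4 * pi * q) ^ n / fact n * ?P)" by linarith
  then have "C \<le> (4 * pi * q) ^ n / fact n * ?P" using Cp q Pp by (subst (asm) ln_le_cancel_iff) auto
  moreover have "volC n \<le> C" using volC_le[OF n] by (simp add: C_def d_def \<kappa>_def)
  ultimately show ?thesis by linarith
qed

section \<open>Invariance of the volume\<close>

text \<open>The change of variables theorem is only available on \<open>real ^ 'm\<close>; the index type \<open>'n bit0\<close> has twice
  the size of \<open>'n\<close> and a well-order.\<close>

definition basis_index :: "complex ^ 'n \<Rightarrow> 'n bit0" where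
  "basis_index = (SOME \<pi>. bij_betw \<pi> Basis UNIV)"

lemma basis_index: "bij_betw (basis_index :: complex ^ 'n \<Rightarrow> 'n bit0) Basis UNIV"
proof -
  have "card (Basis :: (complex ^ 'n) set) = CARD('n bit0)" by simp
  then have "\<exists>\<pi>. bij_betw \<pi> (Basis :: (complex ^ 'n) set) (UNIV :: 'n bit0 set)"
    by (intro finite_same_card_bij) auto
  then show ?thesis unfolding basis_index_def by (rule someI_ex)
qed

definition to_real :: "complex ^ 'n \<Rightarrow> real ^ 'n bit0" where
  "to_real x = (\<chi> j. x \<bullet> inv_into Basis basis_index j)"

definition of_real_vec :: "real ^ 'n bit0 \<Rightarrow> complex ^ 'n" where
  "of_real_vec y = (\<Sum>b\<in>Basis. (y $ basis_index b) *\<^sub>R b)"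

lemma to_real_index: "b \<in> Basis \<Longrightarrow> to_real x $ basis_index b = x \<bullet> b"
  by (simp add: to_real_def bij_betw_inv_into_left[OF basis_index])

lemma basis_index_cases: obtains b :: "complex ^ 'n" where "b \<in> Basis" "j = basis_index b"
  using basis_index by (metis UNIV_I bij_betw_def imageE)

lemma of_real_vec_inner: "b \<in> Basis \<Longrightarrow> of_real_vec y \<bullet> b = y $ basis_index b"
  by (simp add: of_real_vec_def inner_sum_left_Basis)

lemma of_real_vec_to_real [simp]: "of_real_vec (to_real x) = x"
  by (rule euclidean_eqI) (simp add: of_real_vec_inner to_real_index)

lemma to_real_of_real_vec [simp]: "to_real (of_real_vec y) = y"
proof (rule vec_eq_iff[THEN iffD2], rule allI)
  fix j
  obtain b :: "complex ^ 'a" where "b \<in> Basis" "j = basis_index b" by (rule basis_index_cases)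
  then show "to_real (of_real_vec y) $ j = y $ j" by (simp add: to_real_index of_real_vec_inner)
qed

lemma linear_to_real: "linear to_real"
  by (rule linearI) (simp_all add: to_real_def vec_eq_iff inner_add_left)

lemma linear_of_real_vec: "linear of_real_vec"
  by (rule linearI) (simp_all add: of_real_vec_def scaleR_left_distrib sum.distrib scaleR_sum_right)

lemma norm_to_real [simp]: "norm (to_real x) = norm x"
proof -
  have "to_real x \<bullet> to_real x = (\<Sum>j\<in>UNIV. (to_real x $ j)\<^sup>2)" by (simp add: inner_vec_def power2_eq_square)
  also have "\<dots> = (\<Sum>b\<in>Basis. (to_real x $ basis_index b)\<^sup>2)" by (rule sum.reindex_bij_betw[OF basis_index, symmetric])
  also have "\<dots> = x \<bullet> x" by (simp add: to_real_index euclidean_inner[of x x] power2_eq_square)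
  finally show ?thesis by (simp add: norm_eq_sqrt_inner)
qed

lemma norm_of_real_vec [simp]: "norm (of_real_vec y) = norm y"
  using norm_to_real[of "of_real_vec y"] by simp

lemma measurable_of_real_vec [measurable]: "of_real_vec \<in> borel_measurable borel"
  by (intro borel_measurable_continuous_onI linear_continuous_on linear_of_real_vec[THEN linear_conv_bounded_linear[THEN iffD1]])

text \<open>A relabelling of real coordinates maps boxes to boxes of the same volume, which
  determines the measure.\<close>

lemma lborel_of_real_vec: "lborel = distr lborel borel (of_real_vec :: real ^ 'n bit0 \<Rightarrow> complex ^ 'n)"
proof (rule lborel_eqI)
  fix l u :: "complex ^ 'n" assume lu: "\<And>b. b \<in> Basis \<Longrightarrow> l \<bullet> b \<le> u \<bullet> b"
  have le: "to_real l $ j \<le> to_real u $ j" for j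
    by (rule basis_index_cases[of j]) (use lu in \<open>simp add: to_real_index\<close>)
  have inj: "inj_on (\<lambda>j. axis j (1 :: real)) (UNIV :: 'n bit0 set)" by (simp add: inj_on_def axis_eq_axis)
  have B: "(Basis :: (real ^ 'n bit0) set) = range (\<lambda>j. axis j 1)" by (auto simp: Basis_vec_def)
  have box: "of_real_vec -` box l u = box (to_real l) (to_real u)"
  proof (rule set_eqI)
    fix y
    have "(\<forall>b\<in>Basis. l \<bullet> b < y $ basis_index b \<and> y $ basis_index b < u \<bullet> b) \<longleftrightarrow> (\<forall>j. to_real l $ j < y $ j \<and> y $ j < to_real u $ j)"
      by (metis basis_index_cases to_real_index)
    then show "y \<in> of_real_vec -` box l u \<longleftrightarrow> y \<in> box (to_real l) (to_real u)"
      by (simp add: mem_box_cart(1)) (simp add: mem_box(1) of_real_vec_inner)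
  qed
  have "emeasure (distr lborel borel of_real_vec) (box l u) = emeasure lborel (box (to_real l) (to_real u))"
    by (subst emeasure_distr) (auto simp: box)
  also have "\<dots> = (\<Prod>b\<in>Basis. (to_real u - to_real l) \<bullet> b)"
    using le by (intro emeasure_lborel_box) (auto simp: B inner_axis)
  also have "(\<Prod>b\<in>Basis. (to_real u - to_real l) \<bullet> b) = (\<Prod>j\<in>UNIV. to_real u $ j - to_real l $ j)"
    unfolding B by (subst prod.reindex[OF inj]) (simp add: inner_axis)
  also have "\<dots> = (\<Prod>b\<in>Basis. to_real u $ basis_index b - to_real l $ basis_index b)"
    by (rule prod.reindex_bij_betw[OF basis_index, symmetric])
  also have "\<dots> = (\<Prod>b\<in>Basis. (u - l) \<bullet> b)" by (simp add: to_real_index inner_diff_left)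
  finally show "emeasure (distr lborel borel of_real_vec) (box l u) = (\<Prod>b\<in>Basis. (u - l) \<bullet> b)" .
qed simp

section \<open>Jacobian determinants of the action\<close>

definition real_det :: "(complex ^ 'n \<Rightarrow> complex ^ 'n) \<Rightarrow> real" where
  "real_det L = \<bar>det (matrix (to_real \<circ> L \<circ> of_real_vec))\<bar>"

lemma linear_conj_real: "linear L \<Longrightarrow> linear (to_real \<circ> L \<circ> of_real_vec)"
  by (intro linear_compose linear_to_real linear_of_real_vec)

lemma real_det_mult:
  assumes "linear L" "linear K"
  shows "real_det (L \<circ> K) = real_det L * real_det K"
proof -
  have "to_real \<circ> (L \<circ> K) \<circ> of_real_vec = (to_real \<circ> L \<circ> of_real_vec) \<circ> (to_real \<circ> K \<circ> of_real_vec)" by (auto simp: fun_eq_iff)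
  then show ?thesis using matrix_compose[OF linear_conj_real[OF assms(2)] linear_conj_real[OF assms(1)]]
    by (simp add: real_det_def det_mul abs_mult)
qed

lemma real_det_isometry:
  assumes "linear L" "\<And>x. norm (L x) = norm x"
  shows "real_det L = 1"
  unfolding real_det_def
  by (rule orthogonal_transformation_det)
    (use assms linear_conj_real[OF assms(1)] in \<open>simp add: orthogonal_transformation\<close>)

lemma real_det_diagonal:
  fixes L :: "complex ^ 'n \<Rightarrow> complex ^ 'n"
  assumes "\<And>b. b \<in> Basis \<Longrightarrow> L b = \<mu> b *\<^sub>R b"
  shows "real_det L = \<bar>\<Prod>b\<in>Basis. \<mu> b\<bar>"
proof -
  let ?M = "matrix (to_real \<circ> L \<circ> of_real_vec)"
  have ax: "of_real_vec (axis (basis_index b) 1) = b" if "b \<in> Basis" for b :: "complex ^ 'n"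
  proof (rule euclidean_eqI)
    fix c :: "complex ^ 'n" assume c: "c \<in> Basis"
    then have "basis_index c = basis_index b \<longleftrightarrow> c = b" using that inj_on_eq_iff[OF bij_betw_imp_inj_on[OF basis_index]] by blast
    then show "of_real_vec (axis (basis_index b) 1) \<bullet> c = b \<bullet> c"
      using c that by (auto simp: of_real_vec_inner axis_def inner_Basis)
  qed
  have ent: "?M $ basis_index b $ basis_index c = (if b = c then \<mu> b else 0)" if "b \<in> Basis" "c \<in> Basis" for b c
    using that assms[OF that(2)] ax[OF that(2)] by (auto simp: matrix_def to_real_index inner_Basis)
  have "det ?M = (\<Prod>i\<in>UNIV. ?M $ i $ i)"
  proof (rule det_diagonal)
    fix i j :: "'n bit0" assume ij: "i \<noteq> j"
    obtain b :: "complex ^ 'n" where b: "b \<in> Basis" "i = basis_index b" by (rule basis_index_cases)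
    obtain c :: "complex ^ 'n" where c: "c \<in> Basis" "j = basis_index c" by (rule basis_index_cases)
    show "?M $ i $ j = 0" using ent[OF b(1) c(1)] b c ij by auto
  qed
  also have "\<dots> = (\<Prod>b\<in>Basis. ?M $ basis_index b $ basis_index b)" by (rule prod.reindex_bij_betw[OF basis_index, symmetric])
  also have "\<dots> = (\<Prod>b\<in>Basis. \<mu> b)" by (intro prod.cong) (auto simp: ent)
  finally show ?thesis by (simp add: real_det_def)
qed

lemma scaleR_matrix_vector: "(k *\<^sub>R M) *v x = k *\<^sub>R (M *v x)" for M :: "complex ^ 'n ^ 'm"
  by (simp add: matrix_vector_mult_def vec_eq_iff scaleR_sum_right)

lemma act_deriv_Tm_0:
  assumes p: "p \<in> cball_model"
  shows "act_deriv (Tm p) 0 v = (1 / gam p) *\<^sub>R (v - (gam p / (1 + gam p)) *\<^sub>R (herm v p *s p))"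
proof -
  define g where "g = gam p"
  have g: "1 \<le> g" using gam(1)[OF p] by (simp add: g_def)
  have e: "k - g = - (g / (1 + g)) * 1" if "k = g\<^sup>2 / (1 + g)" for k :: real
    using g that by (simp add: field_simps power2_eq_square)
  have o: "outer p p *v v = herm v p *s p"
    by (simp add: matrix_vector_mult_def outer_def herm_def vec_eq_iff sum_distrib_left sum_distrib_right mult_ac)
  have "Tm p *v pv 0 1 = pv (g *\<^sub>R p) (of_real g)" by (simp add: Tm_def bo_def blk_vec g_def)
  moreover have "Tm p *v pv v 0 = pv (v + (g\<^sup>2 / (1 + g)) *\<^sub>R (herm v p *s p)) (of_real g * herm v p)"
    by (simp add: Tm_def bo_def blk_vec g_def matrix_vector_mult_add_rdistrib scaleR_matrix_vector o herm_scaleR_right)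
  ultimately have "act_deriv (Tm p) 0 v = (1 / of_real g) *s (v + (g\<^sup>2 / (1 + g)) *\<^sub>R (herm v p *s p) - (of_real g * herm v p) *s p)"
    unfolding act_deriv_def Let_def act_Tm_0[OF p] by (simp add: pv_def vec_eq_iff) (simp add: scaleR_conv_of_real add_divide_distrib)
  also have "\<dots> = (1 / g) *\<^sub>R (v + (g\<^sup>2 / (1 + g) - g) *\<^sub>R (herm v p *s p))"
    by (simp only: vec_eq_iff vector_smult_component vector_scaleR_component vector_add_component vector_minus_component)
      (simp add: scaleR_conv_of_real algebra_simps)
  also have "g\<^sup>2 / (1 + g) - g = - (g / (1 + g))" using e[OF refl] by simp
  finally show ?thesis unfolding g_def by simp
qed

lemma linear_act_deriv: "un1 A \<Longrightarrow> z \<in> cball_model \<Longrightarrow> linear (act_deriv A z)"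
  using has_derivative_linear[OF act_has_derivative[OF un1_denom]] .

text \<open>In a unitary frame with one axis along p the derivative is diagonal: it contracts by 1 /
  gam^2 along the complex line of p and by 1 / gam in the n - 1 orthogonal complex directions. Each
  factor counts twice over the reals, which gives the exponent 4 + 2 (n - 1).\<close>

lemma real_det_act_deriv_Tm:
  fixes p :: "complex ^ 'n"
  assumes p: "p \<in> cball_model"
  shows "real_det (act_deriv (Tm p) 0) = 1 / gam p ^ (2 * CARD('n) + 2)"
proof -
  define g where "g = gam p"
  have g: "1 \<le> g" "g\<^sup>2 * (1 - (norm p)\<^sup>2) = 1" using gam[OF p] by (simp_all add: g_def)
  define i :: 'n where "i = undefined"
  \<comment> \<open>For p = 0 an arbitrary coordinate axis stands in for the direction of p.\<close>
  define u where "u = (if p = 0 then axis i 1 else (1 / norm p) *\<^sub>R p)"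
  have u: "norm u = 1" "p = norm p *\<^sub>R u" by (auto simp: u_def)
  define V where "V = rot i u"
  have V: "unitary V" "V *v axis i 1 = u" unfolding V_def by (rule rot_unitary[OF u(1)], rule rot_axis[OF u(1)])
  define D where "D v = (1 / g) *\<^sub>R (v - ((g / (1 + g)) * (norm p)\<^sup>2) *\<^sub>R ((v $ i) *s axis i 1))" for v :: "complex ^ 'n"
  have lV: "linear ((*v) V)" using bounded_linear_matrix_vector[of V] by (rule bounded_linear.linear)
  have lD: "linear D"
    by (rule linearI) (simp_all add: D_def vec_eq_iff algebra_simps)
  have hV: "herm (V *v v) u = v $ i" for v
  proof -
    have "herm (V *v v) u = herm (V *v v) (V *v axis i 1)" by (simp only: V(2))
    also have "\<dots> = herm v (axis i 1)" by (simp only: herm_mult_left matrix_vector_mult_assoc' unitaryD[OF V(1)] unitary_adj_cancel[OF V(1)])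
    also have "\<dots> = v $ i" by (simp add: herm_def axis_def if_distrib cong: if_cong)
    finally show ?thesis .
  qed
  have "act_deriv (Tm p) 0 \<circ> ((*v) V) = ((*v) V) \<circ> D"
  proof
    fix v
    have "herm (V *v v) (norm p *\<^sub>R u) = of_real (norm p) * (v $ i)"
      by (simp only: herm_scaleR_right hV)
    then have h: "herm (V *v v) p = of_real (norm p) * (v $ i)" by (simp only: u(2)[symmetric])
    have "herm (V *v v) p *s p = (of_real (norm p) * (v $ i)) *s (norm p *\<^sub>R u)" by (simp only: h u(2)[symmetric])
    also have "\<dots> = (norm p)\<^sup>2 *\<^sub>R ((v $ i) *s u)"
      by (simp only: vec_eq_iff vector_smult_component vector_scaleR_component) (simp add: scaleR_conv_of_real power2_eq_square)
    finally have "herm (V *v v) p *s p = (norm p)\<^sup>2 *\<^sub>R ((v $ i) *s u)" .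
    moreover have "V *v D v = (1 / g) *\<^sub>R (V *v v - ((g / (1 + g)) * (norm p)\<^sup>2) *\<^sub>R ((v $ i) *s u))"
      unfolding D_def by (simp add: matrix_vec_scaleR_right matrix_vector_mult_diff_distrib vector_scalar_commute V(2))
    ultimately show "(act_deriv (Tm p) 0 \<circ> ((*v) V)) v = (((*v) V) \<circ> D) v"
      by (simp add: act_deriv_Tm_0[OF p] g_def[symmetric])
  qed
  then have "real_det (act_deriv (Tm p) 0) * real_det ((*v) V) = real_det ((*v) V) * real_det D"
    by (metis real_det_mult lV lD linear_act_deriv[OF un1_Tm[OF p] zero_in_ball])
  moreover have "real_det ((*v) V) = 1" by (rule real_det_isometry[OF lV]) (simp add: unitary_norm_vec[OF V(1)])
  ultimately have "real_det (act_deriv (Tm p) 0) = real_det D" by simp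
  also have "\<dots> = \<bar>\<Prod>b\<in>Basis. if (b :: complex ^ 'n) $ i = 0 then 1 / g else 1 / g\<^sup>2\<bar>"
  proof (rule real_det_diagonal)
    fix b :: "complex ^ 'n" assume "b \<in> Basis"
    then obtain k c where b: "b = axis k c" "c \<in> Basis" by (auto simp: Basis_vec_def)
    have "c \<noteq> 0" using b(2) by auto
    have "1 - (g / (1 + g)) * (norm p)\<^sup>2 = 1 / g"
    proof -
      have "g\<^sup>2 * (norm p)\<^sup>2 = g\<^sup>2 - 1" using gam(4)[OF p] by (simp add: g_def)
      then have "(norm p)\<^sup>2 = (g\<^sup>2 - 1) / g\<^sup>2" using g(1) by (simp add: field_simps)
      then show ?thesis using g(1) by (simp add: divide_simps power2_eq_square) (simp add: algebra_simps)
    qed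
    moreover have Dk: "(1 / g) *\<^sub>R (c - K *\<^sub>R c) = (1 / g * (1 - K)) *\<^sub>R c" for K
      by (simp only: scaleR_scaleR[symmetric] scaleR_left_diff_distrib scaleR_one)
    moreover have "D b = (1 / g * (if k = i then 1 - (g / (1 + g)) * (norm p)\<^sup>2 else 1)) *\<^sub>R b"
      unfolding b(1) D_def by (simp add: vec_eq_iff axis_def Dk)
    ultimately show "D b = (if b $ i = 0 then 1 / g else 1 / g\<^sup>2) *\<^sub>R b"
      using \<open>c \<noteq> 0\<close> by (auto simp: b(1) axis_def power2_eq_square)
  qed
  also have "(\<Prod>b\<in>Basis. if (b :: complex ^ 'n) $ i = 0 then 1 / g else 1 / g\<^sup>2)
    = (\<Prod>(k, c)\<in>(UNIV :: 'n set) \<times> (Basis :: complex set). if k = i then 1 / g\<^sup>2 else 1 / g)"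
  \<comment> \<open>A real basis vector is an axis k together with a basis element c of the complex
    numbers; k is recovered as the only nonzero coordinate.\<close>
  proof (rule prod.reindex_bij_witness[of _ "\<lambda>(k, c). axis k c" "\<lambda>b. (SOME k. b $ k \<noteq> 0, b $ (SOME k. b $ k \<noteq> 0))"])
    fix b :: "complex ^ 'n" assume "b \<in> Basis"
    then obtain k c where b: "b = axis k c" "c \<in> Basis" by (auto simp: Basis_vec_def)
    have c: "c \<noteq> 0" using b(2) by auto
    have s: "(SOME k. b $ k \<noteq> 0) = k" by (rule some_equality) (use b c in \<open>auto simp: axis_def split: if_splits\<close>)
    show "(case (SOME k. b $ k \<noteq> 0, b $ (SOME k. b $ k \<noteq> 0)) of (k, c) \<Rightarrow> axis k c) = b"
      "(SOME k. b $ k \<noteq> 0, b $ (SOME k. b $ k \<noteq> 0)) \<in> UNIV \<times> Basis"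
      "(case (SOME k. b $ k \<noteq> 0, b $ (SOME k. b $ k \<noteq> 0)) of (k, c) \<Rightarrow> if k = i then 1 / g\<^sup>2 else 1 / g) = (if b $ i = 0 then 1 / g else 1 / g\<^sup>2)"
      unfolding s using b c by (auto simp: axis_def)
  next
    fix x :: "'n \<times> complex" assume "x \<in> UNIV \<times> Basis"
    then obtain k c where x: "x = (k, c)" "c \<in> Basis" by auto
    have c: "c \<noteq> 0" using x(2) by auto
    have s: "(SOME l. axis k c $ l \<noteq> 0) = k" by (rule some_equality) (use c in \<open>auto simp: axis_def split: if_splits\<close>)
    show "(SOME l. (case x of (k, c) \<Rightarrow> axis k c) $ l \<noteq> 0, (case x of (k, c) \<Rightarrow> axis k c) $ (SOME l. (case x of (k, c) \<Rightarrow> axis k c) $ l \<noteq> 0)) = x"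
      unfolding x prod.case s by (simp add: axis_def)
    show "(case x of (k, c) \<Rightarrow> axis k c) \<in> (Basis :: (complex ^ 'n) set)" using x by (auto simp: axis_in_Basis_iff)
  qed
  also have "\<dots> = (\<Prod>k\<in>UNIV. (if k = i then 1 / g\<^sup>2 else 1 / g)\<^sup>2)"
    by (subst prod.cartesian_product[symmetric]) simp
  also have "\<dots> = (1 / g\<^sup>2)\<^sup>2 * (\<Prod>k\<in>UNIV - {i}. (1 / g)\<^sup>2)"
    by (subst prod.remove[of UNIV i]) (auto intro!: prod.cong)
  also have "\<dots> = 1 / g ^ (2 * CARD('n) + 2)"
  proof -
    obtain m where m: "CARD('n) = Suc m" by (metis Suc_pred' zero_less_card_finite)
    have "(1 / g\<^sup>2)\<^sup>2 * (\<Prod>k\<in>UNIV - {i}. (1 / g)\<^sup>2) = (1 / g) ^ 4 * (1 / g) ^ (2 * m)"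
    proof -
      have "(1 / g\<^sup>2)\<^sup>2 = (1 / g) ^ 4" by (simp add: power_divide power4_eq_xxxx power2_eq_square)
      moreover have "(\<Prod>k\<in>UNIV - {i}. (1 / g)\<^sup>2) = (1 / g) ^ (2 * m)"
        by (simp only: prod_constant power_mult) (simp add: card_Diff_singleton m)
      ultimately show ?thesis by simp
    qed
    also have "\<dots> = (1 / g) ^ (4 + 2 * m)" by (simp only: power_add)
    also have "4 + 2 * m = 2 * CARD('n) + 2" by (simp add: m)
    also have "(1 / g) ^ (2 * CARD('n) + 2) = 1 / g ^ (2 * CARD('n) + 2)" by (rule power_one_over)
    finally show ?thesis .
  qed
  finally show ?thesis using g(1) by (simp add: g_def)
qed

lemma cball_model_eq_ball: "cball_model = ball 0 1"
  by (auto simp: cball_model_def)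

lemma open_cball_model [simp]: "open cball_model"
  by (simp add: cball_model_eq_ball)

text \<open>By the polar decomposition, A after the boost to z equals the boost to
  \<open>act A z\<close> after a unitary map. The chain rule at 0 then reduces the Jacobian at z to
  those of two boosts.\<close>

lemma real_det_act_deriv:
  fixes A :: "complex ^ ('n::finite option) ^ ('n option)"
  assumes A: "un1 A" and z: "z \<in> cball_model"
  shows "real_det (act_deriv A z) = (gam z / gam (act A z)) ^ (2 * CARD('n) + 2)"
proof -
  define w where "w = act A z"
  have w: "w \<in> cball_model" unfolding w_def by (rule act_in_ball[OF A z])
  note T = un1_Tm[OF z]
  have B: "un1 (A ** Tm z)" by (rule un1_mult[OF A T])
  have B0: "act (A ** Tm z) 0 = w" by (simp add: act_mult[OF T] act_Tm_0[OF z] w_def)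
  obtain U d where U: "unitary U" "cmod d = 1" "A ** Tm z = Tm w ** blk U 0 0 d"
    using un1_polar[OF B] unfolding B0 by blast
  have unU: "un1 (blk U 0 0 d)" by (rule un1_blk_unitary[OF U(1,2)])
  define K where "K v = (1 / d) *s (U *v v)" for v
  have K: "linear K" unfolding K_def
    by (rule linearI) (simp_all add: matrix_vector_right_distrib matrix_vec_scaleR_right vec_eq_iff algebra_simps)
  have nK: "norm (K v) = norm v" for v
    using U(2) unitary_norm_vec[OF U(1), of v] by (simp add: K_def norm_divide)
  have dK: "(K has_derivative K) (at 0)"
    using K by (intro bounded_linear_imp_has_derivative) (simp add: linear_conv_bounded_linear)
  have "(act A \<circ> act (Tm z) has_derivative act_deriv A z \<circ> act_deriv (Tm z) 0) (at 0)"
    using act_has_derivative[OF un1_denom[OF T zero_in_ball]] act_has_derivative[OF un1_denom[OF A z]]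
    by (intro diff_chain_at) (simp_all add: act_Tm_0[OF z])
  moreover have "(act (Tm w) \<circ> K has_derivative act_deriv (Tm w) 0 \<circ> K) (at 0)"
    using act_has_derivative[OF un1_denom[OF un1_Tm[OF w] zero_in_ball]] dK
    by (intro diff_chain_at) (simp_all add: linear_0[OF K])
  moreover have "(act (Tm w) \<circ> K) x = (act A \<circ> act (Tm z)) x" if "x \<in> cball_model" for x
    using act_mult[OF T that, of A] act_mult[OF unU that, of "Tm w"] unfolding U(3) by (simp add: act_blk_diag K_def)
  ultimately have "act_deriv A z \<circ> act_deriv (Tm z) 0 = act_deriv (Tm w) 0 \<circ> K"
    by (metis has_derivative_transform_within_open has_derivative_unique open_cball_model zero_in_ball)
  then have "real_det (act_deriv A z) * real_det (act_deriv (Tm z) 0) = real_det (act_deriv (Tm w) 0) * real_det K"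
    by (metis real_det_mult K linear_act_deriv A z T un1_Tm[OF w] zero_in_ball)
  then have "real_det (act_deriv A z) * (1 / gam z ^ (2 * CARD('n) + 2)) = 1 / gam w ^ (2 * CARD('n) + 2)"
    by (simp only: real_det_act_deriv_Tm[OF z] real_det_act_deriv_Tm[OF w] real_det_isometry[OF K nK] mult_1_right)
  then show ?thesis using gam(1)[OF z] gam(1)[OF w] unfolding w_def[symmetric] by (simp add: power_divide field_simps)
qed

lemma act_vimage_borel:
  assumes A: "un1 A" and S: "S \<in> sets borel"
  shows "{y \<in> cball_model. act A y \<in> S} \<in> sets borel"
proof -
  have "continuous_on cball_model (act A)"
    by (rule has_derivative_continuous_on, rule has_derivative_at_withinI, rule act_has_derivative[OF un1_denom[OF A]])
  then have "act A \<in> borel_measurable (restrict_space borel cball_model)" by (rule borel_measurable_continuous_on_restrict)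
  from measurable_sets[OF this S]
  have "act A -` S \<inter> cball_model \<in> sets (restrict_space borel cball_model)" by (simp add: space_restrict_space)
  then have "act A -` S \<inter> cball_model \<in> sets borel" by (subst (asm) sets_restrict_space_iff) auto
  moreover have "act A -` S \<inter> cball_model = {y \<in> cball_model. act A y \<in> S}" by auto
  ultimately show ?thesis by simp
qed

lemma act_image_eq:
  assumes A: "un1 A" and S: "S \<subseteq> cball_model"
  shows "act A ` S = {y \<in> cball_model. act (uinv A) y \<in> S}"
proof
  show "act A ` S \<subseteq> {y \<in> cball_model. act (uinv A) y \<in> S}"
    using S act_in_ball[OF A] act_uinv(1)[OF A] by (auto simp: subset_iff)
  show "{y \<in> cball_model. act (uinv A) y \<in> S} \<subseteq> act A ` S"
    using act_uinv(2)[OF A] by (metis (mono_tags, lifting) imageI mem_Collect_eq subsetI)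
qed

lemma act_image_borel: "un1 A \<Longrightarrow> S \<in> sets borel \<Longrightarrow> S \<subseteq> cball_model \<Longrightarrow> act A ` S \<in> sets borel"
  by (simp add: act_image_eq act_vimage_borel un1_uinv)

text \<open>Continuity on a closed ball keeps the image away from the boundary, where the density of
  the volume is unbounded.\<close>

lemma act_image_bounded:
  assumes A: "un1 A" and s: "s < 1" and S: "S \<subseteq> cball 0 s"
  obtains r where "r < 1" "act A ` S \<subseteq> cball 0 r"
proof (cases "0 \<le> s")
  case True
  have sub: "cball 0 s \<subseteq> cball_model" using s by (auto simp: cball_model_def)
  have "continuous_on (cball 0 s) (\<lambda>z. norm (act A z))"
  proof (intro continuous_on_norm continuous_on_subset[OF _ sub])
    show "continuous_on cball_model (act A)"
      by (rule has_derivative_continuous_on, rule has_derivative_at_withinI, rule act_has_derivative[OF un1_denom[OF A]])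
  qed
  moreover have "cball (0 :: complex ^ 'a) s \<noteq> {}" using True by simp
  ultimately obtain x where x: "x \<in> cball 0 s" "\<And>y. y \<in> cball 0 s \<Longrightarrow> norm (act A y) \<le> norm (act A x)"
    using continuous_attains_sup[of "cball 0 s" "\<lambda>z. norm (act A z)"] by auto
  show ?thesis
    by (rule that[of "norm (act A x)"]) (use x sub S act_in_ball[OF A, of x] in \<open>auto simp: cball_model_def\<close>)
next
  case False
  then have "S = {}" using S by auto
  then show ?thesis using that[of 0] by auto
qed

section \<open>Change of variables for the Bergman volume\<close>

lemma bergman_volume_eq_integral:
  fixes S :: "(complex ^ 'n) set"
  assumes S: "S \<in> sets borel" "S \<subseteq> cball_model"
  shows "emeasure bergman_volume S
    = (\<integral>\<^sup>+y. ennreal (4 ^ CARD('n) / (1 - (norm y)\<^sup>2) ^ (CARD('n) + 1)) * indicator (to_real ` S) y \<partial>lborel)"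
proof -
  let ?f = "\<lambda>z :: complex ^ 'n. ennreal (4 ^ CARD('n) / (1 - (norm z)\<^sup>2) ^ (CARD('n) + 1)) * indicator S z"
  have "emeasure bergman_volume S = (\<integral>\<^sup>+z. ?f z \<partial>lborel)"
    unfolding bergman_volume_def using S
    by (subst emeasure_density) (auto intro!: nn_integral_cong split: split_indicator simp: open_cball_model[THEN borel_open])
  also have "\<dots> = (\<integral>\<^sup>+z. ?f z \<partial>(distr lborel borel of_real_vec))" by (simp only: lborel_of_real_vec[symmetric])
  also have "\<dots> = (\<integral>\<^sup>+y. ?f (of_real_vec y) \<partial>lborel)" using S by (subst nn_integral_distr) auto
  also have "\<dots> = (\<integral>\<^sup>+y. ennreal (4 ^ CARD('n) / (1 - (norm y)\<^sup>2) ^ (CARD('n) + 1)) * indicator (to_real ` S) y \<partial>lborel)"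
  proof (rule nn_integral_cong)
    fix y :: "real ^ 'n bit0"
    have "y \<in> to_real ` S \<longleftrightarrow> of_real_vec y \<in> S" by (metis image_iff of_real_vec_to_real to_real_of_real_vec)
    then show "?f (of_real_vec y) = ennreal (4 ^ CARD('n) / (1 - (norm y)\<^sup>2) ^ (CARD('n) + 1)) * indicator (to_real ` S) y"
      by (simp add: indicator_def)
  qed
  finally show ?thesis .
qed

lemma bergman_volume_finite:
  fixes S :: "(complex ^ 'n) set"
  assumes S: "S \<in> sets borel" "S \<subseteq> cball 0 r" "r < 1"
  shows "emeasure bergman_volume S < \<infinity>"
proof -
  define M where "M = 4 ^ CARD('n) / (1 - r\<^sup>2) ^ (CARD('n) + 1)"
  have sub: "S \<subseteq> cball_model" using S by (auto simp: cball_model_def)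
  have "emeasure bergman_volume S = (\<integral>\<^sup>+z. ennreal (4 ^ CARD('n) / (1 - (norm z)\<^sup>2) ^ (CARD('n) + 1)) * indicator S z \<partial>lborel)"
    unfolding bergman_volume_def using S(1) sub
    by (subst emeasure_density) (auto intro!: nn_integral_cong split: split_indicator simp: open_cball_model[THEN borel_open])
  also have "\<dots> \<le> (\<integral>\<^sup>+z. ennreal M * indicator S z \<partial>lborel)"
  proof (rule nn_integral_mono)
    fix z :: "complex ^ 'n"
    show "ennreal (4 ^ CARD('n) / (1 - (norm z)\<^sup>2) ^ (CARD('n) + 1)) * indicator S z \<le> ennreal M * indicator S z"
    proof (cases "z \<in> S")
      case True
      then have "norm z \<le> r" using S(2) by auto
      then have r: "(norm z)\<^sup>2 \<le> r\<^sup>2" "r\<^sup>2 < 1" using S(3) norm_ge_zero[of z]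
        by (auto intro: power_mono simp: power_less_one_iff abs_square_less_1 simp del: norm_ge_zero)
      then have p: "(1 - r\<^sup>2) ^ (CARD('n) + 1) \<le> (1 - (norm z)\<^sup>2) ^ (CARD('n) + 1)" by (intro power_mono) auto
      have pp: "0 < (1 - (norm z)\<^sup>2) ^ (CARD('n) + 1)" "0 < (1 - r\<^sup>2) ^ (CARD('n) + 1)" using r by (intro zero_less_power; linarith)+
      have "4 ^ CARD('n) / (1 - (norm z)\<^sup>2) ^ (CARD('n) + 1) \<le> M"
        unfolding M_def by (rule divide_left_mono[OF p _ mult_pos_pos[OF pp]]) simp
      then show ?thesis by (intro mult_right_mono ennreal_leI) auto
    qed simp
  qed
  also have "\<dots> = ennreal M * emeasure lborel S" using S(1) by (simp add: nn_integral_cmult)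
  also have "\<dots> < \<infinity>"
    using emeasure_bounded_finite[of S] bounded_subset[OF bounded_cball S(2)] by (simp add: ennreal_mult_less_top)
  finally show ?thesis .
qed

text \<open>The density is 4^n gam^(2n+2), so it cancels the Jacobian exactly. The radius r < 1
  makes the integral finite; the reverse inequality is obtained where required by applying the lemma
  to \<open>uinv A\<close>.\<close>

lemma bergman_volume_image_le:
  fixes A :: "complex ^ ('n::finite option) ^ ('n option)"
  assumes A: "un1 A" and S: "S \<in> sets borel" "S \<subseteq> cball 0 r" "r < 1"
  shows "emeasure bergman_volume (act A ` S) \<le> emeasure bergman_volume S"
proof -
  define f where "f y = 4 ^ CARD('n) / (1 - (norm y)\<^sup>2) ^ (CARD('n) + 1)" for y :: "real ^ 'n bit0"
  define T where "T = to_real ` S"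
  define g where "g = to_real \<circ> act A \<circ> of_real_vec"
  define g' where "g' y = to_real \<circ> act_deriv A (of_real_vec y) \<circ> of_real_vec" for y
  have sub: "S \<subseteq> cball_model" using S by (auto simp: cball_model_def)
  have Tin: "of_real_vec y \<in> S" if "y \<in> T" for y using that by (auto simp: T_def)
  have pos: "0 < 1 - (norm y)\<^sup>2" if "of_real_vec y \<in> cball_model" for y using that by (simp add: ball_iff)
  have Tpos: "0 < 1 - (norm y)\<^sup>2" if "y \<in> T" for y using pos Tin[OF that] sub by blast
  have Tb: "T \<in> sets borel"
  proof -
    have "of_real_vec -` S \<inter> space borel \<in> sets (borel :: (real ^ 'n bit0) measure)" by (rule measurable_sets[OF measurable_of_real_vec S(1)])
    moreover have "of_real_vec -` S \<inter> space borel = T" by (auto simp: T_def) (metis image_eqI to_real_of_real_vec)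
    ultimately show ?thesis by simp
  qed
  obtain v where v: "0 \<le> v" "emeasure bergman_volume S = ennreal v"
    using bergman_volume_finite[OF S] by (cases "emeasure bergman_volume S" rule: ennreal_cases) auto
  have "((\<lambda>y. indicator T y * f y) has_integral v) UNIV"
  proof (rule nn_integral_has_integral)
    show "(\<lambda>y. indicator T y * f y) \<in> borel_measurable borel" unfolding f_def using Tb by measurable
    show "0 \<le> indicator T y * f y" for y using Tpos[of y] by (auto simp: f_def split: split_indicator)
    have "(\<integral>\<^sup>+y. ennreal (indicator T y * f y) \<partial>lborel) = (\<integral>\<^sup>+y. ennreal (f y) * indicator T y \<partial>lborel)"
      by (intro nn_integral_cong) (auto split: split_indicator)
    then show "(\<integral>\<^sup>+y. ennreal (indicator T y * f y) \<partial>lborel) = ennreal v"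
      using v bergman_volume_eq_integral[OF S(1) sub] by (simp add: T_def f_def)
  qed (rule v)
  moreover have "indicator T y * f y = (if y \<in> T then f y else 0)" for y by (simp add: indicator_def)
  ultimately have fT: "(f has_integral v) T" by (simp add: has_integral_restrict_UNIV)
  have det: "\<bar>det (matrix (g' y))\<bar> * f (g y) = f y" if "y \<in> T" for y
  proof -
    let ?z = "of_real_vec y :: complex ^ 'n" and ?k = "2 * CARD('n) + 2"
    have z: "?z \<in> cball_model" using Tin[OF that] sub by blast
    note w = act_in_ball[OF A z]
    have fg: "4 ^ CARD('n) / (1 - (norm x)\<^sup>2) ^ (CARD('n) + 1) = 4 ^ CARD('n) * gam x ^ ?k"
      if "x \<in> cball_model" for x :: "complex ^ 'n"
    proof -
      have "gam x ^ ?k = ((gam x)\<^sup>2) ^ (CARD('n) + 1)" by (simp only: power_mult[symmetric] distrib_left) simp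
      then show ?thesis by (simp add: gam(3)[OF that] power_divide)
    qed
    have "\<bar>det (matrix (g' y))\<bar> = (gam ?z / gam (act A ?z)) ^ ?k"
      using real_det_act_deriv[OF A z] by (simp add: real_det_def g'_def)
    moreover have "f y = 4 ^ CARD('n) * gam ?z ^ ?k" using fg[OF z] by (simp add: f_def)
    moreover have "f (g y) = 4 ^ CARD('n) * gam (act A ?z) ^ ?k" using fg[OF w] by (simp add: f_def g_def)
    moreover have "gam (act A ?z) ^ ?k \<noteq> 0" using gam(1)[OF w] by simp
    ultimately show ?thesis by (simp only: power_divide) (simp add: field_simps)
  qed
  have bl: "bounded_linear to_real" "bounded_linear of_real_vec"
    using linear_to_real linear_of_real_vec by (simp_all add: linear_conv_bounded_linear)
  have main: "f integrable_on (g ` T) \<and> integral (g ` T) f \<le> integral T (\<lambda>x. \<bar>det (matrix (g' x))\<bar> * f (g x))"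
  proof (rule integral_on_image_ubound_nonneg)
    fix y assume y: "y \<in> T"
    have z: "of_real_vec y \<in> cball_model" using Tin[OF y] sub by blast
    show "0 \<le> f (g y)" using act_in_ball[OF A z] by (simp add: f_def g_def ball_iff)
    have "(g has_derivative g' y) (at y)"
      unfolding g_def g'_def
      by (intro diff_chain_at bounded_linear_imp_has_derivative bl act_has_derivative un1_denom[OF A z])
    then show "(g has_derivative g' y) (at y within T)" by (rule has_derivative_at_withinI)
  next
    show "(\<lambda>x. \<bar>det (matrix (g' x))\<bar> * f (g x)) integrable_on T"
      using has_integral_integrable[OF fT] by (rule integrable_eq) (simp add: det)
  qed
  have "integral T (\<lambda>x. \<bar>det (matrix (g' x))\<bar> * f (g x)) = integral T f" by (intro integral_cong) (simp add: det)
  also have "\<dots> = v" using fT by (rule integral_unique)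
  finally have le: "integral (g ` T) f \<le> v" using main by simp
  have gT: "g ` T = to_real ` (act A ` S)" by (simp add: g_def T_def image_image)
  have "emeasure bergman_volume (act A ` S) = (\<integral>\<^sup>+y. ennreal (f y) * indicator (g ` T) y \<partial>lborel)"
    unfolding gT f_def using A S sub act_in_ball[OF A]
    by (intro bergman_volume_eq_integral act_image_borel) auto
  also have "\<dots> = ennreal (integral (g ` T) f)"
  proof (rule nn_integral_has_integral_lebesgue')
    show "0 \<le> f y" if y: "y \<in> g ` T" for y
    proof -
      obtain x where x: "x \<in> S" "y = to_real (act A x)" using y unfolding gT by blast
      then have "act A x \<in> cball_model" using act_in_ball[OF A] sub by blast
      then show ?thesis by (simp add: f_def x(2) ball_iff)
    qed
    show "(f has_integral integral (g ` T) f) (g ` T)" using main by (simp add: integrable_integral)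
  qed
  also have "\<dots> \<le> ennreal v" using le by (rule ennreal_leI)
  finally show ?thesis using v by simp
qed

section \<open>Volume of fundamental sets\<close>

lemma sets_bergman_volume [simp, measurable_cong]: "sets bergman_volume = sets borel"
  by (simp add: bergman_volume_def)

lemma space_bergman_volume [simp]: "space bergman_volume = UNIV"
  by (simp add: bergman_volume_def)

lemma holo_group_inverse:
  assumes \<Gamma>: "discrete_holo_group \<Gamma>" and g: "g \<in> \<Gamma>"
  shows "\<exists>h\<in>\<Gamma>. h \<circ> g = id \<and> g \<circ> h = id"
proof -
  obtain h where h: "h \<in> \<Gamma>" "h \<circ> g = id" using \<Gamma> g unfolding discrete_holo_group_def by blast
  obtain k where k: "k \<in> \<Gamma>" "k \<circ> h = id" using \<Gamma> h(1) unfolding discrete_holo_group_def by blast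
  have "g = k" using h(2) k(2) by (metis comp_assoc comp_id id_comp)
  then show ?thesis using h k by blast
qed

text \<open>The definition of the group makes all its elements the identity outside the
  ball.\<close>

lemma holo_group_ext:
  assumes "discrete_holo_group \<Gamma>" "g \<in> \<Gamma>" "h \<in> \<Gamma>" "\<And>z. z \<in> cball_model \<Longrightarrow> g z = h z"
  shows "g = h"
  using assms unfolding discrete_holo_group_def by (metis ext)

lemma holo_group_lift:
  assumes "discrete_holo_group \<Gamma>"
  shows "\<exists>A. \<forall>g\<in>\<Gamma>. un1 (A g) \<and> (\<forall>z\<in>cball_model. g z = act (A g) z)"
proof -
  have "\<forall>g\<in>\<Gamma>. \<exists>A. un1 A \<and> (\<forall>z\<in>cball_model. g z = act A z)"
    using assms holo_isometry_act unfolding discrete_holo_group_def by metis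
  then show ?thesis by metis
qed

lemma holo_group_countable:
  assumes "discrete_holo_group \<Gamma>"
  shows "countable \<Gamma>"
proof -
  have "finite {g \<in> \<Gamma>. bergman_dist 0 (g 0) \<le> real k}" for k
    using assms zero_in_ball unfolding discrete_holo_group_def by blast
  then have "countable (\<Union>k. {g \<in> \<Gamma>. bergman_dist 0 (g 0) \<le> real k})" by (simp add: countable_finite)
  moreover have "\<Gamma> \<subseteq> (\<Union>k. {g \<in> \<Gamma>. bergman_dist 0 (g 0) \<le> real k})" using real_arch_simple by auto
  ultimately show ?thesis by (rule countable_subset[rotated])
qed

text \<open>The pieces \<open>P g\<close> of B that g carries into F cover B; their images
  \<open>Q g\<close> have at least the same volume and lie in W. A point of W lies in at most c of
  these images, so integrating the multiplicity bounds the total by c times the volume of W.\<close>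

lemma fundamental_set_volume_ge:
  fixes B :: "(complex ^ 'n) set"
  assumes \<Gamma>: "discrete_holo_group \<Gamma>" and F: "fundamental_set \<Gamma> F"
    and B: "B \<in> sets borel" "B \<subseteq> cball 0 s" "s < 1"
    and cnt: "\<And>b. b \<in> B \<Longrightarrow> finite {g \<in> \<Gamma>. g b \<in> B} \<and> card {g \<in> \<Gamma>. g b \<in> B} \<le> c"
  shows "emeasure bergman_volume B \<le> of_nat c * emeasure bergman_volume {w \<in> F. \<exists>g\<in>\<Gamma>. g w \<in> B}"
    "{w \<in> F. \<exists>g\<in>\<Gamma>. g w \<in> B} \<in> sets borel"
proof -
  obtain A where A: "\<And>g. g \<in> \<Gamma> \<Longrightarrow> un1 (A g)" "\<And>g z. g \<in> \<Gamma> \<Longrightarrow> z \<in> cball_model \<Longrightarrow> g z = act (A g) z"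
    using holo_group_lift[OF \<Gamma>] by blast
  obtain iv where iv: "\<And>g. g \<in> \<Gamma> \<Longrightarrow> iv g \<in> \<Gamma>" "\<And>g. g \<in> \<Gamma> \<Longrightarrow> iv g \<circ> g = id" "\<And>g. g \<in> \<Gamma> \<Longrightarrow> g \<circ> iv g = id"
    using holo_group_inverse[OF \<Gamma>] by metis
  have comp: "g \<circ> h \<in> \<Gamma>" if "g \<in> \<Gamma>" "h \<in> \<Gamma>" for g h using \<Gamma> that unfolding discrete_holo_group_def by blast
  note cG = holo_group_countable[OF \<Gamma>]
  have Bsub: "B \<subseteq> cball_model" using B by (auto simp: cball_model_def)
  have Fb: "F \<in> sets borel" "F \<subseteq> cball_model" using F by (auto simp: fundamental_set_def)
  define P where "P g = B \<inter> {z \<in> cball_model. act (A g) z \<in> F}" for g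
  define Q where "Q g = act (A g) ` P g" for g
  define W where "W = {w \<in> F. \<exists>g\<in>\<Gamma>. g w \<in> B}"
  have Pb: "P g \<in> sets borel" "P g \<subseteq> cball 0 s" "P g \<subseteq> cball_model" if "g \<in> \<Gamma>" for g
    unfolding P_def using act_vimage_borel[OF A(1)[OF that] Fb(1)] B by auto
  have Qb: "Q g \<in> sets borel" if "g \<in> \<Gamma>" for g
    unfolding Q_def by (rule act_image_borel[OF A(1) Pb(1,3)]) (use that in auto)
  have PQ: "emeasure bergman_volume (P g) \<le> emeasure bergman_volume (Q g)" if g: "g \<in> \<Gamma>" for g
  proof -
    obtain r where r: "r < 1" "act (A g) ` P g \<subseteq> cball 0 r" using act_image_bounded[OF A(1)[OF g] B(3) Pb(2)[OF g]] by blast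
    have "act (uinv (A g)) ` Q g = P g"
      unfolding Q_def image_image using act_uinv(1)[OF A(1)[OF g]] Pb(3)[OF g] by (force simp: subset_iff)
    then show ?thesis using bergman_volume_image_le[OF un1_uinv[OF A(1)[OF g]] Qb[OF g] _ r(1)] r(2) by (simp add: Q_def)
  qed
  have Qmem: "w \<in> F \<and> (\<exists>b\<in>B. w = g b)" if g: "g \<in> \<Gamma>" and w: "w \<in> Q g" for g w
  proof -
    obtain x where x: "x \<in> B" "x \<in> cball_model" "act (A g) x \<in> F" "w = act (A g) x"
      using w unfolding Q_def P_def by auto
    then show ?thesis using A(2)[OF g x(2)] by metis
  qed
  have ivg: "iv g (g x) = x" "g (iv g x) = x" if "g \<in> \<Gamma>" for g x
    using fun_cong[OF iv(2)[OF that], of x] fun_cong[OF iv(3)[OF that], of x] by simp_all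
  have gw: "g w = act (A g) w" if "g \<in> \<Gamma>" "w \<in> F" for g w using A(2) Fb(2) that by blast
  have "W = F \<inter> (\<Union>g\<in>\<Gamma>. {w \<in> cball_model. act (A g) w \<in> B})"
  proof (intro set_eqI iffI)
    fix w assume "w \<in> W"
    then obtain g where "w \<in> F" "g \<in> \<Gamma>" "g w \<in> B" by (auto simp: W_def)
    then show "w \<in> F \<inter> (\<Union>g\<in>\<Gamma>. {w \<in> cball_model. act (A g) w \<in> B})" using gw[of g w] Fb(2) by auto
  next
    fix w assume "w \<in> F \<inter> (\<Union>g\<in>\<Gamma>. {w \<in> cball_model. act (A g) w \<in> B})"
    then obtain g where g: "w \<in> F" "g \<in> \<Gamma>" "act (A g) w \<in> B" by blast
    then have "g w \<in> B" using gw[OF g(2,1)] by simp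
    then show "w \<in> W" unfolding W_def using g(1,2) by blast
  qed
  also have "\<dots> \<in> sets borel"
    using Fb(1) cG act_vimage_borel[OF A(1) B(1)] by (intro sets.Int sets.countable_UN') auto
  finally have Wb: "W \<in> sets borel" .
  then show "{w \<in> F. \<exists>g\<in>\<Gamma>. g w \<in> B} \<in> sets borel" by (simp add: W_def)
  have "emeasure bergman_volume B = (\<integral>\<^sup>+b. indicator B b \<partial>bergman_volume)" using B(1) by simp
  also have "\<dots> \<le> (\<integral>\<^sup>+b. (\<integral>\<^sup>+g. indicator (P g) b \<partial>count_space \<Gamma>) \<partial>bergman_volume)"
  proof (rule nn_integral_mono)
    fix b
    show "indicator B b \<le> (\<integral>\<^sup>+g. indicator (P g) b \<partial>count_space \<Gamma>)"
    proof (cases "b \<in> B")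
      case True
      then obtain w g where w: "w \<in> F" "g \<in> \<Gamma>" "g b = w" using F Bsub unfolding fundamental_set_def by blast
      then have "b \<in> P g" using True Bsub A(2)[OF w(2)] by (auto simp: P_def)
      then have "indicator B b \<le> (indicator (P g) b :: ennreal)" by (simp add: indicator_def)
      also have "\<dots> \<le> (\<integral>\<^sup>+g. indicator (P g) b \<partial>count_space \<Gamma>)" by (rule nn_integral_ge_point[OF w(2)])
      finally show ?thesis .
    qed simp
  qed
  also have "\<dots> = (\<integral>\<^sup>+g. (\<integral>\<^sup>+b. indicator (P g) b \<partial>bergman_volume) \<partial>count_space \<Gamma>)"
    using Pb by (intro nn_integral_count_space_nn_integral cG) auto
  also have "\<dots> \<le> (\<integral>\<^sup>+g. (\<integral>\<^sup>+w. indicator (Q g) w \<partial>bergman_volume) \<partial>count_space \<Gamma>)"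
    by (rule nn_integral_mono) (use PQ Pb Qb in auto)
  also have "\<dots> = (\<integral>\<^sup>+w. (\<integral>\<^sup>+g. indicator (Q g) w \<partial>count_space \<Gamma>) \<partial>bergman_volume)"
    using Qb by (intro nn_integral_count_space_nn_integral[symmetric] cG) auto
  also have "\<dots> \<le> (\<integral>\<^sup>+w. of_nat c * indicator W w \<partial>bergman_volume)"
  proof (rule nn_integral_mono)
    fix w
    let ?S = "{g \<in> \<Gamma>. w \<in> Q g}"
    have "(\<integral>\<^sup>+g. indicator (Q g) w \<partial>count_space \<Gamma>) = (\<integral>\<^sup>+g. indicator ?S g \<partial>count_space \<Gamma>)"
      by (intro nn_integral_cong) (auto split: split_indicator)
    also have "\<dots> = emeasure (count_space \<Gamma>) ?S" by (intro nn_integral_indicator) auto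
    also have "\<dots> \<le> of_nat c * indicator W w"
    proof (cases "?S = {}")
      case False
      then obtain g0 where g0: "g0 \<in> \<Gamma>" "w \<in> Q g0" by blast
      then obtain b0 where b0: "w \<in> F" "b0 \<in> B" "w = g0 b0" using Qmem by blast
      have "iv g0 w \<in> B" using b0 ivg[OF g0(1)] by simp
      then have wW: "w \<in> W" using iv(1)[OF g0(1)] b0(1) by (auto simp: W_def)
      \<comment> \<open>If w = g0 b0 also lies in \<open>Q g\<close>, then the inverse of g after g0
        maps b0 into B. Different g give different such elements, and \<open>cnt\<close> bounds
        their number.\<close>
      have inj: "inj_on (\<lambda>g. iv g \<circ> g0) ?S"
      proof (rule inj_onI)
        fix g g' assume g: "g \<in> ?S" "g' \<in> ?S" "iv g \<circ> g0 = iv g' \<circ> g0"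
        then have "iv g = iv g'" using iv(3)[OF g0(1)] by (metis comp_assoc comp_id)
        then show "g = g'" using g iv by (metis (mono_tags, lifting) comp_assoc comp_id id_comp mem_Collect_eq)
      qed
      have img: "(\<lambda>g. iv g \<circ> g0) ` ?S \<subseteq> {g \<in> \<Gamma>. g b0 \<in> B}"
      proof
        fix f assume "f \<in> (\<lambda>g. iv g \<circ> g0) ` ?S"
        then obtain g where g: "g \<in> \<Gamma>" "w \<in> Q g" "f = iv g \<circ> g0" by auto
        obtain b where b: "b \<in> B" "w = g b" using Qmem[OF g(1,2)] by blast
        have "f b0 = b" using g(3) b b0 ivg[OF g(1)] by simp
        then show "f \<in> {g \<in> \<Gamma>. g b0 \<in> B}" using b g comp iv(1) g0 by auto
      qed
      have "finite ?S" using inj_on_finite[OF inj img] cnt[OF b0(2)] by blast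
      moreover have "card ?S \<le> c" using card_inj_on_le[OF inj img] cnt[OF b0(2)] by linarith
      ultimately show ?thesis using wW by (simp add: emeasure_count_space_finite)
    next
      case True
      show ?thesis unfolding True by simp
    qed
    finally show "(\<integral>\<^sup>+g. indicator (Q g) w \<partial>count_space \<Gamma>) \<le> of_nat c * indicator W w" .
  qed
  also have "\<dots> = of_nat c * emeasure bergman_volume W" using Wb by (simp add: nn_integral_cmult)
  finally show "emeasure bergman_volume B \<le> of_nat c * emeasure bergman_volume {w \<in> F. \<exists>g\<in>\<Gamma>. g w \<in> B}" by (simp add: W_def)
qed

text \<open>The full preimage in \<open>U(n,1)\<close>, containing every unit multiple of each of
  its elements.\<close>

definition unitary_lift :: "(complex ^ 'n \<Rightarrow> complex ^ 'n) set \<Rightarrow> (complex ^ ('n::finite option) ^ ('n option)) set" where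
  "unitary_lift \<Gamma> = {A. un1 A \<and> (\<exists>g\<in>\<Gamma>. \<forall>z\<in>cball_model. g z = act A z)}"

lemma unitary_lift_un1: "A \<in> unitary_lift \<Gamma> \<Longrightarrow> un1 A"
  by (simp add: unitary_lift_def)

lemma unitary_lift_mult:
  assumes "discrete_holo_group \<Gamma>" "A \<in> unitary_lift \<Gamma>" "B \<in> unitary_lift \<Gamma>"
  shows "A ** B \<in> unitary_lift \<Gamma>"
proof -
  obtain g h where gh: "g \<in> \<Gamma>" "h \<in> \<Gamma>" "\<forall>z\<in>cball_model. g z = act A z" "\<forall>z\<in>cball_model. h z = act B z"
    and un: "un1 A" "un1 B" using assms(2,3) by (auto simp: unitary_lift_def)
  have "(g \<circ> h) z = act (A ** B) z" if "z \<in> cball_model" for z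
    using gh(3,4) that act_in_ball[OF un(2) that] by (simp add: act_mult[OF un(2) that])
  moreover have "g \<circ> h \<in> \<Gamma>" using assms(1) gh unfolding discrete_holo_group_def by blast
  ultimately show ?thesis unfolding unitary_lift_def using un1_mult[OF un] by blast
qed

lemma unitary_lift_uinv:
  assumes \<Gamma>: "discrete_holo_group \<Gamma>" and A: "A \<in> unitary_lift \<Gamma>"
  shows "uinv A \<in> unitary_lift \<Gamma>"
proof -
  obtain g where g: "g \<in> \<Gamma>" "\<forall>z\<in>cball_model. g z = act A z" and un: "un1 A" using A by (auto simp: unitary_lift_def)
  obtain h where h: "h \<in> \<Gamma>" "h \<circ> g = id" using holo_group_inverse[OF \<Gamma> g(1)] by blast
  have "h z = act (uinv A) z" if z: "z \<in> cball_model" for z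
    using fun_cong[OF h(2), of "act (uinv A) z"] g(2) act_in_ball[OF un1_uinv[OF un] z] act_uinv(2)[OF un z] by simp
  then show ?thesis unfolding unitary_lift_def using h(1) un1_uinv[OF un] by blast
qed

lemma unitary_lift_scalar:
  assumes "discrete_holo_group \<Gamma>" "cmod d = 1"
  shows "mat d \<in> unitary_lift \<Gamma>"
proof -
  have "d \<noteq> 0" using assms(2) by auto
  moreover have "id \<in> \<Gamma>" using assms(1) by (simp add: discrete_holo_group_def)
  ultimately show ?thesis unfolding unitary_lift_def using un1_mat[OF assms(2)] by (auto intro!: bexI[of _ id])
qed

text \<open>A bound on the Frobenius norm bounds the corner entry and hence the displacement of 0,
  so discreteness leaves finitely many isometries; lifts of the same isometry differ by a
  scalar.\<close>

lemma unitary_lift_finite: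
  fixes \<Gamma> :: "(complex ^ 'n \<Rightarrow> complex ^ 'n) set"
  assumes \<Gamma>: "discrete_holo_group \<Gamma>"
  shows "\<exists>T. finite T \<and> T \<subseteq> unitary_lift \<Gamma> \<and> (\<forall>A\<in>unitary_lift \<Gamma>. norm A \<le> R \<longrightarrow> (\<exists>B\<in>T. \<exists>d. cmod d = 1 \<and> A = mat d ** B))"
proof -
  obtain L where L: "\<And>g. g \<in> \<Gamma> \<Longrightarrow> un1 (L g)" "\<And>g z. g \<in> \<Gamma> \<Longrightarrow> z \<in> cball_model \<Longrightarrow> g z = act (L g) z"
    using holo_group_lift[OF \<Gamma>] by blast
  \<comment> \<open>The radius uses the crude estimate arcosh a \<le> 2 a, where a \<le> R is the
    modulus of the corner entry.\<close>
  define S where "S = {g \<in> \<Gamma>. bergman_dist 0 (g 0) \<le> 2 * (2 * R)}"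
  have fS: "finite S" unfolding S_def using \<Gamma> zero_in_ball unfolding discrete_holo_group_def by blast
  have "\<exists>B\<in>L ` S. \<exists>d. cmod d = 1 \<and> A = mat d ** B" if A: "A \<in> unitary_lift \<Gamma>" "norm A \<le> R" for A
  proof -
    have un: "un1 A" by (rule unitary_lift_un1[OF A(1)])
    obtain g where g: "g \<in> \<Gamma>" "\<forall>z\<in>cball_model. g z = act A z" using A(1) by (auto simp: unitary_lift_def)
    let ?a = "cmod (A $ None $ None)"
    have aR: "?a \<le> R" using A(2) Finite_Cartesian_Product.norm_nth_le[of A None] Finite_Cartesian_Product.norm_nth_le[of "A $ None" None] by linarith
    have den: "(A *v pv 0 1) $ None = A $ None $ None"
      by (simp add: matrix_vector_mult_def sum_option pv_def)
    have n: "1 - (norm (act A 0))\<^sup>2 = 1 / ?a\<^sup>2" using un1_act_norm[OF un zero_in_ball] by (simp add: den)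
    have a0: "?a > 0" using un1_denom[OF un zero_in_ball] by (simp add: den)
    have "1 / ?a\<^sup>2 \<le> 1" using n zero_le_power2[of "norm (act A 0)"] by linarith
    then have "1\<^sup>2 \<le> ?a\<^sup>2" using a0 by (simp add: divide_le_eq)
    then have a1: "1 \<le> ?a" by (rule power2_le_imp_le) simp
    have "sqrt ((cmod (herm 0 (act A 0) - 1))\<^sup>2 / ((1 - (norm (0 :: complex ^ 'n))\<^sup>2) * (1 - (norm (act A 0))\<^sup>2))) = ?a"
      unfolding n using a0 by (simp add: herm_def)
    then have "bergman_dist 0 (act A 0) = 2 * arcosh ?a" unfolding bergman_dist_def by (simp only:)
    also have "arcosh ?a = ln (?a + sqrt (?a\<^sup>2 - 1))" using a1 by (simp add: arcosh_real_def)
    also have "sqrt (?a\<^sup>2 - 1) \<le> ?a" using a0 by (intro real_le_lsqrt) auto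
    then have "ln (?a + sqrt (?a\<^sup>2 - 1)) \<le> 2 * ?a"
      using ln_le_minus_one[of "?a + sqrt (?a\<^sup>2 - 1)"] a0 a1 real_sqrt_ge_zero[of "?a\<^sup>2 - 1"] by (simp add: add_pos_nonneg)
    finally have "bergman_dist 0 (g 0) \<le> 2 * (2 * R)" using aR g(2) by simp
    then have gS: "g \<in> S" using g(1) by (simp add: S_def)
    note Lg = L(1)[OF g(1)]
    have "\<exists>d. cmod d = 1 \<and> uinv (L g) ** A = mat d"
    proof (rule act_trivial[OF un1_mult[OF un1_uinv[OF Lg] un]])
      fix z :: "complex ^ 'n" assume z: "z \<in> cball_model"
      have "act A z = act (L g) z" using g(2) L(2)[OF g(1) z] z by simp
      then show "act (uinv (L g) ** A) z = z" by (simp add: act_mult[OF un z] act_uinv(1)[OF Lg z])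
    qed
    then obtain d where d: "cmod d = 1" "uinv (L g) ** A = mat d" by blast
    have "A = L g ** (uinv (L g) ** A)" by (simp only: un1_cancel(2)[OF Lg])
    also have "\<dots> = mat d ** L g" by (simp only: d(2) mat_commute)
    finally show ?thesis using gS d(1) by blast
  qed
  moreover have "L ` S \<subseteq> unitary_lift \<Gamma>" using L unfolding S_def unitary_lift_def by auto
  ultimately show ?thesis using fS by (intro exI[of _ "L ` S"]) simp
qed

lemma conj_eq_iff: "un1 G \<Longrightarrow> uinv G ** A ** G = uinv G ** B ** G \<longleftrightarrow> A = B"
  by (metis matrix_mul_assoc matrix_mul_rid un1_cancel(2) uinv_right)

text \<open>Conjugation by G moves the base point \<open>act G 0\<close> to 0, where the points of
  the ball satisfy gam^2 \<le> 1 / (1 - q) = 1 + h. \<open>packing_count\<close> limits the elements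
  that return a point to the ball, and \<open>fundamental_set_volume_ge\<close> converts this count
  into volume.\<close>

lemma separated_ball_volume:
  fixes G :: "complex ^ ('n::finite option) ^ ('n option)"
  assumes \<Gamma>: "discrete_holo_group \<Gamma>" and F: "fundamental_set \<Gamma> F" and G: "un1 G"
    and sep: "\<And>A. A \<in> unitary_lift \<Gamma> \<Longrightarrow> \<not> scalar_matrix A \<Longrightarrow> \<epsilon> \<le> norm (uinv G ** A ** G - mat 1)"
    and q: "0 < q" "q < 1" "h = q / (1 - q)" "h \<le> 1"
    and t: "\<And>j. 1 \<le> j \<Longrightarrow> 0 < t j \<and> t j < 1"
    and X: "(\<Sum>j=1..CARD('n). 4 * (1 - sqrt (1 - (t j)\<^sup>2))) \<le> (X / 2)\<^sup>2" "0 \<le> X"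
    and \<epsilon>: "8 * h + 17 * h\<^sup>2 + 2 * h * X + X\<^sup>2 * (1 + h) < \<epsilon>\<^sup>2" "0 \<le> \<epsilon>"
  shows "emeasure bergman_volume {z :: complex ^ 'n. (norm z)\<^sup>2 < q} * ennreal (\<Prod>j=1..CARD('n). cap_ratio j (t j))
    \<le> emeasure bergman_volume {w \<in> F. \<exists>g\<in>\<Gamma>. g w \<in> act G ` {z. (norm z)\<^sup>2 < q}}"
    "{w \<in> F. \<exists>g\<in>\<Gamma>. g w \<in> act G ` {z. (norm z)\<^sup>2 < q}} \<in> sets borel"
proof -
  define D where "D = {z :: complex ^ 'n. (norm z)\<^sup>2 < q}"
  define B where "B = act G ` D"
  define P where "P = (\<Prod>j=1..CARD('n). cap_ratio j (t j))"
  \<comment> \<open>The count is an integer, so rounding 1 / P down loses nothing, and c P \<le> 1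
    holds.\<close>
  define c where "c = nat \<lfloor>1 / P\<rfloor>"
  obtain L where L: "\<And>g. g \<in> \<Gamma> \<Longrightarrow> un1 (L g)" "\<And>g z. g \<in> \<Gamma> \<Longrightarrow> z \<in> cball_model \<Longrightarrow> g z = act (L g) z"
    using holo_group_lift[OF \<Gamma>] by blast
  have P: "0 < P" unfolding P_def using ln_cap_ratio_ge(1) t by (intro prod_pos) auto
  have D: "D \<in> sets borel" "D \<subseteq> cball 0 (sqrt q)" "D \<subseteq> cball_model"
  proof -
    have "open D" unfolding D_def by (intro open_Collect_less continuous_intros)
    then show "D \<in> sets borel" by (rule borel_open)
    show "D \<subseteq> cball 0 (sqrt q)" by (auto simp: D_def intro!: real_le_rsqrt)
    show "D \<subseteq> cball_model" using q by (auto simp: D_def ball_iff)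
  qed
  have sq: "sqrt q < 1" using q by simp
  obtain s where s: "s < 1" "B \<subseteq> cball 0 s" unfolding B_def using act_image_bounded[OF G sq D(2)] by blast
  have Bb: "B \<in> sets borel" unfolding B_def by (rule act_image_borel[OF G D(1,3)])
  have Bsub: "B \<subseteq> cball_model" using s by (auto simp: cball_model_def)
  have cnt: "finite {g \<in> \<Gamma>. g b \<in> B} \<and> card {g \<in> \<Gamma>. g b \<in> B} \<le> c" if b: "b \<in> B" for b
  proof (rule finite_if_finite_subsets_card_bdd)
    fix S assume S: "S \<subseteq> {g \<in> \<Gamma>. g b \<in> B}" "finite S"
    obtain z0 where z0: "z0 \<in> D" "b = act G z0" using b unfolding B_def by blast
    have z0b: "z0 \<in> cball_model" using z0 D by blast
    define K where "K g = uinv G ** L g ** G" for g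
    have Lg: "un1 (L g)" if "g \<in> S" for g using that S L by blast
    have K: "un1 (K g)" if "g \<in> S" for g unfolding K_def by (intro un1_mult un1_uinv G Lg that)
    have lift: "L g \<in> unitary_lift \<Gamma>" if "g \<in> S" for g using that S L unfolding unitary_lift_def by blast
    have inj: "inj_on K S"
    proof (rule inj_onI)
      fix g g' assume g: "g \<in> S" "g' \<in> S" "K g = K g'"
      have "L g = L g'" using g(3) unfolding K_def conj_eq_iff[OF G] .
      moreover have gG: "g \<in> \<Gamma>" "g' \<in> \<Gamma>" using g(1,2) S(1) by blast+
      ultimately have "g z = g' z" if "z \<in> cball_model" for z
        using L(2)[OF gG(1) that] L(2)[OF gG(2) that] by simp
      then show "g = g'" using g(1,2) S(1) by (intro holo_group_ext[OF \<Gamma>]) auto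
    qed
    have "real (card (K ` S)) * (\<Prod>j=1..CARD('n). cap_ratio j (t j)) \<le> 1"
    proof (rule packing_count[OF _ _ z0b _ q(4) _ t X \<epsilon>])
      show "finite (K ` S)" using S by simp
      show "un1 A" if "A \<in> K ` S" for A using that K by blast
      show "(gam (act A z0))\<^sup>2 \<le> 1 + h" if A: "A \<in> K ` S" for A
      proof -
        obtain g where g: "g \<in> S" "A = K g" using A by blast
        have "g b \<in> B" using g S by blast
        then obtain z1 where z1: "z1 \<in> D" "g b = act G z1" unfolding B_def by blast
        have z1b: "z1 \<in> cball_model" using z1 D by blast
        have "act A z0 = act (uinv G) (act (L g) (act G z0))"
          using act_mult[OF G z0b, of "uinv G ** L g"] act_mult[OF Lg[OF g(1)] act_in_ball[OF G z0b], of "uinv G"]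
          by (simp add: g(2) K_def)
        also have "act (L g) (act G z0) = g b"
        proof -
          have "g \<in> \<Gamma>" "b \<in> cball_model" using g S b Bsub by auto
          then show ?thesis unfolding z0(2)[symmetric] using L(2) by simp
        qed
        also have "act (uinv G) (g b) = z1" unfolding z1(2) by (rule act_uinv(1)[OF G z1b])
        finally have "(gam (act A z0))\<^sup>2 = 1 / (1 - (norm z1)\<^sup>2)" using gam(3)[OF z1b] by simp
        also have "\<dots> \<le> 1 / (1 - q)" using z1(1) q by (intro divide_left_mono mult_pos_pos) (auto simp: D_def)
        also have "\<dots> = 1 + h" using q by (simp add: field_simps)
        finally show ?thesis .
      qed
      show "\<epsilon> \<le> norm (mat d ** (A' ** uinv A) - mat 1)" if "A \<in> K ` S" "A' \<in> K ` S" "A \<noteq> A'" "cmod d = 1" for A A' d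
      proof -
        obtain g g' where g: "g \<in> S" "A = K g" "g' \<in> S" "A' = K g'" using \<open>A \<in> K ` S\<close> \<open>A' \<in> K ` S\<close> by blast
        define M where "M = mat d ** (L g' ** uinv (L g))"
        have "M \<in> unitary_lift \<Gamma>" unfolding M_def
          by (intro unitary_lift_mult unitary_lift_uinv unitary_lift_scalar \<Gamma> lift g that)
        moreover have "\<not> scalar_matrix M"
        proof
          assume "scalar_matrix M"
          then obtain e where e: "cmod e = 1" "M = mat e" by (auto simp: scalar_matrix_def)
          have "g' z = g z" if z: "z \<in> cball_model" for z
          proof -
            note gz = act_in_ball[OF Lg[OF g(1)] z]
            have "act M (act (L g) z) = act (mat d) (act (L g') z)"
              unfolding M_def using act_mult[OF un1_mult[OF Lg[OF g(3)] un1_uinv[OF Lg[OF g(1)]]] gz, of "mat d"]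
                act_mult[OF un1_uinv[OF Lg[OF g(1)]] gz, of "L g'"] act_uinv(1)[OF Lg[OF g(1)] z] by simp
            moreover have "e \<noteq> 0" "d \<noteq> 0" using e(1) \<open>cmod d = 1\<close> by auto
            ultimately have "act (L g') z = act (L g) z" unfolding e(2) by simp
            moreover have "g \<in> \<Gamma>" "g' \<in> \<Gamma>" using g S by auto
            ultimately show ?thesis by (simp add: L(2) z)
          qed
          then have "g' = g" using g S by (intro holo_group_ext[OF \<Gamma>]) auto
          then show False using g \<open>A \<noteq> A'\<close> by simp
        qed
        ultimately have "\<epsilon> \<le> norm (uinv G ** M ** G - mat 1)" by (rule sep)
        also have "uinv G ** M ** G = mat d ** (A' ** uinv A)"
        proof -
          have "mat d ** (A' ** uinv A) = mat d ** (uinv G ** L g' ** (G ** (uinv G ** (uinv (L g) ** G))))"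
            by (simp only: g K_def uinv_mult uinv_uinv matrix_mul_assoc)
          also have "\<dots> = (mat d ** uinv G) ** L g' ** (uinv (L g) ** G)"
            by (simp only: un1_cancel(2)[OF G]) (simp only: matrix_mul_assoc)
          also have "mat d ** uinv G = uinv G ** mat d" by (rule mat_commute)
          finally show ?thesis unfolding M_def by (simp only: matrix_mul_assoc)
        qed
        finally show ?thesis .
      qed
    qed
    then have "real (card S) * P \<le> 1" by (simp add: card_image[OF inj] P_def)
    then have "real (card S) \<le> 1 / P" using P by (simp add: field_simps)
    then show "card S \<le> c" unfolding c_def by (simp add: le_nat_floor)
  qed
  note ge = fundamental_set_volume_ge[OF \<Gamma> F Bb s(2,1) cnt]
  show "{w \<in> F. \<exists>g\<in>\<Gamma>. g w \<in> act G ` {z. (norm z)\<^sup>2 < q}} \<in> sets borel" using ge(2) unfolding B_def D_def .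
  have "D = act (uinv G) ` B" unfolding B_def image_image using act_uinv(1)[OF G] D(3) by (force simp: subset_iff)
  then have "emeasure bergman_volume D \<le> emeasure bergman_volume B"
    using bergman_volume_image_le[OF un1_uinv[OF G] Bb s(2,1)] by simp
  also note ge(1)
  finally have "emeasure bergman_volume D * ennreal P \<le> (of_nat c * emeasure bergman_volume {w \<in> F. \<exists>g\<in>\<Gamma>. g w \<in> B}) * ennreal P"
    by (rule mult_right_mono[OF _ zero_le])
  also have "\<dots> = ennreal (real c * P) * emeasure bergman_volume {w \<in> F. \<exists>g\<in>\<Gamma>. g w \<in> B}"
    using P by (simp add: ennreal_mult ennreal_of_nat_eq_real_of_nat mult_ac)
  also have "\<dots> \<le> 1 * emeasure bergman_volume {w \<in> F. \<exists>g\<in>\<Gamma>. g w \<in> B}"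
  proof (rule mult_right_mono)
    have "real c \<le> 1 / P" using P by (simp add: c_def)
    then show "ennreal (real c * P) \<le> 1" using P by (simp add: ennreal_le_1 field_simps)
  qed (rule zero_le)
  finally show "emeasure bergman_volume {z :: complex ^ 'n. (norm z)\<^sup>2 < q} * ennreal (\<Prod>j=1..CARD('n). cap_ratio j (t j))
    \<le> emeasure bergman_volume {w \<in> F. \<exists>g\<in>\<Gamma>. g w \<in> act G ` {z. (norm z)\<^sup>2 < q}}"
    unfolding B_def D_def P_def by simp
qed

section \<open>Conjugation and bounded sets in U(n,1)\<close>

definition conj_by :: "complex ^ ('n::finite option) ^ ('n option) \<Rightarrow> complex ^ ('n option) ^ ('n option) \<Rightarrow> complex ^ ('n option) ^ ('n option)" where
  "conj_by G A = uinv G ** A ** G"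

lemma conj_by_mult: "un1 G \<Longrightarrow> conj_by G (A ** B) = conj_by G A ** conj_by G B"
proof -
  assume G: "un1 G"
  have "conj_by G A ** conj_by G B = uinv G ** A ** (G ** (uinv G ** (B ** G)))" by (simp only: conj_by_def matrix_mul_assoc)
  also have "\<dots> = conj_by G (A ** B)" by (simp only: un1_cancel(2)[OF G]) (simp only: conj_by_def matrix_mul_assoc)
  finally show ?thesis by simp
qed

lemma conj_by_conj_by: "conj_by H (conj_by G A) = conj_by (G ** H) A"
  by (simp only: conj_by_def uinv_mult matrix_mul_assoc)

lemma conj_by_1 [simp]: "conj_by (mat 1) A = A"
  by (simp add: conj_by_def uinv_mat)

lemma conj_by_cancel: "un1 G \<Longrightarrow> conj_by (uinv G) (conj_by G A) = A"
  by (simp add: conj_by_conj_by uinv_right)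

lemma conj_by_mat: "un1 G \<Longrightarrow> conj_by G (mat d) = mat d"
proof -
  assume G: "un1 G"
  have "uinv G ** mat d = mat d ** uinv G" by (rule mat_commute[symmetric])
  then have "conj_by G (mat d) = mat d ** (uinv G ** G)" by (simp only: conj_by_def matrix_mul_assoc)
  then show ?thesis by (simp add: uinv_left[OF G])
qed

lemma conj_by_uinv: "conj_by G (uinv A) = uinv (conj_by G A)"
  by (simp only: conj_by_def uinv_mult uinv_uinv matrix_mul_assoc)

lemma un1_conj_by: "un1 G \<Longrightarrow> un1 A \<Longrightarrow> un1 (conj_by G A)"
  unfolding conj_by_def by (intro un1_mult un1_uinv)

lemma scalar_conj_by: "un1 G \<Longrightarrow> scalar_matrix (conj_by G A) \<longleftrightarrow> scalar_matrix A"
  unfolding scalar_matrix_def by (metis conj_by_cancel conj_by_mat un1_uinv)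

lemma norm_conj_by: "norm (conj_by G A) \<le> norm G * norm A * norm G"
proof -
  have "norm (conj_by G A) \<le> norm (uinv G ** A) * norm G" unfolding conj_by_def by (rule norm_matrix_mult)
  also have "\<dots> \<le> (norm (uinv G) * norm A) * norm G" by (intro mult_right_mono norm_matrix_mult) simp
  finally show ?thesis by simp
qed

lemma tendsto_matrix_mult:
  fixes f :: "'a \<Rightarrow> complex ^ 'k ^ 'm" and g :: "'a \<Rightarrow> complex ^ 'l ^ 'k"
  assumes "(f \<longlongrightarrow> a) F" "(g \<longlongrightarrow> b) F"
  shows "((\<lambda>x. f x ** g x) \<longlongrightarrow> a ** b) F"
  unfolding matrix_matrix_mult_def using assms
  by (intro tendsto_vec_lambda tendsto_sum tendsto_mult tendsto_vec_nth)

lemma tendsto_adj: "(f \<longlongrightarrow> a) F \<Longrightarrow> ((\<lambda>x. adj (f x)) \<longlongrightarrow> adj a) F"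
  unfolding adj_def by (intro tendsto_vec_lambda tendsto_cnj tendsto_vec_nth)

lemma tendsto_conj_by:
  assumes "(f \<longlongrightarrow> a) F" "(g \<longlongrightarrow> b) F"
  shows "((\<lambda>x. conj_by (f x) (g x)) \<longlongrightarrow> conj_by a b) F"
  unfolding conj_by_def uinv_def using assms by (intro tendsto_matrix_mult tendsto_adj tendsto_const)

lemma continuous_mat_mult: "continuous_on S (\<lambda>d. mat d ** B)" for B :: "complex ^ 'm ^ 'n"
proof -
  have "mat d ** B = (\<chi> i j. d * B $ i $ j)" for d
  proof -
    have "(if i = k then d else 0) * B $ k $ j = (if i = k then d * B $ k $ j else 0)" for i j k by simp
    then show ?thesis by (simp add: matrix_matrix_mult_def mat_def vec_eq_iff)
  qed
  then show ?thesis by (simp only:) (intro continuous_intros)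
qed

text \<open>Boosts to z1 and to its image reduce H to an element E fixing 0, whose corner entry has
  modulus 1. In this way conjugates that meet a common ball are confined to a bounded set, from
  which a limit can be extracted.\<close>

lemma un1_norm_bound:
  fixes H :: "complex ^ ('n::finite option) ^ ('n option)"
  assumes H: "un1 H" and z: "z1 \<in> cball_model" "act H z1 \<in> cball_model" "(gam z1)\<^sup>2 \<le> g" "(gam (act H z1))\<^sup>2 \<le> g"
  shows "norm H \<le> (real CARD('n) + 1) * (real CARD('n) + 4 * g)"
proof -
  let ?T1 = "Tm z1" and ?T2 = "Tm (act H z1)"
  note T = un1_Tm[OF z(1)] un1_Tm[OF z(2)]
  have g: "1 \<le> g" using gam(1)[OF z(1)] z(3) by (metis one_le_power order_trans)
  have nT: "norm (Tm x) \<le> sqrt (real CARD('n) + 4 * g)" if x: "x \<in> cball_model" "(gam x)\<^sup>2 \<le> g" for x :: "complex ^ 'n"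
  proof (rule real_le_rsqrt)
    have "Tm x $ None $ None = of_real (gam x)" by (simp add: Tm_def bo_def blk_def)
    then show "(norm (Tm x))\<^sup>2 \<le> real CARD('n) + 4 * g" using un1_norm[OF un1_Tm[OF x(1)]] x(2) by simp
  qed
  define E where "E = uinv ?T2 ** (H ** ?T1)"
  have E: "un1 E" unfolding E_def by (intro un1_mult un1_uinv T H)
  have "act (H ** ?T1) 0 = act H z1" using act_mult[OF T(1) zero_in_ball, of H] by (simp add: act_Tm_0[OF z(1)])
  moreover have "act (uinv ?T2) (act H z1) = 0" using act_uinv(1)[OF T(2) zero_in_ball] by (simp add: act_Tm_0[OF z(2)])
  ultimately have E0: "act E 0 = 0" unfolding E_def using act_mult[OF un1_mult[OF H T(1)] zero_in_ball, of "uinv ?T2"] by simp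
  have den: "(E *v pv 0 1) $ None = E $ None $ None" by (simp add: matrix_vector_mult_def sum_option pv_def)
  have "(cmod (E $ None $ None))\<^sup>2 = 1" using un1_act_norm[OF E zero_in_ball] un1_denom[OF E zero_in_ball] by (simp add: den E0 field_simps)
  then have nE: "(norm E)\<^sup>2 = real CARD('n) + 1" using un1_norm[OF E] by simp
  have "norm E \<le> real CARD('n) + 1"
  proof (rule power2_le_imp_le)
    show "(norm E)\<^sup>2 \<le> (real CARD('n) + 1)\<^sup>2" unfolding nE by (rule self_le_power) auto
  qed simp
  have "H = ?T2 ** (E ** uinv ?T1)"
  proof -
    have "?T2 ** (E ** uinv ?T1) = (?T2 ** (uinv ?T2 ** H)) ** (?T1 ** uinv ?T1)" by (simp only: E_def matrix_mul_assoc)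
    then show ?thesis by (simp only: un1_cancel(2)[OF T(2)] uinv_right[OF T(1)] matrix_mul_rid)
  qed
  then have "norm H \<le> norm ?T2 * norm (E ** uinv ?T1)" using norm_matrix_mult[of ?T2 "E ** uinv ?T1"] by simp
  also have "\<dots> \<le> norm ?T2 * (norm E * norm ?T1)" using norm_matrix_mult[of E "uinv ?T1"] by (intro mult_left_mono) auto
  also have "\<dots> \<le> sqrt (real CARD('n) + 4 * g) * ((real CARD('n) + 1) * sqrt (real CARD('n) + 4 * g))"
    using nT z g \<open>norm E \<le> real CARD('n) + 1\<close> by (intro mult_mono) auto
  also have "\<dots> = (real CARD('n) + 1) * (real CARD('n) + 4 * g)" using g by simp
  finally show ?thesis .
qed

text \<open>A crude choice, with h of order \<epsilon>^2 and X and t of order \<epsilon>. It serves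
  to give small balls some positive volume in the quotient.\<close>

lemma packing_parameters_exist:
  fixes \<epsilon> :: real and n :: nat
  assumes \<epsilon>: "0 < \<epsilon>" "\<epsilon> \<le> 1" and n: "1 \<le> n"
  obtains q h t X :: real where "0 < q" "q < 1" "h = q / (1 - q)" "h \<le> 1" "0 < t" "t < 1" "0 \<le> X"
    "(\<Sum>j=1..n. 4 * (1 - sqrt (1 - t\<^sup>2))) \<le> (X / 2)\<^sup>2" "8 * h + 17 * h\<^sup>2 + 2 * h * X + X\<^sup>2 * (1 + h) < \<epsilon>\<^sup>2"
proof -
  define h X t where "h = \<epsilon>\<^sup>2 / 100" and "X = \<epsilon> / 4" and "t = \<epsilon> / (16 * real n)"
  have e2: "0 < \<epsilon>\<^sup>2" "\<epsilon>\<^sup>2 \<le> 1" using \<epsilon> by (auto simp: power_le_one)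
  have h: "0 < h" "h \<le> 1 / 100" using e2 by (auto simp: h_def)
  have x: "1 \<le> real n" using n by simp
  have t: "0 < t" "t \<le> 1 / 16" "t \<le> \<epsilon> / 16" unfolding t_def using \<epsilon> x by (auto simp: field_simps)
  have t2: "0 \<le> t\<^sup>2" "t\<^sup>2 \<le> 1" using t by (auto simp: power_le_one)
  have "1 - t\<^sup>2 \<le> sqrt (1 - t\<^sup>2)"
  proof (rule real_le_rsqrt)
    have "(1 - t\<^sup>2) * (1 - t\<^sup>2) \<le> (1 - t\<^sup>2) * 1" using t2 by (intro mult_left_mono) auto
    then show "(1 - t\<^sup>2)\<^sup>2 \<le> 1 - t\<^sup>2" by (simp add: power2_eq_square)
  qed
  then have "(\<Sum>j=1..n. 4 * (1 - sqrt (1 - t\<^sup>2))) \<le> real n * (4 * t\<^sup>2)" by (simp add: mult_left_mono)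
  also have "\<dots> = (4 * real n * t) * t" by (simp add: power2_eq_square)
  also have "4 * real n * t = \<epsilon> / 4" unfolding t_def using x by simp
  also have "\<epsilon> / 4 * t \<le> \<epsilon> / 4 * (\<epsilon> / 16)" using t \<epsilon> by (intro mult_left_mono) auto
  also have "\<dots> = (X / 2)\<^sup>2" by (simp add: X_def power2_eq_square)
  finally have s: "(\<Sum>j=1..n. 4 * (1 - sqrt (1 - t\<^sup>2))) \<le> (X / 2)\<^sup>2" .
  have 1: "17 * h\<^sup>2 \<le> 17 / 100 * h" using h mult_left_mono[of h "1 / 100" h] by (simp add: power2_eq_square)
  have 2: "2 * h * X \<le> 2 * h * (1 / 4)" using h \<epsilon> by (intro mult_left_mono) (auto simp: X_def)
  have 3: "X\<^sup>2 * (1 + h) \<le> X\<^sup>2 * (101 / 100)" using h by (intro mult_left_mono) auto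
  have "X\<^sup>2 = \<epsilon>\<^sup>2 / 16" by (simp add: X_def power_divide)
  then have main: "8 * h + 17 * h\<^sup>2 + 2 * h * X + X\<^sup>2 * (1 + h) < \<epsilon>\<^sup>2" using 1 2 3 e2 h_def by linarith
  show thesis
  proof (rule that[of "h / (1 + h)" h t X])
    show "h = (h / (1 + h)) / (1 - h / (1 + h))" using h by (simp add: field_simps)
  qed (use h t \<epsilon> s main in \<open>auto simp: X_def\<close>)
qed

text \<open>To leading order the radii t j enter the volume through the sum of (2 j - 1) ln (t j)
  and the cost through twice the sum of (t j)^2; maximizing at fixed cost makes (t j)^2 proportional
  to 2 j - 1. The numbers 45/1000, 24/1000 and 194/1000 divide the budget (9/20)^2 = 0.2025 between
  displacement, about 8 h, and rotation, about X^2.\<close>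

lemma main_packing_parameters:
  assumes n: "1 \<le> n"
  defines "q \<equiv> 45 / 1000 / (real n + 2)" and "\<sigma> \<equiv> 24 / 1000 / (real n * (real n + 2))"
  defines "h \<equiv> q / (1 - q)" and "X \<equiv> sqrt (194 / 1000 * real n / (real n + 2))"
  shows "0 < q" "q < 1" "h \<le> 1" "0 \<le> X"
    "\<And>j. j \<in> {1..n} \<Longrightarrow> 0 < sqrt ((2 * real j - 1) * \<sigma>) \<and> sqrt ((2 * real j - 1) * \<sigma>) < 1"
    "(\<Sum>j=1..n. 4 * (1 - sqrt (1 - (sqrt ((2 * real j - 1) * \<sigma>))\<^sup>2))) \<le> (X / 2)\<^sup>2"
    "8 * h + 17 * h\<^sup>2 + 2 * h * X + X\<^sup>2 * (1 + h) < (9 / 20)\<^sup>2"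
proof -
  have x: "1 \<le> real n" using n by simp
  \<comment> \<open>In this variable n / (n + 2) is 1 - 2 y, and the last inequality is reduced to a
    quadratic one on (0, 1/3].\<close>
  define y where "y = 1 / (real n + 2)"
  have y: "0 < y" "y \<le> 1 / 3" unfolding y_def using x by (auto simp: field_simps)
  have qy: "q = 45 / 1000 * y" by (simp add: q_def y_def)
  then show q: "0 < q" "q < 1" using y by auto
  have \<sigma>: "0 < \<sigma>" using x by (simp add: \<sigma>_def)
  have ny: "real n / (real n + 2) = 1 - 2 * y" unfolding y_def using x by (simp add: field_simps)
  have n\<sigma>: "real n * \<sigma> = 24 / 1000 * y" unfolding \<sigma>_def y_def using x by simp
  have h: "0 \<le> h" "h \<le> 457 / 10000 * y"
  proof -
    show "0 \<le> h" using q by (simp add: h_def)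
    have "0 \<le> 7 / 10000 - 457 / 10000 * (45 / 1000) * y" using y by simp
    then have "0 \<le> y * (7 / 10000 - 457 / 10000 * (45 / 1000) * y)" using y by (intro mult_nonneg_nonneg) auto
    then have "45 / 1000 * y \<le> 457 / 10000 * y * (1 - 45 / 1000 * y)" by (simp add: algebra_simps)
    then show "h \<le> 457 / 10000 * y" unfolding h_def using q by (subst pos_divide_le_eq) (auto simp: qy)
  qed
  then show "h \<le> 1" using y by linarith
  show X0: "0 \<le> X" by (simp add: X_def)
  have X2: "X\<^sup>2 = 194 / 1000 * (1 - 2 * y)" unfolding X_def ny[symmetric] by simp
  have tj: "0 < (2 * real j - 1) * \<sigma>" "(2 * real j - 1) * \<sigma> \<le> 16 / 1000" if "j \<in> {1..n}" for j
  proof -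
    have j: "1 \<le> real j" "real j \<le> real n" using that by auto
    then show "0 < (2 * real j - 1) * \<sigma>" using \<sigma> by simp
    have "(2 * real j - 1) * \<sigma> \<le> (2 * real n) * \<sigma>" using j \<sigma> by (intro mult_right_mono) auto
    also have "\<dots> = 48 / 1000 * y" using n\<sigma> by (simp add: mult.commute)
    finally show "(2 * real j - 1) * \<sigma> \<le> 16 / 1000" using y by linarith
  qed
  show "0 < sqrt ((2 * real j - 1) * \<sigma>) \<and> sqrt ((2 * real j - 1) * \<sigma>) < 1" if "j \<in> {1..n}" for j
    using tj[OF that] by simp
  have sq: "1 - sqrt (1 - x) \<le> x * (1 / 2 * (1 + 16 / 3000))" if x: "0 \<le> x" "x \<le> 16 / 1000" for x :: real
  proof -
    have "1 - x / 2 * (1 + x / 3) \<le> sqrt (1 - x)"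
    proof (rule real_le_rsqrt)
      have "(1 + x / 3) * (1 + x / 3) \<le> (4 / 3 :: real)" using x mult_mono[of "1 + x / 3" "101 / 100" "1 + x / 3" "101 / 100"] by simp
      then have "0 \<le> x\<^sup>2 / 4 * (4 / 3 - (1 + x / 3) * (1 + x / 3))" by (intro mult_nonneg_nonneg) auto
      also have "\<dots> = (1 - x) - (1 - x / 2 * (1 + x / 3))\<^sup>2" by (simp add: power2_eq_square field_simps)
      finally show "(1 - x / 2 * (1 + x / 3))\<^sup>2 \<le> 1 - x" by simp
    qed
    moreover have "x / 2 * (1 + x / 3) \<le> x / 2 * (1 + 16 / 3000)" using x by (intro mult_left_mono) auto
    ultimately show ?thesis by simp
  qed
  have "(\<Sum>j=1..n. 4 * (1 - sqrt (1 - (sqrt ((2 * real j - 1) * \<sigma>))\<^sup>2)))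
    \<le> (\<Sum>j=1..n. 4 * (((2 * real j - 1) * \<sigma>) * (1 / 2 * (1 + 16 / 3000))))"
  proof (intro sum_mono mult_left_mono)
    fix j assume j: "j \<in> {1..n}"
    show "1 - sqrt (1 - (sqrt ((2 * real j - 1) * \<sigma>))\<^sup>2) \<le> ((2 * real j - 1) * \<sigma>) * (1 / 2 * (1 + 16 / 3000))"
      using sq[of "(2 * real j - 1) * \<sigma>"] tj[OF j] by simp
  qed simp
  also have "\<dots> = (\<Sum>j=1..n. 2 * real j - 1) * (\<sigma> * (2 * (1 + 16 / 3000)))"
    unfolding sum_distrib_right by (intro sum.cong) auto
  also have "\<dots> = real n * (real n * \<sigma>) * (2 * (1 + 16 / 3000))" unfolding sum_odd_numbers by (simp add: power2_eq_square)
  also have "\<dots> = 48 / 1000 * (1 + 16 / 3000) * (real n * y)" unfolding n\<sigma> by simp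
  also have "real n * y = real n / (real n + 2)" by (simp add: y_def)
  also have "48 / 1000 * (1 + 16 / 3000) * (real n / (real n + 2)) \<le> 485 / 10000 * (real n / (real n + 2))" by (intro mult_right_mono) auto
  also have "\<dots> = (X / 2)\<^sup>2" unfolding power_divide X2 ny by simp
  finally show "(\<Sum>j=1..n. 4 * (1 - sqrt (1 - (sqrt ((2 * real j - 1) * \<sigma>))\<^sup>2))) \<le> (X / 2)\<^sup>2" .
  \<comment> \<open>Linearizes X in y by a tangent to the square root; 35/100 lies near the middle
    of the range of X.\<close>
  have Xle: "X \<le> 45215 / 100000 - 5542 / 10000 * y"
  proof -
    have "0 \<le> (X - 35 / 100)\<^sup>2" by simp
    then have "7 / 10 * X \<le> X\<^sup>2 + 1225 / 10000" by (simp add: power2_eq_square algebra_simps)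
    moreover have "X\<^sup>2 = 194 / 1000 - 388 / 1000 * y" unfolding X2 right_diff_distrib by simp
    ultimately show ?thesis using y by linarith
  qed
  have 1: "17 * h\<^sup>2 \<le> 17 * (457 / 10000 * y)\<^sup>2" using h by (intro mult_left_mono power_mono) auto
  have 2: "2 * h * X \<le> 2 * (457 / 10000 * y) * (45215 / 100000 - 5542 / 10000 * y)"
    using h X0 Xle by (intro mult_mono) auto
  have 3: "X\<^sup>2 * (1 + h) \<le> X\<^sup>2 * (1 + 457 / 10000 * y)" using h by (intro mult_left_mono) auto
  have "0 \<le> (y - 2 / 5)\<^sup>2" by simp
  then have 4: "4 / 5 * y - 16 / 100 \<le> y * y" by (simp add: power2_eq_square algebra_simps)
  have "8 * (457 / 10000 * y) + 17 * (457 / 10000 * y)\<^sup>2 + 2 * (457 / 10000 * y) * (45215 / 100000 - 5542 / 10000 * y)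
    + 194 / 1000 * (1 - 2 * y) * (1 + 457 / 10000 * y) < (9 / 20)\<^sup>2"
  proof -
    have e: "8 * (k * y) + 17 * (k * y)\<^sup>2 + 2 * (k * y) * (a - b * y) + c * (1 - 2 * y) * (1 + k * y)
      = c + (8 * k + 2 * k * a - 2 * c + c * k) * y + (17 * (k * k) - 2 * k * b - 2 * c * k) * (y * y)" for k a b c :: real
      by (simp add: power2_eq_square algebra_simps)
    have "(8 * (457 / 10000) + 2 * (457 / 10000) * (45215 / 100000) - 2 * (194 / 1000) + 194 / 1000 * (457 / 10000)) * y \<le> 278 / 10000 * y"
      using y by (intro mult_right_mono) simp_all
    moreover have "(17 * (457 / 10000 * (457 / 10000)) - 2 * (457 / 10000) * (5542 / 10000) - 2 * (194 / 1000) * (457 / 10000)) * (y * y)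
      \<le> - (328 / 10000) * (y * y)"
      using y by (intro mult_right_mono) simp_all
    moreover have "194 / 1000 + 278 / 10000 * y + - (328 / 10000) * (y * y) < (9 / 20)\<^sup>2"
    proof -
      have "(9 / 20)\<^sup>2 = (2025 / 10000 :: real)" by (simp add: power_divide)
      then show ?thesis using 4 y by linarith
    qed
    ultimately show ?thesis unfolding e by linarith
  qed
  then show "8 * h + 17 * h\<^sup>2 + 2 * h * X + X\<^sup>2 * (1 + h) < (9 / 20)\<^sup>2"
    using 1 2 3 h(2) unfolding X2 by linarith
qed

text \<open>The density is at least 4^n, its value at 0, so the Euclidean volume of a ball in real
  dimension 2 n suffices.\<close>

lemma ball_volume_ge:
  assumes q: "0 < q" "q < 1"
  shows "ennreal ((4 * pi * q) ^ CARD('n) / fact CARD('n)) \<le> emeasure bergman_volume {z :: complex ^ 'n. (norm z)\<^sup>2 < q}"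
proof -
  let ?D = "{z :: complex ^ 'n. (norm z)\<^sup>2 < q}"
  have D: "?D = ball 0 (sqrt q)"
    using q by (auto intro: real_less_rsqrt) (metis norm_ge_zero real_sqrt_abs real_sqrt_less_iff abs_norm_cancel real_sqrt_less_mono real_sqrt_pow2_iff less_eq_real_def power_strict_mono zero_less_numeral)
  have sub: "?D \<subseteq> cball_model" using q by (auto simp: ball_iff)
  have Db: "?D \<in> sets borel" unfolding D by simp
  have "ennreal ((4 * pi * q) ^ CARD('n) / fact CARD('n)) = ennreal (4 ^ CARD('n)) * ennreal (unit_ball_vol (real (2 * CARD('n))) * sqrt q ^ (2 * CARD('n)))"
    unfolding unit_ball_vol_even power_mult using q by (simp add: ennreal_mult[symmetric] power_mult_distrib)
  also have "\<dots> = ennreal (4 ^ CARD('n)) * emeasure lborel ?D"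
    unfolding D using q by (subst emeasure_ball) (simp_all add: mult.commute)
  also have "\<dots> = (\<integral>\<^sup>+z. ennreal (4 ^ CARD('n)) * indicator ?D z \<partial>lborel)" using Db by (simp add: nn_integral_cmult)
  also have "\<dots> \<le> (\<integral>\<^sup>+z. ennreal (4 ^ CARD('n) / (1 - (norm z)\<^sup>2) ^ (CARD('n) + 1)) * indicator ?D z \<partial>lborel)"
  proof (rule nn_integral_mono)
    fix z :: "complex ^ 'n"
    show "ennreal (4 ^ CARD('n)) * indicator ?D z \<le> ennreal (4 ^ CARD('n) / (1 - (norm z)\<^sup>2) ^ (CARD('n) + 1)) * indicator ?D z"
    proof (cases "z \<in> ?D")
      case True
      then have z: "0 < 1 - (norm z)\<^sup>2" "1 - (norm z)\<^sup>2 \<le> 1" using q by auto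
      have "(1 - (norm z)\<^sup>2) ^ (CARD('n) + 1) \<le> 1" using z by (intro power_le_one) auto
      moreover have "0 < (1 - (norm z)\<^sup>2) ^ (CARD('n) + 1)" using z by (intro zero_less_power)
      ultimately have "4 ^ CARD('n) * 1 \<le> 4 ^ CARD('n) / (1 - (norm z)\<^sup>2) ^ (CARD('n) + 1)"
        by (subst pos_le_divide_eq) (auto intro: mult_left_mono)
      then show ?thesis by (intro mult_right_mono ennreal_leI) auto
    qed simp
  qed
  also have "\<dots> = emeasure bergman_volume ?D"
    unfolding bergman_volume_def using Db sub
    by (subst emeasure_density) (auto intro!: nn_integral_cong split: split_indicator simp: open_cball_model[THEN borel_open])
  finally show ?thesis .
qed

section \<open>Minimal elements and the extremal conjugate\<close>

lemma unitary_lift_compact: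
  fixes \<Gamma> :: "(complex ^ 'n \<Rightarrow> complex ^ 'n) set"
  assumes \<Gamma>: "discrete_holo_group \<Gamma>"
  shows "compact {A \<in> unitary_lift \<Gamma>. \<not> scalar_matrix A \<and> norm A \<le> R}"
proof -
  obtain T where T: "finite T" "T \<subseteq> unitary_lift \<Gamma>"
    "\<And>A. A \<in> unitary_lift \<Gamma> \<Longrightarrow> norm A \<le> R \<Longrightarrow> \<exists>B\<in>T. \<exists>d. cmod d = 1 \<and> A = mat d ** B"
    using unitary_lift_finite[OF \<Gamma>, of R] by blast
  let ?T = "{B \<in> T. \<not> scalar_matrix B \<and> norm B \<le> R}"
  have sc: "scalar_matrix (mat d ** B) \<longleftrightarrow> scalar_matrix B" if d: "cmod d = 1" for d and B :: "complex ^ 'n option ^ 'n option"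
  proof
    have dd: "cnj d * d = 1" using d by (metis complex_norm_square mult.commute of_real_1 power_one)
    assume "scalar_matrix (mat d ** B)"
    then obtain e where e: "cmod e = 1" "mat d ** B = mat e" by (auto simp: scalar_matrix_def)
    have "B = mat (cnj d) ** (mat d ** B)" by (simp add: matrix_mul_assoc mat_mult_mat dd)
    also have "\<dots> = mat (cnj d * e)" by (simp only: e(2) mat_mult_mat)
    finally show "scalar_matrix B" unfolding scalar_matrix_def using d e(1) by (intro exI[of _ "cnj d * e"]) (simp add: norm_mult)
  next
    assume "scalar_matrix B"
    then obtain e where e: "cmod e = 1" "B = mat e" by (auto simp: scalar_matrix_def)
    then show "scalar_matrix (mat d ** B)"
      unfolding scalar_matrix_def using d by (intro exI[of _ "d * e"]) (simp add: mat_mult_mat norm_mult)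
  qed
  have "{A \<in> unitary_lift \<Gamma>. \<not> scalar_matrix A \<and> norm A \<le> R} = (\<Union>B\<in>?T. (\<lambda>d. mat d ** B) ` sphere 0 1)"
  proof (intro set_eqI iffI)
    fix A assume A: "A \<in> {A \<in> unitary_lift \<Gamma>. \<not> scalar_matrix A \<and> norm A \<le> R}"
    then obtain B d where B: "B \<in> T" "cmod d = 1" "A = mat d ** B" using T(3) by blast
    then have "B \<in> ?T" using A sc[OF B(2)] by (simp add: norm_mat_mult)
    then show "A \<in> (\<Union>B\<in>?T. (\<lambda>d. mat d ** B) ` sphere 0 1)" using B by auto
  next
    fix A assume "A \<in> (\<Union>B\<in>?T. (\<lambda>d. mat d ** B) ` sphere 0 1)"
    then obtain B d where B: "B \<in> ?T" "cmod d = 1" "A = mat d ** B" by auto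
    then have "A \<in> unitary_lift \<Gamma>" using T(2) by (auto intro!: unitary_lift_mult[OF \<Gamma>] unitary_lift_scalar[OF \<Gamma>])
    then show "A \<in> {A \<in> unitary_lift \<Gamma>. \<not> scalar_matrix A \<and> norm A \<le> R}" using B sc[OF B(2)] by (simp add: norm_mat_mult)
  qed
  moreover have "compact \<dots>"
    using T(1) by (intro compact_UN finite_subset[OF _ T(1)] compact_continuous_image continuous_mat_mult) auto
  ultimately show ?thesis by simp
qed

text \<open>Elements whose conjugates are at most as far from the identity as that of A0 have
  bounded norm, so the minimum is attained on a compact set.\<close>

lemma displacement_minimum:
  fixes \<Gamma> :: "(complex ^ 'n \<Rightarrow> complex ^ 'n) set"
  assumes \<Gamma>: "discrete_holo_group \<Gamma>" and G: "un1 G"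
    and A0: "A0 \<in> unitary_lift \<Gamma>" "\<not> scalar_matrix A0"
  shows "\<exists>A. A \<in> unitary_lift \<Gamma> \<and> \<not> scalar_matrix A \<and>
    (\<forall>A'\<in>unitary_lift \<Gamma>. \<not> scalar_matrix A' \<longrightarrow> norm (conj_by G A - mat 1) \<le> norm (conj_by G A' - mat 1))"
proof -
  let ?N = "\<lambda>A. norm (conj_by G A - mat 1)"
  define R where "R = norm G * (?N A0 + norm (mat 1 :: complex ^ 'n option ^ 'n option)) * norm G"
  let ?K = "{A \<in> unitary_lift \<Gamma>. \<not> scalar_matrix A \<and> norm A \<le> R}"
  have inK: "A \<in> ?K" if A: "A \<in> unitary_lift \<Gamma>" "\<not> scalar_matrix A" "?N A \<le> ?N A0" for A
  proof -
    have "norm (conj_by G A) \<le> ?N A + norm (mat 1 :: complex ^ 'n option ^ 'n option)" using norm_triangle_sub[of "conj_by G A" "mat 1"] by simp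
    also have "\<dots> \<le> ?N A0 + norm (mat 1 :: complex ^ 'n option ^ 'n option)" using A(3) by simp
    finally have 1: "norm (conj_by G A) \<le> ?N A0 + norm (mat 1 :: complex ^ 'n option ^ 'n option)" .
    have "norm A = norm (conj_by (uinv G) (conj_by G A))" by (simp only: conj_by_cancel[OF G])
    also have "\<dots> \<le> norm G * norm (conj_by G A) * norm G" using norm_conj_by[of "uinv G" "conj_by G A"] by simp
    also have "\<dots> \<le> R" unfolding R_def using 1 by (intro mult_right_mono mult_left_mono) auto
    finally show ?thesis using A by simp
  qed
  have cont: "continuous_on ?K ?N"
    by (intro continuous_on_norm continuous_on_diff continuous_on_const) (auto simp: continuous_on_def intro!: tendsto_conj_by tendsto_intros)
  have ne: "?K \<noteq> {}" using inK[OF A0 order_refl] by blast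
  obtain A where A: "A \<in> ?K" "\<And>A'. A' \<in> ?K \<Longrightarrow> ?N A \<le> ?N A'"
    using continuous_attains_inf[OF unitary_lift_compact[OF \<Gamma>] ne cont] by blast
  have "?N A \<le> ?N A'" if "A' \<in> unitary_lift \<Gamma>" "\<not> scalar_matrix A'" for A'
  proof (cases "?N A' \<le> ?N A0")
    case True
    show ?thesis by (rule A(2)[OF inK[OF that True]])
  next
    case False
    then show ?thesis using A(2)[OF inK[OF A0 order_refl]] by linarith
  qed
  then show ?thesis using A(1) by blast
qed

text \<open>The assumption that F is too small is used twice: it makes the volume finite, which
  provides an extremal conjugate, and it puts every minimal distance below 9/20, so that
  \<open>small_elements_can_be_enlarged\<close> applies to the extremal one.\<close>

lemma fundamental_set_volume_ge_volC:
  fixes \<Gamma> :: "(complex ^ 'n \<Rightarrow> complex ^ 'n) set"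
  assumes \<Gamma>: "discrete_holo_group \<Gamma>" and F: "fundamental_set \<Gamma> F"
  shows "ennreal (volC CARD('n)) \<le> emeasure bergman_volume F"
proof (rule ccontr)
  assume "\<not> ?thesis"
  then have less: "emeasure bergman_volume F < ennreal (volC CARD('n))" by simp
  let ?\<Lambda> = "unitary_lift \<Gamma>" and ?n = "CARD('n)"
  let ?N = "\<lambda>G A. norm (conj_by G A - mat 1) :: real"
  have n: "1 \<le> ?n" by (simp add: Suc_leI)
  have Fb: "F \<in> sets borel" using F by (simp add: fundamental_set_def)
  \<comment> \<open>If all nonscalar elements stayed at distance 9/20 or more at some G, packing
    around that base point would already give the volume \<open>volC\<close>.\<close>
  have close: "\<exists>A\<in>?\<Lambda>. \<not> scalar_matrix A \<and> ?N G A < 9 / 20" if G: "un1 G" for G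
  proof (rule ccontr)
    assume "\<not> ?thesis"
    then have sep: "9 / 20 \<le> norm (uinv G ** A ** G - mat 1)" if "A \<in> ?\<Lambda>" "\<not> scalar_matrix A" for A
      using that by (force simp: conj_by_def)
    define q where "q = 45 / 1000 / (real ?n + 2)"
    define \<sigma> where "\<sigma> = 24 / 1000 / (real ?n * (real ?n + 2))"
    \<comment> \<open>The value 1/2 beyond n is a filler that keeps every radius in (0, 1); only the
      radii up to n occur in sum and product.\<close>
    define t where "t j = (if j \<le> ?n then sqrt ((2 * real j - 1) * \<sigma>) else 1 / 2)" for j
    note par = main_packing_parameters[OF n, folded q_def \<sigma>_def]
    have t: "0 < t j \<and> t j < 1" if "1 \<le> j" for j using par(5)[of j] that by (simp add: t_def)
    have s: "(\<Sum>j=1..?n. 4 * (1 - sqrt (1 - (t j)\<^sup>2))) \<le> (sqrt (194 / 1000 * real ?n / (real ?n + 2)) / 2)\<^sup>2"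
    proof -
      have "(\<Sum>j=1..?n. 4 * (1 - sqrt (1 - (t j)\<^sup>2))) = (\<Sum>j=1..?n. 4 * (1 - sqrt (1 - (sqrt ((2 * real j - 1) * \<sigma>))\<^sup>2)))"
        by (intro sum.cong) (simp_all add: t_def)
      then show ?thesis using par(6) by (simp only:)
    qed
    have tp: "(\<Prod>j=1..?n. cap_ratio j (t j)) = (\<Prod>j=1..?n. cap_ratio j (sqrt ((2 * real j - 1) * \<sigma>)))"
      by (intro prod.cong) (simp_all add: t_def)
    let ?W = "{w \<in> F. \<exists>g\<in>\<Gamma>. g w \<in> act G ` {z. (norm z)\<^sup>2 < q}}"
    have P0: "0 \<le> (\<Prod>j=1..?n. cap_ratio j (t j))" using ln_cap_ratio_ge(1) t by (intro prod_nonneg less_imp_le) auto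
    have "ennreal (volC ?n) \<le> ennreal ((4 * pi * q) ^ ?n / fact ?n * (\<Prod>j=1..?n. cap_ratio j (t j)))"
      unfolding tp using volC_le_cap_product[OF n, folded q_def \<sigma>_def] by (rule ennreal_leI)
    also have "\<dots> = ennreal ((4 * pi * q) ^ ?n / fact ?n) * ennreal (\<Prod>j=1..?n. cap_ratio j (t j))"
      using par(1) P0 by (intro ennreal_mult) auto
    also have "\<dots> \<le> emeasure bergman_volume {z :: complex ^ 'n. (norm z)\<^sup>2 < q} * ennreal (\<Prod>j=1..?n. cap_ratio j (t j))"
      by (intro mult_right_mono ball_volume_ge par zero_le)
    also have "\<dots> \<le> emeasure bergman_volume ?W"
      by (rule separated_ball_volume(1)[OF \<Gamma> F G sep par(1,2) refl par(3) t s par(4) par(7)]) auto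
    also have "\<dots> \<le> emeasure bergman_volume F" using Fb by (intro emeasure_mono) auto
    finally show False using less by simp
  qed
  obtain A0 where A0: "A0 \<in> ?\<Lambda>" "\<not> scalar_matrix A0" using close[of "mat 1"] un1_mat1 by blast
  obtain a where a: "\<And>G. un1 G \<Longrightarrow> a G \<in> ?\<Lambda>" "\<And>G. un1 G \<Longrightarrow> \<not> scalar_matrix (a G)"
    "\<And>G A. un1 G \<Longrightarrow> A \<in> ?\<Lambda> \<Longrightarrow> \<not> scalar_matrix A \<Longrightarrow> ?N G (a G) \<le> ?N G A"
    using displacement_minimum[OF \<Gamma> _ A0] by metis
  define m where "m G = ?N G (a G)" for G
  have m_lt: "m G < 9 / 20" if "un1 G" for G using close[OF that] a(3)[OF that] unfolding m_def by fastforce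
  have m_pos: "0 < m G" if G: "un1 G" for G
  proof -
    have "conj_by G (a G) \<noteq> mat 1"
    proof
      assume "conj_by G (a G) = mat 1"
      then have "scalar_matrix (conj_by G (a G))" unfolding scalar_matrix_def by (intro exI[of _ 1]) simp
      then show False using a(2)[OF G] scalar_conj_by[OF G] by simp
    qed
    then show ?thesis by (simp add: m_def)
  qed
  have un: "un1 A" if "A \<in> ?\<Lambda>" for A using that by (rule unitary_lift_un1)
  \<comment> \<open>Only conjugates that do at least as well as the identity matter for the
    supremum, and for all of them \<delta> gives one common packing radius q.\<close>
  define \<delta> where "\<delta> = m (mat 1)"
  have \<delta>: "0 < \<delta>" "\<delta> \<le> 1" using m_pos[of "mat 1"] m_lt[of "mat 1"] by (auto simp: \<delta>_def)
  obtain q h t X :: real where p: "0 < q" "q < 1" "h = q / (1 - q)" "h \<le> 1" "0 < t" "t < 1" "0 \<le> X"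
    "(\<Sum>j=1..?n. 4 * (1 - sqrt (1 - t\<^sup>2))) \<le> (X / 2)\<^sup>2" "8 * h + 17 * h\<^sup>2 + 2 * h * X + X\<^sup>2 * (1 + h) < \<delta>\<^sup>2"
    using packing_parameters_exist[OF \<delta> n] by metis
  define D where "D = {z :: complex ^ 'n. (norm z)\<^sup>2 < q}"
  have Dsub: "z \<in> cball_model" if "z \<in> D" for z using that p by (simp add: D_def ball_iff)
  \<comment> \<open>The part of F whose orbits meet the ball at the base point of G. Disjointness of
    these sets expresses disjointness of the balls in the quotient.\<close>
  define Ob where "Ob G = {w \<in> F. \<exists>g\<in>\<Gamma>. g w \<in> act G ` D}" for G
  define v where "v = (4 * pi * q) ^ ?n / fact ?n * (\<Prod>j=1..?n. cap_ratio j t)"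
  have cp: "0 < (\<Prod>j=1..?n. cap_ratio j t)" using ln_cap_ratio_ge(1) p by (intro prod_pos) auto
  have v: "0 < v" unfolding v_def using p cp by simp
  have Ob: "Ob G \<in> sets borel" "ennreal v \<le> emeasure bergman_volume (Ob G)" if G: "un1 G" "\<delta> \<le> m G" for G
  proof -
    have sep: "\<delta> \<le> norm (uinv G ** A ** G - mat 1)" if "A \<in> ?\<Lambda>" "\<not> scalar_matrix A" for A
      using a(3)[OF G(1) that] G(2) by (simp add: m_def conj_by_def)
    note V = separated_ball_volume[OF \<Gamma> F G(1) sep p(1,2,3,4) _ p(8) p(7,9)]
    show "Ob G \<in> sets borel" unfolding Ob_def D_def using p \<delta> by (intro V(2)) auto
    have "ennreal v = ennreal ((4 * pi * q) ^ ?n / fact ?n) * ennreal (\<Prod>j=1..?n. cap_ratio j t)"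
      unfolding v_def using p cp by (intro ennreal_mult) auto
    also have "\<dots> \<le> emeasure bergman_volume D * ennreal (\<Prod>j=1..?n. cap_ratio j t)"
      unfolding D_def by (intro mult_right_mono ball_volume_ge p zero_le)
    also have "\<dots> \<le> emeasure bergman_volume (Ob G)" unfolding Ob_def D_def using p \<delta> by (intro V(1)) auto
    finally show "ennreal v \<le> emeasure bergman_volume (Ob G)" .
  qed
  \<comment> \<open>Disjoint families have at most b / v members, since each set takes volume v out
    of F. A family of largest size is then met by the set \<open>Ob G\<close> of every admissible
    G.\<close>
  define \<P> where "\<P> I \<longleftrightarrow> finite I \<and> (\<forall>G\<in>I. un1 G \<and> \<delta> \<le> m G) \<and> disjoint_family_on Ob I" for I
  obtain b where b: "0 \<le> b" "emeasure bergman_volume F = ennreal b"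
    using less by (cases "emeasure bergman_volume F" rule: ennreal_cases) auto
  have card: "card I < Suc (nat \<lfloor>b / v\<rfloor>)" if I: "\<P> I" for I
  proof -
    have "(\<Sum>G\<in>I. ennreal v) \<le> (\<Sum>G\<in>I. emeasure bergman_volume (Ob G))" using I Ob(2) by (intro sum_mono) (auto simp: \<P>_def)
    also have "\<dots> = emeasure bergman_volume (\<Union>G\<in>I. Ob G)"
      using I Ob(1) by (intro sum_emeasure) (auto simp: \<P>_def)
    also have "\<dots> \<le> emeasure bergman_volume F" using Fb by (intro emeasure_mono) (auto simp: Ob_def)
    finally have "ennreal (real (card I) * v) \<le> ennreal b"
      using v by (simp add: b(2) ennreal_mult ennreal_of_nat_eq_real_of_nat)
    then have "real (card I) * v \<le> b" using b by simp
    then have "real (card I) \<le> b / v" using v by (simp add: field_simps)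
    then show ?thesis by (simp add: le_nat_floor less_Suc_eq_le)
  qed
  have "\<P> {}" by (simp add: \<P>_def disjoint_family_on_def)
  then obtain I where I: "\<P> I" "\<And>J. \<P> J \<Longrightarrow> card J \<le> card I"
    using ex_has_greatest_nat[of \<P> "{}" card "Suc (nat \<lfloor>b / v\<rfloor>)"] card less_imp_le by blast
  have meet: "\<exists>G'\<in>I. Ob G \<inter> Ob G' \<noteq> {}" if G: "un1 G" "\<delta> \<le> m G" for G
  proof (rule ccontr)
    assume no: "\<not> ?thesis"
    have "Ob G \<noteq> {}" using Ob(2)[OF G] v by auto
    then have GI: "G \<notin> I" using no by blast
    have "\<P> (insert G I)" using I(1) no G GI unfolding \<P>_def disjoint_family_on_def by blast
    moreover have "card (insert G I) = Suc (card I)" using I(1) GI by (simp add: \<P>_def)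
    ultimately show False using I(2) by fastforce
  qed
  define c where "c = (real ?n + 1) * (real ?n + 4 * (1 / (1 - q)))"
  define R where "R = (\<Sum>G\<in>I. norm G) * c"
  obtain L where L: "\<And>g. g \<in> \<Gamma> \<Longrightarrow> un1 (L g)" "\<And>g z. g \<in> \<Gamma> \<Longrightarrow> z \<in> cball_model \<Longrightarrow> g z = act (L g) z"
    using holo_group_lift[OF \<Gamma>] by blast
  have Llift: "L g \<in> ?\<Lambda>" if "g \<in> \<Gamma>" for g using L that unfolding unitary_lift_def by blast
  have c: "0 \<le> c" unfolding c_def using p by simp
  have gamD: "(gam z)\<^sup>2 \<le> 1 / (1 - q)" if "z \<in> D" for z
    unfolding gam(3)[OF Dsub[OF that]] using that p by (intro divide_left_mono mult_pos_pos) (auto simp: D_def)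
  \<comment> \<open>A lifted group element M moves G to within a fixed distance of some member of I.
    Conjugation by M maps the lift to itself and keeps nonscalar elements nonscalar, so the minimal
    distance at \<open>M ** G\<close> is no smaller than at G.\<close>
  have bounded: "\<exists>H. un1 H \<and> norm H \<le> R \<and> m G \<le> m H" if G: "un1 G" "\<delta> \<le> m G" for G
  proof -
    obtain G' w where G': "G' \<in> I" "w \<in> Ob G" "w \<in> Ob G'" using meet[OF G] by blast
    have unG': "un1 G'" using I(1) G'(1) by (simp add: \<P>_def)
    obtain g1 z1 where g1: "g1 \<in> \<Gamma>" "z1 \<in> D" "g1 w = act G z1" using G'(2) unfolding Ob_def by auto
    obtain g2 z2 where g2: "g2 \<in> \<Gamma>" "z2 \<in> D" "g2 w = act G' z2" using G'(3) unfolding Ob_def by auto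
    have w: "w \<in> cball_model" using G'(2) F by (auto simp: Ob_def fundamental_set_def)
    define M where "M = L g2 ** uinv (L g1)"
    have M: "M \<in> ?\<Lambda>" unfolding M_def by (intro unitary_lift_mult unitary_lift_uinv \<Gamma> Llift g1 g2)
    define H where "H = uinv G' ** (M ** G)"
    have unH: "un1 H" unfolding H_def by (intro un1_mult un1_uinv unG' un M G(1))
    note z = Dsub[OF g1(2)] Dsub[OF g2(2)]
    have "act (M ** G) z1 = act M (act (L g1) w)"
      using act_mult[OF G(1) z(1), of M] g1(3) L(2)[OF g1(1) w] by simp
    also have "\<dots> = act (L g2) w"
      unfolding M_def using act_mult[OF un1_uinv[OF L(1)[OF g1(1)]] act_in_ball[OF L(1)[OF g1(1)] w], of "L g2"]
        act_uinv(1)[OF L(1)[OF g1(1)] w] by simp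
    also have "\<dots> = act G' z2" using g2(3) L(2)[OF g2(1) w] by simp
    finally have Hz: "act H z1 = z2"
      unfolding H_def using act_mult[OF un1_mult[OF un[OF M] G(1)] z(1), of "uinv G'"] act_uinv(1)[OF unG' z(2)] by simp
    have nH: "norm H \<le> c"
      unfolding c_def by (rule un1_norm_bound[OF unH z(1), unfolded Hz, OF z(2) gamD[OF g1(2)] gamD[OF g2(2)]])
    have "M ** G = G' ** H" unfolding H_def un1_cancel(2)[OF unG'] ..
    then have "norm (M ** G) \<le> norm G' * norm H" using norm_matrix_mult[of G' H] by simp
    also have "\<dots> \<le> (\<Sum>G\<in>I. norm G) * c"
      using nH c G'(1) I(1) by (intro mult_mono member_le_sum sum_nonneg) (auto simp: \<P>_def)
    finally have nR: "norm (M ** G) \<le> R" by (simp add: R_def)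
    have unMG: "un1 (M ** G)" by (intro un1_mult un M G(1))
    have "m G \<le> ?N G (conj_by M (a (M ** G)))"
      unfolding m_def
    proof (rule a(3)[OF G(1)])
      show "conj_by M (a (M ** G)) \<in> ?\<Lambda>"
        unfolding conj_by_def by (intro unitary_lift_mult unitary_lift_uinv \<Gamma> M a(1) unMG)
      show "\<not> scalar_matrix (conj_by M (a (M ** G)))" using scalar_conj_by[OF un[OF M]] a(2)[OF unMG] by simp
    qed
    then have "m G \<le> m (M ** G)" unfolding m_def conj_by_conj_by .
    then show ?thesis using unMG nR by blast
  qed
  \<comment> \<open>The supremum is approached by conjugates of norm at most R and hence along a
    convergent subsequence; the limit stays in \<open>U(n,1)\<close> because the defining equation
    is closed.\<close>
  define S where "S = Sup (m ` Collect un1)"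
  have bdd: "bdd_above (m ` Collect un1)" using m_lt by (intro bdd_aboveI[of _ "9 / 20"]) (auto intro: less_imp_le)
  have mS: "m G \<le> S" if "un1 G" for G unfolding S_def using that bdd by (intro cSup_upper) auto
  have "\<exists>G. un1 G \<and> norm G \<le> R \<and> S - 1 / real (Suc k) \<le> m G" for k
  proof -
    have "\<exists>G. un1 G \<and> \<delta> \<le> m G \<and> S - 1 / real (Suc k) \<le> m G"
    proof (cases "S - 1 / real (Suc k) \<le> \<delta>")
      case True
      then have "\<delta> \<le> m (mat 1)" "S - 1 / real (Suc k) \<le> m (mat 1)" by (simp_all only: \<delta>_def)
      then show ?thesis using un1_mat1 by blast
    next
      case False
      have "m ` Collect un1 \<noteq> {}" using un1_mat1 by blast
      moreover have "S - 1 / real (Suc k) < Sup (m ` Collect un1)" unfolding S_def[symmetric] by simp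
      ultimately obtain x where "x \<in> m ` Collect un1" "S - 1 / real (Suc k) < x" using less_cSup_iff[OF _ bdd] by blast
      then show ?thesis using False by force
    qed
    then show ?thesis using bounded by (meson order_trans)
  qed
  then obtain Gs where Gs: "\<And>k. un1 (Gs k)" "\<And>k. norm (Gs k) \<le> R" "\<And>k. S - 1 / real (Suc k) \<le> m (Gs k)" by metis
  have "\<forall>k. Gs k \<in> cball 0 R" using Gs(2) by simp
  then obtain G r where G: "strict_mono r" "(Gs \<circ> r) \<longlonglongrightarrow> G"
    using compact_cball[of 0 R] unfolding compact_def by metis
  have unG: "un1 G"
  proof -
    have "(\<lambda>k. adj ((Gs \<circ> r) k) ** Jm ** (Gs \<circ> r) k) \<longlonglongrightarrow> adj G ** Jm ** G"
      by (intro tendsto_matrix_mult tendsto_adj tendsto_const G(2))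
    moreover have "adj ((Gs \<circ> r) k) ** Jm ** (Gs \<circ> r) k = Jm" for k using Gs(1)[of "r k"] by (simp add: un1_def)
    ultimately have "(\<lambda>k. Jm) \<longlonglongrightarrow> adj G ** Jm ** G" by simp
    then show ?thesis unfolding un1_def by (metis LIMSEQ_unique tendsto_const)
  qed
  have low: "S \<le> ?N G A" if A: "A \<in> ?\<Lambda>" "\<not> scalar_matrix A" for A
  proof (rule LIMSEQ_le)
    have "(\<lambda>k. S - 1 / real (Suc k)) \<longlonglongrightarrow> S - 0" by (intro tendsto_diff tendsto_const LIMSEQ_Suc[OF lim_1_over_n])
    then have "((\<lambda>k. S - 1 / real (Suc k)) \<circ> r) \<longlonglongrightarrow> S" using LIMSEQ_subseq_LIMSEQ[OF _ G(1)] by simp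
    then show "(\<lambda>k. S - 1 / real (Suc (r k))) \<longlonglongrightarrow> S" by (simp add: o_def)
    show "(\<lambda>k. ?N ((Gs \<circ> r) k) A) \<longlonglongrightarrow> ?N G A"
      by (intro tendsto_norm tendsto_diff tendsto_conj_by tendsto_const G(2))
    show "\<exists>K. \<forall>k\<ge>K. S - 1 / real (Suc (r k)) \<le> ?N ((Gs \<circ> r) k) A"
      using Gs(3) a(3)[OF Gs(1) A] unfolding m_def by (auto intro: order_trans)
  qed
  have S: "0 < S" "S \<le> 9 / 20"
  proof -
    show "0 < S" using mS[OF un1_mat1] \<delta> by (simp add: \<delta>_def)
    have "m ` Collect un1 \<noteq> {}" using un1_mat1 by blast
    then show "S \<le> 9 / 20" unfolding S_def by (rule cSup_least) (use m_lt in \<open>auto intro: less_imp_le\<close>)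
  qed
  have "\<exists>g. un1 g \<and> (\<forall>A\<in>conj_by G ` ?\<Lambda>. \<not> scalar_matrix A \<longrightarrow> S < norm (uinv g ** A ** g - mat 1))"
  proof (rule small_elements_can_be_enlarged[OF _ _ _ _ _ S])
    show "un1 A" if "A \<in> conj_by G ` ?\<Lambda>" for A using that un1_conj_by[OF unG] un by blast
    show "A ** B \<in> conj_by G ` ?\<Lambda>" if "A \<in> conj_by G ` ?\<Lambda>" "B \<in> conj_by G ` ?\<Lambda>" for A B
      using that unitary_lift_mult[OF \<Gamma>] by (auto simp: conj_by_mult[OF unG, symmetric])
    show "uinv A \<in> conj_by G ` ?\<Lambda>" if "A \<in> conj_by G ` ?\<Lambda>" for A
      using that unitary_lift_uinv[OF \<Gamma>] by (auto simp: conj_by_uinv[symmetric])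
    show "mat d \<in> conj_by G ` ?\<Lambda>" if "cmod d = 1" for d
      using unitary_lift_scalar[OF \<Gamma> that] conj_by_mat[OF unG, of d] by (metis imageI)
    show "S \<le> norm (A - mat 1)" if A: "A \<in> conj_by G ` ?\<Lambda>" "\<not> scalar_matrix A" for A
      using that low by (auto simp: scalar_conj_by[OF unG])
    fix R'
    obtain T where T: "finite T" "T \<subseteq> ?\<Lambda>"
      "\<And>A. A \<in> ?\<Lambda> \<Longrightarrow> norm A \<le> norm G * R' * norm G \<Longrightarrow> \<exists>B\<in>T. \<exists>d. cmod d = 1 \<and> A = mat d ** B"
      using unitary_lift_finite[OF \<Gamma>, of "norm G * R' * norm G"] by blast
    have "\<exists>B\<in>conj_by G ` T. \<exists>d. cmod d = 1 \<and> A = mat d ** B" if A: "A \<in> conj_by G ` ?\<Lambda>" "norm A \<le> R'" for A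
    proof -
      obtain A' where A': "A' \<in> ?\<Lambda>" "A = conj_by G A'" using A(1) by blast
      have "norm A' = norm (conj_by (uinv G) A)" by (simp only: A'(2) conj_by_cancel[OF unG])
      also have "\<dots> \<le> norm G * norm A * norm G" using norm_conj_by[of "uinv G" A] by simp
      also have "\<dots> \<le> norm G * R' * norm G" using A(2) by (intro mult_right_mono mult_left_mono) auto
      finally obtain B d where B: "B \<in> T" "cmod d = 1" "A' = mat d ** B" using T(3)[OF A'(1)] by blast
      have "A = mat d ** conj_by G B" by (simp only: A'(2) B(3) conj_by_mult[OF unG] conj_by_mat[OF unG])
      then show ?thesis using B by blast
    qed
    then show "\<exists>T. finite T \<and> T \<subseteq> conj_by G ` ?\<Lambda> \<and> (\<forall>A\<in>conj_by G ` ?\<Lambda>. norm A \<le> R' \<longrightarrow> (\<exists>B\<in>T. \<exists>d. cmod d = 1 \<and> A = mat d ** B))"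
      using T(1,2) by (intro exI[of _ "conj_by G ` T"]) blast
  qed
  then obtain g where g: "un1 g" "\<And>A. A \<in> conj_by G ` ?\<Lambda> \<Longrightarrow> \<not> scalar_matrix A \<Longrightarrow> S < norm (uinv g ** A ** g - mat 1)"
    by blast
  have unGg: "un1 (G ** g)" by (rule un1_mult[OF unG g(1)])
  \<comment> \<open>The minimizer at \<open>G ** g\<close> is itself one of the enlarged elements,
    so the minimal distance there would exceed the supremum.\<close>
  have "S < norm (conj_by g (conj_by G (a (G ** g))) - mat 1)"
    unfolding conj_by_def[of g] using a(1,2)[OF unGg] by (intro g(2)) (auto simp: scalar_conj_by[OF unG])
  then have "S < m (G ** g)" by (simp add: conj_by_conj_by m_def)
  then show False using mS[OF unGg] by simp
qed

theorem theorem1p1: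
  fixes \<Gamma> :: "(complex ^ 'n \<Rightarrow> complex ^ 'n) set"
  assumes "discrete_holo_group \<Gamma>"
  shows "ennreal (volC CARD('n)) \<le> orbifold_vol \<Gamma>"
  unfolding orbifold_vol_def using fundamental_set_volume_ge_volC[OF assms] by (intro INF_greatest) auto

end
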